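(* Let $\alpha \in \mathbb{C}$ with $\alpha \notin \mathbb{Q}$, let $\beta = -\tfrac12 \alpha(\alpha+1)$ and let $\gamma \in \mathbb{C}$. Then $$\mathrm{char}\, L_{\mathcal D}(\alpha,\beta,\gamma)=q_0^{\beta}\left(\sum_{j\in\gamma+\mathbb Z}q_1^{j}\right)\prod_{n\ge1}\left(1-q_0^{-n}\right)^{-3}.$$
   Context: Let $\mathcal R=\mathbb C[t_0^{\pm1},t_1^{\pm1}]$, $d_a=t_a\frac{\partial}{\partial t_a}$ ($a=0,1$), and $\mathcal D=\mathrm{Der}(\mathcal R)=\mathcal R d_0\oplus\mathcal R d_1$, with bracket $[t_0^{m_0}t_1^{m_1}d_a,\,t_0^{r_0}t_1^{r_1}d_b]=r_a t_0^{m_0+r_0}t_1^{m_1+r_1}d_b-m_b t_0^{m_0+r_0}t_1^{m_1+r_1}d_a$. Write $\mathcal D=\mathcal D_-\oplus\mathcal D_0\oplus\mathcal D_+$ for the decomposition into parts of negative, zero and positive degree in $t_0$. For $\alpha,\beta,\gamma\in\mathbb C$, $T=T(\alpha,\beta,\gamma)$ is the $\mathcal D_0$-module with basis $\{v(n)\mid n\in\gamma+\mathbb Z\}$ and action $(t_1^md_1)v(n)=(n-\alpha m)v(n+m)$, $(t_1^md_0)v(n)=\beta v(n+m)$. Let $\mathcal D_+$ act on $T$ by zero, and let $M_{\mathcal D}(\alpha,\beta,\gamma)=\mathrm{Ind}_{\mathcal D_0\oplus\mathcal D_+}^{\mathcal D}T\cong U(\mathcal D_-)\otimes T$. $L_{\mathcal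 D}(\alpha,\beta,\gamma)$ is the quotient of $M_{\mathcal D}(\alpha,\beta,\gamma)$ by its unique maximal submodule. For a $\mathcal D$-module $V=\bigoplus_{(s_0,s_1)\in\mathbb C\times\mathbb C}V_{s_0,s_1}$ with $V_{s_0,s_1}=\{v\in V\mid d_0v=s_0v,\ d_1v=s_1v\}$, its character is the formal sum $\mathrm{char}\,V=\sum_{(s_0,s_1)}\dim(V_{s_0,s_1})\,q_0^{s_0}q_1^{s_1}$. *)

theory Defs
  imports
    "HOL-Library.Poly_Mapping"
    "HOL-Computational_Algebra.Formal_Power_Series"
    "HOL-Analysis.Infinite_Products"
    "HOL-Algebra.Module"
    "HOL-Algebra.AbelCoset"
begin

section \<open>Finitely supported functions as free complex vector spaces\<close>

definition scale_pm :: "complex \<Rightarrow> ('a \<Rightarrow>\<^sub>0 complex) \<Rightarrow> ('a \<Rightarrow>\<^sub>0 complex)" where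
  "scale_pm c = Poly_Mapping.map ((*) c)"

definition lin_ext :: "('a \<Rightarrow> ('b \<Rightarrow>\<^sub>0 complex)) \<Rightarrow> ('a \<Rightarrow>\<^sub>0 complex) \<Rightarrow> ('b \<Rightarrow>\<^sub>0 complex)" where
  "lin_ext f x = (\<Sum>i\<in>Poly_Mapping.keys x. scale_pm (Poly_Mapping.lookup x i) (f i))"

section \<open>The Lie algebra of vector fields on the two-dimensional torus\<close>

datatype direction = Dir0 | Dir1

text \<open>\<open>Monom m0 m1 a\<close> stands for the derivation \<open>t\<^sub>0^m0 t\<^sub>1^m1 d\<^sub>a\<close>.\<close>

datatype vf_basis = Monom int int direction

type_synonym vf = "vf_basis \<Rightarrow>\<^sub>0 complex"

fun component :: "int \<Rightarrow> int \<Rightarrow> direction \<Rightarrow> int" where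
  "component m0 m1 Dir0 = m0"
| "component m0 m1 Dir1 = m1"

fun bracket_basis :: "vf_basis \<Rightarrow> vf_basis \<Rightarrow> vf" where
  "bracket_basis (Monom m0 m1 a) (Monom r0 r1 b) =
     Poly_Mapping.single (Monom (m0 + r0) (m1 + r1) b) (of_int (component r0 r1 a))
     - Poly_Mapping.single (Monom (m0 + r0) (m1 + r1) a) (of_int (component m0 m1 b))"

definition bracket :: "vf \<Rightarrow> vf \<Rightarrow> vf" where
  "bracket x y = lin_ext (\<lambda>i. lin_ext (bracket_basis i) y) x"

fun t0_degree :: "vf_basis \<Rightarrow> int" where
  "t0_degree (Monom m0 m1 a) = m0"

text \<open>The subalgebra \<open>\<D>\<^sub>0 \<oplus> \<D>\<^sub>+\<close>.\<close>

definition vf_nonneg :: "vf set" where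
  "vf_nonneg = {x. \<forall>i\<in>Poly_Mapping.keys x. 0 \<le> t0_degree i}"

definition d_vf :: "direction \<Rightarrow> vf" where
  "d_vf a = Poly_Mapping.single (Monom 0 0 a) 1"

section \<open>The universal enveloping algebra\<close>

text \<open>
  Words under concatenation. With the convolution product on finitely supported functions,
  \<open>vf_basis fword \<Rightarrow>\<^sub>0 complex\<close> is the free associative algebra on the basis of the Lie algebra,
  that is, its tensor algebra.
\<close>

datatype 'a fword = FWord (letters: "'a list")

instantiation fword :: (type) monoid_add
begin

definition zero_fword :: "'a fword" where
  "zero_fword = FWord []"

definition plus_fword :: "'a fword \<Rightarrow> 'a fword \<Rightarrow> 'a fword" where
  "plus_fword u w = FWord (letters u @ letters w)"

instance
  by standard (simp_all add: zero_fword_def plus_fword_def)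

end

type_synonym tensor_alg = "vf_basis fword \<Rightarrow>\<^sub>0 complex"

definition tens_of_vf :: "vf \<Rightarrow> tensor_alg" where
  "tens_of_vf = lin_ext (\<lambda>i. Poly_Mapping.single (FWord [i]) 1)"

inductive_set env_ideal :: "tensor_alg set" where
  zero: "0 \<in> env_ideal"
| rel: "a * (tens_of_vf x * tens_of_vf y - tens_of_vf y * tens_of_vf x
          - tens_of_vf (bracket x y)) * b \<in> env_ideal"
| add: "r \<in> env_ideal \<Longrightarrow> s \<in> env_ideal \<Longrightarrow> r + s \<in> env_ideal"

lemma env_ideal_mult_left: "r \<in> env_ideal \<Longrightarrow> c * r \<in> env_ideal"
proof (induction rule: env_ideal.induct)
  case (rel a x y b)
  show ?case
    using env_ideal.rel[of "c * a" x y b] by (simp only: mult.assoc)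
qed (auto simp: distrib_left intro: env_ideal.intros)

lemma env_ideal_mult_right: "r \<in> env_ideal \<Longrightarrow> r * c \<in> env_ideal"
proof (induction rule: env_ideal.induct)
  case (rel a x y b)
  show ?case
    using env_ideal.rel[of a x y "b * c"] by (simp only: mult.assoc)
qed (auto simp: distrib_right intro: env_ideal.intros)

lemma env_ideal_uminus: "r \<in> env_ideal \<Longrightarrow> - r \<in> env_ideal"
  using env_ideal_mult_left[of r "- 1"] by simp

lemma env_ideal_diff: "r \<in> env_ideal \<Longrightarrow> s \<in> env_ideal \<Longrightarrow> r - s \<in> env_ideal"
  using env_ideal.add[OF _ env_ideal_uminus, of r s] by simp

definition env_rel :: "tensor_alg \<Rightarrow> tensor_alg \<Rightarrow> bool" where
  "env_rel r s \<longleftrightarrow> r - s \<in> env_ideal"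

quotient_type env_alg = tensor_alg / env_rel
proof (rule equivpI)
  show "reflp env_rel"
    by (simp add: reflp_def env_rel_def env_ideal.zero)
  show "symp env_rel"
    unfolding symp_def env_rel_def using env_ideal_uminus by force
  show "transp env_rel"
    unfolding transp_def env_rel_def using env_ideal.add by fastforce
qed

instantiation env_alg :: ring
begin

lift_definition zero_env_alg :: env_alg is 0 .

lift_definition plus_env_alg :: "env_alg \<Rightarrow> env_alg \<Rightarrow> env_alg" is "(+)"
  unfolding env_rel_def using env_ideal.add by (fastforce simp: algebra_simps)

lift_definition minus_env_alg :: "env_alg \<Rightarrow> env_alg \<Rightarrow> env_alg" is "(-)"
  unfolding env_rel_def using env_ideal_diff by (fastforce simp: algebra_simps)

lift_definition uminus_env_alg :: "env_alg \<Rightarrow> env_alg" is uminus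
  unfolding env_rel_def using env_ideal_uminus by (fastforce simp: algebra_simps)

lift_definition times_env_alg :: "env_alg \<Rightarrow> env_alg \<Rightarrow> env_alg" is "(*)"
proof -
  fix r s u w :: tensor_alg
  assume "env_rel r s" "env_rel u w"
  then have "(r - s) * u + s * (u - w) \<in> env_ideal"
    unfolding env_rel_def
    by (intro env_ideal.add env_ideal_mult_left env_ideal_mult_right)
  then show "env_rel (r * u) (s * w)"
    by (simp add: env_rel_def algebra_simps)
qed

instance
  by standard (transfer; simp add: env_rel_def env_ideal.zero algebra_simps)+

end

lift_definition env_of_vf :: "vf \<Rightarrow> env_alg" is tens_of_vf .

lift_definition env_scalar :: "complex \<Rightarrow> env_alg" is "Poly_Mapping.single 0" .

section \<open>Modules over the Lie algebra\<close>

definition complex_field :: "complex ring" where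
  "complex_field = \<lparr>carrier = UNIV, mult = (*), one = 1, zero = 0, add = (+)\<rparr>"

text \<open>The fields \<open>mult\<close> and \<open>one\<close> inherited from the library's record of modules play no role.\<close>

record 'v vf_module = "(complex, 'v) module" +
  act :: "vf \<Rightarrow> 'v \<Rightarrow> 'v"

definition vf_submodule :: "'v vf_module \<Rightarrow> 'v set \<Rightarrow> bool" where
  "vf_submodule V W \<longleftrightarrow> submodule W complex_field V \<and> (\<forall>x. \<forall>w\<in>W. act V x w \<in> W)"

definition maximal_submodule :: "'v vf_module \<Rightarrow> 'v set \<Rightarrow> bool" where
  "maximal_submodule V W \<longleftrightarrow> vf_submodule V W \<and> W \<noteq> carrier V \<and>
     (\<forall>W'. vf_submodule V W' \<and> W \<subseteq> W' \<longrightarrow> W' = W \<or> W' = carrier V)"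

definition quot_module :: "'v vf_module \<Rightarrow> 'v set \<Rightarrow> 'v set vf_module" where
  "quot_module V W =
     \<lparr>carrier = a_rcosets\<^bsub>V\<^esub> W, mult = undefined, one = undefined,
      zero = W, add = set_add V,
      smult = (\<lambda>c X. \<Union>v\<in>X. W +>\<^bsub>V\<^esub> (c \<odot>\<^bsub>V\<^esub> v)),
      act = (\<lambda>x X. \<Union>v\<in>X. W +>\<^bsub>V\<^esub> act V x v)\<rparr>"

section \<open>The modules \<open>T\<close>, \<open>M\<^sub>\<D>\<close> and \<open>L\<^sub>\<D>\<close>\<close>

text \<open>
  The underlying space of \<open>T(\<alpha>,\<beta>,\<gamma>)\<close> is \<open>int \<Rightarrow>\<^sub>0 complex\<close>; the basis vector with index \<open>k\<close>
  is \<open>v(\<gamma> + k)\<close>. Only the action of \<open>\<D>\<^sub>0 \<oplus> \<D>\<^sub>+\<close> is meaningful.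
\<close>

fun T_basis_act :: "complex \<Rightarrow> complex \<Rightarrow> complex \<Rightarrow> vf_basis \<Rightarrow> int \<Rightarrow> (int \<Rightarrow>\<^sub>0 complex)" where
  "T_basis_act \<alpha> \<beta> \<gamma> (Monom m0 m Dir1) k =
     (if m0 = 0 then Poly_Mapping.single (k + m) ((\<gamma> + of_int k) - \<alpha> * of_int m) else 0)"
| "T_basis_act \<alpha> \<beta> \<gamma> (Monom m0 m Dir0) k =
     (if m0 = 0 then Poly_Mapping.single (k + m) \<beta> else 0)"

definition T_act ::
    "complex \<Rightarrow> complex \<Rightarrow> complex \<Rightarrow> vf \<Rightarrow> (int \<Rightarrow>\<^sub>0 complex) \<Rightarrow> (int \<Rightarrow>\<^sub>0 complex)" where
  "T_act \<alpha> \<beta> \<gamma> x t = lin_ext (\<lambda>i. lin_ext (T_basis_act \<alpha> \<beta> \<gamma> i) t) x"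

text \<open>
  \<open>U(\<D>) \<otimes> T\<close> over the complex numbers, as finitely supported functions from the basis of \<open>T\<close>
  to \<open>U(\<D>)\<close>, with \<open>\<D>\<close> acting by left multiplication on the first factor.
\<close>

definition pure_tensor :: "env_alg \<Rightarrow> (int \<Rightarrow>\<^sub>0 complex) \<Rightarrow> (int \<Rightarrow>\<^sub>0 env_alg)" where
  "pure_tensor u = Poly_Mapping.map (\<lambda>c. u * env_scalar c)"

definition env_tensor_T :: "(int \<Rightarrow>\<^sub>0 env_alg) vf_module" where
  "env_tensor_T =
     \<lparr>carrier = UNIV, mult = undefined, one = undefined, zero = 0, add = (+),
      smult = (\<lambda>c. Poly_Mapping.map ((*) (env_scalar c))),
      act = (\<lambda>x. Poly_Mapping.map ((*) (env_of_vf x)))\<rparr>"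

text \<open>
  The relations of the tensor product over \<open>U(\<D>\<^sub>0 \<oplus> \<D>\<^sub>+)\<close>. It suffices to impose them for
  elements of \<open>\<D>\<^sub>0 \<oplus> \<D>\<^sub>+\<close>, which generate that algebra.
\<close>

definition balancing :: "complex \<Rightarrow> complex \<Rightarrow> complex \<Rightarrow> (int \<Rightarrow>\<^sub>0 env_alg) set" where
  "balancing \<alpha> \<beta> \<gamma> = vf_submodule env_tensor_T hull
     {pure_tensor (u * env_of_vf x) t - pure_tensor u (T_act \<alpha> \<beta> \<gamma> x t) | u x t. x \<in> vf_nonneg}"

definition M_D :: "complex \<Rightarrow> complex \<Rightarrow> complex \<Rightarrow> (int \<Rightarrow>\<^sub>0 env_alg) set vf_module" where
  "M_D \<alpha> \<beta> \<gamma> = quot_module env_tensor_T (balancing \<alpha> \<beta> \<gamma>)"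

definition L_D :: "complex \<Rightarrow> complex \<Rightarrow> complex \<Rightarrow> (int \<Rightarrow>\<^sub>0 env_alg) set set vf_module" where
  "L_D \<alpha> \<beta> \<gamma> = quot_module (M_D \<alpha> \<beta> \<gamma>) (THE N. maximal_submodule (M_D \<alpha> \<beta> \<gamma>) N)"

section \<open>Characters\<close>

definition weight_space :: "'v vf_module \<Rightarrow> complex \<times> complex \<Rightarrow> 'v set" where
  "weight_space V s = {v \<in> carrier V. act V (d_vf Dir0) v = fst s \<odot>\<^bsub>V\<^esub> v \<and>
                                      act V (d_vf Dir1) v = snd s \<odot>\<^bsub>V\<^esub> v}"

definition is_weight_module :: "'v vf_module \<Rightarrow> bool" where
  "is_weight_module V \<longleftrightarrow>
     (\<forall>v\<in>carrier V. \<exists>!w. (\<forall>s. w s \<in> weight_space V s) \<and> finite {s. w s \<noteq> \<zero>\<^bsub>V\<^esub>} \<and>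
        v = (\<Oplus>\<^bsub>V\<^esub>s\<in>{s. w s \<noteq> \<zero>\<^bsub>V\<^esub>}. w s))"

definition is_finite_basis :: "'v vf_module \<Rightarrow> 'v set \<Rightarrow> 'v set \<Rightarrow> bool" where
  "is_finite_basis V W B \<longleftrightarrow> finite B \<and> B \<subseteq> W \<and>
     (\<forall>w\<in>W. \<exists>!c. c \<in> B \<rightarrow>\<^sub>E (UNIV :: complex set) \<and> w = (\<Oplus>\<^bsub>V\<^esub>b\<in>B. c b \<odot>\<^bsub>V\<^esub> b))"

text \<open>A function \<open>f\<close> stands for the formal sum of the terms \<open>f (s\<^sub>0, s\<^sub>1) q\<^sub>0^s\<^sub>0 q\<^sub>1^s\<^sub>1\<close>.\<close>

type_synonym formal_sum = "complex \<times> complex \<Rightarrow> real"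

definition has_character :: "'v vf_module \<Rightarrow> formal_sum \<Rightarrow> bool" where
  "has_character V f \<longleftrightarrow> is_weight_module V \<and>
     (\<forall>s. \<exists>B. is_finite_basis V (weight_space V s) B \<and> f s = of_nat (card B))"

text \<open>The product of formal sums, for factors where each coefficient is a finite sum.\<close>

definition fs_times :: "formal_sum \<Rightarrow> formal_sum \<Rightarrow> formal_sum" (infixl \<open>\<star>\<close> 70) where
  "f \<star> g = (\<lambda>s. \<Sum>r | f r \<noteq> 0 \<and> g (s - r) \<noteq> 0. f r * g (s - r))"

definition q0_power :: "complex \<Rightarrow> formal_sum" where
  "q0_power b = (\<lambda>(s0, s1). if s0 = b \<and> s1 = 0 then 1 else 0)"

definition q1_power_sum :: "complex set \<Rightarrow> formal_sum" where
  "q1_power_sum J = (\<lambda>(s0, s1). if s0 = 0 \<and> s1 \<in> J then 1 else 0)"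

text \<open>Substitution of \<open>q\<^sub>0^(-1)\<close> into a power series; each sum has at most one term.\<close>

definition at_inverse_q0 :: "real fps \<Rightarrow> formal_sum" where
  "at_inverse_q0 P = (\<lambda>(s0, s1). \<Sum>k | s0 = - of_nat k \<and> s1 = 0. fps_nth P k)"

end

theory Submission
  imports Defs
begin

text \<open>
  The right-hand side of the theorem is the graded dimension of a Fock space: its basis vectors
  \<open>ket (k, \<mu>)\<close> carry an integer \<open>k\<close> and a monomial \<open>\<mu>\<close> in creation operators of three colors and
  all positive sizes. The proof identifies \<open>L_D\<close> with this space.

  The action. Let \<open>phi\<close> be a field with canonically conjugate field \<open>del\<close>, and let \<open>cur\<close> be a
  Heisenberg current of level \<open>- 1\<close> whose zero mode is \<open>- \<alpha>\<close>. The derivation \<open>t\<^sub>0^j t\<^sub>1^m d\<^sub>1\<close> acts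
  by a Fourier mode of \<open>e^(m phi) del + m e^(m phi) cur\<close>, and \<open>t\<^sub>0^j t\<^sub>1^m d\<^sub>0\<close> by one built from the
  derivative of \<open>phi\<close> and from a Virasoro field made of \<open>cur\<close>. Normal ordering of the vector fields
  creates an anomaly (\<open>cm_avf_avf\<close>), and the central terms of the current create another one
  (\<open>cm_hop_hop\<close>); the level and the background charge are such that the two cancel, so that the
  bracket relations hold exactly (\<open>rep_rep_11\<close>, \<open>rep_rep_10\<close>, \<open>rep_rep_00\<close>). The subspace of
  depth zero is \<open>T(\<alpha>, \<beta>, \<gamma>)\<close> with \<open>\<beta> = - \<alpha> (\<alpha> + 1) / 2\<close> (\<open>rep_vac_0\<close>, \<open>rep_vac_1\<close>).

  Irreducibility. The derivations \<open>t\<^sub>0^j t\<^sub>1^m d\<^sub>1\<close> with \<open>m = - 1, 0, 1\<close> span a copy of the loop algebra of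
  \<open>sl\<^sub>2\<close>, and on the Fock space the degree derivation \<open>d\<^sub>0\<close> is the quadratic Sugawara expression in
  this loop algebra (\<open>sugawara\<close>). If the fields of positive degree map a vector of depth \<open>n\<close> into a
  submodule, then only the zero modes survive in that expression modulo the submodule, so the
  Casimir element of the zero modes acts as \<open>2 n + \<alpha> (\<alpha> + 1)\<close> (\<open>casimir_mod_submodule\<close>). On the
  other hand this Casimir element is triangular with respect to the number \<open>t\<close> of factors of the
  first color minus that of the second, with diagonal entries \<open>(\<alpha> - t) (\<alpha> - t + 1)\<close>
  (\<open>tilts_zero_casimir\<close>). The two values agree only if \<open>2 t \<alpha> = t\<^sup>2 - t - 2 n\<close>; for irrational
  \<open>\<alpha>\<close> this forces \<open>t = 0\<close> and \<open>n = 0\<close>. Hence there are no singular vectors below the top, and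
  every basis vector is generated from the top: the Fock space is irreducible (\<open>fock_irreducible\<close>).

  The quotient. The Fock space thus is a quotient of the induced module. A submodule that is not in
  the kernel maps onto the Fock space, so it contains a vector over a vector of the top; its
  component of depth zero is in the submodule as well, lies in the top, and generates everything
  (\<open>submodule_below_kernel\<close>). So the kernel is the unique maximal submodule and \<open>L_D\<close> is the Fock
  space (\<open>fock_iso\<close>). The vector \<open>ket (k, \<mu>)\<close> has weight \<open>(\<beta> - n, \<gamma> + k)\<close> for \<open>\<mu>\<close> of depth \<open>n\<close>,
  and the number of such \<open>\<mu>\<close> is the coefficient in the product (\<open>prodinf_eq_count\<close>).
\<close>

section \<open>Linear endomorphisms and locally finite sums\<close>

abbreviation lookup :: "('a \<Rightarrow>\<^sub>0 'b::zero) \<Rightarrow> 'a \<Rightarrow> 'b" where "lookup \<equiv> Poly_Mapping.lookup"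
abbreviation keys :: "('a \<Rightarrow>\<^sub>0 'b::zero) \<Rightarrow> 'a set" where "keys \<equiv> Poly_Mapping.keys"
abbreviation single :: "'a \<Rightarrow> 'b::zero \<Rightarrow> ('a \<Rightarrow>\<^sub>0 'b)" where "single \<equiv> Poly_Mapping.single"

lemma lookup_scale_pm [simp]: "lookup (scale_pm c x) i = c * lookup x i"
  by (simp add: scale_pm_def map.rep_eq when_def)

lemma scale_pm_simps [simp]:
  "scale_pm c 0 = 0" "scale_pm 0 x = 0" "scale_pm 1 x = x"
  "scale_pm c (scale_pm d x) = scale_pm (c * d) x"
  "scale_pm c (single i d) = single i (c * d)"
  by (auto intro!: poly_mapping_eqI simp: lookup_single when_def)

lemma scale_pm_add: "scale_pm c (x + y) = scale_pm c x + scale_pm c y"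
  and scale_pm_add_left: "scale_pm (c + d) x = scale_pm c x + scale_pm d x"
  and scale_pm_diff: "scale_pm c (x - y) = scale_pm c x - scale_pm c y"
  and scale_pm_minus: "scale_pm c (- x) = - scale_pm c x"
  by (auto intro!: poly_mapping_eqI simp: lookup_add lookup_minus algebra_simps)

lemma scale_pm_sum: "scale_pm c (sum f A) = (\<Sum>i\<in>A. scale_pm c (f i))"
  by (induction A rule: infinite_finite_induct) (auto simp: scale_pm_add)

lemma pm_expand: "x = (\<Sum>i\<in>keys x. single i (lookup x i))"
  by (rule poly_mapping_eqI)
    (auto simp: lookup_sum lookup_single when_def in_keys_iff
          sum.delta[OF finite_keys, where b="lookup x"] not_in_keys_iff_lookup_eq_zero)

lemma lin_ext_superset:
  assumes "finite S" "keys x \<subseteq> S"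
  shows "lin_ext f x = (\<Sum>i\<in>S. scale_pm (lookup x i) (f i))"
  unfolding lin_ext_def using assms
  by (intro sum.mono_neutral_left) (auto simp: in_keys_iff)

lemma lin_ext_single [simp]: "lin_ext f (single i c) = scale_pm c (f i)"
  by (simp add: lin_ext_def)

lemma lin_ext_0 [simp]: "lin_ext f 0 = 0"
  by (simp add: lin_ext_def)

lemma lin_ext_add: "lin_ext f (x + y) = lin_ext f x + lin_ext f y"
proof -
  let ?S = "keys x \<union> keys y"
  have "keys (x + y) \<subseteq> ?S" by (rule keys_add)
  then show ?thesis
    by (simp add: lin_ext_superset[of ?S] lookup_add scale_pm_add_left sum.distrib)
qed

lemma lin_ext_scale: "lin_ext f (scale_pm c x) = scale_pm c (lin_ext f x)"
proof -
  have "keys (scale_pm c x) \<subseteq> keys x"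
    by (auto simp: in_keys_iff)
  then show ?thesis
    by (simp add: lin_ext_superset[of "keys x"] scale_pm_sum)
qed

definition linear_pm :: "(('a \<Rightarrow>\<^sub>0 complex) \<Rightarrow> ('b \<Rightarrow>\<^sub>0 complex)) \<Rightarrow> bool" where
  "linear_pm f \<longleftrightarrow> (\<forall>x y. f (x + y) = f x + f y) \<and> (\<forall>c x. f (scale_pm c x) = scale_pm c (f x))"

lemma linear_pm_lin_ext: "linear_pm (lin_ext f)"
  by (simp add: linear_pm_def lin_ext_add lin_ext_scale)

lemma linear_pm_0: "linear_pm f \<Longrightarrow> f 0 = 0"
  unfolding linear_pm_def by (metis scale_pm_simps(2))

lemma linear_pm_sum: "linear_pm f \<Longrightarrow> f (sum g A) = (\<Sum>i\<in>A. f (g i))"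
  by (induction A rule: infinite_finite_induct) (auto simp: linear_pm_0, simp add: linear_pm_def)

lemma linear_pm_eq_lin_ext:
  assumes "linear_pm f"
  shows "f = lin_ext (\<lambda>i. f (single i 1))"
proof
  fix x
  have "f x = (\<Sum>i\<in>keys x. f (single i (lookup x i)))"
    using pm_expand[of x] linear_pm_sum[OF assms] by metis
  also have "\<dots> = lin_ext (\<lambda>i. f (single i 1)) x"
    unfolding lin_ext_def
  proof (rule sum.cong)
    fix i
    have "single i (lookup x i)
        = scale_pm (lookup x i) (single i 1)" by simp
    then show "f (single i (lookup x i))
        = scale_pm (lookup x i) (f (single i 1))"
      using assms unfolding linear_pm_def by metis
  qed simp
  finally show "f x = lin_ext (\<lambda>i. f (single i 1)) x" .
qed

text \<open>
  Linear endomorphisms form a ring, so that the commutator calculus below can be left to ring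
  normalization.
\<close>

typedef 'b endo = "{f :: ('b \<Rightarrow>\<^sub>0 complex) \<Rightarrow> ('b \<Rightarrow>\<^sub>0 complex). linear_pm f}"
  morphisms app Endo
  by (rule exI[of _ "\<lambda>_. 0"]) (simp add: linear_pm_def)

setup_lifting type_definition_endo

instantiation endo :: (type) ring_1
begin
lift_definition zero_endo :: "'a endo" is "\<lambda>_. 0" by (simp add: linear_pm_def)
lift_definition one_endo :: "'a endo" is "\<lambda>w. w" by (simp add: linear_pm_def)
lift_definition plus_endo :: "'a endo \<Rightarrow> 'a endo \<Rightarrow> 'a endo" is "\<lambda>f g w. f w + g w"
  by (simp add: linear_pm_def scale_pm_add)
lift_definition minus_endo :: "'a endo \<Rightarrow> 'a endo \<Rightarrow> 'a endo" is "\<lambda>f g w. f w - g w"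
  by (simp add: linear_pm_def scale_pm_diff)
lift_definition uminus_endo :: "'a endo \<Rightarrow> 'a endo" is "\<lambda>f w. - f w"
  by (simp add: linear_pm_def scale_pm_minus)
lift_definition times_endo :: "'a endo \<Rightarrow> 'a endo \<Rightarrow> 'a endo" is "\<lambda>f g w. f (g w)"
  by (simp add: linear_pm_def)
instance
proof
  show "(0 :: 'a endo) \<noteq> 1"
    by transfer (metis zero_neq_one single_zero inj_single injD)
qed (transfer; simp add: linear_pm_def fun_eq_iff algebra_simps)+
end

lift_definition sm :: "complex \<Rightarrow> 'b endo \<Rightarrow> 'b endo" (infixr \<open>*\<^sub>C\<close> 75) is "\<lambda>c f w. scale_pm c (f w)"
  by (simp add: linear_pm_def scale_pm_add mult.commute)

lemma linear_pm_app: "linear_pm (app A)"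
  using app by blast

lemma app_simps [simp]:
  "app 0 w = 0" "app 1 w = w" "app (A + B) w = app A w + app B w" "app (A - B) w = app A w - app B w"
  "app (- A) w = - app A w" "app (A * B) w = app A (app B w)" "app (c *\<^sub>C A) w = scale_pm c (app A w)"
  by (simp_all add: zero_endo.rep_eq one_endo.rep_eq plus_endo.rep_eq minus_endo.rep_eq
      uminus_endo.rep_eq times_endo.rep_eq sm.rep_eq)

lemma app_vec [simp]: "app A 0 = 0" "app A (v + w) = app A v + app A w"
    "app A (scale_pm c w) = scale_pm c (app A w)"
  using linear_pm_app[of A] linear_pm_0[of "app A"] by (auto simp: linear_pm_def)

lemma app_sum: "app A (sum f S) = (\<Sum>i\<in>S. app A (f i))"
  by (rule linear_pm_sum[OF linear_pm_app])

lemma app_sum_endo: "app (sum f S) w = (\<Sum>i\<in>S. app (f i) w)"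
  by (induction S rule: infinite_finite_induct) auto

lemma endo_eqI: "(\<And>w. app A w = app B w) \<Longrightarrow> A = B"
  by (simp add: app_inject[symmetric] fun_eq_iff)

lemma endo_eqI_basis:
  assumes "\<And>b. app A (single b 1) = app B (single b 1)"
  shows "A = B"
proof (rule endo_eqI)
  fix w
  have "app A = lin_ext (\<lambda>i. app B (single i 1))"
    by (subst linear_pm_eq_lin_ext[OF linear_pm_app]) (simp add: assms)
  also have "\<dots> = app B"
    by (rule linear_pm_eq_lin_ext[OF linear_pm_app, symmetric])
  finally show "app A w = app B w" by simp
qed

text \<open>
  Matrix entries turn an identity between linear combinations of operators into an identity of
  complex numbers, where moving the scalars is automatic.
\<close>

definition entry :: "('b \<Rightarrow>\<^sub>0 complex) \<Rightarrow> 'b \<Rightarrow> 'b endo \<Rightarrow> complex" where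
  "entry w p A = lookup (app A w) p"

lemma endo_eqI_entry: "(\<And>w p. entry w p A = entry w p B) \<Longrightarrow> A = B"
  by (intro endo_eqI poly_mapping_eqI) (simp add: entry_def)

lemma entry_simps:
  "entry w p 0 = 0" "entry w p (A + B) = entry w p A + entry w p B"
  "entry w p (A - B) = entry w p A - entry w p B" "entry w p (- A) = - entry w p A"
  "entry w p (c *\<^sub>C A) = c * entry w p A"
  by (simp_all add: entry_def lookup_add lookup_minus)

lemma sm_simps [simp]:
  "c *\<^sub>C (d *\<^sub>C A) = (c * d) *\<^sub>C A" "1 *\<^sub>C A = A" "0 *\<^sub>C A = 0" "c *\<^sub>C 0 = (0 :: 'b endo)"
  "(c *\<^sub>C A) * B = c *\<^sub>C (A * B)" "A * (c *\<^sub>C B) = c *\<^sub>C (A * B)"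
  by (rule endo_eqI; simp)+

lemma sm_distrib: "c *\<^sub>C (A + B) = c *\<^sub>C A + c *\<^sub>C B" "c *\<^sub>C (A - B) = c *\<^sub>C A - c *\<^sub>C B" "c *\<^sub>C (- A) = - (c *\<^sub>C A)"
  "(c + d) *\<^sub>C A = c *\<^sub>C A + d *\<^sub>C A" "(c - d) *\<^sub>C A = c *\<^sub>C A - d *\<^sub>C A" "(- c) *\<^sub>C A = - (c *\<^sub>C A)"
  by (rule endo_eqI_entry; simp add: entry_simps algebra_simps)+

lemma sm_sum: "c *\<^sub>C sum f S = (\<Sum>i\<in>S. c *\<^sub>C f i)"
  by (induction S rule: infinite_finite_induct) (auto simp: sm_distrib)

lift_definition basis_endo :: "('b \<Rightarrow> ('b \<Rightarrow>\<^sub>0 complex)) \<Rightarrow> 'b endo" is lin_ext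
  by (rule linear_pm_lin_ext)

lemma app_basis_endo [simp]: "app (basis_endo f) (single b c) = scale_pm c (f b)"
  by transfer simp

text \<open>
  The infinite sums of operators below have only finitely many nonzero terms on each vector; this
  notion of summation takes the place of a topology.
\<close>

definition lsum :: "('i \<Rightarrow> 'b endo) \<Rightarrow> 'b endo \<Rightarrow> bool" where
  "lsum f A \<longleftrightarrow> (\<forall>w. finite {i. app (f i) w \<noteq> 0} \<and> app A w = (\<Sum>i | app (f i) w \<noteq> 0. app (f i) w))"

lemma lsumI:
  assumes "\<And>w. \<exists>S. finite S \<and> (\<forall>i. i \<notin> S \<longrightarrow> app (f i) w = 0) \<and> app A w = (\<Sum>i\<in>S. app (f i) w)"
  shows "lsum f A"
  unfolding lsum_def
proof
  fix w
  obtain S where S: "finite S" "\<And>i. i \<notin> S \<Longrightarrow> app (f i) w = 0" "app A w = (\<Sum>i\<in>S. app (f i) w)"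
    using assms by blast
  have sub: "{i. app (f i) w \<noteq> 0} \<subseteq> S" using S(2) by blast
  show "finite {i. app (f i) w \<noteq> 0} \<and> app A w = (\<Sum>i | app (f i) w \<noteq> 0. app (f i) w)"
    using S sub by (auto intro: finite_subset intro!: sum.mono_neutral_right)
qed

lemma lsumD:
  assumes "lsum f A" "finite S" "\<And>i. i \<notin> S \<Longrightarrow> app (f i) w = 0"
  shows "app A w = (\<Sum>i\<in>S. app (f i) w)"
proof -
  have sub: "{i. app (f i) w \<noteq> 0} \<subseteq> S" using assms(3) by blast
  have "app A w = (\<Sum>i | app (f i) w \<noteq> 0. app (f i) w)" using assms(1) by (simp add: lsum_def)
  also have "\<dots> = (\<Sum>i\<in>S. app (f i) w)"
    using sub assms(2) by (intro sum.mono_neutral_left) auto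
  finally show ?thesis .
qed

lemma lsum_finite_supp: "lsum f A \<Longrightarrow> finite {i. app (f i) w \<noteq> 0}"
  by (simp add: lsum_def)

lemma lsum_unique: "lsum f A \<Longrightarrow> lsum f B \<Longrightarrow> A = B"
  by (rule endo_eqI) (simp add: lsum_def)

text \<open>
  The locally finite sum as a function of the family; the value is arbitrary if the family is not
  locally finite.
\<close>

definition LS :: "('i \<Rightarrow> 'b endo) \<Rightarrow> 'b endo" where
  "LS f = (THE A. lsum f A)"

lemma LS_eqI: "lsum f A \<Longrightarrow> LS f = A"
  unfolding LS_def by (rule the_equality) (auto intro: lsum_unique)

definition loc_fin :: "('i \<Rightarrow> 'b endo) \<Rightarrow> bool" where
  "loc_fin f \<longleftrightarrow> (\<forall>w. finite {i. app (f i) w \<noteq> 0})"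

lemma lsum_loc_fin: "lsum f A \<Longrightarrow> loc_fin f"
  by (simp add: lsum_def loc_fin_def)

lemma lsum_LS:
  assumes "loc_fin f"
  shows "lsum f (LS f)"
proof -
  let ?g = "\<lambda>w. \<Sum>i | app (f i) w \<noteq> 0. app (f i) w"
  note fin = assms[unfolded loc_fin_def, rule_format]
  have "linear_pm ?g"
    unfolding linear_pm_def
  proof (intro conjI allI)
    fix x y
    let ?S = "{i. app (f i) x \<noteq> 0} \<union> {i. app (f i) y \<noteq> 0}"
    have *: "?g z = (\<Sum>i\<in>?S. app (f i) z)" if "{i. app (f i) z \<noteq> 0} \<subseteq> ?S" for z
      using that fin[of x] fin[of y] by (intro sum.mono_neutral_left) auto
    have "{i. app (f i) (x + y) \<noteq> 0} \<subseteq> ?S" by auto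
    then have "?g (x + y) = (\<Sum>i\<in>?S. app (f i) (x + y))" by (rule *)
    also have "\<dots> = ?g x + ?g y"
      by (simp add: sum.distrib *)
    finally show "?g (x + y) = ?g x + ?g y" .
  next
    fix c x
    show "?g (scale_pm c x) = scale_pm c (?g x)"
    proof -
      have "?g (scale_pm c x) = (\<Sum>i | app (f i) x \<noteq> 0. app (f i) (scale_pm c x))"
        using fin[of x] by (intro sum.mono_neutral_left) auto
      then show ?thesis by (simp add: scale_pm_sum)
    qed
  qed
  then have *: "lsum f (Endo ?g)"
    using fin by (simp add: lsum_def Endo_inverse)
  show ?thesis unfolding LS_eqI[OF *] by (rule *)
qed

lemma lsum_cong: "(\<And>i. f i = g i) \<Longrightarrow> lsum f A \<Longrightarrow> lsum g A"
  by (simp add: lsum_def)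

lemma lsum_add:
  assumes "lsum f A" "lsum g B" shows "lsum (\<lambda>i. f i + g i) (A + B)"
proof (rule lsumI)
  fix w
  let ?S = "{i. app (f i) w \<noteq> 0} \<union> {i. app (g i) w \<noteq> 0}"
  have fin: "finite ?S" using assms by (auto simp: lsum_def)
  show "\<exists>S. finite S \<and> (\<forall>i. i \<notin> S \<longrightarrow> app (f i + g i) w = 0) \<and> app (A + B) w = (\<Sum>i\<in>S. app (f i + g i) w)"
    using fin lsumD[OF assms(1) fin] lsumD[OF assms(2) fin]
    by (intro exI[of _ ?S]) (simp add: sum.distrib)
qed

lemma lsum_mult_left: assumes "lsum f A" shows "lsum (\<lambda>i. C * f i) (C * A)"
proof (rule lsumI)
  fix w
  show "\<exists>S. finite S \<and> (\<forall>i. i \<notin> S \<longrightarrow> app (C * f i) w = 0) \<and> app (C * A) w = (\<Sum>i\<in>S. app (C * f i) w)"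
    using assms by (intro exI[of _ "{i. app (f i) w \<noteq> 0}"]) (simp add: lsum_def app_sum)
qed

lemma lsum_mult_right: assumes "lsum f A" shows "lsum (\<lambda>i. f i * C) (A * C)"
proof (rule lsumI)
  fix w
  show "\<exists>S. finite S \<and> (\<forall>i. i \<notin> S \<longrightarrow> app (f i * C) w = 0) \<and> app (A * C) w = (\<Sum>i\<in>S. app (f i * C) w)"
    using assms by (intro exI[of _ "{i. app (f i) (app C w) \<noteq> 0}"]) (simp add: lsum_def)
qed

lemma lsum_sm: "lsum f A \<Longrightarrow> lsum (\<lambda>i. c *\<^sub>C f i) (c *\<^sub>C A)"
  using lsum_mult_left[of f A "c *\<^sub>C 1"] by simp

lemma lsum_minus: "lsum f A \<Longrightarrow> lsum (\<lambda>i. - f i) (- A)"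
  using lsum_mult_left[of f A "- 1"] by simp

lemma lsum_diff: "lsum f A \<Longrightarrow> lsum g B \<Longrightarrow> lsum (\<lambda>i. f i - g i) (A - B)"
  using lsum_add[OF _ lsum_minus, of f A g B] by simp

lemma lsum_finite:
  assumes "finite S" "\<And>i. i \<notin> S \<Longrightarrow> f i = 0"
  shows "lsum f (\<Sum>i\<in>S. f i)"
  using assms by (intro lsumI exI[of _ S]) (auto simp: app_sum_endo)

lemma lsum_single: "(\<And>i. i \<noteq> a \<Longrightarrow> f i = 0) \<Longrightarrow> lsum f (f a)"
  using lsum_finite[of "{a}" f] by simp

lemma lsum_zero: "lsum (\<lambda>_. 0) 0"
  by (simp add: lsum_def)

lemma lsum_reindex:
  assumes "lsum f A" "bij h"
  shows "lsum (\<lambda>i. f (h i)) A"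
proof (rule lsumI)
  fix w
  let ?S = "{i. app (f i) w \<noteq> 0}"
  have b: "bij_betw h (h -` ?S) ?S"
    using assms(2) by (auto simp: bij_betw_def bij_def inj_on_def surj_def)
  have "finite (h -` ?S)"
    using assms b lsum_finite_supp by (metis bij_betw_finite)
  moreover have "app A w = (\<Sum>i\<in>h -` ?S. app (f (h i)) w)"
    using assms(1) sum.reindex_bij_betw[OF b, of "\<lambda>i. app (f i) w"] by (simp add: lsum_def)
  ultimately show "\<exists>S. finite S \<and> (\<forall>i. i \<notin> S \<longrightarrow> app (f (h i)) w = 0) \<and> app A w = (\<Sum>i\<in>S. app (f (h i)) w)"
    by (intro exI[of _ "h -` ?S"]) auto
qed

lemma bij_int_shift: "bij (\<lambda>n :: int. n + c)" "bij (\<lambda>n :: int. n - c)"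
  "bij (\<lambda>n :: int. c - n)" "bij (\<lambda>n :: int. - n)"
  by (auto simp: bij_def inj_def surj_def)

lemma lsum_fubini:
  fixes F :: "'i \<times> 'j \<Rightarrow> 'b endo"
  assumes "lsum F A" "\<And>i. lsum (\<lambda>j. F (i, j)) (G i)"
  shows "lsum G A"
proof (rule lsumI)
  fix w
  let ?P = "{p. app (F p) w \<noteq> 0}"
  let ?I = "fst ` ?P" and ?J = "snd ` ?P"
  have P: "finite ?P" using assms(1) by (rule lsum_finite_supp)
  have sub: "?P \<subseteq> ?I \<times> ?J" by force
  have G: "app (G i) w = (\<Sum>j\<in>?J. app (F (i, j)) w)" for i
    using P by (intro lsumD[OF assms(2)]) (auto simp: image_iff)
  have "app (G i) w = 0" if "i \<notin> ?I" for i
    unfolding G using that by (intro sum.neutral) (auto simp: image_iff)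
  moreover have "app A w = (\<Sum>p\<in>?I \<times> ?J. app (F p) w)"
    using P sub by (intro lsumD[OF assms(1)]) auto
  ultimately show "\<exists>S. finite S \<and> (\<forall>i. i \<notin> S \<longrightarrow> app (G i) w = 0) \<and> app A w = (\<Sum>i\<in>S. app (G i) w)"
    using P by (intro exI[of _ ?I]) (simp add: G sum.cartesian_product)
qed

lemma lsum_fubini_swap:
  fixes F :: "'i \<times> 'j \<Rightarrow> 'b endo"
  assumes "lsum F A" "\<And>j. lsum (\<lambda>i. F (i, j)) (G j)"
  shows "lsum G A"
proof -
  have "bij (prod.swap :: 'j \<times> 'i \<Rightarrow> 'i \<times> 'j)"
    by (rule bij_swap)
  from lsum_reindex[OF assms(1) this] have "lsum (\<lambda>p. F (prod.swap p)) A" .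
  then show ?thesis
    by (rule lsum_fubini) (use assms(2) in simp)
qed

text \<open>
  The rearrangement principle behind all operator identities below: a double family that is locally
  finite as a whole may be summed along rows or along columns.
\<close>

lemma lsum_exchange:
  fixes F :: "'i \<times> 'j \<Rightarrow> 'b endo"
  assumes "loc_fin F" "\<And>i. lsum (\<lambda>j. F (i, j)) (G i)" "\<And>j. lsum (\<lambda>i. F (i, j)) (H j)"
  obtains A where "lsum G A" "lsum H A"
  using lsum_fubini[OF lsum_LS[OF assms(1)] assms(2)] lsum_fubini_swap[OF lsum_LS[OF assms(1)] assms(3)]
  by blast

section \<open>The Fock space and its modes\<close>

(* Keeps the exponent of a single mode in the form 1, so that equal basis vectors look equal. *)
declare One_nat_def [simp del]

datatype color = ColX | ColY | ColS

text \<open>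
  The variable \<open>(c, i)\<close> stands for the creation operator of color \<open>c\<close> and size \<open>i + 1\<close>. A basis
  vector of the Fock space is a monomial in these variables together with the integer \<open>k\<close> that
  indexes the basis of the top \<open>T(\<alpha>, \<beta>, \<gamma>)\<close>.
\<close>

type_synonym monomial = "(color \<times> nat) \<Rightarrow>\<^sub>0 nat"
type_synonym fock_index = "int \<times> monomial"
type_synonym fock = "fock_index \<Rightarrow>\<^sub>0 complex"
type_synonym operator = "fock_index endo"

abbreviation ket :: "fock_index \<Rightarrow> fock" where
  "ket b \<equiv> single b 1"

definition weight_sum :: "(color \<times> nat \<Rightarrow> int) \<Rightarrow> monomial \<Rightarrow> int" where
  "weight_sum g \<mu> = (\<Sum>v\<in>keys \<mu>. int (lookup \<mu> v) * g v)"

lemma weight_sum_superset: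
  assumes "finite S" "keys \<mu> \<subseteq> S"
  shows "weight_sum g \<mu> = (\<Sum>v\<in>S. int (lookup \<mu> v) * g v)"
  unfolding weight_sum_def using assms by (intro sum.mono_neutral_left) (auto simp: in_keys_iff)

lemma weight_sum_add: "weight_sum g (\<mu> + \<nu>) = weight_sum g \<mu> + weight_sum g \<nu>"
proof -
  let ?S = "keys \<mu> \<union> keys \<nu>"
  have "keys (\<mu> + \<nu>) \<subseteq> ?S" by (rule keys_add)
  then show ?thesis
    by (simp add: weight_sum_superset[of ?S] lookup_add sum.distrib distrib_right)
qed

lemma weight_sum_single [simp]: "weight_sum g (single v n) = int n * g v"
  by (simp add: weight_sum_def)

lemma weight_sum_0 [simp]: "weight_sum g 0 = 0"
  by (simp add: weight_sum_def)

lemma monomial_remove: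
  fixes \<mu> :: monomial
  assumes "lookup \<mu> v \<noteq> 0"
  shows "\<mu> - single v 1 + single v 1 = \<mu>"
  using assms by (intro poly_mapping_eqI) (auto simp: lookup_add lookup_minus lookup_single when_def)

lemma weight_sum_remove:
  assumes "lookup \<mu> v \<noteq> 0"
  shows "weight_sum g (\<mu> - single v 1) = weight_sum g \<mu> - g v"
  using weight_sum_add[of g "\<mu> - single v 1" "single v 1"]
  by (simp add: monomial_remove[OF assms])

definition mode_size :: "color \<times> nat \<Rightarrow> int" where
  "mode_size v = int (Suc (snd v))"

definition depth :: "fock_index \<Rightarrow> int" where
  "depth b = weight_sum mode_size (snd b)"

text \<open>
  The eigenvalue of the number operator of the pair of conjugate fields: it is raised by every mode
  of \<open>phi\<close> and lowered by every nonzero mode of \<open>del\<close>. Triangularity with respect to it is what makes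
  the Casimir operator of the zero modes computable.
\<close>

definition tilt :: "fock_index \<Rightarrow> int" where
  "tilt b = weight_sum (\<lambda>v. case fst v of ColX \<Rightarrow> 1 | ColY \<Rightarrow> - 1 | ColS \<Rightarrow> 0) (snd b)"

lemma depth_nonneg: "0 \<le> depth b"
  unfolding depth_def weight_sum_def mode_size_def by (intro sum_nonneg) auto

subsection \<open>Operators that move the basis vectors in a prescribed way\<close>

definition moves :: "(fock_index \<Rightarrow> fock_index \<Rightarrow> bool) \<Rightarrow> operator \<Rightarrow> bool" where
  "moves R A \<longleftrightarrow> (\<forall>b p. lookup (app A (ket b)) p \<noteq> 0 \<longrightarrow> R b p)"

lemma moves_0: "moves R 0"
  by (simp add: moves_def)

lemma moves_add: "moves R A \<Longrightarrow> moves R B \<Longrightarrow> moves R (A + B)"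
  unfolding moves_def by (simp add: lookup_add) (metis add_0)

lemma moves_uminus: "moves R A \<Longrightarrow> moves R (- A)"
  unfolding moves_def by simp

lemma moves_diff: "moves R A \<Longrightarrow> moves R B \<Longrightarrow> moves R (A - B)"
  using moves_add[OF _ moves_uminus, of R A B] by simp

lemma moves_sm: "moves R A \<Longrightarrow> moves R (c *\<^sub>C A)"
  unfolding moves_def by simp

lemma app_expand: "app A w = (\<Sum>c\<in>keys w. scale_pm (lookup w c) (app A (ket c)))"
proof -
  have "app A w = lin_ext (\<lambda>i. app A (ket i)) w"
    using linear_pm_eq_lin_ext[OF linear_pm_app[of A]] by (rule fun_cong)
  then show ?thesis by (simp add: lin_ext_def)
qed

lemma lookup_app_nonzeroE:
  assumes "lookup (app A w) p \<noteq> 0"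
  obtains c where "lookup w c \<noteq> 0" "lookup (app A (ket c)) p \<noteq> 0"
proof -
  have "(\<Sum>c\<in>keys w. lookup w c * lookup (app A (ket c)) p) \<noteq> 0"
    using assms by (subst (asm) app_expand) (simp add: lookup_sum)
  then obtain c where "lookup w c * lookup (app A (ket c)) p \<noteq> 0"
    using sum.not_neutral_contains_not_neutral by blast
  then show thesis by (intro that[of c]) auto
qed

lemma moves_mult:
  assumes "moves P A" "moves Q B" "\<And>b c p. Q b c \<Longrightarrow> P c p \<Longrightarrow> R b p"
  shows "moves R (A * B)"
  unfolding moves_def
proof (intro allI impI)
  fix b p
  assume "lookup (app (A * B) (ket b)) p \<noteq> 0"
  then obtain c where "lookup (app B (ket b)) c \<noteq> 0" "lookup (app A (ket c)) p \<noteq> 0"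
    using lookup_app_nonzeroE[of A "app B (ket b)" p] by auto
  then show "R b p" using assms unfolding moves_def by blast
qed

lemma moves_lsum:
  assumes "lsum f A" "\<And>i. moves R (f i)"
  shows "moves R A"
  unfolding moves_def
proof (intro allI impI)
  fix b p
  assume "lookup (app A (ket b)) p \<noteq> 0"
  then have "(\<Sum>i | app (f i) (ket b) \<noteq> 0. lookup (app (f i) (ket b)) p) \<noteq> 0"
    using assms(1) by (simp add: lsum_def lookup_sum)
  then obtain i where "lookup (app (f i) (ket b)) p \<noteq> 0"
    using sum.not_neutral_contains_not_neutral by blast
  then show "R b p" using assms(2) unfolding moves_def by blast
qed

lemma moves_mono: "moves R A \<Longrightarrow> (\<And>b p. R b p \<Longrightarrow> Q b p) \<Longrightarrow> moves Q A"
  unfolding moves_def by blast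

definition hom :: "int \<Rightarrow> operator \<Rightarrow> bool" where
  "hom n = moves (\<lambda>b p. depth p = depth b + n)"

definition tilts :: "int \<Rightarrow> operator \<Rightarrow> bool" where
  "tilts n = moves (\<lambda>b p. tilt b + n \<le> tilt p)"

lemma hom_mult: "hom m A \<Longrightarrow> hom n B \<Longrightarrow> hom (m + n) (A * B)"
  unfolding hom_def by (erule (1) moves_mult) simp

lemma tilts_mult: "tilts m A \<Longrightarrow> tilts n B \<Longrightarrow> tilts (m + n) (A * B)"
  unfolding tilts_def by (erule (1) moves_mult) simp

lemmas hom_closed = moves_add[of "\<lambda>b p. depth p = depth b + n" for n, folded hom_def]
  moves_diff[of "\<lambda>b p. depth p = depth b + n" for n, folded hom_def]
  moves_sm[of "\<lambda>b p. depth p = depth b + n" for n, folded hom_def]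
  moves_uminus[of "\<lambda>b p. depth p = depth b + n" for n, folded hom_def]
  moves_0[of "\<lambda>b p. depth p = depth b + n" for n, folded hom_def]

lemmas hom_lsum = moves_lsum[of _ _ "\<lambda>b p. depth p = depth b + n" for n, folded hom_def]

lemmas tilts_closed = moves_add[of "\<lambda>b p. tilt b + n \<le> tilt p" for n, folded tilts_def]
  moves_diff[of "\<lambda>b p. tilt b + n \<le> tilt p" for n, folded tilts_def]
  moves_sm[of "\<lambda>b p. tilt b + n \<le> tilt p" for n, folded tilts_def]
  moves_uminus[of "\<lambda>b p. tilt b + n \<le> tilt p" for n, folded tilts_def]
  moves_0[of "\<lambda>b p. tilt b + n \<le> tilt p" for n, folded tilts_def]

lemmas tilts_lsum = moves_lsum[of _ _ "\<lambda>b p. tilt b + n \<le> tilt p" for n, folded tilts_def]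

lemma tilts_mono: "tilts m A \<Longrightarrow> n \<le> m \<Longrightarrow> tilts n A"
  unfolding tilts_def by (erule moves_mono) simp

lemma hom_1: "hom 0 1"
  by (simp add: hom_def moves_def lookup_single when_def)

lemma tilts_1: "tilts 0 1"
  by (simp add: tilts_def moves_def lookup_single when_def)

text \<open>
  Depths are nonnegative, so a homogeneous operator kills whatever it would push below zero. All
  statements of local finiteness rest on this.
\<close>

lemma hom_kills:
  assumes "hom n A" "depth b + n < 0"
  shows "app A (ket b) = 0"
proof (rule poly_mapping_eqI)
  fix p
  have "depth p = depth b + n" if "lookup (app A (ket b)) p \<noteq> 0"
    using assms(1) that unfolding hom_def moves_def by blast
  then show "lookup (app A (ket b)) p = lookup 0 p"
    using assms(2) depth_nonneg[of p] by (metis lookup_zero not_le)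
qed

lemma loc_finI:
  assumes "\<And>b. finite {i. app (f i) (ket b) \<noteq> 0}"
  shows "loc_fin f"
  unfolding loc_fin_def
proof
  fix w
  have "{i. app (f i) w \<noteq> 0} \<subseteq> (\<Union>b\<in>keys w. {i. app (f i) (ket b) \<noteq> 0})"
  proof safe
    fix i assume nz: "app (f i) w \<noteq> 0"
    show "i \<in> (\<Union>b\<in>keys w. {i. app (f i) (ket b) \<noteq> 0})"
    proof (rule ccontr)
      assume "i \<notin> (\<Union>b\<in>keys w. {i. app (f i) (ket b) \<noteq> 0})"
      then have "app (f i) w = 0" by (subst app_expand) simp
      with nz show False by simp
    qed
  qed
  then show "finite {i. app (f i) w \<noteq> 0}"
    by (rule finite_subset) (intro finite_UN_I finite_keys assms)
qed

subsection \<open>Creation and annihilation\<close>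

definition create :: "color \<times> nat \<Rightarrow> operator" where
  "create v = basis_endo (\<lambda>(k, \<mu>). ket (k, \<mu> + single v 1))"

definition annih :: "color \<times> nat \<Rightarrow> operator" where
  "annih v = basis_endo (\<lambda>(k, \<mu>). single (k, \<mu> - single v 1)
     (of_nat (lookup \<mu> v)))"

definition shift :: "int \<Rightarrow> operator" where
  "shift m = basis_endo (\<lambda>(k, \<mu>). ket (k + m, \<mu>))"

definition momentum :: "complex \<Rightarrow> operator" where
  "momentum \<gamma> = basis_endo (\<lambda>(k, \<mu>). single (k, \<mu>) (\<gamma> + of_int k))"

lemma app_create [simp]: "app (create v) (single (k, \<mu>) c) = single (k, \<mu> + single v 1) c"
  by (simp add: create_def)

lemma app_annih [simp]: "app (annih v) (single (k, \<mu>) c)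
    = single (k, \<mu> - single v 1) (c * of_nat (lookup \<mu> v))"
  by (simp add: annih_def)

lemma app_shift [simp]: "app (shift m) (single (k, \<mu>) c) = single (k + m, \<mu>) c"
  by (simp add: shift_def)

lemma app_momentum [simp]: "app (momentum \<gamma>) (single (k, \<mu>) c)
    = single (k, \<mu>) (c * (\<gamma> + of_int k))"
  by (simp add: momentum_def)

definition cm :: "'b endo \<Rightarrow> 'b endo \<Rightarrow> 'b endo" where
  "cm A B = A * B - B * A"

lemma cm_simps:
  "cm A (B * C) = cm A B * C + B * cm A C" "cm (A * B) C = A * cm B C + cm A C * B"
  "cm A (B + C) = cm A B + cm A C" "cm (A + B) C = cm A C + cm B C"
  "cm A (B - C) = cm A B - cm A C" "cm (A - B) C = cm A C - cm B C"
  "cm A (- B) = - cm A B" "cm (- A) B = - cm A B"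
  "cm A (c *\<^sub>C B) = c *\<^sub>C cm A B" "cm (c *\<^sub>C A) B = c *\<^sub>C cm A B"
  "cm A 0 = 0" "cm 0 A = 0" "cm A A = 0" "cm A 1 = 0" "cm 1 A = 0"
  by (simp_all add: cm_def algebra_simps sm_distrib)

lemma cm_swap: "cm A B = - cm B A"
  by (simp add: cm_def)

lemma cm_eq_0_iff: "cm A B = 0 \<longleftrightarrow> A * B = B * A"
  by (simp add: cm_def)

lemma lsum_cm: "lsum f A \<Longrightarrow> lsum (\<lambda>i. cm C (f i)) (cm C A)"
  unfolding cm_def by (intro lsum_diff lsum_mult_left lsum_mult_right)

lemma lsum_cm': "lsum f A \<Longrightarrow> lsum (\<lambda>i. cm (f i) C) (cm A C)"
  unfolding cm_def by (intro lsum_diff lsum_mult_left lsum_mult_right)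

lemma pm_diff_add_single: "v \<noteq> w \<Longrightarrow> (\<mu> :: monomial) + single v 1 - single w 1
   = \<mu> - single w 1 + single v 1"
  by (intro poly_mapping_eqI) (auto simp: lookup_add lookup_minus lookup_single when_def)

lemma cm_create_create: "cm (create v) (create w) = 0"
  by (rule endo_eqI_basis) (auto simp: cm_def add_ac split: prod.splits)

lemma cm_annih_annih: "cm (annih v) (annih w) = 0"
proof (rule endo_eqI_basis)
  fix b :: fock_index
  obtain k \<mu> where b: "b = (k, \<mu>)" by force
  have "\<mu> - single v 1 - single w 1 = \<mu> - single w 1 - single v 1"
    by (rule poly_mapping_eqI) (simp add: lookup_minus)
  then show "app (cm (annih v) (annih w)) (ket b) = app 0 (ket b)"
    by (cases "v = w") (auto simp: b cm_def lookup_minus lookup_single when_def mult_ac)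
qed

lemma cm_annih_create: "cm (annih v) (create w) = (if v = w then 1 else 0)"
proof (rule endo_eqI_basis)
  fix b :: fock_index
  obtain k \<mu> where b: "b = (k, \<mu>)" by force
  show "app (cm (annih v) (create w)) (ket b) = app (if v = w then 1 else 0) (ket b)"
  proof (cases "v = w")
    case False
    then show ?thesis
      by (simp add: b cm_def lookup_add lookup_single when_def pm_diff_add_single)
  next
    case True
    show ?thesis
    proof (cases "lookup \<mu> w = 0")
      case True
      then show ?thesis using \<open>v = w\<close> by (simp add: b cm_def lookup_add)
    next
      case False
      show ?thesis using \<open>v = w\<close> monomial_remove[OF False]
        by (simp add: b cm_def lookup_add single_diff[symmetric])
    qed
  qed
qed

lemma cm_shift_create: "cm (shift m) (create v) = 0"
  and cm_shift_annih: "cm (shift m) (annih v) = 0"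
  and cm_shift_shift: "cm (shift m) (shift n) = 0"
  and shift_add: "shift m * shift n = shift (m + n)"
  and shift_0: "shift 0 = 1"
  and cm_momentum_create: "cm (momentum \<gamma>) (create v) = 0"
  and cm_momentum_annih: "cm (momentum \<gamma>) (annih v) = 0"
  by (rule endo_eqI_basis; auto simp: cm_def add_ac mult_ac)+

lemma cm_momentum_shift: "cm (momentum \<gamma>) (shift m) = of_int m *\<^sub>C shift m"
  by (rule endo_eqI_basis) (auto simp: cm_def algebra_simps simp flip: single_add)

lemma hom_create: "hom (mode_size v) (create v)"
  and hom_annih: "hom (- mode_size v) (annih v)"
  and hom_shift: "hom 0 (shift m)"
  and hom_momentum: "hom 0 (momentum \<gamma>)"
  by (auto simp: hom_def moves_def lookup_single when_def depth_def weight_sum_add weight_sum_remove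
      split: if_splits)

lemma tilts_create: "tilts (case fst v of ColX \<Rightarrow> 1 | ColY \<Rightarrow> - 1 | ColS \<Rightarrow> 0) (create v)"
  and tilts_annih: "tilts (- (case fst v of ColX \<Rightarrow> 1 | ColY \<Rightarrow> - 1 | ColS \<Rightarrow> 0)) (annih v)"
  and tilts_shift: "tilts 0 (shift m)"
  and tilts_momentum: "tilts 0 (momentum \<gamma>)"
  by (auto simp: tilts_def moves_def lookup_single when_def tilt_def weight_sum_add weight_sum_remove
      split: if_splits)

subsection \<open>The three free fields\<close>

text \<open>
  The modes of a field \<open>phi\<close> and its conjugate \<open>del\<close>. The mode \<open>phi 0\<close> is set to zero because the
  zero mode of \<open>phi\<close> only enters through its exponentials, the operators \<open>shift m\<close>; its conjugate
  is \<open>del \<gamma> 0\<close>, which multiplies by \<open>\<gamma> + k\<close>.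
\<close>

definition phi :: "int \<Rightarrow> operator" where
  "phi n = (if n > 0 then create (ColX, nat n - 1) else if n < 0 then - annih (ColY, nat (- n) - 1) else 0)"

definition del :: "complex \<Rightarrow> int \<Rightarrow> operator" where
  "del \<gamma> n = (if n > 0 then annih (ColX, nat n - 1) else if n < 0 then create (ColY, nat (- n) - 1)
     else momentum \<gamma>)"

text \<open>
  A Heisenberg current of level \<open>- 1\<close> that commutes with the other two fields. The parameter
  \<open>\<alpha>\<close> of the module enters the action only through its zero mode.
\<close>

definition cur :: "complex \<Rightarrow> int \<Rightarrow> operator" where
  "cur \<alpha> n = (if n > 0 then create (ColS, nat n - 1)
     else if n < 0 then of_int (- n) *\<^sub>C annih (ColS, nat (- n) - 1) else - (\<alpha> *\<^sub>C 1))"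

lemma hom_phi: "hom n (phi n)"
  using hom_create[of "(ColX, nat n - 1)"] hom_annih[of "(ColY, nat (- n) - 1)"]
  by (auto simp: phi_def mode_size_def hom_closed of_nat_diff)

lemma hom_del: "hom (- n) (del \<gamma> n)"
  using hom_annih[of "(ColX, nat n - 1)"] hom_create[of "(ColY, nat (- n) - 1)"] hom_momentum[of \<gamma>]
  by (cases "n = 0") (auto simp: del_def mode_size_def hom_closed of_nat_diff)

lemma hom_cur: "hom n (cur \<alpha> n)"
  using hom_create[of "(ColS, nat n - 1)"] hom_annih[of "(ColS, nat (- n) - 1)"] hom_1
  by (cases "n = 0") (auto simp: cur_def mode_size_def hom_closed of_nat_diff)

lemma tilts_phi: "tilts 1 (phi n)"
  using tilts_create[of "(ColX, nat n - 1)"] tilts_annih[of "(ColY, nat (- n) - 1)"]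
  by (auto simp: phi_def tilts_closed)

lemma tilts_del: "n \<noteq> 0 \<Longrightarrow> tilts (- 1) (del \<gamma> n)"
  using tilts_annih[of "(ColX, nat n - 1)"] tilts_create[of "(ColY, nat (- n) - 1)"]
  by (auto simp: del_def)

lemma tilts_cur: "tilts 0 (cur \<alpha> n)"
  using tilts_create[of "(ColS, nat n - 1)"] tilts_annih[of "(ColS, nat (- n) - 1)"] tilts_1
  by (auto simp: cur_def tilts_closed)

lemma nat_index_eq: "0 < (m::int) \<Longrightarrow> 0 < n \<Longrightarrow> (nat m - 1 = nat n - 1) = (m = n)"
  by auto

lemmas free_cms = cm_create_create cm_annih_annih cm_annih_create cm_swap[of "create _" "annih _"]
  cm_shift_create cm_shift_annih cm_shift_shift cm_momentum_create cm_momentum_annih cm_momentum_shift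
  cm_swap[of "create _" "momentum _"] cm_swap[of "annih _" "momentum _"]
  cm_swap[of "create _" "shift _"] cm_swap[of "annih _" "shift _"]

lemma cm_phi_phi: "cm (phi m) (phi n) = 0"
  and cm_phi_shift: "cm (phi m) (shift r) = 0"
  and cm_phi_cur: "cm (phi m) (cur \<alpha> n) = 0"
  and cm_shift_cur: "cm (shift r) (cur \<alpha> n) = 0"
  and cm_del_del: "cm (del \<gamma> m) (del \<gamma> n) = 0"
  and cm_del_cur: "cm (del \<gamma> m) (cur \<alpha> n) = 0"
  and cm_del_shift: "cm (del \<gamma> m) (shift r) = (if m = 0 then of_int r *\<^sub>C shift r else 0)"
  by (auto simp: phi_def del_def cur_def cm_simps free_cms)

lemma cm_del_phi: "cm (del \<gamma> m) (phi n) = (if m = n \<and> n \<noteq> 0 then 1 else 0)"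
  by (auto simp: phi_def del_def cm_simps free_cms nat_index_eq)

lemma cm_cur_cur: "cm (cur \<alpha> m) (cur \<alpha> n) = (if m + n = 0 then - of_int m *\<^sub>C 1 else 0)"
proof -
  have "nat (- n) - 1 = nat m - 1 \<longleftrightarrow> m + n = 0" if "m > 0" "n < 0" for m n :: int
    using that by auto
  then show ?thesis
    by (auto simp: cur_def cm_simps free_cms sm_distrib dest!: eq_neg_iff_add_eq_0[THEN iffD2])
qed

section \<open>Vertex operators\<close>

subsection \<open>Commuting fields and their products\<close>

text \<open>
  The bicommutant of the modes of \<open>phi\<close> and the shifts. Everything built from them, also by locally
  finite sums, stays inside; any two elements commute; and an operator that commutes with the
  generators commutes with all of it. This spares inductions over the construction of the vertex
  operators.
\<close>

definition fun_alg :: "operator set" where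
  "fun_alg = {A. \<forall>B. (\<forall>n. B * phi n = phi n * B) \<and> (\<forall>m. B * shift m = shift m * B) \<longrightarrow> B * A = A * B}"

lemma fun_alg_commutes_with:
  "A \<in> fun_alg \<Longrightarrow> (\<And>n. cm B (phi n) = 0) \<Longrightarrow> (\<And>m. cm B (shift m) = 0) \<Longrightarrow> cm B A = 0"
  unfolding fun_alg_def cm_eq_0_iff by blast

lemma phi_fun_alg: "phi n \<in> fun_alg" and shift_fun_alg: "shift m \<in> fun_alg"
  unfolding fun_alg_def by auto

lemma fun_alg_commute:
  assumes "A \<in> fun_alg" "B \<in> fun_alg"
  shows "A * B = B * A"
proof -
  have *: "cm A (phi n) = 0" for n
    using fun_alg_commutes_with[OF assms(1), of "phi n"] cm_swap[of A "phi n"]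
    by (simp add: cm_phi_phi cm_phi_shift)
  have **: "cm A (shift n) = 0" for n
    using fun_alg_commutes_with[OF assms(1), of "shift n"] cm_swap[of A "shift n"]
      cm_swap[of "shift n" "phi _"]
    by (simp add: cm_phi_phi cm_phi_shift cm_shift_shift)
  show ?thesis
    using fun_alg_commutes_with[OF assms(2) * **] by (simp add: cm_eq_0_iff)
qed

lemma fun_algD:
  "A \<in> fun_alg \<Longrightarrow> (\<forall>n. C * phi n = phi n * C) \<and> (\<forall>m. C * shift m = shift m * C) \<Longrightarrow> C * A = A * C"
  unfolding fun_alg_def by blast

lemma fun_algI:
  "(\<And>C. (\<forall>n. C * phi n = phi n * C) \<and> (\<forall>m. C * shift m = shift m * C) \<Longrightarrow> C * A = A * C) \<Longrightarrow> A \<in> fun_alg"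
  unfolding fun_alg_def by blast

lemma fun_alg_mult:
  assumes "A \<in> fun_alg" "B \<in> fun_alg" shows "A * B \<in> fun_alg"
proof (rule fun_algI)
  fix C assume "(\<forall>n. C * phi n = phi n * C) \<and> (\<forall>m. C * shift m = shift m * C)"
  then have 1: "C * A = A * C" and 2: "C * B = B * C" using assms by (simp_all add: fun_algD)
  have "C * (A * B) = A * (C * B)" by (simp only: 1 flip: mult.assoc)
  then show "C * (A * B) = A * B * C" by (simp only: 2 mult.assoc)
qed

lemma fun_alg_add:
  assumes "A \<in> fun_alg" "B \<in> fun_alg" shows "A + B \<in> fun_alg"
proof (rule fun_algI)
  fix C assume C: "(\<forall>n. C * phi n = phi n * C) \<and> (\<forall>m. C * shift m = shift m * C)"
  show "C * (A + B) = (A + B) * C"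
    by (simp only: distrib_left distrib_right fun_algD[OF assms(1) C] fun_algD[OF assms(2) C])
qed

lemma fun_alg_sm:
  assumes "A \<in> fun_alg" shows "c *\<^sub>C A \<in> fun_alg"
proof (rule fun_algI)
  fix C assume C: "(\<forall>n. C * phi n = phi n * C) \<and> (\<forall>m. C * shift m = shift m * C)"
  show "C * c *\<^sub>C A = c *\<^sub>C A * C"
    by (simp only: sm_simps fun_algD[OF assms C])
qed

lemma fun_alg_0: "0 \<in> fun_alg" and fun_alg_1: "1 \<in> fun_alg"
  unfolding fun_alg_def by auto

lemma fun_alg_lsum:
  assumes "lsum f A" "\<And>i. f i \<in> fun_alg"
  shows "A \<in> fun_alg"
  unfolding fun_alg_def mem_Collect_eq
proof (intro allI impI)
  fix B assume B: "(\<forall>n. B * phi n = phi n * B) \<and> (\<forall>m. B * shift m = shift m * B)"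
  have "B * f i = f i * B" for i
    using assms(2)[of i] B unfolding fun_alg_def by blast
  then have "lsum (\<lambda>i. f i * B) (B * A)"
    using lsum_mult_left[OF assms(1), of B] by simp
  then show "B * A = A * B"
    using lsum_mult_right[OF assms(1), of B] by (rule lsum_unique)
qed

lemma fun_alg_sum: "(\<And>i. i \<in> S \<Longrightarrow> f i \<in> fun_alg) \<Longrightarrow> sum f S \<in> fun_alg"
  by (induction S rule: infinite_finite_induct) (auto intro: fun_alg_0 fun_alg_add)

text \<open>
  Fields that are functions of \<open>phi\<close> alone. Homogeneity is what makes the sums over modes in their
  products locally finite.
\<close>

definition is_field :: "(int \<Rightarrow> operator) \<Rightarrow> bool" where
  "is_field f \<longleftrightarrow> (\<forall>n. f n \<in> fun_alg \<and> hom n (f n))"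

text \<open>
  The modes of the product of two fields.
\<close>

definition conv :: "(int \<Rightarrow> operator) \<Rightarrow> (int \<Rightarrow> operator) \<Rightarrow> int \<Rightarrow> operator" where
  "conv f g l = LS (\<lambda>k. f k * g (l - k))"

lemma field_commute: "is_field f \<Longrightarrow> is_field g \<Longrightarrow> f m * g n = g n * f m"
  unfolding is_field_def by (blast intro: fun_alg_commute)

lemma field_kills: "is_field f \<Longrightarrow> depth b + n < 0 \<Longrightarrow> app (f n) (ket b) = 0"
  unfolding is_field_def using hom_kills by blast

lemma lsum_conv:
  assumes f: "is_field f" and g: "is_field g"
  shows "lsum (\<lambda>k. f k * g (l - k)) (conv f g l)"
  unfolding conv_def
proof (intro lsum_LS loc_finI)
  fix b
  have "{k. app (f k * g (l - k)) (ket b) \<noteq> 0} \<subseteq> {- depth b..l + depth b}"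
  proof
    fix k assume "k \<in> {k. app (f k * g (l - k)) (ket b) \<noteq> 0}"
    then have "app (f k * g (l - k)) (ket b) \<noteq> 0" "app (g (l - k) * f k) (ket b) \<noteq> 0"
      by (auto simp: field_commute[OF f g])
    then have "\<not> depth b + (l - k) < 0" "\<not> depth b + k < 0"
      using field_kills[OF f, of b k] field_kills[OF g, of b "l - k"] by auto
    then show "k \<in> {- depth b..l + depth b}" by auto
  qed
  then show "finite {k. app (f k * g (l - k)) (ket b) \<noteq> 0}"
    by (rule finite_subset) simp
qed

lemma lsum_conv_shift:
  assumes f: "is_field f" and g: "is_field g"
  shows "lsum (\<lambda>i. f (i - a) * g (c - i)) (conv f g (c - a))"
  by (rule lsum_cong[OF _ lsum_reindex[OF lsum_conv[OF assms, of "c - a"] bij_int_shift(2)[of a]]])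
     (simp add: algebra_simps)

lemma lsum_conv_reflect:
  assumes f: "is_field f" and g: "is_field g"
  shows "lsum (\<lambda>i. f (a - i) * g (c + i)) (conv f g (a + c))"
  by (rule lsum_cong[OF _ lsum_reindex[OF lsum_conv[OF assms, of "a + c"] bij_int_shift(3)[of a]]])
     (simp add: algebra_simps)

lemma conv_eqI: "is_field f \<Longrightarrow> is_field g \<Longrightarrow> lsum (\<lambda>k. f k * g (l - k)) A \<Longrightarrow> conv f g l = A"
  by (rule lsum_unique[OF lsum_conv])

lemma field_conv:
  assumes "is_field f" "is_field g" shows "is_field (conv f g)"
  unfolding is_field_def
proof
  fix n
  have "hom n (f k * g (n - k))" for k
    using hom_mult[of k "f k" "n - k" "g (n - k)"] assms unfolding is_field_def by simp
  then show "conv f g n \<in> fun_alg \<and> hom n (conv f g n)"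
    using assms lsum_conv[OF assms, of n] unfolding is_field_def
    by (blast intro: fun_alg_lsum hom_lsum fun_alg_mult)
qed

lemma conv_commute:
  assumes "is_field f" "is_field g" shows "conv f g = conv g f"
proof
  fix l
  have "lsum (\<lambda>k. f (l - k) * g (0 + k)) (conv f g (l + 0))"
    using lsum_conv_reflect[OF assms, of l 0] by simp
  then have "lsum (\<lambda>k. g k * f (l - k)) (conv f g l)"
    by (simp add: field_commute[OF assms])
  then show "conv f g l = conv g f l"
    by (rule conv_eqI[OF assms(2,1), symmetric])
qed

lemma commuting_triple_nonzero:
  assumes "A * B = B * A" "A * C = C * A" "B * C = C * B" "app (A * B * C) w \<noteq> 0"
  shows "app A w \<noteq> 0" "app B w \<noteq> 0" "app C w \<noteq> 0"
proof -
  have 1: "A * B * C = B * C * A" by (metis assms(1,2) mult.assoc)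
  have 2: "A * B * C = A * C * B" by (simp only: mult.assoc assms(3))
  show "app A w \<noteq> 0" using assms(4) unfolding 1 by auto
  show "app B w \<noteq> 0" using assms(4) unfolding 2 by auto
  show "app C w \<noteq> 0" using assms(4) by auto
qed

lemma conv_assoc:
  assumes f: "is_field f" and g: "is_field g" and h: "is_field h"
  shows "conv (conv f g) h = conv f (conv g h)"
proof
  fix n
  let ?F = "\<lambda>(i, k). f k * g (i - k) * h (n - i)"
  have lf: "loc_fin ?F"
  proof (rule loc_finI)
    fix b
    let ?d = "depth b"
    have "{p. app (?F p) (ket b) \<noteq> 0} \<subseteq> {- 2 * ?d..n + ?d} \<times> {- ?d..n + 2 * ?d}"
    proof
      fix p assume p: "p \<in> {p. app (?F p) (ket b) \<noteq> 0}"
      obtain i k where ik: "p = (i, k)" by force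
      have 1: "app (f k * g (i - k) * h (n - i)) (ket b) \<noteq> 0" using p ik by simp
      from commuting_triple_nonzero[OF field_commute[OF f g] field_commute[OF f h] field_commute[OF g h] 1]
      have "\<not> ?d + (n - i) < 0" "\<not> ?d + (i - k) < 0" "\<not> ?d + k < 0"
        using field_kills[OF h, of b "n - i"] field_kills[OF g, of b "i - k"] field_kills[OF f, of b k]
        by auto
      then show "p \<in> {- 2 * ?d..n + ?d} \<times> {- ?d..n + 2 * ?d}" unfolding ik by auto
    qed
    then show "finite {p. app (?F p) (ket b) \<noteq> 0}" by (rule finite_subset) simp
  qed
  have 1: "lsum (\<lambda>k. ?F (i, k)) (conv f g i * h (n - i))" for i
    using lsum_mult_right[OF lsum_conv[OF f g]] by simp
  have 2: "lsum (\<lambda>i. ?F (i, k)) (f k * conv g h (n - k))" for k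
    using lsum_mult_left[OF lsum_conv_shift[OF g h, of k n], of "f k"] by (simp add: mult.assoc)
  obtain A where A: "lsum (\<lambda>i. conv f g i * h (n - i)) A" "lsum (\<lambda>k. f k * conv g h (n - k)) A"
    by (rule lsum_exchange[OF lf 1 2])
  show "conv (conv f g) h n = conv f (conv g h) n"
    unfolding conv_eqI[OF field_conv[OF f g] h A(1)] conv_eqI[OF f field_conv[OF g h] A(2)] ..
qed

lemma conv_left_commute:
  "is_field f \<Longrightarrow> is_field g \<Longrightarrow> is_field h \<Longrightarrow> conv f (conv g h) = conv g (conv f h)"
  by (metis conv_assoc conv_commute)

lemma field_sm: "is_field f \<Longrightarrow> is_field (\<lambda>n. c n *\<^sub>C f n)"
  unfolding is_field_def by (auto intro: fun_alg_sm hom_closed)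

lemma field_add: "is_field f \<Longrightarrow> is_field g \<Longrightarrow> is_field (\<lambda>n. f n + g n)"
  unfolding is_field_def by (auto intro: fun_alg_add hom_closed)

lemma conv_sm_left:
  assumes "is_field f" "is_field g"
  shows "conv (\<lambda>n. c *\<^sub>C f n) g l = c *\<^sub>C conv f g l"
  using lsum_sm[OF lsum_conv[OF assms]] by (intro conv_eqI field_sm assms) simp

lemma conv_sm_right:
  assumes "is_field f" "is_field g"
  shows "conv f (\<lambda>n. c *\<^sub>C g n) l = c *\<^sub>C conv f g l"
  using lsum_sm[OF lsum_conv[OF assms]] by (intro conv_eqI field_sm assms) simp

lemma conv_add_left:
  assumes "is_field f" "is_field g" "is_field h"
  shows "conv (\<lambda>n. f n + g n) h l = conv f h l + conv g h l"
  using lsum_add[OF lsum_conv[OF assms(1,3)] lsum_conv[OF assms(2,3)]]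
  by (intro conv_eqI field_add assms) (simp add: distrib_right)

text \<open>
  The Leibniz rule: multiplying the \<open>n\<close>-th mode by \<open>n\<close> is the derivation \<open>t\<^sub>0 d/dt\<^sub>0\<close>.
\<close>

lemma conv_deriv:
  assumes "is_field f" "is_field g"
  shows "of_int l *\<^sub>C conv f g l
    = conv (\<lambda>n. of_int n *\<^sub>C f n) g l + conv f (\<lambda>n. of_int n *\<^sub>C g n) l"
proof -
  have "lsum (\<lambda>k. (of_int k *\<^sub>C f k) * g (l - k) + f k * (of_int (l - k) *\<^sub>C g (l - k)))
      (conv (\<lambda>n. of_int n *\<^sub>C f n) g l + conv f (\<lambda>n. of_int n *\<^sub>C g n) l)"
    by (intro lsum_add lsum_conv field_sm assms)
  moreover have "(of_int k *\<^sub>C f k) * g (l - k) + f k * (of_int (l - k) *\<^sub>C g (l - k))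
      = of_int l *\<^sub>C (f k * g (l - k))" for k
    by (rule endo_eqI_entry) (simp add: entry_simps algebra_simps)
  ultimately show ?thesis
    using lsum_unique[OF lsum_sm[OF lsum_conv[OF assms]]] by simp
qed

subsection \<open>The exponential of half of a field\<close>

text \<open>
  The coefficients \<open>e n\<close> of the exponential of \<open>\<Sum>i. g i x^i\<close>, by the recursion that the differential
  equation of the exponential forces: \<open>n e n = \<Sum>i. i g i e (n - i)\<close>.
\<close>

fun newton :: "(nat \<Rightarrow> 'b endo) \<Rightarrow> nat \<Rightarrow> 'b endo" where
  "newton g 0 = 1"
| "newton g (Suc n) = (1 / of_nat (Suc n)) *\<^sub>C (\<Sum>i\<le>n. of_nat (Suc i) *\<^sub>C (g (Suc i) * newton g (n - i)))"

definition half_phi :: "int \<Rightarrow> int \<Rightarrow> operator" where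
  "half_phi s k = (if 0 < s * k then of_int k *\<^sub>C phi k else 0)"

text \<open>
  The modes of \<open>exp (m phi\<^sub>+)\<close> for \<open>s = 1\<close> and of \<open>exp (m phi\<^sub>-)\<close> for \<open>s = - 1\<close>, where \<open>phi\<^sub>+\<close> and \<open>phi\<^sub>-\<close> are
  the parts of positive and negative degree. The halves have to be exponentiated separately: each
  mode of such an exponential is a finite expression, and only the product of the two is an
  infinite, locally finite sum.
\<close>

definition half :: "int \<Rightarrow> int \<Rightarrow> int \<Rightarrow> operator" where
  "half s m n = (if 0 \<le> s * n then newton (\<lambda>i. of_int m *\<^sub>C phi (s * int i)) (nat (s * n)) else 0)"

lemma field_half_phi: "is_field (half_phi s)"
  unfolding is_field_def half_phi_def
  by (auto intro: fun_alg_0 fun_alg_sm phi_fun_alg hom_closed hom_phi)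

lemma newton_fun_alg: "(\<And>i. g i \<in> fun_alg) \<Longrightarrow> newton g n \<in> fun_alg"
  by (induction g n rule: newton.induct)
    (auto intro!: fun_alg_0 fun_alg_1 fun_alg_sm fun_alg_sum fun_alg_mult simp del: of_nat_Suc)

lemma hom_sum: "(\<And>i. i \<in> S \<Longrightarrow> hom n (f i)) \<Longrightarrow> hom n (sum f S)"
  by (induction S rule: infinite_finite_induct) (auto intro: hom_closed)

lemma hom_newton:
  assumes g: "\<And>i. hom (s * int i) (g i)"
  shows "hom (s * int n) (newton g n)"
proof (induction n rule: less_induct)
  case (less n)
  show ?case
  proof (cases n)
    case 0
    then show ?thesis by (simp add: hom_1)
  next
    case (Suc N)
    have "hom (s * int (Suc N)) (g (Suc i) * newton g (N - i))" if "i \<le> N" for i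
    proof -
      have "hom (s * int (Suc i) + s * int (N - i)) (g (Suc i) * newton g (N - i))"
        using less Suc by (intro hom_mult g) auto
      moreover have "s * int (Suc i) + s * int (N - i) = s * int (Suc N)"
        using that by (simp add: algebra_simps of_nat_diff)
      ultimately show ?thesis by metis
    qed
    then show ?thesis unfolding Suc newton.simps
      by (intro hom_closed(3) hom_sum) auto
  qed
qed

lemma field_half:
  assumes "s = 1 \<or> s = - 1" shows "is_field (half s m)"
  unfolding is_field_def half_def
proof (intro allI)
  fix n
  let ?g = "\<lambda>i. of_int m *\<^sub>C phi (s * int i)"
  have "hom (s * int (nat (s * n))) (newton ?g (nat (s * n)))"
    by (intro hom_newton hom_closed hom_phi)
  moreover have "s * int (nat (s * n)) = n" if "0 \<le> s * n"
    using that assms by auto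
  ultimately have "0 \<le> s * n \<Longrightarrow> hom n (newton ?g (nat (s * n)))" by metis
  then show "(if 0 \<le> s * n then newton ?g (nat (s * n)) else 0) \<in> fun_alg
      \<and> hom n (if 0 \<le> s * n then newton ?g (nat (s * n)) else 0)"
    by (auto intro: newton_fun_alg fun_alg_sm phi_fun_alg fun_alg_0 hom_closed)
qed

lemma half_0 [simp]: "half s m 0 = 1"
  by (simp add: half_def)

lemma half_neg: "s * n < 0 \<Longrightarrow> half s m n = 0"
  by (simp add: half_def)

lemma half_ode:
  assumes s: "s = 1 \<or> s = - 1"
  shows "of_int n *\<^sub>C half s m n = of_int m *\<^sub>C conv (half_phi s) (half s m) n"
proof (cases "0 < s * n")
  case False
  have "lsum (\<lambda>k. half_phi s k * half s m (n - k)) 0"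
  proof (rule lsum_cong[OF _ lsum_zero])
    fix k
    show "0 = half_phi s k * half s m (n - k)"
      using False half_neg[of s "n - k" m] by (cases "0 < s * k") (auto simp: half_phi_def algebra_simps)
  qed
  then have "conv (half_phi s) (half s m) n = 0"
    by (intro conv_eqI field_half_phi field_half[OF s])
  moreover have "of_int n *\<^sub>C half s m n = 0"
    using False s half_neg[of s n m] by (cases "n = 0") auto
  ultimately show ?thesis by simp
next
  case True
  define N where "N = nat (s * n) - 1"
  have n: "n = s * int (Suc N)" "nat (s * n) = Suc N"
    using True s by (auto simp: N_def)
  have inj: "inj_on (\<lambda>i. s * int (Suc i)) {..N}"
    using s by (auto simp: inj_on_def)
  let ?S = "(\<lambda>i. s * int (Suc i)) ` {..N}"
  let ?g = "\<lambda>i. of_int m *\<^sub>C phi (s * int i)"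
  have "lsum (\<lambda>k. half_phi s k * half s m (n - k)) (\<Sum>k\<in>?S. half_phi s k * half s m (n - k))"
  proof (rule lsum_finite)
    fix k assume k: "k \<notin> ?S"
    show "half_phi s k * half s m (n - k) = 0"
    proof (cases "0 < s * k \<and> 0 \<le> s * (n - k)")
      case True
      have "k = s * int (Suc (nat (s * k) - 1))" "nat (s * k) - 1 \<le> N"
        using True s n by (auto simp: algebra_simps)
      with k show ?thesis by blast
    next
      case False
      then show ?thesis using half_neg[of s "n - k" m] by (auto simp: half_phi_def)
    qed
  qed simp
  then have "conv (half_phi s) (half s m) n = (\<Sum>k\<in>?S. half_phi s k * half s m (n - k))"
    by (intro conv_eqI field_half_phi field_half[OF s])
  also have "\<dots> = (\<Sum>i\<le>N. half_phi s (s * int (Suc i)) * half s m (n - s * int (Suc i)))"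
    using inj by (simp add: sum.reindex)
  also have "\<dots> = (\<Sum>i\<le>N. of_int (s * int (Suc i)) *\<^sub>C (phi (s * int (Suc i)) * newton ?g (N - i)))"
  proof (rule sum.cong)
    fix i assume "i \<in> {..N}"
    then have 1: "s * (n - s * int (Suc i)) = int (N - i)"
      using s n by (auto simp: of_nat_diff algebra_simps)
    have 2: "0 < s * (s * int (Suc i))" using s by auto
    show "half_phi s (s * int (Suc i)) * half s m (n - s * int (Suc i))
       = of_int (s * int (Suc i)) *\<^sub>C (phi (s * int (Suc i)) * newton ?g (N - i))"
      unfolding half_phi_def half_def 1 using 2 by simp
  qed simp
  finally have A: "of_int m *\<^sub>C conv (half_phi s) (half s m) n
     = of_int s *\<^sub>C (\<Sum>i\<le>N. of_nat (Suc i) *\<^sub>C (?g (Suc i) * newton ?g (N - i)))"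
    by (simp add: sm_sum mult_ac del: of_nat_Suc)
  have "of_int n *\<^sub>C half s m n = (of_int n / of_nat (Suc N)) *\<^sub>C (\<Sum>i\<le>N. of_nat (Suc i) *\<^sub>C (?g (Suc i) * newton ?g (N - i)))"
    using True unfolding half_def n(2) by (simp del: of_nat_Suc)
  also have "of_int n / of_nat (Suc N) = (of_int s :: complex)"
    unfolding n(1) by (simp del: of_nat_Suc)
  finally show ?thesis using A by simp
qed

text \<open>
  The differential equation of the exponential determines a one-sided field from its mode zero. The
  functional equation of the exponential and its derivative follow by checking this equation.
\<close>

lemma half_unique:
  assumes s: "s = 1 \<or> s = - 1"
    and f: "is_field f" "\<And>n. s * n < 0 \<Longrightarrow> f n = 0" "f 0 = 1"
      "\<And>n. of_int n *\<^sub>C f n = of_int m *\<^sub>C conv (half_phi s) f n"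
  shows "f = half s m"
proof
  fix n
  show "f n = half s m n"
  proof (induction "nat (s * n)" arbitrary: n rule: less_induct)
    case less
    consider "s * n < 0" | "n = 0" | "0 < s * n" using s by force
    then show ?case
    proof cases
      case 3
      have "half_phi s k * f (n - k) = half_phi s k * half s m (n - k)" for k
      proof (cases "0 < s * k")
        case True
        have "nat (s * (n - k)) < nat (s * n)"
          using True 3 s by (auto simp: algebra_simps)
        then show ?thesis using less by metis
      qed (simp add: half_phi_def)
      then have "conv (half_phi s) f n = conv (half_phi s) (half s m) n"
        unfolding conv_def by simp
      then have "of_int n *\<^sub>C f n = of_int n *\<^sub>C half s m n"
        using f(4) half_ode[OF s] by simp
      then have "(1 / of_int n) *\<^sub>C of_int n *\<^sub>C f n = (1 / of_int n) *\<^sub>C of_int n *\<^sub>C half s m n"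
        by simp
      moreover have "n \<noteq> 0" using 3 by auto
      ultimately show ?thesis by simp
    qed (use f half_neg in auto)
  qed
qed

lemma conv_half_half:
  assumes s: "s = 1 \<or> s = - 1"
  shows "conv (half s m) (half s r) = half s (m + r)"
proof (rule half_unique[OF s])
  note F = field_half[OF s] field_half_phi
  show "is_field (conv (half s m) (half s r))" by (intro field_conv F)
  show "conv (half s m) (half s r) n = 0" if "s * n < 0" for n
  proof (intro conv_eqI F lsum_cong[OF _ lsum_zero])
    fix k
    show "0 = half s m k * half s r (n - k)"
      using that half_neg[of s k m] half_neg[of s "n - k" r]
      by (cases "s * k < 0") (auto simp: algebra_simps)
  qed
  have "lsum (\<lambda>k. half s m k * half s r (0 - k)) (half s m 0 * half s r (0 - 0))"
  proof (rule lsum_single)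
    fix k :: int assume "k \<noteq> 0"
    then have "s * k < 0 \<or> s * (0 - k) < 0" using s by auto
    then show "half s m k * half s r (0 - k) = 0" using half_neg by auto
  qed
  then show "conv (half s m) (half s r) 0 = 1"
    using conv_eqI[OF F(1) F(1)] by simp
  show "of_int n *\<^sub>C conv (half s m) (half s r) n
      = of_int (m + r) *\<^sub>C conv (half_phi s) (conv (half s m) (half s r)) n" for n
    unfolding conv_deriv[OF F(1) F(1)] half_ode[OF s]
    by (simp add: conv_sm_left conv_sm_right F field_conv conv_assoc
        conv_left_commute[OF F(1) F(2) F(1)] sm_distrib)
qed

text \<open>
  The commutator with a mode of \<open>del\<close> is a derivation that acts on \<open>phi\<close> as a shift of the modes, so
  it acts on the exponential as \<open>m\<close> times a shift. The induction runs along the differential equation.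
\<close>

lemma cm_del_half:
  assumes s: "s = 1 \<or> s = - 1"
  shows "cm (del \<gamma> i) (half s m n) = (if 0 < s * i then of_int m *\<^sub>C half s m (n - i) else 0)"
proof (induction "nat (s * n)" arbitrary: n rule: less_induct)
  case less
  note F = field_half[OF s] field_half_phi
  let ?c = "if 0 < s * i then of_int m else 0 :: complex"
  have R: "(if 0 < s * i then of_int m *\<^sub>C half s m n else 0) = ?c *\<^sub>C half s m n" for n by simp
  consider "s * n < 0" | "n = 0" | "0 < s * n" using s by force
  then show ?case
  proof cases
    case 1
    then have "half s m (n - i) = 0" if "0 < s * i"
      using that by (intro half_neg) (simp add: algebra_simps)
    with 1 show ?thesis by (auto simp: half_neg cm_simps)
  next
    case 2
    then show ?thesis by (simp add: cm_simps half_neg)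
  next
    case 3
    let ?d = "if 0 < s * i then of_int i else 0 :: complex"
    have cmh: "cm (del \<gamma> i) (half_phi s k) = (if k = i then ?d *\<^sub>C 1 else 0)" for k
      by (auto simp: half_phi_def cm_simps cm_del_phi)
    have "lsum (\<lambda>k. cm (del \<gamma> i) (half_phi s k * half s m (n - k))) (cm (del \<gamma> i) (conv (half_phi s) (half s m) n))"
      by (intro lsum_cm lsum_conv F)
    moreover have "cm (del \<gamma> i) (half_phi s k * half s m (n - k))
      = (if k = i then ?d *\<^sub>C half s m (n - k) else 0) + ?c *\<^sub>C (half_phi s k * half s m ((n - i) - k))" for k
    proof (cases "0 < s * k")
      case True
      have "nat (s * (n - k)) < nat (s * n)"
        using True 3 s by (auto simp: algebra_simps)
      from less[OF this] show ?thesis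
        unfolding R by (auto simp: cm_simps cmh algebra_simps)
    qed (auto simp: half_phi_def cm_simps)
    ultimately have "lsum (\<lambda>k. (if k = i then ?d *\<^sub>C half s m (n - k) else 0) + ?c *\<^sub>C (half_phi s k * half s m ((n - i) - k)))
        (cm (del \<gamma> i) (conv (half_phi s) (half s m) n))" by simp
    moreover have "lsum (\<lambda>k. (if k = i then ?d *\<^sub>C half s m (n - k) else 0) + ?c *\<^sub>C (half_phi s k * half s m ((n - i) - k)))
       ((if i = i then ?d *\<^sub>C half s m (n - i) else 0) + ?c *\<^sub>C conv (half_phi s) (half s m) (n - i))"
      by (intro lsum_add lsum_sm lsum_conv F lsum_single) simp
    ultimately have eq: "cm (del \<gamma> i) (conv (half_phi s) (half s m) n)
       = ?d *\<^sub>C half s m (n - i) + ?c *\<^sub>C conv (half_phi s) (half s m) (n - i)"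
      by (simp add: lsum_unique)
    have "of_int n *\<^sub>C cm (del \<gamma> i) (half s m n) = of_int m *\<^sub>C cm (del \<gamma> i) (conv (half_phi s) (half s m) n)"
      using half_ode[OF s, of n m] by (metis cm_simps(9))
    also have "\<dots> = (of_int m * ?d) *\<^sub>C half s m (n - i) + ?c *\<^sub>C (of_int (n - i) *\<^sub>C half s m (n - i))"
      unfolding eq half_ode[OF s] by (simp add: sm_distrib)
    also have "\<dots> = of_int n *\<^sub>C ?c *\<^sub>C half s m (n - i)"
      by (rule endo_eqI_entry) (simp add: entry_simps algebra_simps)
    finally have "(1 / of_int n) *\<^sub>C of_int n *\<^sub>C cm (del \<gamma> i) (half s m n)
        = (1 / of_int n) *\<^sub>C of_int n *\<^sub>C ?c *\<^sub>C half s m (n - i)" by simp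
    moreover have "n \<noteq> 0" using 3 by auto
    ultimately show ?thesis unfolding R by simp
  qed
qed

subsection \<open>The vertex operators and their derivatives\<close>

text \<open>
  The vertex operator \<open>e^(m phi)\<close>. The factor \<open>shift m\<close> is the exponential of the zero mode; all
  factors commute, so no normal ordering is needed here.
\<close>

definition vop :: "int \<Rightarrow> int \<Rightarrow> operator" where
  "vop m n = shift m * conv (half 1 m) (half (- 1) m) n"

definition dphi :: "int \<Rightarrow> operator" where
  "dphi k = of_int k *\<^sub>C phi k"

text \<open>
  The modes of the product of the derivative of \<open>phi\<close> and the vertex operator.
\<close>

definition dvop :: "int \<Rightarrow> int \<Rightarrow> operator" where
  "dvop m = conv dphi (vop m)"

lemma field_halfs: "is_field (half 1 m)" "is_field (half (- 1) m)"
  by (simp_all add: field_half)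

lemma field_dphi: "is_field dphi"
  unfolding is_field_def dphi_def by (auto intro: fun_alg_sm phi_fun_alg hom_closed hom_phi)

lemma dphi_split: "dphi = (\<lambda>k. half_phi 1 k + half_phi (- 1) k)"
  by (rule ext) (auto simp: dphi_def half_phi_def)

lemma field_shift_mult:
  assumes "is_field f" shows "is_field (\<lambda>n. shift m * f n)"
  unfolding is_field_def
proof
  fix n
  show "shift m * f n \<in> fun_alg \<and> hom n (shift m * f n)"
    using assms hom_mult[OF hom_shift, of n "f n" m] unfolding is_field_def
    by (auto intro: fun_alg_mult shift_fun_alg)
qed

lemma field_vop: "is_field (vop m)"
  unfolding vop_def by (intro field_shift_mult field_conv field_halfs)

lemma field_dvop: "is_field (dvop m)"
  unfolding dvop_def by (intro field_conv field_dphi field_vop)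

lemma shift_conv:
  assumes "is_field f" "is_field g"
  shows "conv (\<lambda>n. shift m * f n) (\<lambda>n. shift r * g n) l = shift (m + r) * conv f g l"
proof (intro conv_eqI field_shift_mult assms)
  have c: "f n * shift r = shift r * f n" for n
    using assms(1) unfolding is_field_def by (blast intro: fun_alg_commute shift_fun_alg)
  have "shift m * f k * (shift r * g (l - k)) = shift (m + r) * (f k * g (l - k))" for k
  proof -
    have "shift m * f k * (shift r * g (l - k)) = shift m * (f k * shift r) * g (l - k)"
      by (simp add: mult.assoc)
    also have "\<dots> = (shift m * shift r) * (f k * g (l - k))"
      unfolding c by (simp add: mult.assoc)
    finally show ?thesis by (simp add: shift_add)
  qed
  then show "lsum (\<lambda>k. shift m * f k * (shift r * g (l - k))) (shift (m + r) * conv f g l)"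
    using lsum_mult_left[OF lsum_conv[OF assms]] by simp
qed

text \<open>
  The functional equation \<open>e^(m phi) e^(r phi) = e^((m + r) phi)\<close>, from the ones of the two halves.
\<close>

lemma conv_vop_vop: "conv (vop m) (vop r) = vop (m + r)"
proof
  fix l
  let ?P = "half 1" and ?N = "half (- 1)"
  note F = field_halfs field_conv
  have "conv (conv (?P m) (?N m)) (conv (?P r) (?N r)) = conv (?P m) (conv (?N m) (conv (?P r) (?N r)))"
    by (intro conv_assoc F)
  also have "\<dots> = conv (?P m) (conv (?P r) (conv (?N m) (?N r)))"
    by (subst conv_left_commute) (intro F refl)+
  also have "\<dots> = conv (conv (?P m) (?P r)) (conv (?N m) (?N r))"
    by (intro conv_assoc[symmetric] F)
  also have "\<dots> = conv (?P (m + r)) (?N (m + r))" by (simp add: conv_half_half)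
  finally have *: "conv (conv (?P m) (?N m)) (conv (?P r) (?N r)) = conv (?P (m + r)) (?N (m + r))" .
  have "conv (vop m) (vop r) l = shift (m + r) * conv (conv (?P m) (?N m)) (conv (?P r) (?N r)) l"
    unfolding vop_def[abs_def] by (intro shift_conv F)
  then show "conv (vop m) (vop r) l = vop (m + r) l"
    unfolding * vop_def .
qed

lemma conv_dvop_vop: "conv (dvop m) (vop r) = dvop (m + r)"
  unfolding dvop_def by (simp add: conv_assoc field_dphi field_vop conv_vop_vop)

lemma conv_vop_dvop: "conv (vop m) (dvop r) = dvop (m + r)"
  by (simp add: conv_commute[OF field_vop field_dvop] conv_dvop_vop add.commute)

text \<open>
  The chain rule for \<open>e^(m phi)\<close>. For \<open>m = 0\<close> it says nothing about \<open>dvop\<close>, which is why \<open>dvop\<close> is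
  carried along as a field of its own.
\<close>

lemma dvop_eq: "of_int n *\<^sub>C vop m n = of_int m *\<^sub>C dvop m n"
proof -
  let ?P = "half 1 m" and ?N = "half (- 1) m"
  note F = field_halfs field_conv field_half_phi
  have "of_int n *\<^sub>C conv ?P ?N n
      = of_int m *\<^sub>C (conv (conv (half_phi 1) ?P) ?N n + conv ?P (conv (half_phi (- 1)) ?N) n)"
    unfolding conv_deriv[OF F(1,2)] half_ode[of 1 _ m, simplified] half_ode[of "- 1" _ m, simplified]
    by (simp add: conv_sm_left conv_sm_right F sm_distrib)
  also have "conv (conv (half_phi 1) ?P) ?N n + conv ?P (conv (half_phi (- 1)) ?N) n
      = conv (half_phi 1) (conv ?P ?N) n + conv (half_phi (- 1)) (conv ?P ?N) n"
    by (simp add: conv_assoc F conv_left_commute[of ?P "half_phi (- 1)"])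
  also have "\<dots> = conv dphi (conv ?P ?N) n"
    unfolding dphi_split by (simp add: conv_add_left F)
  finally have *: "of_int n *\<^sub>C conv ?P ?N n = of_int m *\<^sub>C conv dphi (conv ?P ?N) n" .
  have "dvop m n = conv (\<lambda>n. shift 0 * dphi n) (\<lambda>n. shift m * conv ?P ?N n) n"
    unfolding dvop_def vop_def[abs_def] by (simp add: shift_0)
  also have "\<dots> = shift m * conv dphi (conv ?P ?N) n"
    by (subst shift_conv) (simp_all add: field_dphi F)
  finally have D: "dvop m n = shift m * conv dphi (conv ?P ?N) n" .
  have "of_int n *\<^sub>C vop m n = shift m * (of_int n *\<^sub>C conv ?P ?N n)"
    unfolding vop_def by simp
  also have "\<dots> = of_int m *\<^sub>C dvop m n" unfolding * D by simp
  finally show ?thesis .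
qed

lemma half_m0: "s = 1 \<or> s = - 1 \<Longrightarrow> half s 0 = (\<lambda>n. if n = 0 then 1 else 0)"
proof (rule half_unique[symmetric])
  show F: "is_field (\<lambda>n. if n = 0 then 1 else 0)"
    unfolding is_field_def by (auto intro: fun_alg_0 fun_alg_1 hom_1 hom_closed)
qed auto

lemma vop_0: "vop 0 n = (if n = 0 then 1 else 0)"
proof -
  have "lsum (\<lambda>k. half 1 0 k * half (- 1) 0 (n - k)) (half 1 0 0 * half (- 1) 0 (n - 0))"
    by (intro lsum_single) (simp add: half_m0)
  then have "conv (half 1 0) (half (- 1) 0) n = half (- 1) 0 n"
    using conv_eqI[OF field_halfs] by simp
  then show ?thesis by (simp add: vop_def shift_0 half_m0)
qed

lemma dvop_0: "dvop 0 n = dphi n"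
proof -
  have "lsum (\<lambda>k. dphi k * vop 0 (n - k)) (dphi n * vop 0 (n - n))"
    by (intro lsum_single) (simp add: vop_0)
  then show ?thesis unfolding dvop_def using conv_eqI[OF field_dphi field_vop] by (simp add: vop_0)
qed

lemma dvop_at_0: "dvop m 0 = 0"
proof (cases "m = 0")
  case True
  then show ?thesis by (simp add: dvop_0 dphi_def)
next
  case False
  then have "dvop m 0 = (1 / of_int m) *\<^sub>C (of_int m *\<^sub>C dvop m 0)" by simp
  also have "\<dots> = 0" unfolding dvop_eq[symmetric] by simp
  finally show ?thesis .
qed

lemma cm_del_vop: "cm (del \<gamma> i) (vop m n) = of_int m *\<^sub>C vop m (n - i)"
proof -
  let ?P = "half 1 m" and ?N = "half (- 1) m"
  have P: "cm (del \<gamma> i) (?P k) = (if 0 < i then of_int m *\<^sub>C ?P (k - i) else 0)"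
    and N: "cm (del \<gamma> i) (?N k) = (if i < 0 then of_int m *\<^sub>C ?N (k - i) else 0)" for k
    using cm_del_half[of 1 \<gamma> i m k] cm_del_half[of "- 1" \<gamma> i m k] by simp_all
  have l: "lsum (\<lambda>k. cm (del \<gamma> i) (?P k * ?N (n - k))) (cm (del \<gamma> i) (conv ?P ?N n))"
    by (intro lsum_cm lsum_conv field_halfs)
  have "cm (del \<gamma> i) (conv ?P ?N n) = (if i = 0 then 0 else of_int m *\<^sub>C conv ?P ?N (n - i))"
  proof -
    consider "0 < i" | "i < 0" | "i = 0" by linarith
    then show ?thesis
    proof cases
      case 1
      have "lsum (\<lambda>k. of_int m *\<^sub>C (?P (k - i) * ?N (n - k))) (of_int m *\<^sub>C conv ?P ?N (n - i))"
        by (intro lsum_sm lsum_conv_shift field_halfs)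
      moreover have "cm (del \<gamma> i) (?P k * ?N (n - k)) = of_int m *\<^sub>C (?P (k - i) * ?N (n - k))" for k
        using 1 by (simp add: cm_simps P N)
      ultimately show ?thesis using l 1 by (simp add: lsum_unique)
    next
      case 2
      have "lsum (\<lambda>k. of_int m *\<^sub>C (?P k * ?N ((n - i) - k))) (of_int m *\<^sub>C conv ?P ?N (n - i))"
        by (intro lsum_sm lsum_conv field_halfs)
      moreover have "cm (del \<gamma> i) (?P k * ?N (n - k)) = of_int m *\<^sub>C (?P k * ?N ((n - i) - k))" for k
        using 2 by (simp add: cm_simps P N algebra_simps)
      ultimately show ?thesis using l 2 by (simp add: lsum_unique)
    next
      case 3
      have "cm (del \<gamma> i) (?P k * ?N (n - k)) = 0" for k
        using 3 P[of k] N[of "n - k"] by (simp add: cm_simps)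
      then have "lsum (\<lambda>k :: int. 0) (cm (del \<gamma> i) (conv ?P ?N n))" using l by simp
      with lsum_unique[OF _ lsum_zero] 3 show ?thesis by simp
    qed
  qed
  then show ?thesis
    by (auto simp: vop_def cm_simps cm_del_shift)
qed

lemma cm_del_dphi: "cm (del \<gamma> i) (dphi n) = (if n = i then of_int i *\<^sub>C 1 else 0)"
  by (auto simp: dphi_def cm_simps cm_del_phi)

lemma cm_del_dvop: "cm (del \<gamma> i) (dvop m n) = of_int n *\<^sub>C vop m (n - i)"
proof -
  have 1: "lsum (\<lambda>k. cm (del \<gamma> i) (dphi k * vop m (n - k))) (cm (del \<gamma> i) (dvop m n))"
    unfolding dvop_def by (intro lsum_cm lsum_conv field_dphi field_vop)
  have 2: "cm (del \<gamma> i) (dphi k * vop m (n - k))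
     = (if k = i then of_int i *\<^sub>C vop m (n - k) else 0) + of_int m *\<^sub>C (dphi k * vop m ((n - i) - k))" for k
    by (simp add: cm_simps cm_del_dphi cm_del_vop algebra_simps)
  have "lsum (\<lambda>k. (if k = i then of_int i *\<^sub>C vop m (n - k) else 0) + of_int m *\<^sub>C (dphi k * vop m ((n - i) - k)))
     ((if i = i then of_int i *\<^sub>C vop m (n - i) else 0) + of_int m *\<^sub>C dvop m (n - i))"
    unfolding dvop_def by (intro lsum_add lsum_sm lsum_conv field_dphi field_vop lsum_single) simp
  then have "cm (del \<gamma> i) (dvop m n) = of_int i *\<^sub>C vop m (n - i) + of_int m *\<^sub>C dvop m (n - i)"
    using 1 unfolding 2 by (simp add: lsum_unique)
  also have "\<dots> = of_int n *\<^sub>C vop m (n - i)"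
    unfolding dvop_eq[symmetric] by (simp add: sm_distrib flip: sm_distrib(4))
  finally show ?thesis .
qed

lemma vop_vacuum: "app (vop m 0) (ket (k, 0)) = ket (k + m, 0)"
proof -
  let ?P = "half 1 m" and ?N = "half (- 1) m"
  have "app (conv ?P ?N 0) (ket (k, 0)) = (\<Sum>i\<in>{0}. app (?P i * ?N (0 - i)) (ket (k, 0)))"
  proof (rule lsumD[OF lsum_conv[OF field_halfs]])
    fix i :: int assume "i \<notin> {0}"
    then consider "i < 0" | "i > 0" by force
    then show "app (?P i * ?N (0 - i)) (ket (k, 0)) = 0"
    proof cases
      case 2
      then have "app (?N (0 - i)) (ket (k, 0)) = 0"
        by (intro field_kills field_halfs) (simp add: depth_def)
      then show ?thesis by simp
    qed (simp add: half_neg)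
  qed simp
  then show ?thesis by (simp add: vop_def)
qed

subsection \<open>Leading terms\<close>

lemma tilts_sum: "(\<And>i. i \<in> S \<Longrightarrow> tilts n (f i)) \<Longrightarrow> tilts n (sum f S)"
  by (induction S rule: infinite_finite_induct) (auto intro: tilts_closed)

text \<open>
  Each factor of the field raises the tilt by one, so modulo terms that raise it by at least two the
  exponential is its linear part.
\<close>

lemma tilts_newton:
  assumes g: "\<And>i. tilts 1 (g i)"
  shows "tilts 0 (newton g n)" and "n > 0 \<Longrightarrow> tilts 1 (newton g n)" and "n > 0 \<Longrightarrow> tilts 2 (newton g n - g n)"
proof -
  have 0: "tilts 0 (newton g n) \<and> (n > 0 \<longrightarrow> tilts 1 (newton g n))" for n
  proof (induction n rule: less_induct)
    case (less n)
    show ?case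
    proof (cases n)
      case (Suc N)
      have "tilts 1 (newton g (Suc N))"
        unfolding newton.simps
      proof (intro tilts_closed(3) tilts_sum)
        fix i assume "i \<in> {..N}"
        then show "tilts 1 (g (Suc i) * newton g (N - i))"
          using tilts_mult[OF g, of 0 "newton g (N - i)" "Suc i"] less Suc by simp
      qed
      then show ?thesis using tilts_mono[of 1 "newton g (Suc N)" 0] unfolding Suc by simp
    qed (simp add: tilts_1)
  qed
  show "tilts 0 (newton g n)" "n > 0 \<Longrightarrow> tilts 1 (newton g n)" using 0 by auto
  assume "n > 0"
  then obtain N where n: "n = Suc N" by (cases n) auto
  let ?t = "\<lambda>i. of_nat (Suc i) *\<^sub>C (g (Suc i) * newton g (N - i))"
  have "{..N} = insert N {..<N}" by auto
  then have "newton g n = (1 / of_nat (Suc N)) *\<^sub>C (?t N + sum ?t {..<N})"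
    unfolding n newton.simps by simp
  then have "newton g n - g n = (1 / of_nat (Suc N)) *\<^sub>C sum ?t {..<N}"
    by (simp add: sm_distrib n del: of_nat_Suc)
  moreover have "tilts 2 (sum ?t {..<N})"
  proof (intro tilts_sum tilts_closed(3))
    fix i assume "i \<in> {..<N}"
    then show "tilts 2 (g (Suc i) * newton g (N - i))"
      using tilts_mult[OF g, of 1 "newton g (N - i)" "Suc i"] 0[of "N - i"] by simp
  qed
  ultimately show "tilts 2 (newton g n - g n)" by (simp add: tilts_closed)
qed

lemma tilts_half:
  assumes "s = 1 \<or> s = - 1"
  shows "tilts 0 (half s m n)" and "n \<noteq> 0 \<Longrightarrow> tilts 1 (half s m n)"
    and "0 < s * n \<Longrightarrow> tilts 2 (half s m n - of_int m *\<^sub>C phi n)"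
proof -
  let ?g = "\<lambda>i. of_int m *\<^sub>C phi (s * int i)"
  have g: "tilts 1 (?g i)" for i by (intro tilts_closed tilts_phi)
  note * = tilts_newton[of ?g, OF g]
  show "tilts 0 (half s m n)" using *(1) by (simp add: half_def tilts_closed)
  show "n \<noteq> 0 \<Longrightarrow> tilts 1 (half s m n)" using *(2)[of "nat (s * n)"] assms
    by (auto simp: half_def tilts_closed)
  show "0 < s * n \<Longrightarrow> tilts 2 (half s m n - of_int m *\<^sub>C phi n)"
    using *(3)[of "nat (s * n)"] assms by (auto simp: half_def)
qed

text \<open>
  Up to higher tilt, \<open>e^(m phi)\<close> is the shift times \<open>1 + m phi\<close>. Only this linear part contributes to
  the diagonal of the zero modes.
\<close>

lemma tilts_vop:
  shows "tilts 2 (vop m 0 - shift m)" and "n \<noteq> 0 \<Longrightarrow> tilts 2 (vop m n - of_int m *\<^sub>C (shift m * phi n))"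
    and "tilts 0 (vop m n)" and "n \<noteq> 0 \<Longrightarrow> tilts 1 (vop m n)"
proof -
  let ?P = "half 1 m" and ?N = "half (- 1) m"
  define lead where "lead n = (if n = 0 then 1 else if n > 0 then ?P n else ?N n)" for n :: int
  have 2: "tilts 2 (conv ?P ?N n - lead n)" for n
  proof (rule tilts_lsum)
    have "lsum (\<lambda>k. if k = (if n > 0 then n else 0) then lead n else 0)
        (if (if n > 0 then n else 0) = (if n > 0 then n else 0) then lead n else 0)"
      by (rule lsum_single) simp
    then have "lsum (\<lambda>k. if k = (if n > 0 then n else 0) then lead n else 0) (lead n)" by simp
    then show "lsum (\<lambda>k. ?P k * ?N (n - k) - (if k = (if n > 0 then n else 0) then lead n else 0)) (conv ?P ?N n - lead n)"
      by (intro lsum_diff lsum_conv field_halfs)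
    fix k
    show "tilts 2 (?P k * ?N (n - k) - (if k = (if n > 0 then n else 0) then lead n else 0))"
    proof (cases "k = (if n > 0 then n else 0)")
      case True
      then show ?thesis by (auto simp: tilts_closed lead_def)
    next
      case False
      have "tilts 2 (?P k * ?N (n - k))"
      proof (cases "k = 0 \<or> k = n")
        case True
        then have "?P k * ?N (n - k) = 0" using False by (auto split: if_splits simp: half_neg)
        then show ?thesis by (simp add: tilts_closed)
      next
        case False
        then show ?thesis using tilts_mult[of 1 "?P k" 1 "?N (n - k)"] by (simp add: tilts_half)
      qed
      then show ?thesis using False by simp
    qed
  qed
  have sh: "tilts j (shift m * A)" if "tilts j A" for j A
    using tilts_mult[OF tilts_shift that, of m] by simp
  show "tilts 2 (vop m 0 - shift m)"
    using sh[OF 2[of 0]] by (simp add: vop_def right_diff_distrib lead_def)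
  show leading: "tilts 2 (vop m n - of_int m *\<^sub>C (shift m * phi n))" if "n \<noteq> 0"
  proof -
    have "tilts 2 (lead n - of_int m *\<^sub>C phi n)"
      using that tilts_half(3)[of 1 n m] tilts_half(3)[of "- 1" n m] by (auto simp: lead_def)
    from tilts_closed(1)[OF 2[of n] this] have "tilts 2 (conv ?P ?N n - of_int m *\<^sub>C phi n)"
      by simp
    from sh[OF this] show ?thesis by (simp add: vop_def right_diff_distrib)
  qed
  show one: "tilts 1 (vop m n)" if "n \<noteq> 0"
  proof -
    have "tilts 1 (of_int m *\<^sub>C (shift m * phi n))" by (intro tilts_closed sh tilts_phi)
    with tilts_mono[OF leading[OF that], of 1] have "tilts 1 (vop m n - of_int m *\<^sub>C (shift m * phi n) + of_int m *\<^sub>C (shift m * phi n))"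
      by (intro tilts_closed(1)) auto
    then show ?thesis by simp
  qed
  show "tilts 0 (vop m n)"
  proof (cases "n = 0")
    case True
    have "tilts 0 (vop m 0 - shift m + shift m)"
      by (intro tilts_closed(1) tilts_shift tilts_mono[OF \<open>tilts 2 (vop m 0 - shift m)\<close>]) simp
    with True show ?thesis by simp
  qed (use one tilts_mono in force)
qed

section \<open>The action of vector fields on the Fock space\<close>

text \<open>
  Two normal orderings of a product differ exactly on the pairs of indices that lie on opposite
  sides of the origin. Such pairs with a fixed difference \<open>N\<close> are finite in number, and
  \<open>signed_sum N\<close> adds up a function over them; it is the discrete integral from \<open>0\<close> to \<open>N\<close>, whence
  the telescoping evaluation.
\<close>

definition crossing :: "int \<Rightarrow> int \<Rightarrow> complex" where
  "crossing n i = (if 0 \<le> n \<and> i < 0 then 1 else if n < 0 \<and> 0 \<le> i then - 1 else 0)"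

definition signed_sum :: "int \<Rightarrow> (int \<Rightarrow> complex) \<Rightarrow> complex" where
  "signed_sum N f = (\<Sum>n\<in>{0..<N}. f n) - (\<Sum>n\<in>{N..<0}. f n)"

lemma signed_sum_step: "signed_sum (N + 1) f = signed_sum N f + f N"
proof (cases "0 \<le> N")
  case True
  then have "{0..<N + 1} = insert N {0..<N}" by auto
  with True show ?thesis by (simp add: signed_sum_def)
next
  case False
  then have "{N..<0} = insert N {N + 1..<0}" by auto
  with False show ?thesis by (simp add: signed_sum_def)
qed

lemma signed_sum_closed:
  assumes "P 0 = 0" "\<And>n. P (n + 1) = P n + f n"
  shows "signed_sum N f = P N"
proof (induction N rule: int_induct[where k = 0])
  case base
  then show ?case using assms by (simp add: signed_sum_def)
next
  case (step1 i)
  then show ?case using assms(2)[of i] by (simp add: signed_sum_step)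
next
  case (step2 i)
  then show ?case using assms(2)[of "i - 1"] signed_sum_step[of "i - 1" f] by simp
qed

lemma sm_sum_left: "(\<Sum>i\<in>S. c i) *\<^sub>C A = (\<Sum>i\<in>S. c i *\<^sub>C A)"
  by (induction S rule: infinite_finite_induct) (auto simp: sm_distrib)

lemma loc_fin_sm: "loc_fin f \<Longrightarrow> loc_fin (\<lambda>i. c i *\<^sub>C f i)"
  unfolding loc_fin_def
proof
  fix w assume "\<forall>w. finite {i. app (f i) w \<noteq> 0}"
  then have "finite {i. app (f i) w \<noteq> 0}" by blast
  then show "finite {i. app (c i *\<^sub>C f i) w \<noteq> 0}" by (rule rev_finite_subset) auto
qed

lemma loc_fin_add: "loc_fin f \<Longrightarrow> loc_fin g \<Longrightarrow> loc_fin (\<lambda>i. f i + g i)"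
  unfolding loc_fin_def
proof
  fix w assume "\<forall>w. finite {i. app (f i) w \<noteq> 0}" "\<forall>w. finite {i. app (g i) w \<noteq> 0}"
  then have "finite ({i. app (f i) w \<noteq> 0} \<union> {i. app (g i) w \<noteq> 0})" by simp
  then show "finite {i. app (f i + g i) w \<noteq> 0}" by (rule rev_finite_subset) auto
qed

lemma lsum_crossing:
  "lsum (\<lambda>n. (crossing n (n - N) * f n) *\<^sub>C A) (signed_sum N f *\<^sub>C A)"
proof -
  have "lsum (\<lambda>n. (crossing n (n - N) * f n) *\<^sub>C A) (\<Sum>n\<in>{0..<N} \<union> {N..<0}. (crossing n (n - N) * f n) *\<^sub>C A)"
    by (rule lsum_finite) (auto simp: crossing_def)
  also have "(\<Sum>n\<in>{0..<N} \<union> {N..<0}. (crossing n (n - N) * f n) *\<^sub>C A)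
      = (\<Sum>n\<in>{0..<N}. (crossing n (n - N) * f n) *\<^sub>C A) + (\<Sum>n\<in>{N..<0}. (crossing n (n - N) * f n) *\<^sub>C A)"
    by (rule sum.union_disjoint) auto
  also have "(\<Sum>n\<in>{0..<N}. (crossing n (n - N) * f n) *\<^sub>C A) = (\<Sum>n\<in>{0..<N}. f n *\<^sub>C A)"
    by (rule sum.cong) (auto simp: crossing_def)
  also have "(\<Sum>n\<in>{N..<0}. (crossing n (n - N) * f n) *\<^sub>C A) = (\<Sum>n\<in>{N..<0}. - (f n *\<^sub>C A))"
    by (rule sum.cong) (auto simp: crossing_def sm_distrib)
  also have "(\<Sum>n\<in>{0..<N}. f n *\<^sub>C A) + (\<Sum>n\<in>{N..<0}. - (f n *\<^sub>C A)) = signed_sum N f *\<^sub>C A"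
    by (simp add: signed_sum_def sum_negf sm_distrib sm_sum_left)
  finally show ?thesis .
qed

text \<open>
  The parameters of the module; \<open>\<gamma>\<close> is the offset of the zero mode of \<open>del\<close> and \<open>- \<alpha>\<close> the zero mode of
  the current.
\<close>

locale torus_fock =
  fixes \<alpha> \<gamma> :: complex
begin

abbreviation dd :: "int \<Rightarrow> operator" where "dd \<equiv> del \<gamma>"
abbreviation II :: "int \<Rightarrow> operator" where "II \<equiv> cur \<alpha>"

subsection \<open>Normally ordered vector fields\<close>

text \<open>
  Modes of \<open>del\<close> with nonnegative index annihilate on the right, those with negative index create
  on the left. The zero mode is put on the right so that it acts first on the vacuum.
\<close>

definition nord :: "operator \<Rightarrow> int \<Rightarrow> operator" where
  "nord A n = (if 0 \<le> n then A * dd n else dd n * A)"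

lemma nord_simps: "nord (c *\<^sub>C A) n = c *\<^sub>C nord A n" "nord (A + B) n = nord A n + nord B n"
  "nord (A - B) n = nord A n - nord B n" "nord (- A) n = - nord A n" "nord 0 n = 0"
  by (simp_all add: nord_def algebra_simps)

lemma lsum_nord: "lsum f A \<Longrightarrow> lsum (\<lambda>i. nord (f i) n) (nord A n)"
  by (cases "0 \<le> n") (auto simp: nord_def intro: lsum_mult_left lsum_mult_right)

lemma dd_kills: "0 \<le> n \<Longrightarrow> depth b < n \<Longrightarrow> app (dd n) (ket b) = 0"
  using hom_kills[OF hom_del, of b n \<gamma>] by simp

text \<open>
  The mode of the normally ordered product \<open>f del\<close>, a vector field in the variable \<open>phi\<close>.
\<close>

definition avf :: "(int \<Rightarrow> operator) \<Rightarrow> int \<Rightarrow> operator" where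
  "avf f j = LS (\<lambda>n. nord (f (n - j)) n)"

lemma lsum_avf:
  assumes "is_field f"
  shows "lsum (\<lambda>n. nord (f (n - j)) n) (avf f j)"
  unfolding avf_def
proof (intro lsum_LS loc_finI)
  fix b
  have "{n. app (nord (f (n - j)) n) (ket b) \<noteq> 0} \<subseteq> {min 0 (j - depth b)..depth b}"
  proof
    fix n assume "n \<in> {n. app (nord (f (n - j)) n) (ket b) \<noteq> 0}"
    then have n: "app (nord (f (n - j)) n) (ket b) \<noteq> 0" by simp
    then have "0 \<le> n \<Longrightarrow> \<not> depth b < n" using dd_kills[of n b] by (auto simp: nord_def)
    moreover have "n < 0 \<Longrightarrow> \<not> depth b + (n - j) < 0"
      using n field_kills[OF assms, of b "n - j"] by (auto simp: nord_def)
    ultimately show "n \<in> {min 0 (j - depth b)..depth b}"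
      using depth_nonneg[of b] by (cases "0 \<le> n") auto
  qed
  then show "finite {n. app (nord (f (n - j)) n) (ket b) \<noteq> 0}" by (rule finite_subset) simp
qed

text \<open>
  Both \<open>e^(m phi)\<close> and \<open>phi' e^(m phi)\<close> have the property that all variational derivatives are multiples
  of modes of \<open>e^(m phi)\<close>, with a factor \<open>c\<close> that depends on the mode. This common shape lets one
  commutator computation serve all brackets.
\<close>

definition tangent :: "(int \<Rightarrow> operator) \<Rightarrow> int \<Rightarrow> (int \<Rightarrow> complex) \<Rightarrow> bool" where
  "tangent f m c \<longleftrightarrow> is_field f \<and> (\<forall>i n. cm (dd i) (f n) = c n *\<^sub>C vop m (n - i))"

lemma tangent_vop: "tangent (vop m) m (\<lambda>_. of_int m)"
  and tangent_dvop: "tangent (dvop m) m (\<lambda>n. of_int n)"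
  by (auto simp: tangent_def field_vop field_dvop cm_del_vop cm_del_dvop)

lemma tangent_field: "tangent f m c \<Longrightarrow> is_field f"
  and tangent_cm: "tangent f m c \<Longrightarrow> cm (dd i) (f n) = c n *\<^sub>C vop m (n - i)"
  by (auto simp: tangent_def)

lemma field_cm: "is_field f \<Longrightarrow> is_field g \<Longrightarrow> cm (f i) (g n) = 0"
  by (simp add: cm_eq_0_iff field_commute)

lemma cm_avf_field:
  assumes f: "is_field f" and g: "tangent g r c"
  shows "cm (avf f j) (g N) = c N *\<^sub>C conv f (vop r) (N - j)"
proof -
  note G = tangent_field[OF g]
  have "lsum (\<lambda>n. cm (nord (f (n - j)) n) (g N)) (cm (avf f j) (g N))"
    by (intro lsum_cm' lsum_avf f)
  moreover have "cm (nord (f (n - j)) n) (g N) = c N *\<^sub>C (f (n - j) * vop r (N - n))" for n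
    by (simp add: nord_def cm_simps tangent_cm[OF g] field_cm[OF f G] field_commute[OF f field_vop])
  ultimately show ?thesis
    using lsum_sm[OF lsum_conv_shift[OF f field_vop[of r], of j N]] by (simp add: lsum_unique)
qed

lemma lsum_cm_avf_del:
  assumes f: "tangent f m c"
  shows "lsum (\<lambda>i. - (c (i - j) *\<^sub>C nord (vop m (i - j - n)) i)) (cm (avf f j) (dd n))"
proof -
  have "lsum (\<lambda>i. cm (nord (f (i - j)) i) (dd n)) (cm (avf f j) (dd n))"
    by (intro lsum_cm' lsum_avf tangent_field[OF f])
  moreover have "cm (nord (f (i - j)) i) (dd n) = - (c (i - j) *\<^sub>C nord (vop m (i - j - n)) i)" for i
    by (simp add: nord_def cm_simps cm_del_del cm_swap[of "f _"] tangent_cm[OF f])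
  ultimately show ?thesis by simp
qed

text \<open>
  Moving \<open>G\<close> into a normally ordered product on the side prescribed by the sign of one index, instead
  of the side prescribed by the other, costs the commutator exactly when the signs differ.
\<close>

lemma normal_order_mismatch:
  assumes c: "V * G = G * V" "W * V = V * W" and d: "cm (dd i) G = x *\<^sub>C W"
  shows "(if 0 \<le> n then G * nord V i else nord V i * G)
    = nord (V * G) i - (crossing n i * x) *\<^sub>C (W * V)"
proof -
  have dG: "dd i * G = G * dd i + x *\<^sub>C W"
    using d by (simp add: cm_def algebra_simps)
  have "G * (dd i * V) = dd i * (V * G) - x *\<^sub>C (W * V)"
  proof -
    have "dd i * (V * G) = (dd i * G) * V" by (simp only: c(1) mult.assoc)
    also have "\<dots> = G * (dd i * V) + x *\<^sub>C (W * V)" unfolding dG by (simp add: distrib_right mult.assoc)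
    finally show ?thesis by simp
  qed
  moreover have "V * dd i * G = V * G * dd i + x *\<^sub>C (W * V)"
    unfolding mult.assoc dG by (simp add: distrib_left c(2))
  ultimately show ?thesis
    by (auto simp: nord_def crossing_def mult.assoc c(1) sm_distrib)
qed

text \<open>
  The bracket of two vector fields. The terms \<open>A\<close> and \<open>B\<close> are the classical bracket. The term
  \<open>C\<close> is the anomaly: it comes from restoring the normal order and consists of vertex operators
  only, with polynomial coefficients that \<open>signed_sum\<close> evaluates.
\<close>

lemma cm_avf_avf:
  assumes f: "tangent f m cf" and g: "tangent g r cg"
  obtains A B C where
    "lsum (\<lambda>n. cg (n - l) *\<^sub>C nord (conv f (vop r) (n - l - j)) n) A"
    "lsum (\<lambda>n. cf (n - j) *\<^sub>C nord (conv (vop m) g (n - j - l)) n) B"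
    "lsum (\<lambda>N. signed_sum N (\<lambda>n. cf (n - N - j) * cg (n - l)) *\<^sub>C (vop r (N - l) * vop m (- N - j))) C"
    "cm (avf f j) (avf g l) = A - B + C"
proof -
  note F = tangent_field[OF f] and G = tangent_field[OF g]
  (* ?P has its factor del in normal order; ?Q is the cost of moving the factor g (n - l) there. *)
  let ?V = "\<lambda>n i. vop m (i - j - n)"
  let ?P = "\<lambda>(n, i). - (cf (i - j) *\<^sub>C nord (?V n i * g (n - l)) i)"
  let ?Q = "\<lambda>(n, i). (crossing n i * (cf (i - j) * cg (n - l))) *\<^sub>C (vop r (n - l - i) * ?V n i)"
  have lfP: "loc_fin ?P"
  proof (rule loc_finI)
    fix b
    let ?d = "depth b"
    define lo where "lo = - \<bar>l\<bar> - \<bar>j\<bar> - 2 * ?d"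
    define hi where "hi = \<bar>j\<bar> + 2 * ?d"
    have "{p. app (?P p) (ket b) \<noteq> 0} \<subseteq> {lo..hi} \<times> {lo..hi}"
    proof
      fix p assume "p \<in> {p. app (?P p) (ket b) \<noteq> 0}"
      moreover obtain n i where p: "p = (n, i)" by force
      ultimately have nz: "app (nord (?V n i * g (n - l)) i) (ket b) \<noteq> 0" by auto
      have c: "?V n i * g (n - l) = g (n - l) * ?V n i" by (rule field_commute[OF field_vop G])
      show "p \<in> {lo..hi} \<times> {lo..hi}"
      proof (cases "0 \<le> i")
        case True
        then have nz': "app (?V n i * g (n - l)) (app (dd i) (ket b)) \<noteq> 0" using nz by (simp add: nord_def)
        then have i: "i \<le> ?d" using dd_kills[OF True, of b] by force
        have h1: "hom (n - l + - i) (g (n - l) * dd i)" and h2: "hom (i - j - n + - i) (?V n i * dd i)"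
          using G field_vop[of m] unfolding is_field_def by (simp_all only: hom_mult hom_del)
        have "\<not> ?d + (n - l + - i) < 0" using hom_kills[OF h1, of b] nz' by auto
        moreover have "\<not> ?d + (i - j - n + - i) < 0" using hom_kills[OF h2, of b] nz' unfolding c by auto
        ultimately show ?thesis using True i depth_nonneg[of b] unfolding p lo_def hi_def by auto
      next
        case False
        then have nz': "app (?V n i * g (n - l)) (ket b) \<noteq> 0" using nz by (auto simp: nord_def)
        have "\<not> ?d + (n - l) < 0" using field_kills[OF G, of b] nz' by auto
        moreover have "\<not> ?d + (i - j - n) < 0" using field_kills[OF field_vop, of b] nz' unfolding c by auto
        ultimately show ?thesis using False depth_nonneg[of b] unfolding p lo_def hi_def by auto
      qed
    qed
    then show "finite {p. app (?P p) (ket b) \<noteq> 0}" by (rule finite_subset) simp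
  qed
  have lfQ: "loc_fin ?Q"
  proof (rule loc_finI)
    fix b
    let ?d = "depth b"
    define hi where "hi = \<bar>j\<bar> + \<bar>l\<bar> + ?d"
    have "{p. app (?Q p) (ket b) \<noteq> 0} \<subseteq> {- hi..hi} \<times> {- hi..hi}"
    proof
      fix p assume "p \<in> {p. app (?Q p) (ket b) \<noteq> 0}"
      moreover obtain n i where p: "p = (n, i)" by force
      ultimately have nz: "app (vop r (n - l - i) * ?V n i) (ket b) \<noteq> 0" "crossing n i \<noteq> 0" by auto
      have "app (?V n i * vop r (n - l - i)) (ket b) \<noteq> 0"
        using nz(1) unfolding field_commute[OF field_vop field_vop, of r "n - l - i"] .
      then have "\<not> ?d + (n - l - i) < 0" "\<not> ?d + (i - j - n) < 0"
        using nz(1) field_kills[OF field_vop, of b] by auto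
      with nz(2) show "p \<in> {- hi..hi} \<times> {- hi..hi}"
        unfolding p hi_def crossing_def by (auto split: if_splits)
    qed
    then show "finite {p. app (?Q p) (ket b) \<noteq> 0}" by (rule finite_subset) simp
  qed
  have A: "loc_fin (\<lambda>n. cg (n - l) *\<^sub>C nord (conv f (vop r) (n - l - j)) n)"
    using loc_fin_sm[OF lsum_loc_fin[OF lsum_avf[OF field_conv[OF F field_vop[of r]], of "l + j"]]]
    by (simp add: algebra_simps)
  define A' where "A' = LS (\<lambda>n. cg (n - l) *\<^sub>C nord (conv f (vop r) (n - l - j)) n)"
  have A': "lsum (\<lambda>n. cg (n - l) *\<^sub>C nord (conv f (vop r) (n - l - j)) n) A'"
    unfolding A'_def by (rule lsum_LS[OF A])
  let ?B = "\<lambda>n. if 0 \<le> n then g (n - l) * cm (avf f j) (dd n) else cm (avf f j) (dd n) * g (n - l)"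
  have "lsum (\<lambda>n. cm (avf f j) (nord (g (n - l)) n)) (cm (avf f j) (avf g l))"
    by (intro lsum_cm lsum_avf G)
  moreover have "cm (avf f j) (nord (g (n - l)) n) = cg (n - l) *\<^sub>C nord (conv f (vop r) (n - l - j)) n + ?B n" for n
    by (simp add: nord_def cm_simps cm_avf_field[OF F g])
  ultimately have "lsum (\<lambda>n. cg (n - l) *\<^sub>C nord (conv f (vop r) (n - l - j)) n + ?B n) (cm (avf f j) (avf g l))"
    by simp
  from lsum_diff[OF this A'] have B: "lsum ?B (cm (avf f j) (avf g l) - A')" by simp
  let ?F = "\<lambda>p. ?P p + ?Q p"
  have F': "?F (n, i) = (if 0 \<le> n then g (n - l) * - (cf (i - j) *\<^sub>C nord (?V n i) i)
      else - (cf (i - j) *\<^sub>C nord (?V n i) i) * g (n - l))" for n i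
  proof -
    have "(if 0 \<le> n then g (n - l) * nord (?V n i) i else nord (?V n i) i * g (n - l))
       = nord (?V n i * g (n - l)) i - (crossing n i * cg (n - l)) *\<^sub>C (vop r (n - l - i) * ?V n i)"
      by (intro normal_order_mismatch field_commute field_vop G tangent_cm[OF g])
    then show ?thesis by (cases "0 \<le> n") (simp_all add: sm_distrib mult_ac)
  qed
  have S: "lsum ?F (LS ?F)" by (intro lsum_LS loc_fin_add lfP lfQ)
  have "lsum ?B (LS ?F)"
  proof (rule lsum_fubini[OF S])
    fix n
    show "lsum (\<lambda>i. ?F (n, i)) (?B n)"
      unfolding F' using lsum_cm_avf_del[OF f, of j n]
      by (cases "0 \<le> n") (simp_all only: if_True if_False lsum_mult_left lsum_mult_right)
  qed
  then have 1: "cm (avf f j) (avf g l) - A' = LS ?F" using B by (rule lsum_unique[rotated])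
  have 2: "LS ?F = LS ?P + LS ?Q"
    by (intro LS_eqI lsum_add lsum_LS lfP lfQ)
  have "lsum (\<lambda>i. - (cf (i - j) *\<^sub>C nord (conv (vop m) g (i - j - l)) i)) (LS ?P)"
  proof (rule lsum_fubini_swap[OF lsum_LS[OF lfP]])
    fix i
    have "lsum (\<lambda>n. vop m (i - j - n) * g (- l + n)) (conv (vop m) g (i - j + - l))"
      by (intro lsum_conv_reflect field_vop G)
    from lsum_minus[OF lsum_sm[OF lsum_nord[OF this, of i], of "cf (i - j)"]]
    show "lsum (\<lambda>n. ?P (n, i)) (- (cf (i - j) *\<^sub>C nord (conv (vop m) g (i - j - l)) i))"
      by simp
  qed
  from lsum_minus[OF this]
  have 3: "lsum (\<lambda>i. cf (i - j) *\<^sub>C nord (conv (vop m) g (i - j - l)) i) (- LS ?P)" by simp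
  have 4: "lsum (\<lambda>N. signed_sum N (\<lambda>n. cf (n - N - j) * cg (n - l)) *\<^sub>C (vop r (N - l) * vop m (- N - j))) (LS ?Q)"
  proof (rule lsum_fubini)
    (* The sum is finite along the lines n - i = N, on which the vertex operators are constant. *)
    let ?h = "\<lambda>(N, n). (n, n - N) :: int \<times> int"
    have "bij ?h"
      by (rule bij_betw_byWitness[where f' = "\<lambda>(n, i). (n - i, n)"]) auto
    then show "lsum (\<lambda>p. ?Q (?h p)) (LS ?Q)"
      by (rule lsum_reindex[OF lsum_LS[OF lfQ]])
    fix N
    have "n - l - (n - N) = N - l" "n - N - j - n = - N - j" for n by simp_all
    then show "lsum (\<lambda>n. ?Q (?h (N, n)))
       (signed_sum N (\<lambda>n. cf (n - N - j) * cg (n - l)) *\<^sub>C (vop r (N - l) * vop m (- N - j)))"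
      using lsum_crossing[of N "\<lambda>n. cf (n - N - j) * cg (n - l)" "vop r (N - l) * vop m (- N - j)"]
      by simp
  qed
  have "cm (avf f j) (avf g l) = A' - (- LS ?P) + LS ?Q"
    using 1 2 by (simp add: algebra_simps)
  from that[OF A' 3 4 this] show thesis .
qed


subsection \<open>Currents multiplied by vertex operators\<close>

text \<open>
  Fields built from the third color: they commute with both conjugate fields, hence with all vertex
  operators.
\<close>

definition is_current :: "(int \<Rightarrow> operator) \<Rightarrow> bool" where
  "is_current c \<longleftrightarrow> (\<forall>k. hom k (c k) \<and> (\<forall>n. cm (c k) (phi n) = 0)
     \<and> (\<forall>m. cm (c k) (shift m) = 0) \<and> (\<forall>n. cm (c k) (dd n) = 0))"

lemma current_field: "is_current c \<Longrightarrow> is_field f \<Longrightarrow> cm (c k) (f n) = 0"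
  unfolding is_current_def is_field_def by (blast intro: fun_alg_commutes_with)

lemma current_field': "is_current c \<Longrightarrow> is_field f \<Longrightarrow> cm (f n) (c k) = 0"
  using current_field[of c f k n] by (simp add: cm_eq_0_iff)

lemma current_hom: "is_current c \<Longrightarrow> hom k (c k)"
  and current_dd: "is_current c \<Longrightarrow> cm (c k) (dd n) = 0"
  unfolding is_current_def by auto

lemma current_dd': "is_current c \<Longrightarrow> cm (dd n) (c k) = 0"
  using current_dd[of c k n] by (simp add: cm_eq_0_iff)

lemma current_sm: "is_current c \<Longrightarrow> is_current (\<lambda>k. x k *\<^sub>C c k)"
  and current_diff: "is_current c \<Longrightarrow> is_current c' \<Longrightarrow> is_current (\<lambda>k. c k - c' k)"
  unfolding is_current_def by (auto simp: cm_simps intro: hom_closed)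

lemma current_cur: "is_current II"
  unfolding is_current_def
  using cm_phi_cur[of _ \<alpha>] cm_shift_cur[of _ \<alpha>] cm_del_cur[of \<gamma> _ \<alpha>]
  by (auto simp: hom_cur cm_eq_0_iff)

text \<open>
  The mode of the product of a current and a function of \<open>phi\<close>. It is indexed like \<open>avf\<close>, by the degree
  of the derivation, which lowers the depth by \<open>j\<close>.
\<close>

definition hop :: "(int \<Rightarrow> operator) \<Rightarrow> (int \<Rightarrow> operator) \<Rightarrow> int \<Rightarrow> operator" where
  "hop c f j = LS (\<lambda>k. c k * f (- j - k))"

lemma lsum_hop:
  assumes c: "is_current c" and f: "is_field f"
  shows "lsum (\<lambda>k. c k * f (- j - k)) (hop c f j)"
  unfolding hop_def
proof (intro lsum_LS loc_finI)
  fix b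
  have "{k. app (c k * f (- j - k)) (ket b) \<noteq> 0} \<subseteq> {- depth b..depth b - j}"
  proof
    fix k assume "k \<in> {k. app (c k * f (- j - k)) (ket b) \<noteq> 0}"
    then have nz: "app (c k * f (- j - k)) (ket b) \<noteq> 0" by simp
    have "c k * f (- j - k) = f (- j - k) * c k"
      using current_field[OF c f] by (simp add: cm_eq_0_iff)
    then have "app (f (- j - k) * c k) (ket b) \<noteq> 0" using nz by metis
    with nz have "\<not> depth b + k < 0" "\<not> depth b + (- j - k) < 0"
      using hom_kills[OF current_hom[OF c], of b k] field_kills[OF f, of b "- j - k"] by auto
    then show "k \<in> {- depth b..depth b - j}" by auto
  qed
  then show "finite {k. app (c k * f (- j - k)) (ket b) \<noteq> 0}" by (rule finite_subset) simp
qed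

lemma cm_avf_current:
  assumes f: "is_field f" and c: "is_current c"
  shows "cm (avf f j) (c k) = 0"
proof -
  have "lsum (\<lambda>n. cm (nord (f (n - j)) n) (c k)) (cm (avf f j) (c k))"
    by (intro lsum_cm' lsum_avf f)
  moreover have "cm (nord (f (n - j)) n) (c k) = 0" for n
    by (simp add: nord_def cm_simps current_field'[OF c f] current_dd'[OF c])
  ultimately show ?thesis using lsum_unique[OF _ lsum_zero] by simp
qed

lemma cm_avf_hop:
  assumes f: "is_field f" and c: "is_current c"
  shows "cm (avf f j) (hop c (vop r) l) = of_int r *\<^sub>C hop c (conv f (vop r)) (j + l)"
proof -
  have "lsum (\<lambda>k. cm (avf f j) (c k * vop r (- l - k))) (cm (avf f j) (hop c (vop r) l))"
    by (intro lsum_cm lsum_hop c field_vop)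
  moreover have "cm (avf f j) (c k * vop r (- l - k))
      = of_int r *\<^sub>C (c k * conv f (vop r) (- (j + l) - k))" for k
  proof -
    have "- l - k - j = - (j + l) - k" by simp
    moreover have "cm (avf f j) (c k * vop r (- l - k)) = of_int r *\<^sub>C (c k * conv f (vop r) (- l - k - j))"
      by (simp add: cm_simps cm_avf_current[OF f c] cm_avf_field[OF f tangent_vop])
    ultimately show ?thesis by (simp only:)
  qed
  ultimately show ?thesis
    using lsum_sm[OF lsum_hop[OF c field_conv[OF f field_vop[of r]], of "j + l"]] by (simp add: lsum_unique)
qed

text \<open>
  The bracket of two products of a current and a vertex operator. The operator part of the commutator
  of the currents depends on the index \<open>k\<close> affinely, so summation over \<open>k\<close> with \<open>K\<close> fixed gives a vertex
  operator and, for the linear term, its derivative. The scalar part \<open>z\<close> gives the series \<open>Z\<close>, of the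
  same shape as the anomaly of the vector fields.
\<close>

lemma cm_hop_hop:
  assumes a: "is_current a" and b: "is_current b" and c: "is_current c" and c': "is_current c'"
    and ab: "\<And>k k'. cm (a k) (b k')
      = (q0 (k + k') + q1 * of_int k) *\<^sub>C c (k + k') + (p0 (k + k') + p1 * of_int k) *\<^sub>C c' (k + k')
        + (if k + k' = 0 then z k else 0) *\<^sub>C 1"
  obtains X Z where
    "lsum (\<lambda>K. (q0 K - of_int j * q1) *\<^sub>C (c K * vop (m + r) (- j - l - K))
            - (q1 * of_int m) *\<^sub>C (c K * dvop (m + r) (- j - l - K))
            + (p0 K - of_int j * p1) *\<^sub>C (c' K * vop (m + r) (- j - l - K))
            - (p1 * of_int m) *\<^sub>C (c' K * dvop (m + r) (- j - l - K))) X"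
    "lsum (\<lambda>N. z N *\<^sub>C (vop r (N - l) * vop m (- N - j))) Z"
    "cm (hop a (vop m) j) (hop b (vop r) l) = X + Z"
proof -
  let ?A = "hop a (vop m) j" and ?B = "hop b (vop r) l"
  let ?V = "\<lambda>k. vop m (- j - k)" and ?W = "\<lambda>k. vop r (- l - k)"
  let ?F = "\<lambda>(k, k'). cm (a k) (b k') * (?V k * ?W k')"
  note vv = field_commute[OF field_vop field_vop]
  have sw: "vop m n * a k = a k * vop m n" "vop m n * b k = b k * vop m n"
    "vop r n * a k = a k * vop r n" "vop r n * b k = b k * vop r n" for n k
    using current_field[OF a field_vop] current_field[OF b field_vop] by (simp_all add: cm_eq_0_iff)
  have cms: "cm (a k) (b k') * (vop m n * vop r n') = (vop m n * vop r n') * cm (a k) (b k')" for k k' n n'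
  proof -
    have "cm (vop m n * vop r n') (cm (a k) (b k')) = 0"
      unfolding cm_def[of "a k"] by (simp add: cm_simps current_field'[OF a field_vop] current_field'[OF b field_vop])
    then show ?thesis by (simp add: cm_eq_0_iff)
  qed
  have lf: "loc_fin ?F"
  proof (rule loc_finI)
    fix d
    let ?d = "depth d"
    define hi where "hi = 2 * ?d + \<bar>j\<bar> + \<bar>l\<bar>"
    have "{p. app (?F p) (ket d) \<noteq> 0} \<subseteq> {- hi..hi} \<times> {- hi..hi}"
    proof
      fix p assume "p \<in> {p. app (?F p) (ket d) \<noteq> 0}"
      moreover obtain k k' where p: "p = (k, k')" by force
      ultimately have nz: "app (cm (a k) (b k') * (?V k * ?W k')) (ket d) \<noteq> 0" by auto
      have "app (cm (a k) (b k') * (?W k' * ?V k)) (ket d) \<noteq> 0"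
        using nz unfolding vv[of m "- j - k"] .
      then have "\<not> ?d + (- j - k) < 0" using field_kills[OF field_vop, of d] by auto
      moreover have "\<not> ?d + (- l - k') < 0" using nz field_kills[OF field_vop, of d] by auto
      moreover have "app ((?V k * ?W k') * cm (a k) (b k')) (ket d) \<noteq> 0"
        using nz unfolding cms .
      then have "app (cm (a k) (b k')) (ket d) \<noteq> 0" by auto
      moreover have "hom (k + k') (cm (a k) (b k'))"
      proof -
        have "hom (k + k') (a k * b k')" by (intro hom_mult current_hom a b)
        moreover have "hom (k' + k) (b k' * a k)" by (intro hom_mult current_hom a b)
        ultimately show ?thesis unfolding cm_def by (simp add: hom_closed add.commute)
      qed
      ultimately have "\<not> ?d + (k + k') < 0" "\<not> ?d + (- j - k) < 0" "\<not> ?d + (- l - k') < 0"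
        using hom_kills by blast+
      then show "p \<in> {- hi..hi} \<times> {- hi..hi}"
        unfolding p hi_def using depth_nonneg[of d] by auto
    qed
    then show "finite {p. app (?F p) (ket d) \<noteq> 0}" by (rule finite_subset) simp
  qed
  have S: "lsum ?F (LS ?F)" by (rule lsum_LS[OF lf])
  have "lsum (\<lambda>k'. cm ?A (b k' * ?W k')) (LS ?F)"
  proof (rule lsum_fubini_swap[OF S])
    fix k'
    have "lsum (\<lambda>k. cm (a k * ?V k) (b k' * ?W k')) (cm ?A (b k' * ?W k'))"
      by (intro lsum_cm' lsum_hop a field_vop)
    moreover have "cm (a k * ?V k) (b k' * ?W k') = ?F (k, k')" for k
      using current_field'[OF a field_vop[of r], of "- l - k'" k]
      by (simp add: cm_simps field_cm[OF field_vop field_vop] current_field'[OF b field_vop]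
          current_field[OF a field_vop] mult.assoc sw vv)
    ultimately show "lsum (\<lambda>k. ?F (k, k')) (cm ?A (b k' * ?W k'))" by simp
  qed
  moreover have "lsum (\<lambda>k'. cm ?A (b k' * ?W k')) (cm ?A ?B)"
    by (intro lsum_cm lsum_hop b field_vop)
  ultimately have AB: "cm ?A ?B = LS ?F" by (rule lsum_unique[rotated])
  let ?VW = "\<lambda>K k. ?V k * vop r (- l - K + k)"
  let ?E = "\<lambda>K. vop (m + r) (- j - l - K)" and ?D = "\<lambda>K. dvop (m + r) (- j - l - K)"
  have idx: "- j + (- l - K) = - j - l - K" for K by simp
  have VW: "lsum (?VW K) (?E K)" for K
    using lsum_conv_reflect[OF field_vop[of m] field_vop[of r], of "- j" "- l - K"]
    by (simp only: conv_vop_vop idx)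
  have DW: "lsum (\<lambda>k. dvop m (- j - k) * vop r (- l - K + k)) (?D K)" for K
    using lsum_conv_reflect[OF field_dvop[of m] field_vop[of r], of "- j" "- l - K"]
    by (simp only: conv_dvop_vop idx)
  have kVW: "lsum (\<lambda>k. of_int k *\<^sub>C ?VW K k) (- (of_int j *\<^sub>C ?E K) - of_int m *\<^sub>C ?D K)" for K
  proof -
    have "of_int k *\<^sub>C ?VW K k = - (of_int j *\<^sub>C ?VW K k) - of_int m *\<^sub>C (dvop m (- j - k) * vop r (- l - K + k))" for k
    proof -
      have "of_int m *\<^sub>C (dvop m (- j - k) * vop r (- l - K + k)) = of_int (- j - k) *\<^sub>C ?VW K k"
        using dvop_eq[of "- j - k" m] by (metis sm_simps(5))
      then show ?thesis by (simp add: sm_distrib)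
    qed
    then show ?thesis
      using lsum_diff[OF lsum_minus[OF lsum_sm[OF VW[of K], of "of_int j"]] lsum_sm[OF DW[of K], of "of_int m"]]
      by simp
  qed
  have Zl: "loc_fin (\<lambda>k. z k *\<^sub>C ?VW 0 k)"
    by (rule loc_fin_sm[OF lsum_loc_fin[OF VW]])
  define Z where "Z = LS (\<lambda>k. z k *\<^sub>C ?VW 0 k)"
  have Z: "lsum (\<lambda>k. z k *\<^sub>C ?VW 0 k) Z" unfolding Z_def by (rule lsum_LS[OF Zl])
  let ?G = "\<lambda>K. (q0 K - of_int j * q1) *\<^sub>C (c K * ?E K) - (q1 * of_int m) *\<^sub>C (c K * ?D K)
       + (p0 K - of_int j * p1) *\<^sub>C (c' K * ?E K) - (p1 * of_int m) *\<^sub>C (c' K * ?D K)"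
  have GG: "lsum (\<lambda>K. ?G K + (if K = 0 then Z else 0)) (LS ?F)"
  proof (rule lsum_fubini)
    (* The currents only depend on K = k + k', so the sum over k is a product of vertex operators. *)
    let ?h = "\<lambda>(K, k). (k, K - k) :: int \<times> int"
    have "bij ?h"
      by (rule bij_betw_byWitness[where f' = "\<lambda>(k, k'). (k + k', k)"]) auto
    then show "lsum (\<lambda>p. ?F (?h p)) (LS ?F)"
      by (rule lsum_reindex[OF S])
    fix K
    have "lsum (\<lambda>k. c K * (q0 K *\<^sub>C ?VW K k + q1 *\<^sub>C (of_int k *\<^sub>C ?VW K k))
          + c' K * (p0 K *\<^sub>C ?VW K k + p1 *\<^sub>C (of_int k *\<^sub>C ?VW K k))
          + (if K = 0 then z k *\<^sub>C ?VW 0 k else 0))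
        (c K * (q0 K *\<^sub>C ?E K + q1 *\<^sub>C (- (of_int j *\<^sub>C ?E K) - of_int m *\<^sub>C ?D K))
          + c' K * (p0 K *\<^sub>C ?E K + p1 *\<^sub>C (- (of_int j *\<^sub>C ?E K) - of_int m *\<^sub>C ?D K))
          + (if K = 0 then Z else 0))"
      using Z by (intro lsum_add lsum_mult_left lsum_sm VW kVW) (auto intro: lsum_zero)
    moreover have "c K * (q0 K *\<^sub>C ?VW K k + q1 *\<^sub>C (of_int k *\<^sub>C ?VW K k))
          + c' K * (p0 K *\<^sub>C ?VW K k + p1 *\<^sub>C (of_int k *\<^sub>C ?VW K k))
          + (if K = 0 then z k *\<^sub>C ?VW 0 k else 0) = ?F (?h (K, k))" for k
    proof -
      have "- l - (K - k) = - l - K + k" by simp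
      then show ?thesis
        by (rule_tac endo_eqI_entry) (simp add: ab entry_simps algebra_simps)
    qed
    moreover have "c K * (q0 K *\<^sub>C ?E K + q1 *\<^sub>C (- (of_int j *\<^sub>C ?E K) - of_int m *\<^sub>C ?D K))
          + c' K * (p0 K *\<^sub>C ?E K + p1 *\<^sub>C (- (of_int j *\<^sub>C ?E K) - of_int m *\<^sub>C ?D K))
        = ?G K"
      by (rule endo_eqI_entry) (simp add: entry_simps algebra_simps)
    ultimately show "lsum (\<lambda>k. ?F (?h (K, k))) (?G K + (if K = 0 then Z else 0))" by simp
  qed
  have "lsum (\<lambda>K. if K = (0::int) then Z else 0) (if (0::int) = 0 then Z else 0)"
    by (rule lsum_single) simp
  then have "lsum (\<lambda>K. if K = (0::int) then Z else 0) Z" by simp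
  from lsum_diff[OF GG this] have X: "lsum ?G (LS ?F - Z)" by simp
  have Z': "lsum (\<lambda>N. z N *\<^sub>C (vop r (N - l) * vop m (- N - j))) Z"
  proof (rule lsum_cong[OF _ Z])
    fix k
    have "- j - k = - k - j" "- l - 0 + k = k - l" by simp_all
    then show "z k *\<^sub>C ?VW 0 k = z k *\<^sub>C (vop r (k - l) * vop m (- k - j))"
      by (simp only: vv[of m "- k - j" r])
  qed
  show thesis by (rule that[OF X Z']) (simp add: AB)
qed

subsection \<open>The Virasoro operators of the current\<close>

text \<open>
  Twice the Sugawara field of the current, before summation, in normal order.
\<close>

definition sno :: "int \<Rightarrow> int \<Rightarrow> operator" where
  "sno n k = (if 0 \<le> n then II n * II (k - n) else II (k - n) * II n)"

definition sug :: "int \<Rightarrow> operator" where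
  "sug k = (1/2) *\<^sub>C LS (\<lambda>n. sno n k)"

lemma loc_fin_sno: "loc_fin (\<lambda>n. sno n k)"
proof (rule loc_finI)
  fix b
  have "{n. app (sno n k) (ket b) \<noteq> 0} \<subseteq> {- depth b..k + depth b}"
  proof
    fix n assume "n \<in> {n. app (sno n k) (ket b) \<noteq> 0}"
    then have n: "app (sno n k) (ket b) \<noteq> 0" by simp
    have "0 \<le> n \<Longrightarrow> \<not> depth b + (k - n) < 0" "n < 0 \<Longrightarrow> \<not> depth b + n < 0"
      using n hom_kills[OF hom_cur, of b] by (auto simp: sno_def)
    moreover have "n < 0 \<Longrightarrow> n \<le> k + depth b"
    proof (rule ccontr)
      assume "n < 0" "\<not> n \<le> k + depth b"
      then have "\<not> depth b + n < 0" "k \<noteq> 0" using calculation depth_nonneg[of b] by auto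
      then have "sno n k = II n * II (k - n)"
        using cm_cur_cur[of \<alpha> n "k - n"] by (simp add: sno_def cm_eq_0_iff)
      moreover have "app (II (k - n)) (ket b) = 0"
        using \<open>\<not> n \<le> k + depth b\<close> by (intro hom_kills[OF hom_cur]) simp
      ultimately show False using n by simp
    qed
    ultimately show "n \<in> {- depth b..k + depth b}"
      using depth_nonneg[of b] by (cases "0 \<le> n") auto
  qed
  then show "finite {n. app (sno n k) (ket b) \<noteq> 0}" by (rule finite_subset) simp
qed

lemma lsum_sug: "lsum (\<lambda>n. sno n k) (2 *\<^sub>C sug k)"
  using lsum_LS[OF loc_fin_sno[of k]] by (simp add: sug_def)

lemma current_sug: "is_current sug"
  unfolding is_current_def
proof (intro allI conjI)
  fix k
  have sm2: "hom k (sno n k)" for n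
    using hom_mult[of n "II n" "k - n" "II (k - n)"] hom_mult[of "k - n" "II (k - n)" n "II n"]
    by (simp add: sno_def hom_cur)
  have "hom k (LS (\<lambda>n. sno n k))"
    by (rule hom_lsum[OF lsum_LS[OF loc_fin_sno] sm2])
  then show "hom k (sug k)" unfolding sug_def by (intro hom_closed)
  have *: "cm (sug k) A = 0" if "\<And>n. cm (II n) A = 0" for A
  proof -
    have "lsum (\<lambda>n. cm (sno n k) A) (cm (2 *\<^sub>C sug k) A)"
      by (intro lsum_cm' lsum_sug)
    moreover have "cm (sno n k) A = 0" for n by (simp add: sno_def cm_simps that)
    ultimately have "cm (2 *\<^sub>C sug k) A = 0" using lsum_unique[OF _ lsum_zero] by simp
    then have "(1/2) *\<^sub>C cm (2 *\<^sub>C sug k) A = 0" by simp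
    then show ?thesis by (simp add: cm_simps del: sm_simps(4))
  qed
  note cc = current_cur[unfolded is_current_def, rule_format]
  show "cm (sug k) (phi n) = 0" "cm (sug k) (shift m) = 0" "cm (sug k) (dd n) = 0" for n m
    using cc by (auto intro: *)
qed

lemma cm_sug_cur: "cm (sug k) (II l) = of_int l *\<^sub>C II (k + l)"
proof -
  have 1: "lsum (\<lambda>n. cm (sno n k) (II l)) (cm (2 *\<^sub>C sug k) (II l))"
    by (intro lsum_cm' lsum_sug)
  have "cm (sno n k) (II l) = (if n = - l then of_int l *\<^sub>C II (k + l) else 0)
      + (if n = k + l then of_int l *\<^sub>C II (k + l) else 0)" for n
  proof (cases "n = - l \<and> n = k + l")
    case True
    then have "k = - l - l" by simp
    with True show ?thesis by (simp add: sno_def cm_simps cm_cur_cur sm_distrib)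
  next
    case False
    then show ?thesis by (auto simp: sno_def cm_simps cm_cur_cur sm_distrib algebra_simps)
  qed
  moreover have "lsum (\<lambda>n. (if n = - l then of_int l *\<^sub>C II (k + l) else 0)
      + (if n = k + l then of_int l *\<^sub>C II (k + l) else 0))
     ((if - l = - l then of_int l *\<^sub>C II (k + l) else 0) + (if k + l = k + l then of_int l *\<^sub>C II (k + l) else 0))"
    by (intro lsum_add lsum_single) auto
  ultimately have "cm (2 *\<^sub>C sug k) (II l) = of_int l *\<^sub>C II (k + l) + of_int l *\<^sub>C II (k + l)"
    using 1 by (simp add: lsum_unique)
  then have "(1/2) *\<^sub>C cm (2 *\<^sub>C sug k) (II l) = (1/2) *\<^sub>C (2 *\<^sub>C of_int l *\<^sub>C II (k + l))"
    by (simp add: sm_distrib flip: sm_distrib(4))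
  then show ?thesis by (simp add: cm_simps)
qed

text \<open>
  The Virasoro relation with central charge \<open>1\<close>, in the indexing where \<open>sug (- k)\<close> is the usual \<open>k\<close>-th
  generator. The central term arises from restoring the normal order and is a cubic sum evaluated by telescoping.
\<close>

lemma cm_sug_sug:
  "cm (sug k) (sug l) = of_int (l - k) *\<^sub>C sug (k + l)
     + (if k + l = 0 then - (of_int (k ^ 3 - k) / 12) else 0) *\<^sub>C 1"
proof -
  let ?\<delta> = "if k + l = 0 then 1 else 0 :: complex"
  have 1: "lsum (\<lambda>n. cm (sug k) (sno n l)) (cm (sug k) (2 *\<^sub>C sug l))"
    by (intro lsum_cm lsum_sug)
  have term_eq: "cm (sug k) (sno n l)
     = of_int n *\<^sub>C sno (n + k) (k + l) + of_int (l - n) *\<^sub>C sno n (k + l)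
       + (crossing n (n - - k) * (- ?\<delta> * of_int (n * (n + k)))) *\<^sub>C 1" for n
  proof -
    have ex: "II (n + k) * II (l - n) = II (l - n) * II (n + k) - (?\<delta> * of_int (n + k)) *\<^sub>C 1"
    proof -
      have "II (n + k) * II (l - n) = II (l - n) * II (n + k) + cm (II (n + k)) (II (l - n))"
        by (simp add: cm_def)
      then show ?thesis by (simp add: cm_cur_cur sm_distrib add.commute)
    qed
    let ?P = "II (n + k) * II (l - n)" and ?Q = "II (l - n) * II (n + k)"
    have cn: "cm (sug k) (II n) = of_int n *\<^sub>C II (n + k)"
      using cm_sug_cur[of k n] by (simp only: add.commute)
    have cl: "cm (sug k) (II (l - n)) = of_int (l - n) *\<^sub>C II (k + l - n)"
      using cm_sug_cur[of k "l - n"] by (simp only: add_diff_eq)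
    have L: "cm (sug k) (sno n l) = of_int n *\<^sub>C (if 0 \<le> n then ?P else ?Q) + of_int (l - n) *\<^sub>C sno n (k + l)"
      by (simp add: sno_def cm_simps cn cl)
    have "k + l - (n + k) = l - n" by simp
    then have R: "sno (n + k) (k + l) = (if 0 \<le> n + k then ?P else ?Q)"
      by (simp only: sno_def)
    have x: "of_int n *\<^sub>C ?P = of_int n *\<^sub>C ?Q - (?\<delta> * of_int (n * (n + k))) *\<^sub>C 1"
      unfolding ex sm_distrib sm_simps by (simp only: of_int_mult mult_ac)
    consider "0 \<le> n" "n + k < 0" | "n < 0" "0 \<le> n + k" | "(0 \<le> n) = (0 \<le> n + k)" by linarith
    then show ?thesis
    proof cases
      case 1
      then show ?thesis unfolding L R by (simp add: x crossing_def sm_distrib)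
    next
      case 2
      then show ?thesis unfolding L R by (simp add: x crossing_def sm_distrib)
    next
      case 3
      then have "crossing n (n - - k) = 0" by (auto simp: crossing_def)
      with 3 show ?thesis unfolding L R by simp
    qed
  qed
  define X where "X = LS (\<lambda>n. of_int n *\<^sub>C sno (n + k) (k + l))"
  have X: "lsum (\<lambda>n. of_int n *\<^sub>C sno (n + k) (k + l)) X"
    unfolding X_def
    by (intro lsum_LS loc_fin_sm lsum_loc_fin[OF lsum_reindex[OF lsum_sug bij_int_shift(1)]])
  from lsum_reindex[OF this bij_int_shift(2)[of k]]
  have X': "lsum (\<lambda>n. of_int (n - k) *\<^sub>C sno n (k + l)) X" by simp
  define Y where "Y = LS (\<lambda>n. of_int (l - n) *\<^sub>C sno n (k + l))"
  have Y: "lsum (\<lambda>n. of_int (l - n) *\<^sub>C sno n (k + l)) Y"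
    unfolding Y_def by (intro lsum_LS loc_fin_sm loc_fin_sno)
  have "lsum (\<lambda>n. of_int (l - k) *\<^sub>C sno n (k + l)) (X + Y)"
    by (rule lsum_cong[OF _ lsum_add[OF X' Y]]) (simp flip: sm_distrib(4))
  moreover have "lsum (\<lambda>n. of_int (l - k) *\<^sub>C sno n (k + l)) (of_int (l - k) *\<^sub>C 2 *\<^sub>C sug (k + l))"
    by (intro lsum_sm lsum_sug)
  ultimately have XY: "X + Y = of_int (l - k) *\<^sub>C 2 *\<^sub>C sug (k + l)" by (rule lsum_unique)
  have sum: "signed_sum N (\<lambda>n. - ?\<delta> * of_int (n * (n - N))) = ?\<delta> * of_int (N ^ 3 - N) / 6" for N
  proof -
    have "signed_sum M (\<lambda>n. - ?\<delta> * of_int (n * (n - N)))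
       = - ?\<delta> * (of_int ((M - 1) * M * (2 * M - 1)) / 6 - of_int (N * M * (M - 1)) / 2)" for M
      by (rule signed_sum_closed) (auto simp: field_simps)
    note closed = this
    show ?thesis unfolding closed by (simp add: field_simps power3_eq_cube)
  qed
  have "lsum (\<lambda>n. (crossing n (n - - k) * (- ?\<delta> * of_int (n * (n + k)))) *\<^sub>C 1)
      ((- (?\<delta> * of_int (k ^ 3 - k) / 6)) *\<^sub>C 1 :: operator)"
  proof -
    have "signed_sum (- k) (\<lambda>n. - ?\<delta> * of_int (n * (n + k))) = ?\<delta> * of_int ((- k) ^ 3 - (- k)) / 6"
      using sum[of "- k"] by (simp only: diff_minus_eq_add)
    also have "\<dots> = - (?\<delta> * of_int (k ^ 3 - k) / 6)"
      by (cases "k + l = 0") (simp_all add: field_simps)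
    finally show ?thesis
      using lsum_crossing[of "- k" "\<lambda>n. - ?\<delta> * of_int (n * (n + k))" 1] by (simp only:)
  qed
  from lsum_add[OF lsum_add[OF X Y] this]
  have "cm (sug k) (2 *\<^sub>C sug l) = X + Y + (- (?\<delta> * of_int (k ^ 3 - k) / 6)) *\<^sub>C 1"
    using 1 unfolding term_eq by (rule lsum_unique[rotated])
  then have "(1/2) *\<^sub>C cm (sug k) (2 *\<^sub>C sug l)
     = (1/2) *\<^sub>C (of_int (l - k) *\<^sub>C 2 *\<^sub>C sug (k + l) + (- (?\<delta> * of_int (k ^ 3 - k) / 6)) *\<^sub>C 1)"
    unfolding XY by simp
  then show ?thesis
    by (simp add: cm_simps sm_distrib)
qed

text \<open>
  The background charge changes the central charge from \<open>1\<close> to \<open>- 2\<close>, the negative of that of the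
  conjugate fields \<open>phi\<close> and \<open>del\<close>, and makes the bracket with the current anomalous as the mixed
  bracket relation requires.
\<close>

definition vir :: "int \<Rightarrow> operator" where
  "vir k = sug k - (of_int (k + 1) / 2) *\<^sub>C II k"

lemma current_vir: "is_current vir"
  unfolding vir_def[abs_def] by (intro current_diff current_sm current_sug current_cur)

lemma cm_vir_cur: "cm (vir k) (II l) = of_int l *\<^sub>C II (k + l)
    + (if k + l = 0 then of_int (k ^ 2 + k) / 2 else 0) *\<^sub>C 1"
  by (simp add: vir_def cm_simps cm_sug_cur cm_cur_cur sm_distrib field_simps power2_eq_square)

lemma cm_cur_vir: "cm (II k) (vir l) = - (of_int k *\<^sub>C II (k + l))
    - (if k + l = 0 then of_int (k ^ 2 - k) / 2 else 0) *\<^sub>C 1"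
proof -
  have "cm (II k) (vir l) = - (of_int k *\<^sub>C II (k + l)
     + (if k + l = 0 then of_int (l ^ 2 + l) / 2 else 0) *\<^sub>C 1)"
    using cm_swap[of "II k" "vir l"] cm_vir_cur[of l k] by (simp only: add.commute)
  moreover have "(if k + l = 0 then of_int (l ^ 2 + l) / 2 else 0 :: complex)
      = (if k + l = 0 then of_int (k ^ 2 - k) / 2 else 0)"
  proof (cases "k + l = 0")
    case True
    then have "l = - k" by simp
    then show ?thesis by simp
  qed simp
  ultimately show ?thesis by (simp only: minus_add_distrib diff_conv_add_uminus)
qed

lemma cm_vir_vir: "cm (vir k) (vir l) = of_int (l - k) *\<^sub>C vir (k + l)
    + (if k + l = 0 then of_int (k ^ 3 - k) / 6 else 0) *\<^sub>C 1"
proof (cases "k + l = 0")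
  case True
  then have l: "l = - k" by simp
  show ?thesis
    unfolding vir_def cm_simps cm_sug_sug cm_sug_cur cm_swap[of "II k" "sug l"] cm_cur_cur
    by (rule endo_eqI_entry) (simp add: l entry_simps field_simps power3_eq_cube)
next
  case False
  then show ?thesis
    unfolding vir_def cm_simps cm_sug_sug cm_sug_cur cm_swap[of "II k" "sug l"] cm_cur_cur
    by (rule_tac endo_eqI_entry) (simp add: entry_simps field_simps add.commute)
qed

subsection \<open>The commutation relations of the vector fields\<close>

definition vcur :: "int \<Rightarrow> int \<Rightarrow> operator" where
  "vcur j k = vir k - of_int j *\<^sub>C II k"

lemma current_vcur: "is_current (vcur j)"
  unfolding vcur_def[abs_def] by (intro current_diff current_sm current_vir current_cur)

text \<open>
  The action of \<open>t\<^sub>0^j t\<^sub>1^m d\<^sub>a\<close>. Because of the background charge, the factor \<open>t\<^sub>0^j\<close> contributes through its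
  derivative as well; this is the term \<open>- j cur\<close> in \<open>vcur j\<close>.
\<close>

fun rep :: "vf_basis \<Rightarrow> operator" where
  "rep (Monom j m Dir1) = avf (vop m) j + of_int m *\<^sub>C hop II (vop m) j"
| "rep (Monom j m Dir0) = - avf (dvop m) j - hop (vcur j) (vop m) j"

lemma hop_diff:
  assumes "is_current c" "is_current c'" "is_field f"
  shows "hop (\<lambda>k. c k - x *\<^sub>C c' k) f j = hop c f j - x *\<^sub>C hop c' f j"
proof -
  have "lsum (\<lambda>k. (c k - x *\<^sub>C c' k) * f (- j - k)) (hop (\<lambda>k. c k - x *\<^sub>C c' k) f j)"
    by (intro lsum_hop current_diff current_sm assms)
  moreover have "lsum (\<lambda>k. c k * f (- j - k) - x *\<^sub>C (c' k * f (- j - k))) (hop c f j - x *\<^sub>C hop c' f j)"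
    by (intro lsum_diff lsum_sm lsum_hop assms)
  ultimately show ?thesis by (simp add: left_diff_distrib lsum_unique)
qed

lemma hop_vcur: "is_field f \<Longrightarrow> hop (vcur i) f j = hop vir f j - of_int i *\<^sub>C hop II f j"
  unfolding vcur_def[abs_def] by (intro hop_diff current_vir current_cur)

text \<open>
  In each bracket relation the anomaly of the vector fields and the scalar terms of the currents are
  series in the same products of vertex operators. They cancel because the coefficients do, for
  each \<open>N\<close>; the products themselves need not be evaluated.
\<close>

lemma central_cancel:
  assumes "lsum (\<lambda>N. w N *\<^sub>C (vop r (N - l) * vop m (- N - j))) C"
    and "lsum (\<lambda>N. z N *\<^sub>C (vop r (N - l) * vop m (- N - j))) Z"
    and "\<And>N. w N + s * z N = 0"
  shows "C + s *\<^sub>C Z = 0"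
proof -
  have "lsum (\<lambda>N. w N *\<^sub>C (vop r (N - l) * vop m (- N - j)) + s *\<^sub>C (z N *\<^sub>C (vop r (N - l) * vop m (- N - j)))) (C + s *\<^sub>C Z)"
    by (intro lsum_add lsum_sm assms(1,2))
  then have "lsum (\<lambda>N. (w N + s * z N) *\<^sub>C (vop r (N - l) * vop m (- N - j))) (C + s *\<^sub>C Z)"
    by (simp add: sm_distrib)
  then have "lsum (\<lambda>N :: int. 0) (C + s *\<^sub>C Z)" unfolding assms(3) by simp
  then show ?thesis by (rule lsum_unique[OF _ lsum_zero])
qed

lemma signed_sum_const: "signed_sum N (\<lambda>n. c) = c * of_int N"
  by (rule signed_sum_closed[where P = "\<lambda>n. c * of_int n"]) (auto simp: algebra_simps)

lemma dvop_entry: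
  "of_int n * entry w p (A * vop m n) = of_int m * entry w p (A * dvop m n)"
proof -
  have "A * (of_int n *\<^sub>C vop m n) = A * (of_int m *\<^sub>C dvop m n)" by (simp only: dvop_eq)
  then have "of_int n *\<^sub>C (A * vop m n) = of_int m *\<^sub>C (A * dvop m n)" by simp
  then show ?thesis by (metis entry_simps(5))
qed

lemma dvop_nord_entry:
  "of_int n * entry w p (nord (vop m n) i) = of_int m * entry w p (nord (dvop m n) i)"
proof -
  have "nord (of_int n *\<^sub>C vop m n) i = nord (of_int m *\<^sub>C dvop m n) i" by (simp only: dvop_eq)
  then have "of_int n *\<^sub>C nord (vop m n) i = of_int m *\<^sub>C nord (dvop m n) i" by (simp only: nord_simps)
  then show ?thesis by (metis entry_simps(5))
qed

text \<open>
  The three bracket relations follow one pattern. The mixed commutators are given by \<open>cm_avf_hop\<close>; the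
  classical parts of the remaining two combine to the expected modes, by the chain rule \<open>dvop_eq\<close>
  whenever coefficients depend on the mode; and \<open>central_cancel\<close> removes the rest.
\<close>

lemma rep_rep_11:
  "cm (rep (Monom j m Dir1)) (rep (Monom l r Dir1)) = of_int (r - m) *\<^sub>C rep (Monom (j + l) (m + r) Dir1)"
proof -
  let ?J = "j + l" and ?M = "m + r"
  obtain A B C where A: "lsum (\<lambda>n. of_int r *\<^sub>C nord (conv (vop m) (vop r) (n - l - j)) n) A"
    and B: "lsum (\<lambda>n. of_int m *\<^sub>C nord (conv (vop m) (vop r) (n - j - l)) n) B"
    and C: "lsum (\<lambda>N. signed_sum N (\<lambda>n. of_int m * of_int r) *\<^sub>C (vop r (N - l) * vop m (- N - j))) C"
    and avav: "cm (avf (vop m) j) (avf (vop r) l) = A - B + C"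
    using cm_avf_avf[OF tangent_vop[of m] tangent_vop[of r]] by blast
  have A': "A = of_int r *\<^sub>C avf (vop ?M) ?J" and B': "B = of_int m *\<^sub>C avf (vop ?M) ?J"
    using A B lsum_sm[OF lsum_avf[OF field_vop[of ?M], of ?J]]
    by (auto simp: conv_vop_vop diff_diff_eq add.commute intro: lsum_unique)
  have "cm (II k) (II k') = (0 + 0 * of_int k) *\<^sub>C II (k + k') + (0 + 0 * of_int k) *\<^sub>C II (k + k')
        + (if k + k' = 0 then - of_int k else 0) *\<^sub>C 1" for k k'
    by (simp add: cm_cur_cur)
  from cm_hop_hop[OF current_cur current_cur current_cur current_cur this, of j m r l]
  obtain X Z where "lsum (\<lambda>K :: int. 0) X"
    and Z: "lsum (\<lambda>N. (- of_int N) *\<^sub>C (vop r (N - l) * vop m (- N - j))) Z"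
    and hh: "cm (hop II (vop m) j) (hop II (vop r) l) = X + Z"
    by auto
  then have X: "X = 0" using lsum_unique[OF _ lsum_zero] by blast
  have CZ: "C + (of_int m * of_int r) *\<^sub>C Z = 0"
    by (rule central_cancel[OF C Z]) (simp add: signed_sum_const)
  have ah: "cm (avf (vop m) j) (hop II (vop r) l) = of_int r *\<^sub>C hop II (vop ?M) ?J"
    using cm_avf_hop[OF field_vop[of m] current_cur] by (simp add: conv_vop_vop)
  have ha: "cm (hop II (vop m) j) (avf (vop r) l) = - (of_int m *\<^sub>C hop II (vop ?M) ?J)"
    using cm_avf_hop[OF field_vop[of r] current_cur, of l m j] cm_swap[of "hop II (vop m) j"]
    by (simp add: conv_vop_vop add.commute)
  have "cm (rep (Monom j m Dir1)) (rep (Monom l r Dir1))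
     = A - B + (C + (of_int m * of_int r) *\<^sub>C Z)
       + of_int r *\<^sub>C of_int r *\<^sub>C hop II (vop ?M) ?J - of_int m *\<^sub>C of_int m *\<^sub>C hop II (vop ?M) ?J"
    unfolding rep.simps cm_simps avav ah ha hh X
    by (rule endo_eqI_entry) (simp add: entry_simps algebra_simps)
  also have "\<dots> = of_int (r - m) *\<^sub>C rep (Monom ?J ?M Dir1)"
    unfolding CZ A' B' by (rule endo_eqI_entry) (simp add: entry_simps algebra_simps)
  finally show ?thesis .
qed

lemma rep_rep_10:
  "cm (rep (Monom j m Dir1)) (rep (Monom l r Dir0))
   = of_int r *\<^sub>C rep (Monom (j + l) (m + r) Dir0) - of_int j *\<^sub>C rep (Monom (j + l) (m + r) Dir1)"
proof -
  let ?J = "j + l" and ?M = "m + r"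
  obtain A B C where A: "lsum (\<lambda>n. of_int (n - l) *\<^sub>C nord (conv (vop m) (vop r) (n - l - j)) n) A"
    and B: "lsum (\<lambda>n. of_int m *\<^sub>C nord (conv (vop m) (dvop r) (n - j - l)) n) B"
    and C: "lsum (\<lambda>N. signed_sum N (\<lambda>n. of_int m * of_int (n - l)) *\<^sub>C (vop r (N - l) * vop m (- N - j))) C"
    and avav: "cm (avf (vop m) j) (avf (dvop r) l) = A - B + C"
    using cm_avf_avf[OF tangent_vop[of m] tangent_dvop[of r]] by blast
  have idx: "n - l - j = n - ?J" "n - j - l = n - ?J" for n by simp_all
  have AB: "A - B = of_int r *\<^sub>C avf (dvop ?M) ?J + of_int j *\<^sub>C avf (vop ?M) ?J"
  proof (rule lsum_unique[OF lsum_diff[OF A B]])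
    have "of_int (n - l) *\<^sub>C nord (vop ?M (n - ?J)) n - of_int m *\<^sub>C nord (dvop ?M (n - ?J)) n
       = of_int r *\<^sub>C nord (dvop ?M (n - ?J)) n + of_int j *\<^sub>C nord (vop ?M (n - ?J)) n" for n
      using dvop_nord_entry[of "n - ?J" _ _ ?M n]
      by (intro endo_eqI_entry) (simp add: entry_simps algebra_simps)
    then show "lsum (\<lambda>n. of_int (n - l) *\<^sub>C nord (conv (vop m) (vop r) (n - l - j)) n - of_int m *\<^sub>C nord (conv (vop m) (dvop r) (n - j - l)) n)
       (of_int r *\<^sub>C avf (dvop ?M) ?J + of_int j *\<^sub>C avf (vop ?M) ?J)"
      using lsum_add[OF lsum_sm[OF lsum_avf[OF field_dvop[of ?M], of ?J], of "of_int r"] lsum_sm[OF lsum_avf[OF field_vop[of ?M], of ?J], of "of_int j"]]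
      unfolding idx conv_vop_vop conv_vop_dvop by simp
  qed
  have "cm (II k) (vcur l k') = (0 + - 1 * of_int k) *\<^sub>C II (k + k') + (0 + 0 * of_int k) *\<^sub>C II (k + k')
        + (if k + k' = 0 then of_int l * of_int k - of_int (k ^ 2 - k) / 2 else 0) *\<^sub>C 1" for k k'
    by (rule endo_eqI_entry) (simp add: vcur_def cm_simps cm_cur_vir cm_cur_cur entry_simps algebra_simps)
  from cm_hop_hop[OF current_cur current_vcur current_cur current_cur this, of j m r l]
  obtain X Z where X: "lsum (\<lambda>K. of_int j *\<^sub>C (II K * vop ?M (- j - l - K)) + of_int m *\<^sub>C (II K * dvop ?M (- j - l - K))) X"
    and Z: "lsum (\<lambda>N. (of_int l * of_int N - of_int (N ^ 2 - N) / 2) *\<^sub>C (vop r (N - l) * vop m (- N - j))) Z"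
    and hh: "cm (hop II (vop m) j) (hop (vcur l) (vop r) l) = X + Z"
    by (auto simp: sm_distrib)
  have idx': "- j - l - K = - ?J - K" for K by simp
  have X: "X = of_int j *\<^sub>C hop II (vop ?M) ?J + of_int m *\<^sub>C hop II (dvop ?M) ?J"
    using X unfolding idx'
    by (rule lsum_unique) (intro lsum_add lsum_sm lsum_hop current_cur field_vop field_dvop)
  have CZ: "C + of_int m *\<^sub>C Z = 0"
  proof (rule central_cancel[OF C Z])
    fix N
    have "signed_sum N (\<lambda>n. of_int m * of_int (n - l)) = of_int m * (of_int (N * (N - 1)) / 2 - of_int (l * N))"
      by (rule signed_sum_closed[where P = "\<lambda>N. of_int m * (of_int (N * (N - 1)) / 2 - of_int (l * N))"])
         (auto simp: field_simps)
    then show "signed_sum N (\<lambda>n. of_int m * of_int (n - l)) + of_int m * (of_int l * of_int N - of_int (N ^ 2 - N) / 2) = 0"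
      by (simp add: field_simps power2_eq_square)
  qed
  have ah: "cm (avf (vop m) j) (hop (vcur l) (vop r) l) = of_int r *\<^sub>C (hop vir (vop ?M) ?J - of_int l *\<^sub>C hop II (vop ?M) ?J)"
    using cm_avf_hop[OF field_vop[of m] current_vcur, of j l r l] by (simp add: conv_vop_vop hop_vcur field_vop)
  have ha: "cm (hop II (vop m) j) (avf (dvop r) l) = - (of_int m *\<^sub>C hop II (dvop ?M) ?J)"
    using cm_avf_hop[OF field_dvop[of r] current_cur, of l m j] cm_swap[of "hop II (vop m) j"]
    by (simp add: conv_dvop_vop add.commute)
  have "cm (rep (Monom j m Dir1)) (rep (Monom l r Dir0))
     = - (A - B) - (C + of_int m *\<^sub>C Z) - of_int r *\<^sub>C (hop vir (vop ?M) ?J - of_int l *\<^sub>C hop II (vop ?M) ?J)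
       + of_int m *\<^sub>C of_int m *\<^sub>C hop II (dvop ?M) ?J - of_int m *\<^sub>C X"
    unfolding rep.simps cm_simps avav ah ha hh
    by (rule endo_eqI_entry) (simp add: entry_simps algebra_simps)
  also have "\<dots> = of_int r *\<^sub>C rep (Monom ?J ?M Dir0) - of_int j *\<^sub>C rep (Monom ?J ?M Dir1)"
    unfolding CZ AB X rep.simps hop_vcur[OF field_vop] by (rule endo_eqI_entry) (simp add: entry_simps algebra_simps)
  finally show ?thesis .
qed

lemma rep_rep_00:
  "cm (rep (Monom j m Dir0)) (rep (Monom l r Dir0)) = of_int (l - j) *\<^sub>C rep (Monom (j + l) (m + r) Dir0)"
proof -
  let ?J = "j + l" and ?M = "m + r"
  obtain A B C where A: "lsum (\<lambda>n. of_int (n - l) *\<^sub>C nord (conv (dvop m) (vop r) (n - l - j)) n) A"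
    and B: "lsum (\<lambda>n. of_int (n - j) *\<^sub>C nord (conv (vop m) (dvop r) (n - j - l)) n) B"
    and C: "lsum (\<lambda>N. signed_sum N (\<lambda>n. of_int (n - N - j) * of_int (n - l)) *\<^sub>C (vop r (N - l) * vop m (- N - j))) C"
    and avav: "cm (avf (dvop m) j) (avf (dvop r) l) = A - B + C"
    using cm_avf_avf[OF tangent_dvop[of m] tangent_dvop[of r]] by blast
  have idx: "n - l - j = n - ?J" "n - j - l = n - ?J" for n by simp_all
  have AB: "A - B = of_int (j - l) *\<^sub>C avf (dvop ?M) ?J"
  proof (rule lsum_unique[OF lsum_diff[OF A B]])
    show "lsum (\<lambda>n. of_int (n - l) *\<^sub>C nord (conv (dvop m) (vop r) (n - l - j)) n - of_int (n - j) *\<^sub>C nord (conv (vop m) (dvop r) (n - j - l)) n)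
       (of_int (j - l) *\<^sub>C avf (dvop ?M) ?J)"
      using lsum_sm[OF lsum_avf[OF field_dvop[of ?M], of ?J], of "of_int (j - l)"]
      unfolding idx conv_dvop_vop conv_vop_dvop by (simp flip: sm_distrib(5))
  qed
  let ?z = "\<lambda>k :: int. of_int (k ^ 3 - k) / 6 - of_int l * (of_int (k ^ 2 + k) / 2)
      + of_int j * (of_int (k ^ 2 - k) / 2) - of_int (j * l * k) :: complex"
  have "cm (vcur j k) (vcur l k') = (- of_int l * of_int (k + k') + of_int (j + l) * of_int k) *\<^sub>C II (k + k')
        + (of_int (k + k') + - 2 * of_int k) *\<^sub>C vir (k + k')
        + (if k + k' = 0 then ?z k else 0) *\<^sub>C 1" for k k'
    by (rule endo_eqI_entry)
       (simp add: vcur_def cm_simps cm_cur_vir cm_cur_cur cm_vir_cur cm_vir_vir entry_simps field_simps)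
  from cm_hop_hop[OF current_vcur current_vcur current_cur current_vir this, of j m r l]
  obtain X Z where X: "lsum (\<lambda>K. (- of_int l * of_int K - of_int j * of_int (j + l)) *\<^sub>C (II K * vop ?M (- j - l - K))
          - (of_int (j + l) * of_int m) *\<^sub>C (II K * dvop ?M (- j - l - K))
          + (of_int K - of_int j * - 2) *\<^sub>C (vir K * vop ?M (- j - l - K))
          - (- 2 * of_int m) *\<^sub>C (vir K * dvop ?M (- j - l - K))) X"
    and Z: "lsum (\<lambda>N. ?z N *\<^sub>C (vop r (N - l) * vop m (- N - j))) Z"
    and hh: "cm (hop (vcur j) (vop m) j) (hop (vcur l) (vop r) l) = X + Z"
    by blast
  have idx': "- j - l - K = - ?J - K" for K by simp
  let ?h = "\<lambda>c f. hop c f ?J"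
  let ?rest = "of_int r *\<^sub>C (?h vir (dvop ?M) - of_int l *\<^sub>C ?h II (dvop ?M))
      - of_int m *\<^sub>C (?h vir (dvop ?M) - of_int j *\<^sub>C ?h II (dvop ?M))"
  have XR: "X + ?rest = of_int (j - l) *\<^sub>C (?h vir (vop ?M) - of_int (j + l) *\<^sub>C ?h II (vop ?M))"
  proof (rule lsum_unique)
    let ?f = "\<lambda>K. (- of_int l * of_int K - of_int j * of_int (j + l)) *\<^sub>C (II K * vop ?M (- ?J - K))
          - (of_int (j + l) * of_int m) *\<^sub>C (II K * dvop ?M (- ?J - K))
          + (of_int K - of_int j * - 2) *\<^sub>C (vir K * vop ?M (- ?J - K))
          - (- 2 * of_int m) *\<^sub>C (vir K * dvop ?M (- ?J - K))
       + (of_int r *\<^sub>C (vir K * dvop ?M (- ?J - K) - of_int l *\<^sub>C (II K * dvop ?M (- ?J - K)))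
         - of_int m *\<^sub>C (vir K * dvop ?M (- ?J - K) - of_int j *\<^sub>C (II K * dvop ?M (- ?J - K))))"
    show "lsum ?f (X + ?rest)"
      using X unfolding idx'
      by (intro lsum_add lsum_diff lsum_sm lsum_hop current_cur current_vir field_dvop) simp_all
    have "?f K = of_int (j - l) *\<^sub>C (vir K * vop ?M (- ?J - K) - of_int (j + l) *\<^sub>C (II K * vop ?M (- ?J - K)))" for K
    proof (rule endo_eqI_entry)
      fix w p
      have 1: "of_int (- ?J - K) * entry w p (II K * vop ?M (- ?J - K)) = of_int ?M * entry w p (II K * dvop ?M (- ?J - K))"
        and 2: "of_int (- ?J - K) * entry w p (vir K * vop ?M (- ?J - K)) = of_int ?M * entry w p (vir K * dvop ?M (- ?J - K))"
        by (rule dvop_entry)+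
      define a b c d where "a = entry w p (II K * vop ?M (- ?J - K))" and "b = entry w p (II K * dvop ?M (- ?J - K))"
        and "c = entry w p (vir K * vop ?M (- ?J - K))" and "d = entry w p (vir K * dvop ?M (- ?J - K))"
      have 1: "- (of_int j + of_int l + of_int K) * a = (of_int m + of_int r) * b"
        and 2: "- (of_int j + of_int l + of_int K) * c = (of_int m + of_int r) * d"
        using 1 2 unfolding a_def[symmetric] b_def[symmetric] c_def[symmetric] d_def[symmetric] by simp_all
      have 3: "(of_int m + of_int r) * b + (of_int j + of_int l + of_int K) * a = 0"
        and 4: "(of_int m + of_int r) * d + (of_int j + of_int l + of_int K) * c = 0"
        unfolding 1[symmetric] 2[symmetric] by (simp_all add: algebra_simps)
      let ?lhs = "(- of_int l * of_int K - of_int j * of_int (j + l)) * a - (of_int (j + l) * of_int m) * b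
          + (of_int K - of_int j * - 2) * c - (- 2 * of_int m) * d
          + (of_int r * (d - of_int l * b) - of_int m * (d - of_int j * b))"
      let ?rhs = "of_int (j - l) * (c - of_int (j + l) * a)"
      have "?lhs = ?rhs + - of_int l * ((of_int m + of_int r) * b + (of_int j + of_int l + of_int K) * a)
         + ((of_int m + of_int r) * d + (of_int j + of_int l + of_int K) * c)"
        by (simp add: algebra_simps)
      then have "?lhs = ?rhs" unfolding 3 4 by simp
      then show "entry w p (?f K) = entry w p (of_int (j - l) *\<^sub>C (vir K * vop ?M (- ?J - K) - of_int (j + l) *\<^sub>C (II K * vop ?M (- ?J - K))))"
        unfolding entry_simps a_def b_def c_def d_def .
    qed
    moreover have "lsum (\<lambda>K. of_int (j - l) *\<^sub>C (vir K * vop ?M (- ?J - K) - of_int (j + l) *\<^sub>C (II K * vop ?M (- ?J - K))))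
      (of_int (j - l) *\<^sub>C (?h vir (vop ?M) - of_int (j + l) *\<^sub>C ?h II (vop ?M)))"
      by (intro lsum_diff lsum_sm lsum_hop current_cur current_vir field_vop)
    ultimately show "lsum ?f (of_int (j - l) *\<^sub>C (?h vir (vop ?M) - of_int (j + l) *\<^sub>C ?h II (vop ?M)))"
      by simp
  qed
  have CZ: "C + 1 *\<^sub>C Z = 0"
  proof (rule central_cancel[OF C Z])
    fix N
    have "signed_sum M (\<lambda>n. of_int (n - N - j) * of_int (n - l))
      = of_int ((M - 1) * M * (2 * M - 1)) / 6 - of_int ((N + j + l) * M * (M - 1)) / 2 + of_int (l * (N + j) * M)" for M
      by (rule signed_sum_closed) (auto simp: field_simps)
    note closed = this
    show "signed_sum N (\<lambda>n. of_int (n - N - j) * of_int (n - l)) + 1 * ?z N = 0"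
      unfolding closed by (simp add: field_simps power2_eq_square power3_eq_cube)
  qed
  have ah: "cm (avf (dvop m) j) (hop (vcur l) (vop r) l) = of_int r *\<^sub>C (?h vir (dvop ?M) - of_int l *\<^sub>C ?h II (dvop ?M))"
    using cm_avf_hop[OF field_dvop[of m] current_vcur, of j l r l] by (simp add: conv_dvop_vop hop_vcur field_dvop)
  have ha: "cm (hop (vcur j) (vop m) j) (avf (dvop r) l) = - (of_int m *\<^sub>C (?h vir (dvop ?M) - of_int j *\<^sub>C ?h II (dvop ?M)))"
    using cm_avf_hop[OF field_dvop[of r] current_vcur, of l j m j] cm_swap[of "hop (vcur j) (vop m) j"]
    by (simp add: conv_dvop_vop hop_vcur field_dvop add.commute)
  have "cm (rep (Monom j m Dir0)) (rep (Monom l r Dir0)) = (A - B) + (C + 1 *\<^sub>C Z) + (X + ?rest)"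
    unfolding rep.simps cm_simps avav ah ha hh
    by (rule endo_eqI_entry) (simp add: entry_simps algebra_simps)
  also have "\<dots> = of_int (l - j) *\<^sub>C rep (Monom ?J ?M Dir0)"
    unfolding CZ AB XR rep.simps hop_vcur[OF field_vop] by (rule endo_eqI_entry) (simp add: entry_simps algebra_simps)
  finally show ?thesis .
qed


subsection \<open>Homogeneity and the top of the Fock space\<close>

lemma hom_avf:
  assumes "is_field f" shows "hom (- j) (avf f j)"
proof (rule hom_lsum[OF lsum_avf[OF assms]])
  fix n
  have f: "hom (n - j) (f (n - j))" using assms by (simp add: is_field_def)
  show "hom (- j) (nord (f (n - j)) n)"
    using hom_mult[OF f hom_del[where n = n and \<gamma> = \<gamma>]] hom_mult[OF hom_del[where n = n and \<gamma> = \<gamma>] f]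
    by (simp add: nord_def)
qed

lemma hom_hop:
  assumes "is_current c" "is_field f" shows "hom (- j) (hop c f j)"
proof (rule hom_lsum[OF lsum_hop[OF assms]])
  fix k
  have "hom (- j - k) (f (- j - k))" using assms by (simp add: is_field_def)
  from hom_mult[OF current_hom[OF assms(1), of k] this] show "hom (- j) (c k * f (- j - k))" by simp
qed

lemma hom_rep: "hom (- t0_degree i) (rep i)"
proof (cases i)
  case (Monom j m a)
  then show ?thesis
    by (cases a) (auto intro!: hom_closed hom_avf hom_hop field_vop field_dvop current_cur current_vcur)
qed

abbreviation vac :: "int \<Rightarrow> fock" where "vac k \<equiv> ket (k, 0)"

lemma depth_vac [simp]: "depth (k, 0) = 0"
  by (simp add: depth_def)

text \<open>
  On the vacuum vectors only the zero modes act, so the top of the Fock space can be read off.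
\<close>

lemma avf_vac:
  assumes f: "is_field f"
  shows "app (avf f 0) (vac k) = scale_pm (\<gamma> + of_int k) (app (f 0) (vac k))"
proof -
  have "app (avf f 0) (vac k) = (\<Sum>n\<in>{0}. app (nord (f (n - 0)) n) (vac k))"
  proof (rule lsumD[OF lsum_avf[OF f]])
    fix n :: int assume "n \<notin> {0}"
    then consider "n > 0" | "n < 0" by force
    then show "app (nord (f (n - 0)) n) (vac k) = 0"
      by cases (simp_all add: nord_def dd_kills field_kills[OF f])
  qed simp
  moreover have "app (dd 0) (vac k) = scale_pm (\<gamma> + of_int k) (vac k)"
    by (simp add: del_def)
  ultimately show ?thesis by (simp add: nord_def del: scale_pm_simps(5))
qed

lemma hop_vac:
  assumes c: "is_current c" and f: "is_field f"
  shows "app (hop c f 0) (vac k) = app (c 0) (app (f 0) (vac k))"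
proof -
  have "app (hop c f 0) (vac k) = (\<Sum>n\<in>{0}. app (c n * f (- 0 - n)) (vac k))"
  proof (rule lsumD[OF lsum_hop[OF c f]])
    fix n :: int assume "n \<notin> {0}"
    then consider "n > 0" | "n < 0" by force
    then show "app (c n * f (- 0 - n)) (vac k) = 0"
    proof cases
      case 2
      have "c n * f (- 0 - n) = f (- 0 - n) * c n"
        using current_field[OF c f] by (simp add: cm_eq_0_iff)
      moreover have "app (c n) (vac k) = 0" using 2 by (intro hom_kills[OF current_hom[OF c]]) simp
      ultimately show ?thesis by simp
    qed (simp add: field_kills[OF f])
  qed simp
  then show ?thesis by simp
qed

lemma sug_vac: "app (sug 0) (vac k) = scale_pm (\<alpha> ^ 2 / 2) (vac k)"
proof -
  have "app (2 *\<^sub>C sug 0) (vac k) = (\<Sum>n\<in>{0}. app (sno n 0) (vac k))"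
  proof (rule lsumD[OF lsum_sug])
    fix n :: int assume "n \<notin> {0}"
    then consider "n > 0" | "n < 0" by force
    then show "app (sno n 0) (vac k) = 0"
      by cases (simp_all add: sno_def hom_kills[OF hom_cur])
  qed simp
  then have "app (2 *\<^sub>C sug 0) (vac k) = scale_pm (\<alpha> ^ 2) (vac k)"
    by (simp add: sno_def cur_def power2_eq_square flip: single_uminus)
  then have "scale_pm (1/2) (app (2 *\<^sub>C sug 0) (vac k)) = scale_pm (1/2) (scale_pm (\<alpha> ^ 2) (vac k))" by simp
  then show ?thesis by simp
qed

lemma vir_vac: "app (vir 0) (vac k) = scale_pm (\<alpha> * (\<alpha> + 1) / 2) (vac k)"
  by (simp add: vir_def sug_vac cur_def field_simps power2_eq_square
      flip: single_uminus single_add single_diff)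

lemma rep_vac_1: "app (rep (Monom 0 m Dir1)) (vac k) = scale_pm ((\<gamma> + of_int k) - \<alpha> * of_int m) (vac (k + m))"
  by (simp add: avf_vac hop_vac field_vop current_cur vop_vacuum cur_def mult.commute
      flip: single_uminus single_add single_diff)

lemma rep_vac_0: "app (rep (Monom 0 m Dir0)) (vac k) = scale_pm (- (\<alpha> * (\<alpha> + 1) / 2)) (vac (k + m))"
proof -
  have "vcur 0 0 = vir 0" by (simp add: vcur_def)
  then show ?thesis
    by (simp add: avf_vac hop_vac field_vop field_dvop current_vcur vop_vacuum dvop_at_0 vir_vac
        flip: single_uminus)
qed

lemma rep_kills:
  assumes "depth b < t0_degree i" shows "app (rep i) (ket b) = 0"
  using hom_kills[OF hom_rep, of b i] assms by simp

subsection \<open>The embedded loop algebra\<close>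

abbreviation loop :: "int \<Rightarrow> int \<Rightarrow> operator" where "loop m j \<equiv> rep (Monom j m Dir1)"

lemma loop_0: "loop 0 j = dd j"
proof -
  have "lsum (\<lambda>n. nord (vop 0 (n - j)) n) (nord (vop 0 (j - j)) j)"
    by (rule lsum_single) (simp add: vop_0 nord_simps)
  then have "avf (vop 0) j = nord 1 j"
    using lsum_unique[OF lsum_avf[OF field_vop]] by (simp add: vop_0)
  then show ?thesis by (simp add: nord_def)
qed

definition euler :: operator where "euler = rep (Monom 0 0 Dir0)"

lemma euler_eq: "euler = - avf (dvop 0) 0 - vir 0"
proof -
  have "lsum (\<lambda>k. vcur 0 k * vop 0 (- 0 - k)) (vcur 0 0 * vop 0 (- 0 - 0))"
    by (rule lsum_single) (simp add: vop_0)
  then have "hop (vcur 0) (vop 0) 0 = vcur 0 0 * vop 0 (- 0 - 0)"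
    by (rule lsum_unique[OF lsum_hop[OF current_vcur field_vop]])
  then show ?thesis by (simp add: euler_def vop_0 vcur_def)
qed

lemma cm_hop_field: "is_current c \<Longrightarrow> is_field f \<Longrightarrow> is_field g \<Longrightarrow> cm (hop c f j) (g n) = 0"
proof -
  assume c: "is_current c" and f: "is_field f" and g: "is_field g"
  have "lsum (\<lambda>k. cm (c k * f (- j - k)) (g n)) (cm (hop c f j) (g n))"
    by (intro lsum_cm' lsum_hop c f)
  moreover have "cm (c k * f (- j - k)) (g n) = 0" for k
    by (simp add: cm_simps field_cm[OF f g] current_field[OF c g])
  ultimately have "lsum (\<lambda>k :: int. 0) (cm (hop c f j) (g n))" by simp
  then show ?thesis by (rule lsum_unique[OF _ lsum_zero])
qed

lemma cm_loop_dphi: "cm (loop m j) (dphi i) = of_int i *\<^sub>C vop m (i - j)"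
proof -
  have "cm (avf (vop m) j) (dvop 0 i) = of_int i *\<^sub>C conv (vop m) (vop 0) (i - j)"
    by (rule cm_avf_field[OF field_vop tangent_dvop])
  then show ?thesis
    by (simp add: cm_simps cm_hop_field current_cur field_vop field_dphi conv_vop_vop dvop_0)
qed

lemma cm_loop_cur: "cm (loop m j) (II i) = (of_int m * of_int i) *\<^sub>C vop m (i - j)"
proof -
  have "lsum (\<lambda>k. cm (II k * vop m (- j - k)) (II i)) (cm (hop II (vop m) j) (II i))"
    by (intro lsum_cm' lsum_hop current_cur field_vop)
  moreover have "cm (II k * vop m (- j - k)) (II i) = (if k = - i then of_int i *\<^sub>C vop m (- j - k) else 0)" for k
    by (auto simp: cm_simps cm_cur_cur current_field'[OF current_cur field_vop])
  ultimately have "lsum (\<lambda>k. if k = - i then of_int i *\<^sub>C vop m (- j - k) else 0) (cm (hop II (vop m) j) (II i))" by simp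
  moreover have "lsum (\<lambda>k. if k = - i then of_int i *\<^sub>C vop m (- j - k) else 0)
      (if - i = - i then of_int i *\<^sub>C vop m (- j - - i) else 0)"
    by (rule lsum_single) simp
  ultimately have "cm (hop II (vop m) j) (II i) = of_int i *\<^sub>C vop m (i - j)"
    by (simp add: lsum_unique)
  then show ?thesis
    by (simp add: cm_simps cm_avf_current field_vop current_cur)
qed

lemma cm_dd_loop: "cm (dd i) (loop m j) = of_int m *\<^sub>C loop m (i + j)"
  using rep_rep_11[of i 0 j m] by (simp only: loop_0) simp

lemma cm_loop_loop: "cm (loop 1 i) (loop (- 1) j) = - 2 *\<^sub>C dd (i + j)"
  using rep_rep_11[of i 1 j "- 1"] by (simp add: loop_0 del: rep.simps)

text \<open>
  Products of two elements of the loop algebra are ordered by a threshold on the index. The position of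
  the threshold matters, since the summands do not commute; it is kept as a parameter.
\<close>

definition ordered :: "bool \<Rightarrow> operator \<Rightarrow> operator \<Rightarrow> operator" where
  "ordered P A B = (if P then A * B else B * A)"

lemma ordered_simps: "ordered P A (B + C) = ordered P A B + ordered P A C"
  "ordered P A (- B) = - ordered P A B"
  "ordered P A (c *\<^sub>C B) = c *\<^sub>C ordered P A B"
  "ordered P (c *\<^sub>C A) B = c *\<^sub>C ordered P A B"
  by (simp_all add: ordered_def algebra_simps)

lemma lsum_ordered_current_part:
  "lsum (\<lambda>j. ordered (P j) (vop (- m) (i + j)) (hop II (vop m) j)) (II i)"
proof -
  let ?F = "\<lambda>(j, k). II k * (vop m (- k - j) * vop (- m) (i + j))"
  note vv = field_commute[OF field_vop field_vop]
  have Iv: "II k * vop r n = vop r n * II k" for k r n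
    using current_field[OF current_cur field_vop] by (simp add: cm_eq_0_iff)
  have lf: "loc_fin ?F"
  proof (rule loc_finI)
    fix b
    let ?d = "depth b"
    define hi where "hi = 3 * ?d + 2 * \<bar>i\<bar>"
    have "{p. app (?F p) (ket b) \<noteq> 0} \<subseteq> {- hi..hi} \<times> {- hi..hi}"
    proof
      fix p assume "p \<in> {p. app (?F p) (ket b) \<noteq> 0}"
      moreover obtain j k where p: "p = (j, k)" by force
      ultimately have "app (II k * vop m (- k - j) * vop (- m) (i + j)) (ket b) \<noteq> 0" by auto
      from commuting_triple_nonzero[OF Iv Iv vv this]
      have "\<not> ?d + k < 0" "\<not> ?d + (- k - j) < 0" "\<not> ?d + (i + j) < 0"
        using hom_kills[OF hom_cur, of b k] field_kills[OF field_vop, of b] by blast+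
      then show "p \<in> {- hi..hi} \<times> {- hi..hi}" unfolding p hi_def using depth_nonneg[of b] by auto
    qed
    then show "finite {p. app (?F p) (ket b) \<noteq> 0}" by (rule finite_subset) simp
  qed
  have 1: "lsum (\<lambda>k. ?F (j, k)) (ordered (P j) (vop (- m) (i + j)) (hop II (vop m) j))" for j
  proof -
    have "vop (- m) (i + j) * hop II (vop m) j = hop II (vop m) j * vop (- m) (i + j)"
      using cm_hop_field[OF current_cur field_vop field_vop, of m j "- m" "i + j"] by (simp add: cm_eq_0_iff)
    then have "ordered (P j) (vop (- m) (i + j)) (hop II (vop m) j) = hop II (vop m) j * vop (- m) (i + j)"
      by (simp add: ordered_def)
    moreover have "- j - k = - k - j" for k by simp
    ultimately show ?thesis
      using lsum_mult_right[OF lsum_hop[OF current_cur field_vop[of m], of j], of "vop (- m) (i + j)"]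
      by (simp only: mult.assoc split_conv)
  qed
  have 2: "lsum (\<lambda>j. ?F (j, k)) (II k * vop 0 (- k + i))" for k
    using lsum_mult_left[OF lsum_conv_reflect[OF field_vop[of m] field_vop[of "- m"], of "- k" i], of "II k"]
    by (simp add: conv_vop_vop)
  obtain A where A: "lsum (\<lambda>j. ordered (P j) (vop (- m) (i + j)) (hop II (vop m) j)) A"
      "lsum (\<lambda>k. II k * vop 0 (- k + i)) A"
    by (rule lsum_exchange[OF lf 1 2])
  have "lsum (\<lambda>k. II k * vop 0 (- k + i)) (II i * vop 0 (- i + i))"
    by (rule lsum_single) (simp add: vop_0)
  with A(2) have "A = II i" by (simp add: vop_0 lsum_unique)
  with A(1) show ?thesis by simp
qed

lemma lsum_ordered_vector_part:
  "lsum (\<lambda>j. ordered (t \<le> j) (vop (- m) (i + j)) (avf (vop m) j))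
    (dd (- i) - (of_int m * of_int m) *\<^sub>C dphi i - (if i = 0 then of_int m * of_int t else 0) *\<^sub>C 1)"
proof -
  let ?V = "\<lambda>j n. vop m (n - j)" and ?G = "\<lambda>j. vop (- m) (i + j)" and ?W = "\<lambda>j n. vop (- m) (i + j - n)"
  let ?P = "\<lambda>(j, n). nord (?V j n * ?G j) n"
  let ?Q = "\<lambda>(j, n). (crossing (j - t) n * of_int m) *\<^sub>C (?W j n * ?V j n)"
  note vv = field_commute[OF field_vop field_vop]
  have lfP: "loc_fin ?P"
  proof (rule loc_finI)
    fix b
    let ?d = "depth b"
    define hi where "hi = 3 * ?d + 2 * \<bar>i\<bar>"
    have "{p. app (?P p) (ket b) \<noteq> 0} \<subseteq> {- hi..hi} \<times> {- hi..hi}"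
    proof
      fix p assume "p \<in> {p. app (?P p) (ket b) \<noteq> 0}"
      moreover obtain j n where p: "p = (j, n)" by force
      ultimately have nz: "app (nord (?V j n * ?G j) n) (ket b) \<noteq> 0" by auto
      have c: "?V j n * ?G j = ?G j * ?V j n" by (rule vv)
      show "p \<in> {- hi..hi} \<times> {- hi..hi}"
      proof (cases "0 \<le> n")
        case True
        then have nz': "app (?V j n * ?G j) (app (dd n) (ket b)) \<noteq> 0" using nz by (simp add: nord_def)
        then have n: "n \<le> ?d" using dd_kills[OF True, of b] by force
        have h1: "hom (i + j + - n) (?G j * dd n)" and h2: "hom (n - j + - n) (?V j n * dd n)"
          using field_vop[of m] field_vop[of "- m"] unfolding is_field_def by (simp_all only: hom_mult hom_del)
        have "\<not> ?d + (i + j + - n) < 0" using hom_kills[OF h1, of b] nz' by auto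
        moreover have "\<not> ?d + (n - j + - n) < 0" using hom_kills[OF h2, of b] nz' unfolding c by auto
        ultimately show ?thesis using True n depth_nonneg[of b] unfolding p hi_def by auto
      next
        case False
        then have nz': "app (?V j n * ?G j) (ket b) \<noteq> 0" using nz by (auto simp: nord_def)
        have "\<not> ?d + (i + j) < 0" using field_kills[OF field_vop, of b] nz' by auto
        moreover have "\<not> ?d + (n - j) < 0" using field_kills[OF field_vop, of b] nz' unfolding c by auto
        ultimately show ?thesis using False depth_nonneg[of b] unfolding p hi_def by auto
      qed
    qed
    then show "finite {p. app (?P p) (ket b) \<noteq> 0}" by (rule finite_subset) simp
  qed
  have lfQ: "loc_fin ?Q"
  proof (rule loc_finI)
    fix b
    let ?d = "depth b"
    define hi where "hi = ?d + \<bar>i\<bar> + \<bar>t\<bar>"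
    have "{p. app (?Q p) (ket b) \<noteq> 0} \<subseteq> {- hi..hi} \<times> {- hi..hi}"
    proof
      fix p assume "p \<in> {p. app (?Q p) (ket b) \<noteq> 0}"
      moreover obtain j n where p: "p = (j, n)" by force
      ultimately have nz: "app (?W j n * ?V j n) (ket b) \<noteq> 0" "crossing (j - t) n \<noteq> 0" by auto
      have "app (?V j n * ?W j n) (ket b) \<noteq> 0"
        using nz(1) unfolding vv[of "- m" "i + j - n"] .
      then have "\<not> ?d + (i + j - n) < 0" "\<not> ?d + (n - j) < 0"
        using nz(1) field_kills[OF field_vop, of b] by auto
      with nz(2) show "p \<in> {- hi..hi} \<times> {- hi..hi}"
        unfolding p hi_def crossing_def by (auto split: if_splits)
    qed
    then show "finite {p. app (?Q p) (ket b) \<noteq> 0}" by (rule finite_subset) simp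
  qed
  let ?F = "\<lambda>p. ?P p + ?Q p"
  have S: "lsum ?F (LS ?P + LS ?Q)" by (intro lsum_add lsum_LS lfP lfQ)
  have F: "?F (j, n) = ordered (t \<le> j) (?G j) (nord (?V j n) n)" for j n
  proof -
    have "cm (dd n) (?G j) = (- of_int m) *\<^sub>C ?W j n" by (simp add: cm_del_vop)
    from normal_order_mismatch[OF vv vv this, of "j - t"]
    show ?thesis by (simp add: ordered_def sm_distrib)
  qed
  have sum: "lsum (\<lambda>j. ordered (t \<le> j) (?G j) (avf (vop m) j)) (LS ?P + LS ?Q)"
  proof (rule lsum_fubini[OF S])
    fix j
    show "lsum (\<lambda>n. ?F (j, n)) (ordered (t \<le> j) (?G j) (avf (vop m) j))"
      unfolding F using lsum_avf[OF field_vop, of m j]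
      by (cases "t \<le> j") (simp_all add: ordered_def lsum_mult_left lsum_mult_right)
  qed
  have P: "LS ?P = dd (- i)"
  proof -
    have "lsum (\<lambda>n. nord (vop 0 (n + i)) n) (LS ?P)"
    proof (rule lsum_fubini_swap[OF lsum_LS[OF lfP]])
      fix n
      show "lsum (\<lambda>j. ?P (j, n)) (nord (vop 0 (n + i)) n)"
        using lsum_nord[OF lsum_conv_reflect[OF field_vop[of m] field_vop[of "- m"], of n i], of n]
        by (simp add: conv_vop_vop)
    qed
    moreover have "lsum (\<lambda>n. nord (vop 0 (n + i)) n) (nord (vop 0 (- i + i)) (- i))"
      by (rule lsum_single) (simp add: vop_0 nord_simps)
    ultimately have "LS ?P = nord 1 (- i)" by (simp add: vop_0 lsum_unique)
    then show ?thesis by (simp add: nord_def)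
  qed
  have Q: "LS ?Q = - ((of_int m * of_int m) *\<^sub>C dphi i) - (if i = 0 then of_int m * of_int t else 0) *\<^sub>C 1"
  proof -
    have "lsum (\<lambda>M. (of_int m * of_int M) *\<^sub>C (vop (- m) (i + M + t) * vop m (- M - t))) (LS ?Q)"
    proof (rule lsum_fubini)
      let ?h = "\<lambda>(M, p). (p + t, p - M) :: int \<times> int"
      have "bij ?h"
        by (rule bij_betw_byWitness[where f' = "\<lambda>(j, n). (j - t - n, j - t)"]) auto
      then show "lsum (\<lambda>p. ?Q (?h p)) (LS ?Q)"
        by (rule lsum_reindex[OF lsum_LS[OF lfQ]])
      fix M
      have idx: "i + (p + t) - (p - M) = i + M + t" "p - M - (p + t) = - M - t" "p + t - t = p" for p
        by simp_all
      then show "lsum (\<lambda>p. ?Q (?h (M, p))) ((of_int m * of_int M) *\<^sub>C (vop (- m) (i + M + t) * vop m (- M - t)))"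
        using lsum_crossing[of M "\<lambda>_. of_int m" "vop (- m) (i + M + t) * vop m (- M - t)"]
        by (simp only: split_conv idx signed_sum_const)
    qed
    from lsum_reindex[OF this bij_int_shift(3)[of "- t"]]
    have "lsum (\<lambda>N. (of_int m * of_int (- t - N)) *\<^sub>C (vop (- m) (i - N) * vop m N)) (LS ?Q)"
      by (simp add: algebra_simps)
    moreover have "lsum (\<lambda>N. - (of_int m *\<^sub>C of_int m *\<^sub>C (dvop m N * vop (- m) (i - N))) - (of_int m * of_int t) *\<^sub>C (vop m N * vop (- m) (i - N)))
       (- (of_int m *\<^sub>C of_int m *\<^sub>C dvop 0 i) - (of_int m * of_int t) *\<^sub>C vop 0 i)"
      using lsum_diff[OF lsum_minus[OF lsum_sm[OF lsum_sm[OF lsum_conv[OF field_dvop[of m] field_vop[of "- m"], of i], of "of_int m"], of "of_int m"]]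
          lsum_sm[OF lsum_conv[OF field_vop[of m] field_vop[of "- m"], of i], of "of_int m * of_int t"]]
      by (simp add: conv_dvop_vop conv_vop_vop)
    moreover have "(of_int m * of_int (- t - N)) *\<^sub>C (vop (- m) (i - N) * vop m N)
      = - (of_int m *\<^sub>C of_int m *\<^sub>C (dvop m N * vop (- m) (i - N))) - (of_int m * of_int t) *\<^sub>C (vop m N * vop (- m) (i - N))" for N
    proof -
      have e: "of_int m *\<^sub>C (dvop m N * vop (- m) (i - N)) = of_int N *\<^sub>C (vop m N * vop (- m) (i - N))"
        using dvop_eq[of N m] by (metis sm_simps(5))
      show ?thesis unfolding e vv[of "- m" "i - N" m N]
        by (rule endo_eqI_entry) (simp add: entry_simps algebra_simps)
    qed
    ultimately have "LS ?Q = - (of_int m *\<^sub>C of_int m *\<^sub>C dvop 0 i) - (of_int m * of_int t) *\<^sub>C vop 0 i"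
      by (simp add: lsum_unique)
    then show ?thesis by (simp add: dvop_0 vop_0)
  qed
  have "dd (- i) - x - y = dd (- i) + (- x - y)" for x y by simp
  then show ?thesis using sum unfolding P Q by (simp only:)
qed

text \<open>
  Contracting a loop with the vertex operator of opposite exponent collapses \<open>e^(m phi) e^(- m phi)\<close> to
  one, so the sum is a combination of single modes of the three fields. The term with \<open>t\<close> records
  the threshold of the ordering.
\<close>

lemma lsum_ordered_loop:
  "lsum (\<lambda>j. ordered (t \<le> j) (vop (- m) (i + j)) (loop m j))
    (dd (- i) + of_int m *\<^sub>C II i - (of_int m * of_int m) *\<^sub>C dphi i
      - (if i = 0 then of_int m * of_int t else 0) *\<^sub>C 1)"
proof -
  have "lsum (\<lambda>j. ordered (t \<le> j) (vop (- m) (i + j)) (avf (vop m) j)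
        + of_int m *\<^sub>C ordered (t \<le> j) (vop (- m) (i + j)) (hop II (vop m) j))
    ((dd (- i) - (of_int m * of_int m) *\<^sub>C dphi i - (if i = 0 then of_int m * of_int t else 0) *\<^sub>C 1)
       + of_int m *\<^sub>C II i)"
    by (intro lsum_add lsum_sm lsum_ordered_vector_part lsum_ordered_current_part)
  then show ?thesis by (simp add: ordered_simps algebra_simps)
qed

subsection \<open>The Sugawara identity\<close>

lemma loc_fin_dd_dd: "loc_fin (\<lambda>j. dd (- j) * dd j)"
proof (rule loc_finI)
  fix b
  have "{j. app (dd (- j) * dd j) (ket b) \<noteq> 0} \<subseteq> {- depth b..depth b}"
  proof
    fix j assume j: "j \<in> {j. app (dd (- j) * dd j) (ket b) \<noteq> 0}"
    have c: "dd (- j) * dd j = dd j * dd (- j)"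
      using cm_del_del[of \<gamma> "- j" j] by (simp add: cm_eq_0_iff)
    have 1: "app (dd (- j)) (app (dd j) (ket b)) \<noteq> 0" using j by simp
    have 2: "app (dd j) (app (dd (- j)) (ket b)) \<noteq> 0" using j unfolding mem_Collect_eq c by simp
    have "0 \<le> j \<Longrightarrow> \<not> depth b < j" using dd_kills[of j b] 1 by auto
    moreover have "0 \<le> - j \<Longrightarrow> \<not> depth b < - j" using dd_kills[of "- j" b] 2 by auto
    ultimately show "j \<in> {- depth b..depth b}" using depth_nonneg[of b] by (cases "0 \<le> j") auto
  qed
  then show "finite {j. app (dd (- j) * dd j) (ket b) \<noteq> 0}" by (rule finite_subset) simp
qed

lemma loc_fin_loop_loop: "loc_fin (\<lambda>j. ordered (1 \<le> j) (loop 1 (a - j)) (loop (- 1) j))"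
proof (rule loc_finI)
  fix b
  have "{j. app (ordered (1 \<le> j) (loop 1 (a - j)) (loop (- 1) j)) (ket b) \<noteq> 0} \<subseteq> {- \<bar>a\<bar> - depth b..depth b}"
  proof
    fix j assume "j \<in> {j. app (ordered (1 \<le> j) (loop 1 (a - j)) (loop (- 1) j)) (ket b) \<noteq> 0}"
    then have j: "app (ordered (1 \<le> j) (loop 1 (a - j)) (loop (- 1) j)) (ket b) \<noteq> 0" by simp
    have "1 \<le> j \<Longrightarrow> \<not> depth b < j" "\<not> 1 \<le> j \<Longrightarrow> \<not> depth b < a - j"
      using j rep_kills[of b "Monom j (- 1) Dir1"] rep_kills[of b "Monom (a - j) 1 Dir1"]
      by (auto simp: ordered_def simp del: rep.simps)
    then show "j \<in> {- \<bar>a\<bar> - depth b..depth b}" using depth_nonneg[of b] by (cases "1 \<le> j") auto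
  qed
  then show "finite {j. app (ordered (1 \<le> j) (loop 1 (a - j)) (loop (- 1) j)) (ket b) \<noteq> 0}"
    by (rule finite_subset) simp
qed

definition square_sum :: operator where
  "square_sum = LS (\<lambda>j. dd (- j) * dd j)"

definition cross_sum :: operator where
  "cross_sum = LS (\<lambda>j. ordered (1 \<le> j) (loop 1 (- j)) (loop (- 1) j))"

lemma lsum_square_sum: "lsum (\<lambda>j. dd (- j) * dd j) square_sum"
  unfolding square_sum_def by (rule lsum_LS[OF loc_fin_dd_dd])

lemma lsum_cross_sum: "lsum (\<lambda>j. ordered (1 \<le> j) (loop 1 (- j)) (loop (- 1) j)) cross_sum"
  unfolding cross_sum_def using lsum_LS[OF loc_fin_loop_loop[of 0]] by simp

text \<open>
  The difference of the two sides of the Sugawara identity. It commutes with all creation operators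
  and kills the vacuum vectors, so it vanishes.
\<close>

definition sugawara_defect :: operator where
  "sugawara_defect = square_sum - cross_sum + dd 0 + 2 *\<^sub>C euler"

lemma cm_ordered: "cm A (ordered P B C) = ordered P (cm A B) C + ordered P B (cm A C)"
  by (simp add: ordered_def cm_simps)

text \<open>
  Every mode of the three fields has vertex operators as commutators with the loops, so its commutator with
  the mixed part of the Casimir element is a contraction as computed before.
\<close>

lemma cm_cross_sum_field:
  assumes A: "\<And>m j. m = 1 \<or> m = - 1 \<Longrightarrow> cm A (loop m j) = c m *\<^sub>C vop m (i - j)"
  shows "cm A cross_sum = c 1 *\<^sub>C (dd (- i) - II i - dphi i + (if i = 0 then 1 else 0) *\<^sub>C 1)
    + c (- 1) *\<^sub>C (dd (- i) + II i - dphi i)"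
proof -
  have 1: "lsum (\<lambda>j. ordered (1 \<le> j) (vop 1 (i + j)) (loop (- 1) j))
      (dd (- i) - II i - dphi i + (if i = 0 then 1 else 0) *\<^sub>C 1)"
    using lsum_ordered_loop[of 1 "- 1" i] by (cases "i = 0") (simp_all add: sm_distrib del: rep.simps)
  have "lsum (\<lambda>j. ordered (0 \<le> - j) (vop (- 1) (i + - j)) (loop 1 (- j))) (dd (- i) + II i - dphi i)"
    using lsum_reindex[OF lsum_ordered_loop[of 0 1 i] bij_int_shift(4)]
    by (cases "i = 0") (simp_all del: rep.simps)
  moreover have "ordered (0 \<le> - j) (vop (- 1) (i + - j)) (loop 1 (- j)) = ordered (1 \<le> j) (loop 1 (- j)) (vop (- 1) (i - j))" for j
    by (auto simp: ordered_def simp del: rep.simps)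
  ultimately have 2: "lsum (\<lambda>j. ordered (1 \<le> j) (loop 1 (- j)) (vop (- 1) (i - j))) (dd (- i) + II i - dphi i)"
    by simp
  have "lsum (\<lambda>j. cm A (ordered (1 \<le> j) (loop 1 (- j)) (loop (- 1) j))) (cm A cross_sum)"
    by (rule lsum_cm[OF lsum_cross_sum])
  moreover have "cm A (ordered (1 \<le> j) (loop 1 (- j)) (loop (- 1) j))
     = c 1 *\<^sub>C ordered (1 \<le> j) (vop 1 (i + j)) (loop (- 1) j)
       + c (- 1) *\<^sub>C ordered (1 \<le> j) (loop 1 (- j)) (vop (- 1) (i - j))" for j
    by (simp add: cm_ordered A ordered_simps del: rep.simps)
  ultimately show ?thesis
    using lsum_add[OF lsum_sm[OF 1, of "c 1"] lsum_sm[OF 2, of "c (- 1)"]]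
    by (simp add: lsum_unique del: rep.simps)
qed

lemma cm_euler: "cm (dphi i) euler = of_int i *\<^sub>C dphi i" "cm (II i) euler = of_int i *\<^sub>C II i"
  "cm (dd i) euler = - (of_int i *\<^sub>C dd i)"
proof -
  have "cm (dphi i) (avf (dvop 0) 0) = - (of_int i *\<^sub>C conv (dvop 0) (vop 0) i)"
    using cm_swap[of "dphi i"] cm_avf_field[OF field_dvop tangent_dvop, of 0 0 0 i] by (simp add: dvop_0)
  then show "cm (dphi i) euler = of_int i *\<^sub>C dphi i"
    using current_field'[OF current_vir field_dphi]
    by (simp add: euler_eq cm_simps conv_dvop_vop dvop_0)
  have "cm (II i) (avf (dvop 0) 0) = 0"
    using cm_swap[of "II i" "avf (dvop 0) 0"] cm_avf_current[OF field_dvop current_cur, of 0 0 i] by simp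
  then show "cm (II i) euler = of_int i *\<^sub>C II i" by (auto simp: euler_eq cm_simps cm_cur_vir)
  show "cm (dd i) euler = - (of_int i *\<^sub>C dd i)"
    using rep_rep_10[of i 0 0 0] by (simp add: loop_0 euler_def sm_distrib del: rep.simps)
qed

lemma defect_dphi: "cm (dphi i) sugawara_defect = 0"
proof -
  have dd: "cm (dphi i) (dd j) = (if j = i then - of_int i else 0) *\<^sub>C 1" for j
    using cm_swap[of "dphi i" "dd j"] cm_del_dphi[of \<gamma> j i] by (auto simp: sm_distrib)
  have "lsum (\<lambda>j. cm (dphi i) (dd (- j) * dd j)) (cm (dphi i) square_sum)"
    by (rule lsum_cm[OF lsum_square_sum])
  moreover have "cm (dphi i) (dd (- j) * dd j)
      = (if j = - i then - of_int i *\<^sub>C dd j else 0) + (if j = i then - of_int i *\<^sub>C dd (- j) else 0)" for j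
    by (auto simp: cm_simps dd)
  moreover have "lsum (\<lambda>j. (if j = - i then - of_int i *\<^sub>C dd j else 0) + (if j = i then - of_int i *\<^sub>C dd (- j) else 0))
     ((if - i = - i then - of_int i *\<^sub>C dd (- i) else 0) + (if i = i then - of_int i *\<^sub>C dd (- i) else 0))"
    by (intro lsum_add lsum_single) auto
  ultimately have "cm (dphi i) square_sum = - of_int i *\<^sub>C dd (- i) + - of_int i *\<^sub>C dd (- i)"
    by (simp add: lsum_unique)
  also have "\<dots> = - (2 * of_int i) *\<^sub>C dd (- i)"
    by (rule endo_eqI_entry) (simp add: entry_simps algebra_simps)
  finally have sq: "cm (dphi i) square_sum = - (2 * of_int i) *\<^sub>C dd (- i)" .
  have "cm (dphi i) (loop m j) = (- of_int i) *\<^sub>C vop m (i - j)" for m j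
    using cm_swap[of "dphi i" "loop m j"] by (simp add: cm_loop_dphi sm_distrib del: rep.simps)
  then have cr: "cm (dphi i) cross_sum = (- of_int i) *\<^sub>C (dd (- i) - II i - dphi i + (if i = 0 then 1 else 0) *\<^sub>C 1)
    + (- of_int i) *\<^sub>C (dd (- i) + II i - dphi i)"
    by (rule cm_cross_sum_field[where c = "\<lambda>_. - of_int i"])
  show ?thesis
    unfolding sugawara_defect_def cm_simps sq cr cm_euler dd
    by (rule endo_eqI_entry) (simp add: entry_simps algebra_simps)
qed

lemma defect_cur: "cm (II i) sugawara_defect = 0"
proof -
  have dd: "cm (II i) (dd j) = 0" for j by (rule current_dd[OF current_cur])
  have "lsum (\<lambda>j. cm (II i) (dd (- j) * dd j)) (cm (II i) square_sum)"
    by (rule lsum_cm[OF lsum_square_sum])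
  then have "lsum (\<lambda>j :: int. 0) (cm (II i) square_sum)" by (simp add: cm_simps dd)
  then have sq: "cm (II i) square_sum = 0" by (rule lsum_unique[OF _ lsum_zero])
  have "cm (II i) (loop m j) = (- of_int (m * i)) *\<^sub>C vop m (i - j)" for m j
    using cm_swap[of "II i" "loop m j"] by (simp add: cm_loop_cur sm_distrib del: rep.simps)
  then have cr: "cm (II i) cross_sum = (- of_int (1 * i)) *\<^sub>C (dd (- i) - II i - dphi i + (if i = 0 then 1 else 0) *\<^sub>C 1)
    + (- of_int (- 1 * i)) *\<^sub>C (dd (- i) + II i - dphi i)"
    by (rule cm_cross_sum_field[where c = "\<lambda>m. - of_int (m * i)"])
  show ?thesis
    unfolding sugawara_defect_def cm_simps sq cr cm_euler dd
    by (rule endo_eqI_entry) (simp add: entry_simps algebra_simps)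
qed

text \<open>
  The commutator with \<open>dd i\<close> shifts the index of either factor. The two shifted sums are the same up to
  the threshold of their ordering, and moving the threshold across \<open>i\<close> places costs \<open>i\<close> commutators.
\<close>

lemma defect_del: "cm (dd i) sugawara_defect = 0"
proof -
  have "lsum (\<lambda>j. cm (dd i) (dd (- j) * dd j)) (cm (dd i) square_sum)"
    by (rule lsum_cm[OF lsum_square_sum])
  then have "lsum (\<lambda>j :: int. 0) (cm (dd i) square_sum)" by (simp add: cm_simps cm_del_del)
  then have sq: "cm (dd i) square_sum = 0" by (rule lsum_unique[OF _ lsum_zero])
  let ?V = "\<lambda>s j. ordered (s \<le> j) (loop 1 (i - j)) (loop (- 1) j)"
  have A: "lsum (?V 1) (LS (?V 1))" by (rule lsum_LS[OF loc_fin_loop_loop])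
  have "lsum (\<lambda>j. cm (dd i) (ordered (1 \<le> j) (loop 1 (- j)) (loop (- 1) j))) (cm (dd i) cross_sum)"
    by (rule lsum_cm[OF lsum_cross_sum])
  moreover have "cm (dd i) (ordered (1 \<le> j) (loop 1 (- j)) (loop (- 1) j))
     = ?V 1 j - ordered (1 \<le> j) (loop 1 (- j)) (loop (- 1) (i + j))" for j
    by (simp add: cm_ordered cm_dd_loop ordered_simps sm_distrib del: rep.simps)
  ultimately have "lsum (\<lambda>j. ?V 1 j - ordered (1 \<le> j) (loop 1 (- j)) (loop (- 1) (i + j))) (cm (dd i) cross_sum)"
    by simp
  from lsum_diff[OF A this]
  have "lsum (\<lambda>j. ordered (1 \<le> j) (loop 1 (- j)) (loop (- 1) (i + j))) (LS (?V 1) - cm (dd i) cross_sum)"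
    by simp
  from lsum_reindex[OF this bij_int_shift(2)[of i]]
  have B: "lsum (?V (1 + i)) (LS (?V 1) - cm (dd i) cross_sum)"
    by (simp add: algebra_simps del: rep.simps)
  have "?V 1 j - ?V (1 + i) j = (crossing (j - 1) (j - 1 - i) * - 2) *\<^sub>C dd i" for j
  proof -
    have "loop 1 (i - j) * loop (- 1) j - loop (- 1) j * loop 1 (i - j) = - 2 *\<^sub>C dd i"
      using cm_loop_loop[of "i - j" j] by (simp add: cm_def del: rep.simps)
    then have "loop 1 (i - j) * loop (- 1) j = loop (- 1) j * loop 1 (i - j) - 2 *\<^sub>C dd i"
      by (simp add: algebra_simps sm_distrib del: rep.simps)
    then show ?thesis by (auto simp: ordered_def crossing_def sm_distrib simp del: rep.simps)
  qed
  with lsum_diff[OF A B]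
  have "lsum (\<lambda>j. (crossing (j - 1) (j - 1 - i) * - 2) *\<^sub>C dd i) (cm (dd i) cross_sum)" by simp
  moreover have "lsum (\<lambda>j. (crossing (j - 1) (j - 1 - i) * - 2) *\<^sub>C dd i) (signed_sum i (\<lambda>_. - 2) *\<^sub>C dd i)"
    by (rule lsum_reindex[OF lsum_crossing bij_int_shift(2)[of 1]])
  ultimately have cr: "cm (dd i) cross_sum = (- 2 * of_int i) *\<^sub>C dd i"
    by (simp add: lsum_unique signed_sum_const)
  show ?thesis
    unfolding sugawara_defect_def cm_simps sq cr cm_euler cm_del_del
    by (rule endo_eqI_entry) (simp add: entry_simps algebra_simps)
qed

lemma dd_0_vac: "app (dd 0) (vac k) = scale_pm (\<gamma> + of_int k) (vac k)"
  by (simp add: del_def)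

text \<open>
  The scalar identity behind it is \<open>n\<^sup>2 - (n - \<alpha>) (n + 1 + \<alpha>) + n = \<alpha> (\<alpha> + 1)\<close>; this is where the value of
  \<open>\<beta>\<close> is used.
\<close>

lemma defect_vac: "app sugawara_defect (vac k) = 0"
proof -
  let ?n = "\<gamma> + of_int k"
  have "app square_sum (vac k) = (\<Sum>j\<in>{0}. app (dd (- j) * dd j) (vac k))"
  proof (rule lsumD[OF lsum_square_sum])
    fix j :: int assume "j \<notin> {0}"
    then consider "j > 0" | "j < 0" by force
    then show "app (dd (- j) * dd j) (vac k) = 0"
    proof cases
      case 2
      have "dd (- j) * dd j = dd j * dd (- j)"
        using cm_del_del[of \<gamma> "- j" j] by (simp add: cm_eq_0_iff)
      then show ?thesis using 2 by (simp add: dd_kills)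
    qed (simp add: dd_kills)
  qed simp
  then have sq: "app square_sum (vac k) = scale_pm (?n * ?n) (vac k)"
    by (simp add: dd_0_vac del: scale_pm_simps(5))
  have "app cross_sum (vac k) = (\<Sum>j\<in>{0}. app (ordered (1 \<le> j) (loop 1 (- j)) (loop (- 1) j)) (vac k))"
  proof (rule lsumD[OF lsum_cross_sum])
    fix j :: int assume "j \<notin> {0}"
    then consider "j > 0" | "j < 0" by force
    then show "app (ordered (1 \<le> j) (loop 1 (- j)) (loop (- 1) j)) (vac k) = 0"
      by cases (simp_all add: ordered_def rep_kills del: rep.simps)
  qed simp
  then have cr: "app cross_sum (vac k) = scale_pm ((?n - \<alpha>) * (?n + 1 + \<alpha>)) (vac k)"
    by (simp add: ordered_def rep_vac_1 del: rep.simps scale_pm_simps(5)) (simp add: algebra_simps)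
  have eu: "app euler (vac k) = scale_pm (- (\<alpha> * (\<alpha> + 1) / 2)) (vac k)"
    unfolding euler_def rep_vac_0 by simp
  have "app sugawara_defect (vac k)
    = scale_pm (?n * ?n - (?n - \<alpha>) * (?n + 1 + \<alpha>) + ?n + 2 * - (\<alpha> * (\<alpha> + 1) / 2)) (vac k)"
    unfolding sugawara_defect_def app_simps sq cr eu dd_0_vac
    by (intro poly_mapping_eqI)
      (simp add: lookup_add lookup_minus algebra_simps del: scale_pm_simps(5))
  also have "?n * ?n - (?n - \<alpha>) * (?n + 1 + \<alpha>) + ?n + 2 * - (\<alpha> * (\<alpha> + 1) / 2) = 0"
    by (simp add: field_simps)
  finally show ?thesis by simp
qed

lemma fock_induct [case_names vac create]:
  fixes P :: "fock_index \<Rightarrow> bool"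
  assumes "\<And>k. P (k, 0)" "\<And>k \<mu> v. P (k, \<mu>) \<Longrightarrow> P (k, \<mu> + single v 1)"
  shows "P b"
proof -
  have "P (k, \<mu>)" for k \<mu>
  proof (induction "nat (weight_sum (\<lambda>_. 1) \<mu>)" arbitrary: \<mu> rule: less_induct)
    case less
    show ?case
    proof (cases "\<mu> = 0")
      case False
      then obtain v where v: "lookup \<mu> v \<noteq> 0"
        by (metis poly_mapping_eqI lookup_zero)
      let ?\<nu> = "\<mu> - single v 1"
      have "0 \<le> weight_sum (\<lambda>_. 1) ?\<nu>" unfolding weight_sum_def by (intro sum_nonneg) auto
      with weight_sum_remove[OF v, of "\<lambda>_. 1"]
      have "nat (weight_sum (\<lambda>_. 1) ?\<nu>) < nat (weight_sum (\<lambda>_. 1) \<mu>)" by simp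
      from less[OF this] have "P (k, ?\<nu> + single v 1)" by (rule assms(2))
      then show ?thesis unfolding monomial_remove[OF v] .
    qed (simp add: assms(1))
  qed
  then show ?thesis by (cases b) simp
qed

lemma create_modes: "create (ColX, i) = phi (int (Suc i))" "create (ColY, i) = dd (- int (Suc i))"
  "create (ColS, i) = II (int (Suc i))"
  by (simp_all add: phi_def del_def cur_def del: of_nat_Suc)

lemma phi_dphi: "phi (int (Suc i)) = (1 / of_int (int (Suc i))) *\<^sub>C dphi (int (Suc i))"
  by (simp add: dphi_def del: of_nat_Suc)

text \<open>
  The degree derivation is quadratic in the loop algebra of \<open>sl\<^sub>2\<close> spanned by the modes \<open>loop 1\<close>, \<open>dd\<close>
  and \<open>loop (- 1)\<close>. The level is zero, so the usual normalization of the Sugawara construction is \<open>2\<close>,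
  the dual Coxeter number.
\<close>

lemma sugawara: "square_sum - cross_sum + dd 0 = - 2 *\<^sub>C euler"
proof -
  have phi: "cm (phi (int (Suc i))) sugawara_defect = 0" for i
    unfolding phi_dphi cm_simps defect_dphi by simp
  have cr: "sugawara_defect * create v = create v * sugawara_defect" for v
  proof -
    obtain c i where v: "v = (c, i)" by force
    have "cm (create v) sugawara_defect = 0"
      unfolding v by (cases c) (simp_all only: create_modes phi defect_cur defect_del)
    then show ?thesis by (simp add: cm_eq_0_iff)
  qed
  have "app sugawara_defect (ket b) = 0" for b
  proof (induction b rule: fock_induct)
    case (create k \<mu> v)
    have "app sugawara_defect (ket (k, \<mu> + single v 1)) = app (sugawara_defect * create v) (ket (k, \<mu>))"
      by simp
    also have "\<dots> = 0" unfolding cr using create by simp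
    finally show ?case .
  qed (rule defect_vac)
  then have "sugawara_defect = 0" by (intro endo_eqI_basis) simp
  then show ?thesis
    by (simp add: sugawara_defect_def sm_distrib eq_neg_iff_add_eq_0)
qed

end

section \<open>Irreducibility of the Fock space\<close>

text \<open>
  The usual elimination argument, in a form that only needs the components to be eigenvectors modulo
  \<open>N\<close>: it is applied both on the Fock space and on the tensor product before the relations are divided
  out. The scalar action is a parameter because the two spaces have different ones.
\<close>

lemma eigen_components:
  fixes sc :: "complex \<Rightarrow> 'v::ab_group_add \<Rightarrow> 'v"
  assumes sc: "\<And>c x y. sc c (x + y) = sc c x + sc c y" "\<And>a b x. sc a (sc b x) = sc (a * b) x"
      "\<And>x. sc 1 x = x" "\<And>a b x. sc (a - b) x = sc a x - sc b x"
    and D: "\<And>x y. D (x + y) = D x + D y" "\<And>c x. D (sc c x) = sc c (D x)"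
    and N: "0 \<in> N" "\<And>x y. x \<in> N \<Longrightarrow> y \<in> N \<Longrightarrow> x + y \<in> N" "\<And>c x. x \<in> N \<Longrightarrow> sc c x \<in> N"
      "\<And>x. x \<in> N \<Longrightarrow> D x \<in> N"
    and S: "finite S" "\<And>c. c \<in> S \<Longrightarrow> D (s c) - sc c (s c) \<in> N" "(\<Sum>c\<in>S. s c) \<in> N"
  shows "\<forall>c\<in>S. s c \<in> N"
  using S
proof (induction S arbitrary: s rule: finite_induct)
  case (insert a S)
  have sc0: "sc c 0 = 0" for c using sc(1)[of c 0 0] by simp
  have D0: "D 0 = 0" using D(1)[of 0 0] by simp
  have scs: "sc c (sum f T) = (\<Sum>i\<in>T. sc c (f i))" for c f and T :: "complex set"
    by (induction T rule: infinite_finite_induct) (auto simp: sc0 sc(1))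
  have Ds: "D (sum f T) = (\<Sum>i\<in>T. D (f i))" for f and T :: "complex set"
    by (induction T rule: infinite_finite_induct) (auto simp: D0 D(1))
  have sc00: "sc 0 x = 0" for x using sc(4)[of 1 1 x] by simp
  have scm: "sc (- 1) x = - x" for x
    using sc(4)[of 0 1 x] sc(3)[of x] sc00[of x] by simp
  have Nm: "- x \<in> N" if "x \<in> N" for x using N(3)[OF that, of "- 1"] by (simp add: scm)
  have Nd: "x - y \<in> N" if "x \<in> N" "y \<in> N" for x y using N(2)[OF that(1) Nm[OF that(2)]] by simp
  have Nsum: "sum f T \<in> N" if "\<And>i. i \<in> T \<Longrightarrow> f i \<in> N" for f and T :: "complex set"
    using that by (induction T rule: infinite_finite_induct) (auto intro: N)
  let ?v = "\<Sum>c\<in>insert a S. s c"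
  have scd: "sc a (x - y) = sc a x - sc a y" for a x y
    using sc(1)[of a "x - y" y] by simp
  let ?e = "\<lambda>c. D (s c) - sc c (s c)"
  have "D ?v - sc a ?v = (\<Sum>c\<in>insert a S. D (s c) - sc a (s c))"
    by (simp only: Ds scs sum_subtractf)
  also have "\<dots> = (\<Sum>c\<in>insert a S. ?e c + sc (c - a) (s c))"
  proof (rule sum.cong[OF refl])
    fix c
    show "D (s c) - sc a (s c) = ?e c + sc (c - a) (s c)" unfolding sc(4) by simp
  qed
  also have "\<dots> = (\<Sum>c\<in>insert a S. ?e c) + (\<Sum>c\<in>S. sc (c - a) (s c))"
    using insert.hyps by (simp add: sum.distrib sc00)
  finally have "(\<Sum>c\<in>S. sc (c - a) (s c)) = D ?v - sc a ?v - (\<Sum>c\<in>insert a S. ?e c)"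
    by simp
  moreover have "D ?v - sc a ?v - (\<Sum>c\<in>insert a S. ?e c) \<in> N"
  proof (intro Nd)
    show "D ?v \<in> N" "sc a ?v \<in> N" using insert.prems(2) by (auto intro: N(3,4))
    show "(\<Sum>c\<in>insert a S. ?e c) \<in> N" using insert.prems(1) by (rule Nsum)
  qed
  ultimately have sumN: "(\<Sum>c\<in>S. sc (c - a) (s c)) \<in> N" by simp
  have "D (sc (c - a) (s c)) - sc c (sc (c - a) (s c)) \<in> N" if "c \<in> S" for c
  proof -
    have "D (sc (c - a) (s c)) - sc c (sc (c - a) (s c)) = sc (c - a) (?e c)"
      by (simp add: D(2) sc(2) scd mult.commute)
    then show ?thesis using N(3) insert.prems(1) that by simp
  qed
  note IH = insert.IH[OF this sumN]
  have S: "s c \<in> N" if "c \<in> S" for c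
  proof -
    have "sc (c - a) (s c) \<in> N" using IH that by blast
    from N(3)[OF this, of "1 / (c - a)"] have "sc (1 / (c - a) * (c - a)) (s c) \<in> N" by (simp add: sc(2))
    moreover have "c \<noteq> a" using insert.hyps that by blast
    ultimately show ?thesis by (simp add: sc(3))
  qed
  have "s a = ?v - (\<Sum>c\<in>S. s c)" using insert.hyps by simp
  moreover have "?v - (\<Sum>c\<in>S. s c) \<in> N" by (rule Nd[OF insert.prems(2) Nsum[OF S]])
  ultimately show ?case using S by simp
qed simp

definition part :: "('b \<Rightarrow> bool) \<Rightarrow> ('b \<Rightarrow>\<^sub>0 complex) \<Rightarrow> ('b \<Rightarrow>\<^sub>0 complex)" where
  "part P w = (\<Sum>b\<in>{b \<in> keys w. P b}. single b (lookup w b))"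

lemma lookup_part: "lookup (part P w) p = (if P p then lookup w p else 0)"
proof -
  have "lookup (part P w) p
     = (\<Sum>b\<in>{b \<in> keys w. P b}. if b = p then lookup w p else 0)"
    unfolding part_def lookup_sum by (rule sum.cong) (auto simp: lookup_single when_def)
  also have "\<dots> = (if P p then lookup w p else 0)"
    by (simp add: in_keys_iff)
  finally show ?thesis .
qed

lemma diag_homogeneous:
  assumes "\<And>b. app D (ket b) = scale_pm (ev b) (ket b)" "\<And>b. b \<in> keys w \<Longrightarrow> ev b = c"
  shows "app D w = scale_pm c w"
proof -
  have "app D w = (\<Sum>b\<in>keys w. scale_pm c (single b (lookup w b)))"
    by (subst app_expand) (rule sum.cong, simp_all add: assms mult.commute)
  also have "\<dots> = scale_pm c w"
    unfolding scale_pm_sum[symmetric] pm_expand[of w, symmetric] ..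
  finally show ?thesis .
qed

definition pm_subspace :: "('b \<Rightarrow>\<^sub>0 complex) set \<Rightarrow> bool" where
  "pm_subspace N \<longleftrightarrow> 0 \<in> N \<and> (\<forall>x\<in>N. \<forall>y\<in>N. x + y \<in> N) \<and> (\<forall>c. \<forall>x\<in>N. scale_pm c x \<in> N)"

lemma pm_subspaceD:
  assumes "pm_subspace N"
  shows "0 \<in> N" "x \<in> N \<Longrightarrow> y \<in> N \<Longrightarrow> x + y \<in> N" "x \<in> N \<Longrightarrow> scale_pm c x \<in> N"
    "x \<in> N \<Longrightarrow> - x \<in> N" "x \<in> N \<Longrightarrow> y \<in> N \<Longrightarrow> x - y \<in> N"
proof -
  show *: "0 \<in> N" "x \<in> N \<Longrightarrow> y \<in> N \<Longrightarrow> x + y \<in> N" "x \<in> N \<Longrightarrow> scale_pm c x \<in> N" for x y c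
    using assms unfolding pm_subspace_def by auto
  have "scale_pm (- 1) x = - x" for x :: "'a \<Rightarrow>\<^sub>0 complex" by (rule poly_mapping_eqI) simp
  with *(3)[of _ "- 1"] show m: "x \<in> N \<Longrightarrow> - x \<in> N" for x by metis
  show "x \<in> N \<Longrightarrow> y \<in> N \<Longrightarrow> x - y \<in> N" for x y using *(2)[of x "- y"] m[of y] by simp
qed

lemma pm_subspace_sum:
  assumes "pm_subspace N" "\<And>i. i \<in> S \<Longrightarrow> f i \<in> N" shows "sum f S \<in> N"
  using assms(2) by (induction S rule: infinite_finite_induct) (auto intro: pm_subspaceD[OF assms(1)])

lemma pm_subspace_expand:
  assumes "pm_subspace N" "\<And>b. b \<in> keys w \<Longrightarrow> single b 1 \<in> N" shows "w \<in> N"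
proof -
  have "(\<Sum>b\<in>keys w. single b (lookup w b)) \<in> N"
  proof (rule pm_subspace_sum[OF assms(1)])
    fix b assume "b \<in> keys w"
    then have "scale_pm (lookup w b) (single b 1) \<in> N"
      using assms by (blast intro: pm_subspaceD(3)[OF assms(1)])
    then show "single b (lookup w b) \<in> N" by simp
  qed
  then show ?thesis unfolding pm_expand[of w, symmetric] .
qed

lemma part_in_subspace:
  assumes N: "pm_subspace N" "\<And>x. x \<in> N \<Longrightarrow> app D x \<in> N"
    and D: "\<And>b. app D (ket b) = scale_pm (ev b) (ket b)" and w: "w \<in> N"
  shows "part (\<lambda>b. ev b = c) w \<in> N"
proof -
  let ?S = "insert c (ev ` keys w)"
  let ?s = "\<lambda>c. part (\<lambda>b. ev b = c) w"
  have sum: "(\<Sum>c\<in>?S. ?s c) = w"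
  proof (rule poly_mapping_eqI)
    fix p
    have "lookup (\<Sum>c\<in>?S. ?s c) p = (\<Sum>c\<in>?S. if c = ev p then lookup w p else 0)"
      unfolding lookup_sum lookup_part by (rule sum.cong) auto
    also have "\<dots> = (if ev p \<in> ?S then lookup w p else 0)"
      by (intro sum.delta) simp
    also have "\<dots> = lookup w p" by (auto simp: in_keys_iff)
    finally show "lookup (\<Sum>c\<in>?S. ?s c) p = lookup w p" .
  qed
  have "\<forall>c\<in>?S. ?s c \<in> N"
  proof (rule eigen_components[where sc = scale_pm and D = "app D"])
    fix c assume "c \<in> ?S"
    have "app D (?s c) = scale_pm c (?s c)"
      by (rule diag_homogeneous[of D ev]) (auto simp: D in_keys_iff lookup_part split: if_splits)
    then show "app D (?s c) - scale_pm c (?s c) \<in> N" using pm_subspaceD(1)[OF N(1)] by simp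
  next
    fix a b :: complex and x :: "fock_index \<Rightarrow>\<^sub>0 complex"
    show "scale_pm (a - b) x = scale_pm a x - scale_pm b x"
      by (rule poly_mapping_eqI) (simp add: lookup_minus algebra_simps)
  qed (use N w sum pm_subspaceD[OF N(1)] in \<open>auto simp: scale_pm_add\<close>)
  then show ?thesis by blast
qed

lemma depth_0_iff: "depth (k, \<mu>) = 0 \<longleftrightarrow> \<mu> = 0"
proof
  assume d: "depth (k, \<mu>) = 0"
  have "(\<Sum>v\<in>keys \<mu>. int (lookup \<mu> v) * mode_size v) = 0"
    using d by (simp add: depth_def weight_sum_def)
  moreover have "\<forall>v\<in>keys \<mu>. 0 \<le> int (lookup \<mu> v) * mode_size v"
    by (auto simp: mode_size_def)
  ultimately have "\<forall>v\<in>keys \<mu>. int (lookup \<mu> v) * mode_size v = 0"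
    by (subst (asm) sum_nonneg_eq_0_iff) auto
  then have "\<forall>v\<in>keys \<mu>. lookup \<mu> v = 0" by (auto simp: mode_size_def)
  then show "\<mu> = 0" by (intro poly_mapping_eqI) (metis in_keys_iff lookup_zero)
qed (simp add: depth_def)

lemma tilt_le_depth: "tilt b \<le> depth b"
  unfolding tilt_def depth_def weight_sum_def mode_size_def
  by (intro sum_mono mult_left_mono) (auto split: color.splits)

subsection \<open>Leading terms of the zero modes\<close>

lemma lsumI_basis:
  fixes f :: "'i \<Rightarrow> operator"
  assumes "\<And>b. \<exists>S. finite S \<and> (\<forall>i. i \<notin> S \<longrightarrow> app (f i) (ket b) = 0) \<and> app A (ket b) = (\<Sum>i\<in>S. app (f i) (ket b))"
  shows "lsum f A"
proof -
  have "loc_fin f"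
  proof (rule loc_finI)
    fix b
    obtain S where "finite S" "\<And>i. i \<notin> S \<Longrightarrow> app (f i) (ket b) = 0" using assms[of b] by blast
    then show "finite {i. app (f i) (ket b) \<noteq> 0}" by (auto intro: finite_subset[of _ S])
  qed
  then have L: "lsum f (LS f)" by (rule lsum_LS)
  have "LS f = A"
  proof (rule endo_eqI_basis)
    fix b
    obtain S where "finite S" "\<And>i. i \<notin> S \<Longrightarrow> app (f i) (ket b) = 0" "app A (ket b) = (\<Sum>i\<in>S. app (f i) (ket b))"
      using assms[of b] by blast
    then show "app (LS f) (ket b) = app A (ket b)" using lsumD[OF L] by metis
  qed
  with L show ?thesis by simp
qed

definition diag_op :: "(fock_index \<Rightarrow> complex) \<Rightarrow> operator" where
  "diag_op c = basis_endo (\<lambda>b. single b (c b))"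

lemma app_diag_op [simp]: "app (diag_op c) (single b x) = single b (x * c b)"
  by (simp add: diag_op_def)

lemma lookup_diag_op: "lookup (app (diag_op c) w) p = c p * lookup w p"
proof -
  have "app (diag_op c) w = (\<Sum>b\<in>keys w. single b (lookup w b * c b))"
    by (subst app_expand) simp
  then have "lookup (app (diag_op c) w) p
      = (\<Sum>b\<in>keys w. if b = p then lookup w p * c p else 0)"
    by (auto simp: lookup_sum lookup_single when_def intro!: sum.cong)
  also have "\<dots> = c p * lookup w p" by (simp add: in_keys_iff)
  finally show ?thesis .
qed

lemma tilts_diag_op: "tilts 0 (diag_op c)"
  by (simp add: tilts_def moves_def lookup_single when_def)

context torus_fock
begin

text \<open>
  The normally ordered number operator of the conjugate fields is diagonal with eigenvalue the
  tilt.
\<close>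

lemma lsum_tilt: "lsum (\<lambda>n. nord (phi n) n) (diag_op (\<lambda>b. of_int (tilt b)))"
proof (rule lsumI_basis)
  fix b :: fock_index
  obtain k \<mu> where b: "b = (k, \<mu>)" by force
  let ?c = "\<lambda>n. if n > 0 then of_nat (lookup \<mu> (ColX, nat n - 1))
      else if n < 0 then - of_nat (lookup \<mu> (ColY, nat (- n) - 1)) else 0 :: complex"
  have trm: "app (nord (phi n) n) (ket b) = scale_pm (?c n) (ket b)" for n
  proof -
    have ca: "app (create v) (app (annih v) (ket b)) = scale_pm (of_nat (lookup \<mu> v)) (ket b)" for v
      using monomial_remove[of \<mu> v] by (cases "lookup \<mu> v = 0") (simp_all add: b)
    consider "n > 0" | "n < 0" | "n = 0" by linarith
    then show ?thesis
      by cases (simp_all add: nord_def phi_def del_def ca single_uminus[symmetric])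
  qed
  let ?K = "{v \<in> keys \<mu>. fst v \<noteq> ColS}"
  let ?h = "\<lambda>v :: color \<times> nat. if fst v = ColX then int (Suc (snd v)) else - int (Suc (snd v))"
  have inj: "inj_on ?h ?K"
  proof (rule inj_onI)
    fix v v' assume "v \<in> ?K" "v' \<in> ?K" "?h v = ?h v'"
    then show "v = v'"
      by (cases v; cases v'; cases "fst v"; cases "fst v'") auto
  qed
  show "\<exists>S. finite S \<and> (\<forall>n. n \<notin> S \<longrightarrow> app (nord (phi n) n) (ket b) = 0)
     \<and> app (diag_op (\<lambda>b. of_int (tilt b))) (ket b) = (\<Sum>n\<in>S. app (nord (phi n) n) (ket b))"
  proof (intro exI conjI allI impI)
    show "finite (?h ` ?K)" by simp
    fix n assume n: "n \<notin> ?h ` ?K"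
    have "?c n = 0"
    proof (rule ccontr)
      assume nz: "?c n \<noteq> 0"
      then have "n > 0 \<and> (ColX, nat n - 1) \<in> ?K \<or> n < 0 \<and> (ColY, nat (- n) - 1) \<in> ?K"
        by (auto simp: in_keys_iff split: if_splits)
      then have "n = ?h (ColX, nat n - 1) \<and> (ColX, nat n - 1) \<in> ?K \<or> n = ?h (ColY, nat (- n) - 1) \<and> (ColY, nat (- n) - 1) \<in> ?K"
        by auto
      with n show False by blast
    qed
    then show "app (nord (phi n) n) (ket b) = 0" unfolding trm by simp
  next
    have c: "?c (?h v) = of_int (int (lookup \<mu> v) * (case fst v of ColX \<Rightarrow> 1 | ColY \<Rightarrow> - 1 | ColS \<Rightarrow> 0))"
      if "v \<in> ?K" for v
    proof -
      obtain c i where v: "v = (c, i)" by force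
      have "nat (int (Suc i)) - 1 = i" by (simp del: of_nat_Suc)
      then show ?thesis using that unfolding v by (cases c) (auto simp del: of_nat_Suc)
    qed
    have "of_int (tilt b) = (\<Sum>v\<in>keys \<mu>. of_int (int (lookup \<mu> v) * (case fst v of ColX \<Rightarrow> 1 | ColY \<Rightarrow> - 1 | ColS \<Rightarrow> 0)) :: complex)"
      unfolding tilt_def weight_sum_def b snd_conv of_int_sum ..
    also have "\<dots> = (\<Sum>v\<in>?K. of_int (int (lookup \<mu> v) * (case fst v of ColX \<Rightarrow> 1 | ColY \<Rightarrow> - 1 | ColS \<Rightarrow> 0)))"
      by (intro sum.mono_neutral_right) auto
    also have "\<dots> = (\<Sum>v\<in>?K. ?c (?h v))" by (intro sum.cong c[symmetric] refl)
    also have "\<dots> = (\<Sum>n\<in>?h ` ?K. ?c n)" unfolding sum.reindex[OF inj] comp_def ..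
    finally have t: "of_int (tilt b) = (\<Sum>n\<in>?h ` ?K. ?c n)" .
    have sl: "scale_pm (\<Sum>n\<in>S. f n) w = (\<Sum>n\<in>S. scale_pm (f n) w)" for f :: "int \<Rightarrow> complex" and S and w :: "fock_index \<Rightarrow>\<^sub>0 complex"
      by (induction S rule: infinite_finite_induct) (auto simp: scale_pm_add_left)
    have "app (diag_op (\<lambda>b. of_int (tilt b))) (ket b) = scale_pm (of_int (tilt b)) (ket b)" by simp
    also have "\<dots> = (\<Sum>n\<in>?h ` ?K. app (nord (phi n) n) (ket b))"
      unfolding t trm sl ..
    finally show "app (diag_op (\<lambda>b. of_int (tilt b))) (ket b) = (\<Sum>n\<in>?h ` ?K. app (nord (phi n) n) (ket b))" .
  qed
qed

abbreviation tilt_op :: operator where "tilt_op \<equiv> diag_op (\<lambda>b. of_int (tilt b))"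

lemma tilts_dd_0: "tilts 0 (dd 0)"
  by (simp add: del_def tilts_momentum)

text \<open>
  The leading part of the zero mode \<open>loop m 0\<close> acts in \<open>k\<close> as in the module \<open>T\<close>, with \<open>\<alpha>\<close> replaced by \<open>\<alpha> - t\<close>
  on vectors of tilt \<open>t\<close>.
\<close>

lemma tilts_loop_0: "tilts 1 (loop m 0 - shift m * (dd 0 + of_int m *\<^sub>C tilt_op - (of_int m * \<alpha>) *\<^sub>C 1))"
proof -
  have A: "tilts 1 (avf (vop m) 0 - (of_int m *\<^sub>C (shift m * tilt_op) + shift m * dd 0))"
  proof (rule tilts_lsum)
    have "lsum (\<lambda>n. if n = (0::int) then shift m * dd 0 else 0) (if (0::int) = 0 then shift m * dd 0 else 0)"
      by (rule lsum_single) simp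
    then have "lsum (\<lambda>n. if n = (0::int) then shift m * dd 0 else 0) (shift m * dd 0)" by simp
    then show "lsum (\<lambda>n. nord (vop m (n - 0)) n - (of_int m *\<^sub>C (shift m * nord (phi n) n) + (if n = 0 then shift m * dd 0 else 0)))
       (avf (vop m) 0 - (of_int m *\<^sub>C (shift m * tilt_op) + shift m * dd 0))"
      by (intro lsum_diff lsum_add lsum_sm lsum_mult_left lsum_avf field_vop lsum_tilt)
    fix n :: int
    show "tilts 1 (nord (vop m (n - 0)) n - (of_int m *\<^sub>C (shift m * nord (phi n) n) + (if n = 0 then shift m * dd 0 else 0)))"
    proof (cases "n = 0")
      case True
      have "tilts 1 ((vop m 0 - shift m) * dd 0)"
        using tilts_mult[OF tilts_vop(1)[of m] tilts_dd_0] by (rule tilts_mono) simp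
      then show ?thesis using True by (simp add: nord_def phi_def left_diff_distrib)
    next
      case False
      have "shift m * dd n = dd n * shift m"
        using cm_del_shift[of \<gamma> n m] False by (simp add: cm_eq_0_iff)
      then have "shift m * nord (phi n) n = nord (shift m * phi n) n"
        by (auto simp: nord_def simp flip: mult.assoc)
      moreover have "tilts 1 (nord (vop m n - of_int m *\<^sub>C (shift m * phi n)) n)"
        using tilts_mult[OF tilts_vop(2)[OF False, of m] tilts_del[OF False, of \<gamma>]]
          tilts_mult[OF tilts_del[OF False, of \<gamma>] tilts_vop(2)[OF False, of m]]
        by (simp add: nord_def)
      ultimately show ?thesis using False by (simp add: nord_simps)
    qed
  qed
  have B: "tilts 1 (hop II (vop m) 0 - II 0 * shift m)"
  proof (rule tilts_lsum)
    have "lsum (\<lambda>k. if k = (0::int) then II 0 * shift m else 0) (if (0::int) = 0 then II 0 * shift m else 0)"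
      by (rule lsum_single) simp
    then have "lsum (\<lambda>k. if k = (0::int) then II 0 * shift m else 0) (II 0 * shift m)" by simp
    then show "lsum (\<lambda>k. II k * vop m (- 0 - k) - (if k = 0 then II 0 * shift m else 0)) (hop II (vop m) 0 - II 0 * shift m)"
      by (intro lsum_diff lsum_hop current_cur field_vop)
    fix k :: int
    show "tilts 1 (II k * vop m (- 0 - k) - (if k = 0 then II 0 * shift m else 0))"
    proof (cases "k = 0")
      case True
      have "tilts 1 (II 0 * (vop m 0 - shift m))"
        using tilts_mult[OF tilts_cur tilts_vop(1)] by (rule tilts_mono) simp
      then show ?thesis using True by (simp add: right_diff_distrib)
    next
      case False
      then show ?thesis using tilts_mult[OF tilts_cur tilts_vop(4)[of "- k" m]] by simp
    qed
  qed
  have "tilts 1 ((avf (vop m) 0 - (of_int m *\<^sub>C (shift m * tilt_op) + shift m * dd 0))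
     + of_int m *\<^sub>C (hop II (vop m) 0 - II 0 * shift m))"
    by (intro tilts_closed A B)
  moreover have "(avf (vop m) 0 - (of_int m *\<^sub>C (shift m * tilt_op) + shift m * dd 0))
     + of_int m *\<^sub>C (hop II (vop m) 0 - II 0 * shift m)
     = loop m 0 - shift m * (dd 0 + of_int m *\<^sub>C tilt_op - (of_int m * \<alpha>) *\<^sub>C 1)"
    by (rule endo_eqI_entry)
      (simp add: cur_def distrib_left right_diff_distrib entry_simps algebra_simps)
  ultimately show ?thesis by simp
qed

text \<open>
  The terms of the Sugawara expression that only involve zero modes: the Casimir element of \<open>sl\<^sub>2\<close>.
\<close>

definition zero_casimir :: operator where
  "zero_casimir = dd 0 * dd 0 - loop (- 1) 0 * loop 1 0 + dd 0"

definition casimir_value :: "fock_index \<Rightarrow> complex" where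
  "casimir_value b = (\<alpha> - of_int (tilt b)) * (\<alpha> - of_int (tilt b) + 1)"

text \<open>
  The leading parts of the zero modes generate an action of \<open>sl\<^sub>2\<close> on the vectors of a fixed monomial,
  on which the Casimir element is a scalar; all corrections raise the tilt.
\<close>

lemma tilts_zero_casimir: "tilts 1 (zero_casimir - diag_op casimir_value)"
proof -
  define A where "A m = shift m * (dd 0 + of_int m *\<^sub>C tilt_op - (of_int m * \<alpha>) *\<^sub>C 1)" for m :: int
  define B where "B m = loop m 0 - A m" for m
  have A: "tilts 0 (A m)" for m
    unfolding A_def using tilts_mult[of 0 "shift m" 0 "dd 0 + of_int m *\<^sub>C tilt_op - (of_int m * \<alpha>) *\<^sub>C 1"]
    by (simp add: tilts_shift tilts_closed tilts_dd_0 tilts_diag_op tilts_1)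
  have B: "tilts 1 (B m)" for m unfolding B_def A_def by (rule tilts_loop_0)
  have exact: "dd 0 * dd 0 - A (- 1) * A 1 + dd 0 = diag_op casimir_value"
  proof (rule endo_eqI_basis)
    fix b :: fock_index
    obtain k \<mu> where b: "b = (k, \<mu>)" by force
    define t where "t = (of_int (tilt (0, \<mu>)) :: complex)"
    have t: "of_int (tilt (k', \<mu>)) = t" for k' by (simp add: t_def tilt_def)
    have A1: "app (A 1) (single (k', \<mu>) x) = single (k' + 1, \<mu>) (x * (\<gamma> + of_int k' + t - \<alpha>))" for k' x
      by (simp add: A_def del_def t single_add[symmetric] single_diff[symmetric] algebra_simps)
    have A2: "app (A (- 1)) (single (k', \<mu>) x) = single (k' - 1, \<mu>) (x * (\<gamma> + of_int k' - t + \<alpha>))" for k' x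
      by (simp add: A_def del_def t single_add[symmetric] single_diff[symmetric] single_uminus[symmetric] algebra_simps)
    show "app (dd 0 * dd 0 - A (- 1) * A 1 + dd 0) (ket b) = app (diag_op casimir_value) (ket b)"
      by (simp add: b A1 A2 del_def casimir_value_def t single_add[symmetric] single_diff[symmetric])
         (simp add: algebra_simps)
  qed
  have "zero_casimir - diag_op casimir_value = - (A (- 1) * B 1 + B (- 1) * A 1 + B (- 1) * B 1)"
    unfolding exact[symmetric] zero_casimir_def B_def by (simp add: algebra_simps del: rep.simps)
  moreover have "tilts 1 (A (- 1) * B 1 + B (- 1) * A 1 + B (- 1) * B 1)"
    using tilts_mult[OF A B] tilts_mult[OF B A] tilts_mono[OF tilts_mult[OF B B], of 1]
    by (intro tilts_closed) auto
  ultimately show ?thesis by (simp only: tilts_closed(4))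
qed

text \<open>
  A creation operator of size \<open>w\<close> lowers the eigenvalue of the degree derivation by \<open>w\<close>.
\<close>

lemma euler_ket: "app euler (ket b) = scale_pm (- (of_int (depth b) + \<alpha> * (\<alpha> + 1) / 2)) (ket b)"
proof (induction b rule: fock_induct)
  case (vac k)
  then show ?case unfolding euler_def rep_vac_0 by simp
next
  case (create k \<mu> v)
  have "cm (create v) euler = of_int (mode_size v) *\<^sub>C create v"
  proof -
    obtain c i where v: "v = (c, i)" by force
    have "cm (phi (int (Suc i))) euler = of_int (int (Suc i)) *\<^sub>C phi (int (Suc i))"
      unfolding phi_dphi cm_simps cm_euler by simp
    then show ?thesis
      unfolding v mode_size_def snd_conv by (cases c) (simp_all only: create_modes cm_euler, simp add: sm_distrib)
  qed
  then have "euler * create v = create v * euler - of_int (mode_size v) *\<^sub>C create v"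
    by (simp add: cm_def algebra_simps)
  then have "app (euler * create v) (ket (k, \<mu>)) = app (create v * euler - of_int (mode_size v) *\<^sub>C create v) (ket (k, \<mu>))"
    by simp
  then have "app euler (ket (k, \<mu> + single v 1))
     = scale_pm (- (of_int (depth (k, \<mu>)) + \<alpha> * (\<alpha> + 1) / 2)) (ket (k, \<mu> + single v 1))
       - scale_pm (of_int (mode_size v)) (ket (k, \<mu> + single v 1))"
    by (simp add: create)
  moreover have "- (of_int (depth (k, \<mu> + single v 1)) + \<alpha> * (\<alpha> + 1) / 2)
      = - (of_int (depth (k, \<mu>)) + \<alpha> * (\<alpha> + 1) / 2) - of_int (mode_size v)"
    by (simp add: depth_def weight_sum_add)
  ultimately show ?case
    by (intro poly_mapping_eqI) (simp add: lookup_minus left_diff_distrib del: scale_pm_simps(5))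
qed

lemma dd_0_ket: "app (dd 0) (ket b) = scale_pm (\<gamma> + of_int (fst b)) (ket b)"
  by (cases b) (simp add: del_def)

subsection \<open>Submodules\<close>

definition rep_stable :: "fock set \<Rightarrow> bool" where
  "rep_stable N \<longleftrightarrow> pm_subspace N \<and> (\<forall>i. \<forall>w\<in>N. app (rep i) w \<in> N)"

text \<open>
  The only place where the irrationality of \<open>\<alpha>\<close> is essential: a nonzero tilt would express \<open>\<alpha>\<close> as
  a quotient of integers.
\<close>

lemma casimir_value_eq:
  assumes "\<alpha> \<notin> \<rat>" "casimir_value b = 2 * of_int n + \<alpha> * (\<alpha> + 1)"
  shows "n = 0"
proof -
  define t where "t = tilt b"
  have e: "2 * of_int t * \<alpha> = of_int (t * t - t - 2 * n)"
    using assms(2) by (simp add: casimir_value_def t_def[symmetric] algebra_simps)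
  show ?thesis
  proof (cases "t = 0")
    case True
    with e have "of_int (- 2 * n) = (0 :: complex)" by simp
    then show ?thesis by (simp only: of_int_eq_0_iff)
  next
    case False
    then have "\<alpha> = of_int (t * t - t - 2 * n) / of_int (2 * t)"
      using e by (simp add: field_simps)
    then have "\<alpha> \<in> \<rat>" by (simp only: Rats_divide Rats_of_int)
    with assms(1) show ?thesis by simp
  qed
qed

lemma weight_nonzero: "\<alpha> \<notin> \<rat> \<Longrightarrow> \<alpha> * (\<alpha> + 1) \<noteq> 0"
proof
  assume a: "\<alpha> \<notin> \<rat>" and "\<alpha> * (\<alpha> + 1) = 0"
  then have "\<alpha> = 0 \<or> \<alpha> = - 1" by (auto simp: eq_neg_iff_add_eq_0)
  with a show False by auto
qed

text \<open>
  In the Sugawara expression every term other than that of the zero modes has a factor of positive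
  degree, which acts first. Modulo the submodule only the zero modes remain, and the degree
  derivation is a known scalar. With \<open>N = {0}\<close> this is the case of singular vectors.
\<close>

lemma casimir_mod_submodule:
  assumes N: "rep_stable N" and low: "\<And>i. 0 < t0_degree i \<Longrightarrow> app (rep i) w \<in> N"
    and deg: "\<And>b. b \<in> keys w \<Longrightarrow> depth b = n"
  shows "app zero_casimir w - scale_pm (2 * of_int n + \<alpha> * (\<alpha> + 1)) w \<in> N"
proof -
  have sp: "pm_subspace N" and st: "\<And>i v. v \<in> N \<Longrightarrow> app (rep i) v \<in> N"
    using N by (auto simp: rep_stable_def)
  note S = pm_subspaceD[OF sp]
  have lowl: "app (loop m j) w \<in> N" if "0 < j" for m j
    using low[of "Monom j m Dir1"] that by simp
  have sq: "app square_sum w - app (dd 0 * dd 0) w \<in> N"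
  proof -
    let ?f = "\<lambda>j. app (dd (- j) * dd j) w"
    let ?T = "insert 0 {j. ?f j \<noteq> 0}"
    have fin: "finite ?T" using lsum_finite_supp[OF lsum_square_sum] by simp
    have "app square_sum w = (\<Sum>j\<in>?T. ?f j)" by (rule lsumD[OF lsum_square_sum fin]) auto
    also have "\<dots> = ?f 0 + (\<Sum>j\<in>?T - {0}. ?f j)" using fin by (subst sum.remove[of _ 0]) auto
    finally have "app square_sum w - app (dd 0 * dd 0) w = (\<Sum>j\<in>?T - {0}. ?f j)" by simp
    moreover have "?f j \<in> N" if "j \<noteq> 0" for j
    proof (cases "0 < j")
      case True
      then show ?thesis using st[OF lowl[of j 0], of "Monom (- j) 0 Dir1"] by (simp only: loop_0 app_simps)
    next
      case False
      have "dd (- j) * dd j = dd j * dd (- j)"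
        using cm_del_del[of \<gamma> "- j" j] by (simp add: cm_eq_0_iff)
      then show ?thesis using False that st[OF lowl[of "- j" 0], of "Monom j 0 Dir1"]
        by (simp only: loop_0 app_simps)
    qed
    ultimately show ?thesis by (auto intro: pm_subspace_sum[OF sp])
  qed
  have cr: "app cross_sum w - app (loop (- 1) 0 * loop 1 0) w \<in> N"
  proof -
    let ?f = "\<lambda>j. app (ordered (1 \<le> j) (loop 1 (- j)) (loop (- 1) j)) w"
    let ?T = "insert 0 {j. ?f j \<noteq> 0}"
    have fin: "finite ?T" using lsum_finite_supp[OF lsum_cross_sum] by simp
    have "app cross_sum w = (\<Sum>j\<in>?T. ?f j)" by (rule lsumD[OF lsum_cross_sum fin]) auto
    also have "\<dots> = ?f 0 + (\<Sum>j\<in>?T - {0}. ?f j)" using fin by (subst sum.remove[of _ 0]) auto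
    finally have "app cross_sum w - app (loop (- 1) 0 * loop 1 0) w = (\<Sum>j\<in>?T - {0}. ?f j)"
      by (simp add: ordered_def del: rep.simps)
    moreover have "?f j \<in> N" if "j \<noteq> 0" for j
      using that st[OF lowl[of j "- 1"], of "Monom (- j) 1 Dir1"] st[OF lowl[of "- j" 1], of "Monom j (- 1) Dir1"]
      by (cases "0 < j") (simp_all add: ordered_def del: rep.simps)
    ultimately show ?thesis by (auto intro: pm_subspace_sum[OF sp])
  qed
  have "app euler w = scale_pm (- (of_int n + \<alpha> * (\<alpha> + 1) / 2)) w"
    by (rule diag_homogeneous[OF euler_ket]) (simp add: deg)
  moreover have "- 2 * - (of_int n + \<alpha> * (\<alpha> + 1) / 2) = 2 * of_int n + \<alpha> * (\<alpha> + 1)"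
    by (simp add: field_simps)
  ultimately have "app (- 2 *\<^sub>C euler) w = scale_pm (2 * of_int n + \<alpha> * (\<alpha> + 1)) w"
    by (simp only: app_simps scale_pm_simps(4))
  then have "app square_sum w - app cross_sum w + app (dd 0) w = scale_pm (2 * of_int n + \<alpha> * (\<alpha> + 1)) w"
    unfolding sugawara[symmetric] by simp
  then have "app zero_casimir w - scale_pm (2 * of_int n + \<alpha> * (\<alpha> + 1)) w
     = (app cross_sum w - app (loop (- 1) 0 * loop 1 0) w) - (app square_sum w - app (dd 0 * dd 0) w)"
    unfolding zero_casimir_def app_simps by (simp add: algebra_simps del: rep.simps)
  then show ?thesis using S(5)[OF cr sq] by simp
qed

lemma hom_app_depth:
  assumes "hom m A" "\<And>b. b \<in> keys w \<Longrightarrow> depth b = n" "p \<in> keys (app A w)"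
  shows "depth p = n + m"
proof -
  obtain c where c: "lookup w c \<noteq> 0" "lookup (app A (ket c)) p \<noteq> 0"
    using assms(3) by (auto simp: in_keys_iff elim: lookup_app_nonzeroE)
  then have "depth p = depth c + m" using assms(1) unfolding hom_def moves_def by blast
  then show ?thesis using assms(2)[of c] c by (simp add: in_keys_iff)
qed

text \<open>
  A nonzero vector of least depth in a submodule is singular, so the Casimir element acts on it by a
  scalar; on its component of least tilt that scalar is \<open>casimir_value\<close>. Hence its depth is zero.
\<close>

lemma submodule_contains_vac:
  assumes irr: "\<alpha> \<notin> \<rat>" and N: "rep_stable N" and w: "w \<in> N" "w \<noteq> 0"
  shows "vac k \<in> N"
proof -
  have sp: "pm_subspace N" and st: "\<And>i v. v \<in> N \<Longrightarrow> app (rep i) v \<in> N"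
    using N by (auto simp: rep_stable_def)
  note S = pm_subspaceD[OF sp]
  define Q where "Q n \<longleftrightarrow> (\<exists>v\<in>N. v \<noteq> 0 \<and> (\<forall>b\<in>keys v. depth b = int n))" for n
  have "\<exists>n. Q n"
  proof -
    obtain p where p: "lookup w p \<noteq> 0" using w(2) by (metis poly_mapping_eqI lookup_zero)
    let ?ev = "\<lambda>b. - (of_int (depth b) + \<alpha> * (\<alpha> + 1) / 2)"
    have "part (\<lambda>b. ?ev b = ?ev p) w \<in> N"
      by (rule part_in_subspace[OF sp _ euler_ket w(1)]) (simp add: euler_def st del: rep.simps)
    moreover have "\<forall>b\<in>keys (part (\<lambda>b. ?ev b = ?ev p) w). depth b = int (nat (depth p))"
      using depth_nonneg[of p] by (auto simp: in_keys_iff lookup_part split: if_splits)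
    moreover have "lookup (part (\<lambda>b. ?ev b = ?ev p) w) p \<noteq> 0" using p by (simp add: lookup_part)
    then have "part (\<lambda>b. ?ev b = ?ev p) w \<noteq> 0" by auto
    ultimately show ?thesis unfolding Q_def by blast
  qed
  define n where "n = (LEAST n. Q n)"
  have Qn: "Q n" unfolding n_def using \<open>\<exists>n. Q n\<close> by (rule LeastI_ex)
  then obtain v where v: "v \<in> N" "v \<noteq> 0" "\<And>b. b \<in> keys v \<Longrightarrow> depth b = int n"
    unfolding Q_def by blast
  have sing: "app (rep i) v = 0" if "0 < t0_degree i" for i
  proof (rule ccontr)
    assume nz: "app (rep i) v \<noteq> 0"
    have d: "depth p = int n - t0_degree i" if "p \<in> keys (app (rep i) v)" for p
      using hom_app_depth[OF hom_rep v(3) that] by simp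
    obtain p where "p \<in> keys (app (rep i) v)"
      using nz by (metis ex_in_conv keys_eq_empty)
    with d depth_nonneg[of p] have "0 \<le> int n - t0_degree i" by simp
    then have "Q (nat (int n - t0_degree i))"
      unfolding Q_def using st[OF v(1)] nz d by (intro bexI[of _ "app (rep i) v"]) auto
    then have "n \<le> nat (int n - t0_degree i)" unfolding n_def by (rule Least_le)
    with \<open>0 \<le> int n - t0_degree i\<close> \<open>0 < t0_degree i\<close> show False by linarith
  qed
  have "app zero_casimir v - scale_pm (2 * of_int (int n) + \<alpha> * (\<alpha> + 1)) v \<in> {0}"
    by (rule casimir_mod_submodule)
      (auto simp: rep_stable_def pm_subspace_def sing v(3) simp del: rep.simps)
  then have cas: "app zero_casimir v = scale_pm (2 * of_int (int n) + \<alpha> * (\<alpha> + 1)) v" by simp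
  have "n = 0"
  proof -
    have ne: "keys v \<noteq> {}" using v(2) by simp
    define t where "t = Min (tilt ` keys v)"
    have "t \<in> tilt ` keys v" unfolding t_def using ne by (intro Min_in) auto
    then obtain p where p: "p \<in> keys v" "tilt p = t" by auto
    have min: "t \<le> tilt b" if "b \<in> keys v" for b
      unfolding t_def using that by simp
    have "lookup (app (zero_casimir - diag_op casimir_value) v) p = 0"
    proof (rule ccontr)
      assume nz: "lookup (app (zero_casimir - diag_op casimir_value) v) p \<noteq> 0"
      obtain c where c: "lookup v c \<noteq> 0"
          "lookup (app (zero_casimir - diag_op casimir_value) (ket c)) p \<noteq> 0"
        by (rule lookup_app_nonzeroE[OF nz])
      then have "tilt c + 1 \<le> tilt p"
        using tilts_zero_casimir unfolding tilts_def moves_def by blast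
      moreover have "t \<le> tilt c" using min c(1) by (simp add: in_keys_iff)
      ultimately show False using p by simp
    qed
    then have "casimir_value p * lookup v p = (2 * of_int (int n) + \<alpha> * (\<alpha> + 1)) * lookup v p"
      by (auto simp: cas lookup_minus lookup_diag_op simp del: of_int_of_nat_eq)
    then have "casimir_value p = 2 * of_int (int n) + \<alpha> * (\<alpha> + 1)"
      using p(1) by (simp add: in_keys_iff)
    from casimir_value_eq[OF irr this] show ?thesis by simp
  qed
  obtain k0 \<mu> where k0: "(k0, \<mu>) \<in> keys v" using v(2) by (metis ex_in_conv keys_eq_empty surj_pair)
  have "part (\<lambda>b. \<gamma> + of_int (fst b) = \<gamma> + of_int k0) v \<in> N"
    by (rule part_in_subspace[OF sp _ dd_0_ket v(1)]) (metis st loop_0)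
  moreover have "part (\<lambda>b. \<gamma> + of_int (fst b) = \<gamma> + of_int k0) v = single (k0, 0) (lookup v (k0, 0))"
  proof (rule poly_mapping_eqI)
    fix p :: fock_index
    obtain k' \<nu> where p: "p = (k', \<nu>)" by force
    have "lookup v (k', \<nu>) = 0" if "\<nu> \<noteq> 0"
    proof (rule ccontr)
      assume "lookup v (k', \<nu>) \<noteq> 0"
      then have "depth (k', \<nu>) = 0" using v(3) \<open>n = 0\<close> by (simp add: in_keys_iff)
      with that show False by (simp add: depth_0_iff)
    qed
    then show "lookup (part (\<lambda>b. \<gamma> + of_int (fst b) = \<gamma> + of_int k0) v) p
       = lookup (single (k0, 0) (lookup v (k0, 0))) p"
      by (auto simp: p lookup_part lookup_single when_def)
  qed
  ultimately have "single (k0, 0) (lookup v (k0, 0)) \<in> N" by simp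
  from S(3)[OF this, of "1 / lookup v (k0, 0)"]
  have k0N: "vac k0 \<in> N"
  proof -
    have "\<mu> = 0" using v(3)[OF k0] \<open>n = 0\<close> depth_0_iff[of k0 \<mu>] by simp
    then have "lookup v (k0, 0) \<noteq> 0" using k0 by (simp add: in_keys_iff)
    then show ?thesis
      using S(3)[OF \<open>single (k0, 0) (lookup v (k0, 0)) \<in> N\<close>, of "1 / lookup v (k0, 0)"]
      by simp
  qed
  let ?\<beta> = "- (\<alpha> * (\<alpha> + 1) / 2)"
  have "scale_pm (1 / ?\<beta>) (app (rep (Monom 0 (k - k0) Dir0)) (vac k0)) \<in> N"
    by (intro S(3) st k0N)
  moreover have "scale_pm (1 / ?\<beta>) (app (rep (Monom 0 (k - k0) Dir0)) (vac k0)) = vac k"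
    unfolding rep_vac_0 using weight_nonzero[OF irr] by simp
  ultimately show ?thesis by simp
qed

text \<open>
  Basis vectors are reached from the top by induction on the depth \<open>n\<close>, and for fixed depth from large
  tilt to small tilt, which is possible as the tilt is at most the depth. Positive modes lower the
  depth, so \<open>casimir_mod_submodule\<close> applies; the corrections to the diagonal of the Casimir operator
  raise the tilt; and the remaining multiple of the basis vector is nonzero.
\<close>

theorem fock_irreducible:
  assumes irr: "\<alpha> \<notin> \<rat>" and N: "rep_stable N" and w: "w \<in> N" "w \<noteq> 0"
  shows "N = UNIV"
proof -
  have sp: "pm_subspace N" and st: "\<And>i v. v \<in> N \<Longrightarrow> app (rep i) v \<in> N"
    using N by (auto simp: rep_stable_def)
  note S = pm_subspaceD[OF sp]
  have "ket b \<in> N" if "depth b = int n" for n b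
    using that
  proof (induction n arbitrary: b rule: less_induct)
    case (less n)
    show ?case
    proof (cases "n = 0")
      case True
      then have "b = (fst b, 0)" using less.prems depth_0_iff[of "fst b" "snd b"] by (simp add: prod_eq_iff)
      then show ?thesis using submodule_contains_vac[OF irr N w] by metis
    next
      case False
      from less.prems show ?thesis
      proof (induction "nat (int n - tilt b)" arbitrary: b rule: less_induct)
        case (less b)
        let ?c = "2 * of_int (int n) + \<alpha> * (\<alpha> + 1)"
        have low: "app (rep i) (ket b) \<in> N" if i: "0 < t0_degree i" for i
        proof (rule pm_subspace_expand[OF sp])
          fix p assume "p \<in> keys (app (rep i) (ket b))"
          then have "depth p = int n - t0_degree i"
            using hom_app_depth[OF hom_rep, of "ket b" "int n" p i] less.prems by simp
          then show "ket p \<in> N" using \<open>\<And>y b. y < n \<Longrightarrow> depth b = int y \<Longrightarrow> ket b \<in> N\<close>[of "nat (depth p)" p]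
            depth_nonneg[of p] i by simp
        qed
        have 1: "app zero_casimir (ket b) - scale_pm ?c (ket b) \<in> N"
          by (rule casimir_mod_submodule[OF N low]) (use less.prems in auto)
        have 2: "app (zero_casimir - diag_op casimir_value) (ket b) \<in> N"
        proof (rule pm_subspace_expand[OF sp])
          fix p assume p: "p \<in> keys (app (zero_casimir - diag_op casimir_value) (ket b))"
          have "hom 0 zero_casimir"
          proof -
            have d: "hom 0 (dd 0)" using hom_del[of 0 \<gamma>] by simp
            have l: "hom 0 (loop m 0)" for m using hom_rep[of "Monom 0 m Dir1"] by (simp del: rep.simps)
            show ?thesis unfolding zero_casimir_def
              using hom_mult[OF d d] hom_mult[OF l[of "- 1"] l[of 1]] d
              by (intro hom_closed) (simp_all del: rep.simps)
          qed
          moreover have "hom 0 (diag_op casimir_value)"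
            by (simp add: hom_def moves_def lookup_single when_def)
          ultimately have "hom 0 (zero_casimir - diag_op casimir_value)" by (rule hom_closed)
          from hom_app_depth[OF this _ p, of "int n"] less.prems have dp: "depth p = int n" by simp
          have tp: "tilt b + 1 \<le> tilt p"
            using p tilts_zero_casimir unfolding tilts_def moves_def in_keys_iff by blast
          have "nat (int n - tilt p) < nat (int n - tilt b)"
            using tp tilt_le_depth[of p] dp by simp
          then show "ket p \<in> N" using dp by (rule less.hyps)
        qed
        have "app zero_casimir (ket b) - scale_pm ?c (ket b) - app (zero_casimir - diag_op casimir_value) (ket b)
           = scale_pm (casimir_value b - ?c) (ket b)"
          by (rule poly_mapping_eqI) (simp add: lookup_minus lookup_single when_def)
        then have "scale_pm (casimir_value b - ?c) (ket b) \<in> N" using S(5)[OF 1 2] by simp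
        moreover have "casimir_value b - ?c \<noteq> 0" using casimir_value_eq[OF irr, of b "int n"] False by auto
        ultimately show ?case using S(3)[of "scale_pm (casimir_value b - ?c) (ket b)" "1 / (casimir_value b - ?c)"] by simp
      qed
    qed
  qed
  then have "ket b \<in> N" for b using depth_nonneg[of b] by (metis nonneg_int_cases)
  then show ?thesis using pm_subspace_expand[OF sp] by blast
qed

subsection \<open>The action of arbitrary vector fields\<close>

definition rho :: "vf \<Rightarrow> operator" where
  "rho x = (\<Sum>i\<in>keys x. lookup x i *\<^sub>C rep i)"

lemma rho_superset:
  assumes "finite S" "keys x \<subseteq> S"
  shows "rho x = (\<Sum>i\<in>S. lookup x i *\<^sub>C rep i)"
  unfolding rho_def using assms by (intro sum.mono_neutral_left) (auto simp: in_keys_iff)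

lemma rho_single [simp]: "rho (single i c) = c *\<^sub>C rep i"
  by (simp add: rho_def)

lemma rho_0 [simp]: "rho 0 = 0"
  by (simp add: rho_def)

lemma rho_add: "rho (x + y) = rho x + rho y"
proof -
  let ?S = "keys x \<union> keys y"
  have "keys (x + y) \<subseteq> ?S" by (rule keys_add)
  then show ?thesis
    by (simp add: rho_superset[of ?S] lookup_add sm_distrib sum.distrib)
qed

lemma rho_scale: "rho (scale_pm c x) = c *\<^sub>C rho x"
proof -
  have "keys (scale_pm c x) \<subseteq> keys x" by (auto simp: in_keys_iff)
  then show ?thesis
    by (simp add: rho_superset[of "keys x"] sm_sum)
qed

lemma rho_diff: "rho (x - y) = rho x - rho y"
proof -
  have "rho (x - y) + rho y = rho x" using rho_add[of "x - y" y] by simp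
  then show ?thesis by (simp add: eq_diff_eq)
qed

lemma rho_lin_ext:
  fixes x :: "'i \<Rightarrow>\<^sub>0 complex"
  shows "rho (lin_ext f x) = (\<Sum>i\<in>keys x. lookup x i *\<^sub>C rho (f i))"
proof -
  have "rho (sum g S) = (\<Sum>i\<in>S. rho (g i))" for g and S :: "'i set"
    by (induction S rule: infinite_finite_induct) (auto simp: rho_add)
  then show ?thesis by (simp add: lin_ext_def rho_scale)
qed

lemma cm_rep_rep: "cm (rep i) (rep j) = rho (bracket_basis i j)"
proof -
  obtain j0 m a where i: "i = Monom j0 m a" by (cases i) auto
  obtain l r b where j: "j = Monom l r b" by (cases j) auto
  consider "a = Dir1" "b = Dir1" | "a = Dir1" "b = Dir0" | "a = Dir0" "b = Dir1" | "a = Dir0" "b = Dir0"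
    by (cases a; cases b) auto
  then show ?thesis
  proof cases
    case 1
    then show ?thesis by (simp add: i j rep_rep_11 rho_diff sm_distrib del: rep.simps)
  next
    case 2
    then show ?thesis by (simp add: i j rep_rep_10 rho_diff del: rep.simps)
  next
    case 3
    then show ?thesis using cm_swap[of "rep i" "rep j"]
      by (simp add: i j rep_rep_10 rho_diff add.commute del: rep.simps)
  next
    case 4
    then show ?thesis by (simp add: i j rep_rep_00 rho_diff sm_distrib del: rep.simps)
  qed
qed

lemma cm_sum_left: "cm (sum f S) B = (\<Sum>i\<in>S. cm (f i) B)"
  by (induction S rule: infinite_finite_induct) (auto simp: cm_simps)

lemma cm_sum_right: "cm B (sum f S) = (\<Sum>i\<in>S. cm B (f i))"
  by (induction S rule: infinite_finite_induct) (auto simp: cm_simps)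

lemma rho_bracket: "rho (bracket x y) = rho x * rho y - rho y * rho x"
proof -
  have "rho (bracket x y) = (\<Sum>i\<in>keys x. lookup x i *\<^sub>C
      (\<Sum>j\<in>keys y. lookup y j *\<^sub>C cm (rep i) (rep j)))"
    unfolding bracket_def rho_lin_ext cm_rep_rep ..
  also have "\<dots> = (\<Sum>i\<in>keys x. lookup x i *\<^sub>C cm (rep i) (rho y))"
    unfolding rho_def[of y] cm_sum_right cm_simps ..
  also have "\<dots> = cm (rho x) (rho y)"
    unfolding rho_def[of x] cm_sum_left cm_simps ..
  finally show ?thesis by (simp add: cm_def)
qed

end

section \<open>Quotients of modules over the Lie algebra\<close>

text \<open>
  Closure and additivity of the two actions, which make the operations on cosets well defined. The
  property passes to quotients, so it can be used for both steps from the tensor product to \<open>L_D\<close>.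
\<close>

definition operator_module :: "'v vf_module \<Rightarrow> bool" where
  "operator_module V \<longleftrightarrow> abelian_group V
    \<and> (\<forall>c. \<forall>v\<in>carrier V. c \<odot>\<^bsub>V\<^esub> v \<in> carrier V)
    \<and> (\<forall>c. \<forall>v\<in>carrier V. \<forall>w\<in>carrier V. c \<odot>\<^bsub>V\<^esub> (v \<oplus>\<^bsub>V\<^esub> w) = c \<odot>\<^bsub>V\<^esub> v \<oplus>\<^bsub>V\<^esub> c \<odot>\<^bsub>V\<^esub> w)
    \<and> (\<forall>x. \<forall>v\<in>carrier V. act V x v \<in> carrier V)
    \<and> (\<forall>x. \<forall>v\<in>carrier V. \<forall>w\<in>carrier V. act V x (v \<oplus>\<^bsub>V\<^esub> w) = act V x v \<oplus>\<^bsub>V\<^esub> act V x w)"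

lemma operator_moduleD:
  assumes "operator_module V"
  shows "abelian_group V" "v \<in> carrier V \<Longrightarrow> c \<odot>\<^bsub>V\<^esub> v \<in> carrier V"
    "v \<in> carrier V \<Longrightarrow> w \<in> carrier V \<Longrightarrow> c \<odot>\<^bsub>V\<^esub> (v \<oplus>\<^bsub>V\<^esub> w) = c \<odot>\<^bsub>V\<^esub> v \<oplus>\<^bsub>V\<^esub> c \<odot>\<^bsub>V\<^esub> w"
    "v \<in> carrier V \<Longrightarrow> act V x v \<in> carrier V"
    "v \<in> carrier V \<Longrightarrow> w \<in> carrier V \<Longrightarrow> act V x (v \<oplus>\<^bsub>V\<^esub> w) = act V x v \<oplus>\<^bsub>V\<^esub> act V x w"
  using assms unfolding operator_module_def by blast+

lemma vf_submodule_iff: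
  assumes "abelian_group V"
  shows "vf_submodule V W \<longleftrightarrow> W \<subseteq> carrier V \<and> \<zero>\<^bsub>V\<^esub> \<in> W \<and> (\<forall>v\<in>W. \<forall>w\<in>W. v \<oplus>\<^bsub>V\<^esub> w \<in> W)
    \<and> (\<forall>v\<in>W. \<ominus>\<^bsub>V\<^esub> v \<in> W) \<and> (\<forall>c. \<forall>v\<in>W. c \<odot>\<^bsub>V\<^esub> v \<in> W) \<and> (\<forall>x. \<forall>v\<in>W. act V x v \<in> W)"
    (is "_ \<longleftrightarrow> ?R")
proof
  assume L: "vf_submodule V W"
  then have s: "subgroup W (add_monoid V)" and c: "\<And>a x. x \<in> W \<Longrightarrow> a \<odot>\<^bsub>V\<^esub> x \<in> W"
    unfolding vf_submodule_def submodule_def submodule_axioms_def complex_field_def by auto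
  show ?R
    using subgroup.subset[OF s] subgroup.one_closed[OF s] subgroup.m_closed[OF s] subgroup.m_inv_closed[OF s] c L
    unfolding vf_submodule_def a_inv_def by auto
next
  assume R: ?R
  have "subgroup W (add_monoid V)"
    by (rule subgroup.intro) (use R in \<open>auto simp: a_inv_def\<close>)
  then show "vf_submodule V W"
    using R unfolding vf_submodule_def submodule_def submodule_axioms_def by auto
qed

lemma vf_submoduleD:
  assumes "abelian_group V" "vf_submodule V W"
  shows "W \<subseteq> carrier V" "\<zero>\<^bsub>V\<^esub> \<in> W" "v \<in> W \<Longrightarrow> w \<in> W \<Longrightarrow> v \<oplus>\<^bsub>V\<^esub> w \<in> W"
    "v \<in> W \<Longrightarrow> \<ominus>\<^bsub>V\<^esub> v \<in> W" "v \<in> W \<Longrightarrow> c \<odot>\<^bsub>V\<^esub> v \<in> W" "v \<in> W \<Longrightarrow> act V x v \<in> W"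
  using assms(2) unfolding vf_submodule_iff[OF assms(1)] by blast+

locale quotient_setup =
  fixes V :: "'v vf_module" and W :: "'v set"
  assumes V: "operator_module V" and W: "vf_submodule V W"
begin

lemma abV: "abelian_group V" by (rule operator_moduleD(1)[OF V])

lemma abW: "abelian_subgroup W V"
proof (rule abelian_subgroupI3[OF additive_subgroupI abV])
  show "subgroup W (add_monoid V)"
    using W unfolding vf_submodule_def submodule_def by blast
qed

sublocale abelian_group V by (rule abV)

abbreviation cls :: "'v \<Rightarrow> 'v set" where "cls v \<equiv> W +>\<^bsub>V\<^esub> v"
abbreviation Q :: "'v set vf_module" where "Q \<equiv> quot_module V W"

lemma cls_eqI: "w \<in> W \<Longrightarrow> v \<in> carrier V \<Longrightarrow> cls (w \<oplus>\<^bsub>V\<^esub> v) = cls v"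
  using abelian_subgroup.a_repr_independence'[OF abW a_rcosI] vf_submoduleD(1)[OF abV W] by metis

lemma mem_cls: "x \<in> cls v \<longleftrightarrow> (\<exists>w\<in>W. x = w \<oplus>\<^bsub>V\<^esub> v)"
  unfolding a_r_coset_def' by auto

lemma cls_eq_iff:
  assumes "v \<in> carrier V" "w \<in> carrier V"
  shows "cls v = cls w \<longleftrightarrow> v \<ominus>\<^bsub>V\<^esub> w \<in> W"
proof
  assume "cls v = cls w"
  then have "v \<in> cls w" using abelian_subgroup.a_rcos_self[OF abW assms(1)] by simp
  then obtain u where u: "u \<in> W" "v = u \<oplus>\<^bsub>V\<^esub> w" unfolding mem_cls by blast
  then have "v \<ominus>\<^bsub>V\<^esub> w = u" using assms vf_submoduleD(1)[OF abV W] by (auto simp: a_minus_def a_assoc r_neg)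
  then show "v \<ominus>\<^bsub>V\<^esub> w \<in> W" using u by simp
next
  assume d: "v \<ominus>\<^bsub>V\<^esub> w \<in> W"
  have "v = (v \<ominus>\<^bsub>V\<^esub> w) \<oplus>\<^bsub>V\<^esub> w" using assms by (simp add: a_minus_def a_assoc l_neg)
  then show "cls v = cls w" using cls_eqI[OF d assms(2)] by simp
qed

lemma Q_carrier: "carrier Q = cls ` carrier V"
  unfolding quot_module_def A_RCOSETS_def RCOSETS_def a_r_coset_def by auto

lemma Q_zero: "\<zero>\<^bsub>Q\<^esub> = cls \<zero>\<^bsub>V\<^esub>"
  using a_coset_add_zero[OF vf_submoduleD(1)[OF abV W]] by (simp add: quot_module_def)

lemma Q_add: "v \<in> carrier V \<Longrightarrow> w \<in> carrier V \<Longrightarrow> cls v \<oplus>\<^bsub>Q\<^esub> cls w = cls (v \<oplus>\<^bsub>V\<^esub> w)"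
  using abelian_subgroup.a_rcos_sum[OF abW] by (simp add: quot_module_def)

text \<open>
  The scalar and Lie algebra actions on cosets are given as unions over representatives; all
  representatives contribute the same coset.
\<close>

lemma Q_lift:
  assumes "\<And>w. w \<in> W \<Longrightarrow> f (w \<oplus>\<^bsub>V\<^esub> v) \<in> (\<lambda>u. u \<oplus>\<^bsub>V\<^esub> f v) ` W" "v \<in> carrier V" "f v \<in> carrier V"
  shows "(\<Union>u\<in>cls v. cls (f u)) = cls (f v)"
proof -
  have "cls (f u) = cls (f v)" if "u \<in> cls v" for u
    using that assms cls_eqI unfolding mem_cls by force
  moreover have "v \<in> cls v" by (rule abelian_subgroup.a_rcos_self[OF abW assms(2)])
  ultimately show ?thesis by blast
qed

lemma Q_smult: "v \<in> carrier V \<Longrightarrow> c \<odot>\<^bsub>Q\<^esub> cls v = cls (c \<odot>\<^bsub>V\<^esub> v)"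
  unfolding quot_module_def using vf_submoduleD(1,5)[OF abV W]
  by (simp, intro Q_lift) (auto simp: operator_moduleD[OF V] subset_eq)

lemma Q_act: "v \<in> carrier V \<Longrightarrow> act Q x (cls v) = cls (act V x v)"
  unfolding quot_module_def using vf_submoduleD(1,6)[OF abV W]
  by (simp, intro Q_lift) (auto simp: operator_moduleD[OF V] subset_eq)

lemma Q_abelian: "abelian_group Q"
proof (rule abelian_groupI)
  fix X Y Z
  assume "X \<in> carrier Q" "Y \<in> carrier Q" "Z \<in> carrier Q"
  then obtain x y z where [simp]: "X = cls x" "Y = cls y" "Z = cls z"
    and [simp]: "x \<in> carrier V" "y \<in> carrier V" "z \<in> carrier V"
    unfolding Q_carrier by auto
  show "X \<oplus>\<^bsub>Q\<^esub> Y \<in> carrier Q" by (simp add: Q_add) (simp add: Q_carrier)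
  show "(X \<oplus>\<^bsub>Q\<^esub> Y) \<oplus>\<^bsub>Q\<^esub> Z = X \<oplus>\<^bsub>Q\<^esub> (Y \<oplus>\<^bsub>Q\<^esub> Z)" by (simp add: Q_add a_assoc)
  show "X \<oplus>\<^bsub>Q\<^esub> Y = Y \<oplus>\<^bsub>Q\<^esub> X" by (simp add: Q_add a_comm)
  show "\<zero>\<^bsub>Q\<^esub> \<oplus>\<^bsub>Q\<^esub> X = X" by (simp add: Q_add Q_zero)
  have "cls (\<ominus>\<^bsub>V\<^esub> x) \<oplus>\<^bsub>Q\<^esub> X = \<zero>\<^bsub>Q\<^esub>" by (simp add: Q_add Q_zero l_neg)
  then show "\<exists>y\<in>carrier Q. y \<oplus>\<^bsub>Q\<^esub> X = \<zero>\<^bsub>Q\<^esub>" unfolding Q_carrier by force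
qed (simp add: Q_zero, simp add: Q_carrier)

lemma Q_module: "operator_module Q"
  unfolding operator_module_def
proof (intro conjI allI ballI Q_abelian)
  fix X Y x c
  assume "X \<in> carrier Q" "Y \<in> carrier Q"
  then obtain v w where [simp]: "X = cls v" "Y = cls w" "v \<in> carrier V" "w \<in> carrier V"
    unfolding Q_carrier by auto
  note [simp] = Q_add Q_smult Q_act operator_moduleD[OF V]
  show "c \<odot>\<^bsub>Q\<^esub> (X \<oplus>\<^bsub>Q\<^esub> Y) = c \<odot>\<^bsub>Q\<^esub> X \<oplus>\<^bsub>Q\<^esub> c \<odot>\<^bsub>Q\<^esub> Y" by simp
  show "act Q x (X \<oplus>\<^bsub>Q\<^esub> Y) = act Q x X \<oplus>\<^bsub>Q\<^esub> act Q x Y" by simp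
next
  fix X x c
  assume "X \<in> carrier Q"
  then obtain v where [simp]: "X = cls v" "v \<in> carrier V"
    unfolding Q_carrier by auto
  show "c \<odot>\<^bsub>Q\<^esub> X \<in> carrier Q" by (simp add: Q_smult) (simp add: Q_carrier operator_moduleD[OF V])
  show "act Q x X \<in> carrier Q" by (simp add: Q_act) (simp add: Q_carrier operator_moduleD[OF V])
qed

lemma Q_uminus: "v \<in> carrier V \<Longrightarrow> \<ominus>\<^bsub>Q\<^esub> cls v = cls (\<ominus>\<^bsub>V\<^esub> v)"
proof -
  assume v: "v \<in> carrier V"
  interpret Q: abelian_group Q by (rule Q_abelian)
  have c: "cls v \<in> carrier Q" "cls (\<ominus>\<^bsub>V\<^esub> v) \<in> carrier Q" using v by (auto simp: Q_carrier)
  have "cls (\<ominus>\<^bsub>V\<^esub> v) \<oplus>\<^bsub>Q\<^esub> cls v = \<zero>\<^bsub>Q\<^esub>" using v by (simp add: Q_add Q_zero l_neg)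
  then show "\<ominus>\<^bsub>Q\<^esub> cls v = cls (\<ominus>\<^bsub>V\<^esub> v)" using c by (rule Q.minus_equality)
qed

definition preim :: "'v set set \<Rightarrow> 'v set" where "preim N = {v \<in> carrier V. cls v \<in> N}"

lemma preim_submodule:
  assumes N: "vf_submodule Q N"
  shows "vf_submodule V (preim N)" "W \<subseteq> preim N" "N = cls ` preim N"
proof -
  note S = vf_submoduleD[OF Q_abelian N]
  show "vf_submodule V (preim N)"
    unfolding vf_submodule_iff[OF abV] preim_def
    using S by (auto simp: operator_moduleD[OF V] simp flip: Q_zero Q_add Q_uminus Q_smult Q_act)
  show "W \<subseteq> preim N"
  proof
    fix w assume w: "w \<in> W"
    then have c: "w \<in> carrier V" using vf_submoduleD(1)[OF abV W] by blast
    have "cls w = \<zero>\<^bsub>Q\<^esub>" unfolding Q_zero using cls_eqI[OF w zero_closed] c by simp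
    then show "w \<in> preim N" using c S(2) by (simp add: preim_def)
  qed
  show "N = cls ` preim N" using S(1) unfolding preim_def Q_carrier by blast
qed

lemma image_submodule:
  assumes K: "vf_submodule V K"
  shows "vf_submodule Q (cls ` K)"
proof -
  note S = vf_submoduleD[OF abV K]
  have c: "v \<in> K \<Longrightarrow> v \<in> carrier V" for v using S(1) by blast
  show ?thesis
    unfolding vf_submodule_iff[OF Q_abelian]
  proof (intro conjI ballI allI)
    show "cls ` K \<subseteq> carrier Q" using S(1) by (auto simp: Q_carrier)
    show "\<zero>\<^bsub>Q\<^esub> \<in> cls ` K" using S(2) by (simp add: Q_zero)
    fix X Y assume "X \<in> cls ` K" "Y \<in> cls ` K"
    then show "X \<oplus>\<^bsub>Q\<^esub> Y \<in> cls ` K" using S(3) c by (auto simp: Q_add)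
  next
    fix X assume "X \<in> cls ` K"
    then show "\<ominus>\<^bsub>Q\<^esub> X \<in> cls ` K" using S(4) c by (auto simp: Q_uminus)
  next
    fix X a assume "X \<in> cls ` K"
    then show "a \<odot>\<^bsub>Q\<^esub> X \<in> cls ` K" using S(5) c by (auto simp: Q_smult)
  next
    fix X x assume "X \<in> cls ` K"
    then show "act Q x X \<in> cls ` K" using S(6) c by (auto simp: Q_act)
  qed
qed

lemma cls_mem_image:
  assumes K: "vf_submodule V K" "W \<subseteq> K" and v: "v \<in> carrier V"
  shows "cls v \<in> cls ` K \<longleftrightarrow> v \<in> K"
proof
  assume "cls v \<in> cls ` K"
  then obtain k where k: "k \<in> K" "cls v = cls k" by blast
  note S = vf_submoduleD[OF abV K(1)]
  have kc: "k \<in> carrier V" using k S(1) by blast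
  then have "v \<ominus>\<^bsub>V\<^esub> k \<in> K" using k(2) cls_eq_iff[OF v kc] K(2) by blast
  then have "(v \<ominus>\<^bsub>V\<^esub> k) \<oplus>\<^bsub>V\<^esub> k \<in> K" using k by (intro S(3))
  then show "v \<in> K" using v kc by (simp add: a_minus_def a_assoc l_neg)
qed blast

end

section \<open>The tensor product and its submodules\<close>

abbreviation ET :: "(int \<Rightarrow>\<^sub>0 env_alg) vf_module" where "ET \<equiv> env_tensor_T"
abbreviation emul :: "env_alg \<Rightarrow> (int \<Rightarrow>\<^sub>0 env_alg) \<Rightarrow> (int \<Rightarrow>\<^sub>0 env_alg)" where
  "emul a \<equiv> Poly_Mapping.map ((*) a)"

lemma lookup_emul [simp]: "lookup (emul a s) k = a * lookup s k"
  by (simp add: map.rep_eq when_def)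

lemma emul_simps: "emul a (s + t) = emul a s + emul a t" "emul a 0 = 0" "emul a (- s) = - emul a s"
  "emul a (s - t) = emul a s - emul a t"
  "emul (a + b) s = emul a s + emul b s" "emul (a - b) s = emul a s - emul b s"
  "emul a (emul b s) = emul (a * b) s"
  by (rule poly_mapping_eqI; simp add: lookup_add lookup_minus algebra_simps)+

lemma ET_simps [simp]: "carrier ET = UNIV" "\<zero>\<^bsub>ET\<^esub> = 0" "v \<oplus>\<^bsub>ET\<^esub> w = v + w"
  "c \<odot>\<^bsub>ET\<^esub> v = emul (env_scalar c) v" "act ET x v = emul (env_of_vf x) v"
  by (simp_all add: env_tensor_T_def)

lemma ET_module: "operator_module ET"
proof -
  have "abelian_group ET"
    by (rule abelian_groupI) (auto simp: add_ac intro: exI[of _ "- _"] left_minus)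
  then show ?thesis by (simp add: operator_module_def emul_simps)
qed

lemma ET_uminus [simp]: "\<ominus>\<^bsub>ET\<^esub> v = - v"
proof -
  interpret abelian_group ET by (rule operator_moduleD(1)[OF ET_module])
  show ?thesis by (rule minus_equality) auto
qed

lemma ET_submodule_iff: "vf_submodule ET W \<longleftrightarrow> 0 \<in> W \<and> (\<forall>v\<in>W. \<forall>w\<in>W. v + w \<in> W)
    \<and> (\<forall>v\<in>W. - v \<in> W) \<and> (\<forall>c. \<forall>v\<in>W. emul (env_scalar c) v \<in> W) \<and> (\<forall>x. \<forall>v\<in>W. emul (env_of_vf x) v \<in> W)"
  by (subst vf_submodule_iff[OF operator_moduleD(1)[OF ET_module]]) simp

lemma ET_submoduleD:
  assumes "vf_submodule ET W"
  shows "0 \<in> W" "v \<in> W \<Longrightarrow> w \<in> W \<Longrightarrow> v + w \<in> W" "v \<in> W \<Longrightarrow> - v \<in> W" "v \<in> W \<Longrightarrow> w \<in> W \<Longrightarrow> v - w \<in> W"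
    "v \<in> W \<Longrightarrow> emul (env_scalar c) v \<in> W" "v \<in> W \<Longrightarrow> emul (env_of_vf x) v \<in> W"
proof -
  show *: "0 \<in> W" "v \<in> W \<Longrightarrow> w \<in> W \<Longrightarrow> v + w \<in> W" "v \<in> W \<Longrightarrow> - v \<in> W"
    "v \<in> W \<Longrightarrow> emul (env_scalar c) v \<in> W" "v \<in> W \<Longrightarrow> emul (env_of_vf x) v \<in> W" for v w
    using assms unfolding ET_submodule_iff by blast+
  show "v \<in> W \<Longrightarrow> w \<in> W \<Longrightarrow> v - w \<in> W" using *(2)[of v "- w"] *(3)[of w] by simp
qed

lemma balancing_submodule: "vf_submodule ET (balancing \<alpha> \<beta> \<gamma>)"
  unfolding balancing_def hull_def ET_submodule_iff by blast

lemma balancing_generator: "x \<in> vf_nonneg \<Longrightarrow>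
   pure_tensor (u * env_of_vf x) t - pure_tensor u (T_act \<alpha> \<beta> \<gamma> x t) \<in> balancing \<alpha> \<beta> \<gamma>"
  unfolding balancing_def by (intro hull_inc) blast

lemma env_scalar_simps: "env_scalar (c + d) = env_scalar c + env_scalar d" "env_scalar 0 = 0"
  "env_scalar (c - d) = env_scalar c - env_scalar d"
  "env_scalar c * env_scalar d = env_scalar (c * d)"
  by (simp_all add: env_scalar.abs_eq zero_env_alg.abs_eq plus_env_alg.abs_eq minus_env_alg.abs_eq
      times_env_alg.abs_eq single_add single_diff mult_single)

lemma single_0_central: "single 0 c * r = r * single 0 (c :: complex)"
  for r :: tensor_alg
proof -
  have "single 0 c * sum f S = sum f S * single 0 c"
    if "\<And>u. u \<in> S \<Longrightarrow> single 0 c * f u = f u * single 0 c"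
    for f :: "vf_basis fword \<Rightarrow> tensor_alg" and S
    using that by (simp add: sum_distrib_left sum_distrib_right)
  then have "single 0 c * (\<Sum>u\<in>keys r. single u (lookup r u))
     = (\<Sum>u\<in>keys r. single u (lookup r u)) * single 0 c"
    by (simp add: mult_single mult.commute)
  then show ?thesis unfolding pm_expand[of r, symmetric] .
qed

lemma env_scalar_central: "env_scalar c * a = a * env_scalar c"
  by (induction a rule: env_alg.abs_induct)
    (simp add: env_scalar.abs_eq times_env_alg.abs_eq single_0_central)

lemma env_scalar_1: "env_scalar 1 * a = a" "a * env_scalar 1 = a"
  by (induction a rule: env_alg.abs_induct)
    (simp_all add: env_scalar.abs_eq times_env_alg.abs_eq)

lemma tens_of_vf_linear: "tens_of_vf (x + y) = tens_of_vf x + tens_of_vf y"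
  "tens_of_vf (scale_pm c x) = single 0 c * tens_of_vf x"
proof -
  show "tens_of_vf (x + y) = tens_of_vf x + tens_of_vf y"
    by (simp add: tens_of_vf_def lin_ext_add)
  have "scale_pm c r = single 0 c * r" for r :: tensor_alg
    by (simp add: scale_pm_def mult_map_scale_conv_mult)
  then show "tens_of_vf (scale_pm c x) = single 0 c * tens_of_vf x"
    by (simp add: tens_of_vf_def lin_ext_scale)
qed

lemma env_of_vf_linear: "env_of_vf (x + y) = env_of_vf x + env_of_vf y"
  "env_of_vf (scale_pm c x) = env_scalar c * env_of_vf x"
  by (simp_all add: env_of_vf.abs_eq plus_env_alg.abs_eq times_env_alg.abs_eq env_scalar.abs_eq
      tens_of_vf_linear)

lemma env_of_vf_bracket:
  "env_of_vf x * env_of_vf y = env_of_vf y * env_of_vf x + env_of_vf (bracket x y)"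
proof -
  have "1 * (tens_of_vf x * tens_of_vf y - tens_of_vf y * tens_of_vf x - tens_of_vf (bracket x y)) * 1 \<in> env_ideal"
    by (rule env_ideal.rel)
  then have "env_rel (tens_of_vf x * tens_of_vf y) (tens_of_vf y * tens_of_vf x + tens_of_vf (bracket x y))"
    by (simp add: env_rel_def algebra_simps)
  then show ?thesis
    by (simp add: env_of_vf.abs_eq plus_env_alg.abs_eq times_env_alg.abs_eq env_alg.abs_eq_iff)
qed

abbreviation top_vec :: "(int \<Rightarrow>\<^sub>0 complex) \<Rightarrow> (int \<Rightarrow>\<^sub>0 env_alg)" where
  "top_vec t \<equiv> pure_tensor (env_scalar 1) t"

abbreviation amul :: "vf_basis \<Rightarrow> (int \<Rightarrow>\<^sub>0 env_alg) \<Rightarrow> (int \<Rightarrow>\<^sub>0 env_alg)" where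
  "amul i \<equiv> emul (env_of_vf (single i 1))"

lemma lookup_pure_tensor: "lookup (pure_tensor u t) k = u * env_scalar (lookup t k)"
  by (simp add: pure_tensor_def map.rep_eq when_def env_scalar_simps)

lemma pure_tensor_simps: "pure_tensor u 0 = 0"
  "emul a (pure_tensor u t) = pure_tensor (a * u) t"
  by (rule poly_mapping_eqI; simp add: lookup_pure_tensor env_scalar_simps mult.assoc)+

lemma pure_tensor_scale: "pure_tensor u (scale_pm c t) = emul (env_scalar c) (pure_tensor u t)"
proof (rule poly_mapping_eqI)
  fix k
  let ?d = "lookup t k"
  have "u * env_scalar (c * ?d) = (u * env_scalar c) * env_scalar ?d"
    by (simp add: env_scalar_simps mult.assoc)
  also have "\<dots> = env_scalar c * (u * env_scalar ?d)"
    by (simp only: env_scalar_central[of c u, symmetric] mult.assoc)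
  finally show "lookup (pure_tensor u (scale_pm c t)) k
      = lookup (emul (env_scalar c) (pure_tensor u t)) k"
    by (simp only: lookup_pure_tensor lookup_emul lookup_scale_pm)
qed

text \<open>
  An induction principle: the enveloping algebra is a quotient of the tensor algebra, so everything is
  obtained from the basis of the top by applying derivations letter by letter.
\<close>

lemma ET_generated:
  assumes zero: "0 \<in> S" and add: "\<And>s t. s \<in> S \<Longrightarrow> t \<in> S \<Longrightarrow> s + t \<in> S"
    and scale: "\<And>c s. s \<in> S \<Longrightarrow> emul (env_scalar c) s \<in> S"
    and act: "\<And>i s. s \<in> S \<Longrightarrow> amul i s \<in> S"
    and top: "\<And>k. top_vec (single k 1) \<in> S"
  shows "s \<in> S"
proof -
  have Ssum: "sum f A \<in> S" if "\<And>a. a \<in> A \<Longrightarrow> f a \<in> S" for f :: "'c \<Rightarrow> _" and A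
    using that by (induction A rule: infinite_finite_induct) (auto intro: zero add)
  have word: "single k (abs_env_alg (single (FWord ws) c)) \<in> S" for k c ws
  proof (induction ws)
    case Nil
    have "abs_env_alg (single (FWord []) c) = env_scalar c"
      by (simp add: env_scalar.abs_eq zero_fword_def)
    then have "single k (abs_env_alg (single (FWord []) c))
       = emul (env_scalar c) (top_vec (single k 1))"
      by (intro poly_mapping_eqI)
        (auto simp: lookup_pure_tensor lookup_single when_def env_scalar_simps)
    then show ?case using scale[OF top] by simp
  next
    case (Cons i ws)
    have "single (FWord (i # ws)) c = tens_of_vf (single i 1) * single (FWord ws) c"
      by (simp add: tens_of_vf_def mult_single plus_fword_def)
    then have "single k (abs_env_alg (single (FWord (i # ws)) c))
       = amul i (single k (abs_env_alg (single (FWord ws) c)))"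
      by (intro poly_mapping_eqI)
        (auto simp: lookup_single when_def env_of_vf.abs_eq times_env_alg.abs_eq)
    then show ?case using act[OF Cons.IH] by simp
  qed
  have abs_sum: "abs_env_alg (sum f A) = (\<Sum>a\<in>A. abs_env_alg (f a))" for f :: "vf_basis fword \<Rightarrow> tensor_alg" and A
    by (induction A rule: infinite_finite_induct)
      (auto simp: zero_env_alg.abs_eq simp flip: plus_env_alg.abs_eq)
  have single_sum: "single k (sum f A) = (\<Sum>a\<in>A. single k (f a))"
    for f :: "vf_basis fword \<Rightarrow> env_alg" and A and k :: int
    by (induction A rule: infinite_finite_induct) (auto simp: single_add)
  have "single k a \<in> S" for k a
  proof (induction a rule: env_alg.abs_induct)
    case (1 r)
    have "single k (abs_env_alg (\<Sum>u\<in>keys r. single u (lookup r u))) \<in> S"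
      unfolding abs_sum single_sum
    proof (rule Ssum)
      fix u
      show "single k (abs_env_alg (single u (lookup r u))) \<in> S"
        using word[of k "letters u"] by simp
    qed
    then show ?case unfolding pm_expand[of r, symmetric] .
  qed
  moreover have "s = (\<Sum>k\<in>keys s. single k (lookup s k))"
  proof (rule poly_mapping_eqI)
    fix k
    have "(\<Sum>i\<in>keys s. lookup (single i (lookup s i)) k)
        = (\<Sum>i\<in>keys s. if i = k then lookup s k else 0)"
      by (rule sum.cong) (auto simp: lookup_single when_def)
    then show "lookup s k
        = lookup (\<Sum>k\<in>keys s. single k (lookup s k)) k"
      by (simp add: lookup_sum in_keys_iff)
  qed
  ultimately show ?thesis using Ssum by metis
qed

lemma bracket_basis_single: "bracket (single i 1) (single j 1) = bracket_basis i j"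
  by (simp add: bracket_def)

section \<open>The irreducible quotient is the Fock space\<close>

context torus_fock
begin

abbreviation bal :: "(int \<Rightarrow>\<^sub>0 env_alg) set" where
  "bal \<equiv> balancing \<alpha> (- (\<alpha> * (\<alpha> + 1) / 2)) \<gamma>"

abbreviation topw :: complex where "topw \<equiv> - (\<alpha> * (\<alpha> + 1) / 2)"

fun word_op :: "vf_basis list \<Rightarrow> operator" where
  "word_op [] = 1"
| "word_op (i # ws) = rep i * word_op ws"

lemma word_op_append: "word_op (u @ w) = word_op u * word_op w"
  by (induction u) (simp_all add: mult.assoc del: rep.simps)

text \<open>
  The action extends from words of derivations to the tensor algebra; the bracket relation makes it
  vanish on the defining ideal of the enveloping algebra.
\<close>

definition tens_op :: "tensor_alg \<Rightarrow> operator" where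
  "tens_op r = (\<Sum>u\<in>keys r. lookup r u *\<^sub>C word_op (letters u))"

lemma tens_op_superset:
  assumes "finite S" "keys r \<subseteq> S"
  shows "tens_op r = (\<Sum>u\<in>S. lookup r u *\<^sub>C word_op (letters u))"
  unfolding tens_op_def using assms by (intro sum.mono_neutral_left) (auto simp: in_keys_iff)

lemma tens_op_single [simp]: "tens_op (single u c) = c *\<^sub>C word_op (letters u)"
  by (simp add: tens_op_def)

lemma tens_op_0 [simp]: "tens_op 0 = 0"
  by (simp add: tens_op_def)

lemma tens_op_add: "tens_op (r + s) = tens_op r + tens_op s"
proof -
  let ?S = "keys r \<union> keys s"
  have "keys (r + s) \<subseteq> ?S" by (rule keys_add)
  then show ?thesis
    by (simp add: tens_op_superset[of ?S] lookup_add sm_distrib sum.distrib)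
qed

lemma tens_op_diff: "tens_op (r - s) = tens_op r - tens_op s"
  using tens_op_add[of "r - s" s] by (simp add: eq_diff_eq)

lemma tens_op_sum: "tens_op (sum f A) = (\<Sum>a\<in>A. tens_op (f a))"
  by (induction A rule: infinite_finite_induct) (auto simp: tens_op_add)

lemma tens_op_mult: "tens_op (r * s) = tens_op r * tens_op s"
proof -
  let ?e = "\<lambda>r u. single u (lookup r u) :: tensor_alg"
  have e: "r = (\<Sum>u\<in>keys r. ?e r u)" "s = (\<Sum>w\<in>keys s. ?e s w)"
    by (rule pm_expand)+
  have "r * s = (\<Sum>u\<in>keys r. \<Sum>w\<in>keys s. ?e r u * ?e s w)"
    by (subst e(1), subst e(2)) (rule sum_product)
  moreover have "tens_op (?e r u * ?e s w) = tens_op (?e r u) * tens_op (?e s w)" for u w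
    by (simp add: mult_single plus_fword_def word_op_append mult.commute)
  ultimately have "tens_op (r * s) = (\<Sum>u\<in>keys r. \<Sum>w\<in>keys s. tens_op (?e r u) * tens_op (?e s w))"
    by (simp only: tens_op_sum)
  also have "\<dots> = (\<Sum>u\<in>keys r. tens_op (?e r u)) * (\<Sum>w\<in>keys s. tens_op (?e s w))"
    by (rule sum_product[symmetric])
  also have "\<dots> = tens_op r * tens_op s"
    unfolding tens_op_sum[symmetric] e[symmetric] ..
  finally show ?thesis .
qed

lemma tens_op_vf: "tens_op (tens_of_vf x) = rho x"
proof -
  have "tens_op (scale_pm c r) = c *\<^sub>C tens_op r" for c r
  proof -
    have "scale_pm c r = single 0 c * r"
      by (simp add: scale_pm_def mult_map_scale_conv_mult)
    then show ?thesis by (simp add: tens_op_mult zero_fword_def)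
  qed
  then show ?thesis
    by (simp add: tens_of_vf_def lin_ext_def tens_op_sum rho_def del: scale_pm_simps(5))
qed

lemma tens_op_ideal: "r \<in> env_ideal \<Longrightarrow> tens_op r = 0"
proof (induction rule: env_ideal.induct)
  case (rel a x y b)
  show ?case
    by (simp add: tens_op_mult tens_op_diff tens_op_vf rho_bracket)
qed (simp_all add: tens_op_add)

definition env_op :: "env_alg \<Rightarrow> operator" where
  "env_op a = tens_op (rep_env_alg a)"

lemma env_op_abs: "env_op (abs_env_alg r) = tens_op r"
proof -
  have "env_rel r r" by (simp add: env_rel_def env_ideal.zero)
  then have "env_rel (rep_env_alg (abs_env_alg r)) r"
    by (rule Quotient_rep_abs[OF Quotient_env_alg])
  then have "tens_op (rep_env_alg (abs_env_alg r) - r) = 0"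
    unfolding env_rel_def by (rule tens_op_ideal)
  then show ?thesis by (simp add: env_op_def tens_op_diff)
qed

lemma env_op_add: "env_op (a + b) = env_op a + env_op b"
  by (induction a rule: env_alg.abs_induct, induction b rule: env_alg.abs_induct)
    (simp add: plus_env_alg.abs_eq env_op_abs tens_op_add)

lemma env_op_mult: "env_op (a * b) = env_op a * env_op b"
  by (induction a rule: env_alg.abs_induct, induction b rule: env_alg.abs_induct)
    (simp add: times_env_alg.abs_eq env_op_abs tens_op_mult)

lemma env_op_simps [simp]: "env_op 0 = 0" "env_op (env_of_vf x) = rho x" "env_op (env_scalar c) = c *\<^sub>C 1"
  by (simp_all add: zero_env_alg.abs_eq env_of_vf.abs_eq env_scalar.abs_eq env_op_abs tens_op_vf zero_fword_def)

subsection \<open>The map from the tensor product onto the Fock space\<close>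

text \<open>
  The map \<open>u \<otimes> v \<mapsto> u v\<close> that the universal property of the induced module provides.
\<close>

definition realize :: "(int \<Rightarrow>\<^sub>0 env_alg) \<Rightarrow> fock" where
  "realize s = (\<Sum>k\<in>keys s. app (env_op (lookup s k)) (vac k))"

lemma realize_superset:
  assumes "finite S" "keys s \<subseteq> S"
  shows "realize s = (\<Sum>k\<in>S. app (env_op (lookup s k)) (vac k))"
  unfolding realize_def using assms by (intro sum.mono_neutral_left) (auto simp: in_keys_iff)

lemma realize_add: "realize (s + t) = realize s + realize t"
proof -
  let ?S = "keys s \<union> keys t"
  have "keys (s + t) \<subseteq> ?S" by (rule keys_add)
  then show ?thesis
    by (simp add: realize_superset[of ?S] lookup_add env_op_add sum.distrib)
qed

lemma realize_0 [simp]: "realize 0 = 0"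
  by (simp add: realize_def)

lemma realize_uminus: "realize (- s) = - realize s"
  using realize_add[of s "- s"] by (simp add: minus_unique)

lemma realize_diff: "realize (s - t) = realize s - realize t"
  using realize_add[of s "- t"] by (simp add: realize_uminus)

lemma realize_sum: "realize (sum f A) = (\<Sum>a\<in>A. realize (f a))"
  by (induction A rule: infinite_finite_induct) (auto simp: realize_add)

lemma realize_emul: "realize (emul a s) = app (env_op a) (realize s)"
proof -
  have "keys (emul a s) \<subseteq> keys s"
    by (auto simp: in_keys_iff)
  then have "realize (emul a s) = (\<Sum>k\<in>keys s. app (env_op (lookup (emul a s) k)) (vac k))"
    by (intro realize_superset) auto
  then show ?thesis by (simp add: realize_def app_sum env_op_mult)
qed

lemma realize_scalar: "realize (emul (env_scalar c) s) = scale_pm c (realize s)"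
  and realize_act: "realize (emul (env_of_vf x) s) = app (rho x) (realize s)"
  by (simp_all add: realize_emul)

definition embed :: "(int \<Rightarrow>\<^sub>0 complex) \<Rightarrow> fock" where
  "embed = lin_ext (\<lambda>k. vac k)"

lemma lin_ext_lin_ext: "lin_ext f (lin_ext g x) = lin_ext (\<lambda>i. lin_ext f (g i)) x"
  by (simp add: lin_ext_def[of _ x] linear_pm_sum[OF linear_pm_lin_ext] lin_ext_scale
      del: scale_pm_simps)

lemma realize_pure: "realize (pure_tensor u t) = app (env_op u) (embed t)"
proof -
  have "keys (pure_tensor u t) \<subseteq> keys t"
    by (auto simp: in_keys_iff lookup_pure_tensor env_scalar_simps)
  then have "realize (pure_tensor u t)
     = (\<Sum>k\<in>keys t. app (env_op (lookup (pure_tensor u t) k)) (vac k))"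
    by (intro realize_superset) auto
  then show ?thesis
    by (simp add: lookup_pure_tensor env_op_mult embed_def lin_ext_def app_sum del: scale_pm_simps(5))
qed

lemma lookup_embed: "lookup (embed t) (k, 0) = lookup t k"
proof -
  have "lookup (embed t) (k, 0) = (\<Sum>i\<in>keys t. if i = k then lookup t k else 0)"
    unfolding embed_def lin_ext_def lookup_sum by (rule sum.cong) (auto simp: lookup_single when_def)
  then show ?thesis by (simp add: in_keys_iff)
qed

lemma rep_embed:
  assumes "0 \<le> t0_degree i"
  shows "app (rep i) (vac k) = embed (T_basis_act \<alpha> topw \<gamma> i k)"
proof (cases i)
  case (Monom j m a)
  consider "j = 0" | "j > 0" using assms Monom by force
  then show ?thesis
  proof cases
    case 1
    then show ?thesis using Monom by (cases a) (simp_all add: rep_vac_0 rep_vac_1 embed_def del: rep.simps)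
  next
    case 2
    then have "app (rep i) (vac k) = 0" using Monom by (intro rep_kills) simp
    moreover have "T_basis_act \<alpha> topw \<gamma> i k = 0" using 2 Monom by (cases a) auto
    ultimately show ?thesis by (simp add: embed_def)
  qed
qed

lemma rho_embed:
  assumes "x \<in> vf_nonneg"
  shows "app (rho x) (embed t) = embed (T_act \<alpha> topw \<gamma> x t)"
proof -
  have "app (rep i) (embed t) = lin_ext (\<lambda>k. app (rep i) (vac k)) t" for i
    by (simp add: embed_def lin_ext_def app_sum del: scale_pm_simps(5) rep.simps)
  then have "app (rho x) (embed t) = (\<Sum>i\<in>keys x. scale_pm (lookup x i)
      (lin_ext (\<lambda>k. app (rep i) (vac k)) t))"
    by (simp add: rho_def app_sum_endo del: rep.simps)
  also have "\<dots> = (\<Sum>i\<in>keys x. scale_pm (lookup x i)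
      (lin_ext (\<lambda>k. embed (T_basis_act \<alpha> topw \<gamma> i k)) t))"
    using assms by (intro sum.cong refl) (simp add: rep_embed vf_nonneg_def del: rep.simps)
  also have "\<dots> = embed (T_act \<alpha> topw \<gamma> x t)"
    unfolding lin_ext_def[of _ x, symmetric] T_act_def embed_def lin_ext_lin_ext ..
  finally show ?thesis .
qed

definition kernel :: "(int \<Rightarrow>\<^sub>0 env_alg) set" where
  "kernel = {s. realize s = 0}"

lemma kernel_submodule: "vf_submodule ET kernel"
  unfolding ET_submodule_iff kernel_def
  by (auto simp: realize_add realize_uminus realize_scalar realize_act)

text \<open>
  Because the top of the Fock space is the module \<open>T\<close>.
\<close>

lemma bal_subset_kernel: "bal \<subseteq> kernel"
  unfolding balancing_def
proof (rule hull_minimal)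
  show "vf_submodule ET kernel" by (rule kernel_submodule)
  show "{pure_tensor (u * env_of_vf x) t - pure_tensor u (T_act \<alpha> topw \<gamma> x t) |u x t. x \<in> vf_nonneg} \<subseteq> kernel"
    by (auto simp: kernel_def realize_diff realize_pure env_op_mult rho_embed)
qed

lemma image_rep_stable:
  assumes "vf_submodule ET K"
  shows "rep_stable (realize ` K)"
proof -
  note S = ET_submoduleD[OF assms]
  have "pm_subspace (realize ` K)"
    unfolding pm_subspace_def
  proof (intro conjI ballI allI)
    show "0 \<in> realize ` K" using S(1) by (auto intro: image_eqI[of _ _ 0])
    fix x y assume "x \<in> realize ` K" "y \<in> realize ` K"
    then show "x + y \<in> realize ` K" using S(2) by (auto simp flip: realize_add)
  next
    fix c x assume "x \<in> realize ` K"
    then show "scale_pm c x \<in> realize ` K" using S(5) by (auto simp flip: realize_scalar)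
  qed
  moreover have "app (rep i) w \<in> realize ` K" if w: "w \<in> realize ` K" for i w
  proof -
    obtain s where s: "s \<in> K" "w = realize s" using w by blast
    have "app (rep i) w = realize (amul i s)" by (simp add: s realize_act del: rep.simps)
    then show ?thesis using S(6)[OF s(1)] by blast
  qed
  ultimately show ?thesis unfolding rep_stable_def by blast
qed

subsection \<open>The grading of the induced module\<close>

text \<open>
  The component of depth \<open>n\<close> of the induced module, as a predicate on representatives: it is closed
  under adding elements of \<open>bal\<close>. It is generated by words in derivations of negative degree, without
  reference to a basis of the enveloping algebra.
\<close>

inductive graded :: "nat \<Rightarrow> (int \<Rightarrow>\<^sub>0 env_alg) \<Rightarrow> bool" where
  top: "graded 0 (top_vec t)"
| zero: "graded n 0"
| add: "graded n s \<Longrightarrow> graded n t \<Longrightarrow> graded n (s + t)"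
| scale: "graded n s \<Longrightarrow> graded n (emul (env_scalar c) s)"
| step: "t0_degree y < 0 \<Longrightarrow> graded n s \<Longrightarrow> graded (n + nat (- t0_degree y)) (amul y s)"
| bal: "graded n s \<Longrightarrow> b \<in> bal \<Longrightarrow> graded n (s + b)"

text \<open>
  Extension of the grading to negative depths, where the module vanishes; derivations then shift the
  grading without case distinctions.
\<close>

definition zgraded :: "int \<Rightarrow> (int \<Rightarrow>\<^sub>0 env_alg) \<Rightarrow> bool" where
  "zgraded z s \<longleftrightarrow> (if 0 \<le> z then graded (nat z) s else s \<in> bal)"

lemmas balD = ET_submoduleD[OF balancing_submodule]

lemma graded_bal: "b \<in> bal \<Longrightarrow> graded n b"
  using graded.bal[OF graded.zero] by simp

lemma zgraded_add: "zgraded z s \<Longrightarrow> zgraded z t \<Longrightarrow> zgraded z (s + t)"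
  and zgraded_scale: "zgraded z s \<Longrightarrow> zgraded z (emul (env_scalar c) s)"
  and zgraded_bal: "b \<in> bal \<Longrightarrow> zgraded z b"
  and zgraded_nat: "graded n s \<Longrightarrow> zgraded (int n) s"
  by (auto simp: zgraded_def graded_bal intro: graded.intros balD)

lemma zgraded_step: "t0_degree y < 0 \<Longrightarrow> zgraded z s \<Longrightarrow> zgraded (z - t0_degree y) (amul y s)"
proof -
  assume y: "t0_degree y < 0" and s: "zgraded z s"
  show ?thesis
  proof (cases "0 \<le> z")
    case True
    then have "graded (nat z + nat (- t0_degree y)) (amul y s)" using y s by (intro graded.step) (auto simp: zgraded_def)
    moreover have "nat z + nat (- t0_degree y) = nat (z - t0_degree y)" using True y by simp
    ultimately show ?thesis using True y by (simp add: zgraded_def)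
  next
    case False
    then have "amul y s \<in> bal" using s balD(6) by (simp add: zgraded_def)
    then show ?thesis by (rule zgraded_bal)
  qed
qed

lemma env_tensor_bracket: "amul i (amul j s) = amul j (amul i s) + emul (env_of_vf (bracket_basis i j)) s"
  using env_of_vf_bracket[of "single i 1" "single j 1"]
  by (simp add: bracket_basis_single emul_simps)

lemma env_of_vf_single: "env_of_vf (single i c) = env_scalar c * env_of_vf (single i 1)"
  using env_of_vf_linear(2)[of c "single i 1"] by simp

lemma amul_scalar: "emul (env_of_vf x) (emul (env_scalar c) s) = emul (env_scalar c) (emul (env_of_vf x) s)"
  by (simp add: emul_simps env_scalar_central)

lemma bracket_basis_graded:
  assumes "\<And>i. t0_degree i = d \<Longrightarrow> zgraded z (amul i s)" "d = t0_degree i + t0_degree j"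
  shows "zgraded z (emul (env_of_vf (bracket_basis i j)) s)"
proof -
  obtain j0 m a where i: "i = Monom j0 m a" by (cases i) auto
  obtain l r b where j: "j = Monom l r b" by (cases j) auto
  let ?A = "Monom (j0 + l) (m + r) b" and ?B = "Monom (j0 + l) (m + r) a"
  have "bracket_basis i j = single ?A (of_int (component l r a)) + single ?B (- of_int (component j0 m b))"
    by (simp add: i j single_uminus)
  then have "emul (env_of_vf (bracket_basis i j)) s
     = emul (env_scalar (of_int (component l r a))) (amul ?A s) + emul (env_scalar (- of_int (component j0 m b))) (amul ?B s)"
    by (simp only: env_of_vf_linear(1) env_of_vf_single[of _ "of_int _"] env_of_vf_single[of _ "- of_int _"] emul_simps)
  moreover have "zgraded z (amul ?A s)" "zgraded z (amul ?B s)"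
    using assms by (simp_all add: i j)
  ultimately show ?thesis by (simp add: zgraded_add zgraded_scale)
qed

lemma top_vec_act:
  assumes "x \<in> vf_nonneg"
  shows "emul (env_of_vf x) (top_vec t) - top_vec (T_act \<alpha> topw \<gamma> x t) \<in> bal"
  using balancing_generator[OF assms, of "env_scalar 1" t \<alpha> topw \<gamma>]
  by (simp add: pure_tensor_simps env_scalar_1)

lemma single_nonneg: "0 \<le> t0_degree i \<Longrightarrow> single i 1 \<in> vf_nonneg"
  by (simp add: vf_nonneg_def)

lemma T_act_single: "T_act \<alpha> \<beta> \<gamma> (single i 1) t = lin_ext (T_basis_act \<alpha> \<beta> \<gamma> i) t"
  by (simp add: T_act_def)

text \<open>
  Derivations of nonnegative degree are moved to the right past the negative ones until they act on
  the top.
\<close>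

lemma zgraded_amul: "graded n s \<Longrightarrow> zgraded (int n - t0_degree i) (amul i s)"
proof (induction arbitrary: i rule: graded.induct)
  case (top t)
  show ?case
  proof (cases "t0_degree i < 0")
    case True
    then show ?thesis using zgraded_step[OF True zgraded_nat[OF graded.top]] by simp
  next
    case False
    let ?u = "top_vec (lin_ext (T_basis_act \<alpha> topw \<gamma> i) t)"
    have d: "amul i (top_vec t) - ?u \<in> bal"
      using top_vec_act[OF single_nonneg, of i t] False by (simp add: T_act_single)
    have "zgraded (int 0 - t0_degree i) ?u"
    proof (cases "t0_degree i = 0")
      case True
      then show ?thesis using zgraded_nat[OF graded.top] by (metis diff_zero)
    next
      case F: False
      have "T_basis_act \<alpha> topw \<gamma> i k = 0" for k
        using F by (cases i; cases "case i of Monom _ _ a \<Rightarrow> a") auto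
      then have "lin_ext (T_basis_act \<alpha> topw \<gamma> i) t = 0" by (simp add: lin_ext_def)
      then show ?thesis by (simp add: pure_tensor_simps zgraded_bal balD)
    qed
    from zgraded_add[OF this zgraded_bal[OF d]] show ?thesis by simp
  qed
next
  case (zero n)
  then show ?case by (simp add: emul_simps zgraded_bal balD)
next
  case (add n s t)
  then show ?case by (simp add: emul_simps zgraded_add)
next
  case (scale n s c)
  then show ?case by (simp add: amul_scalar zgraded_scale)
next
  case (step y n s)
  have 1: "zgraded (int n - t0_degree i - t0_degree y) (amul y (amul i s))"
    by (rule zgraded_step[OF step.hyps(1) step.IH])
  have 2: "zgraded (int n - (t0_degree i + t0_degree y)) (emul (env_of_vf (bracket_basis i y)) s)"
    by (rule bracket_basis_graded[where d = "t0_degree i + t0_degree y"]) (use step.IH in metis, simp)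
  have "int (n + nat (- t0_degree y)) - t0_degree i = int n - t0_degree i - t0_degree y"
    using step.hyps(1) by simp
  then show ?case unfolding env_tensor_bracket[of i y] using 1 2 by (simp add: zgraded_add diff_diff_eq add.commute)
next
  case (bal n s b)
  then show ?case using zgraded_add[OF _ zgraded_bal[OF balD(6)]] by (simp add: emul_simps)
qed

lemma graded_decomposition:
  "\<exists>f N. (\<forall>n. graded n (f n)) \<and> s = (\<Sum>n<N. f n)"
proof -
  let ?S = "{s. \<exists>f N. (\<forall>n. graded n (f n)) \<and> s = (\<Sum>n<N. f n)}"
  have extend: "\<exists>f N'. N \<le> N' \<and> (\<forall>n. graded n (f n)) \<and> (\<forall>n\<ge>N'. f n = 0) \<and> s = (\<Sum>n<N'. f n)" if s: "s \<in> ?S" for s and N :: nat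
  proof -
    obtain f M where f: "\<And>n. graded n (f n)" "s = (\<Sum>n<M. f n)" using s by blast
    let ?g = "\<lambda>n. if n < M then f n else 0"
    have "s = (\<Sum>n<max N M. ?g n)"
      unfolding f(2) by (rule sum.mono_neutral_cong_left) auto
    then show ?thesis
      by (intro exI[of _ ?g] exI[of _ "max N M"]) (auto simp: f graded.zero)
  qed
  have "s \<in> ?S"
  proof (rule ET_generated)
    show "0 \<in> ?S" by (auto intro!: exI[of _ "\<lambda>_. 0"] exI[of _ 0] graded.zero)
    show add: "s + t \<in> ?S" if st: "s \<in> ?S" "t \<in> ?S" for s t
    proof -
      obtain f N where f: "\<And>n. graded n (f n)" "\<And>n. n \<ge> N \<Longrightarrow> f n = 0" "s = (\<Sum>n<N. f n)"
        using extend[OF st(1), of 0] by auto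
      obtain g M where g: "N \<le> M" "\<And>n. graded n (g n)" "t = (\<Sum>n<M. g n)"
        using extend[OF st(2), of N] by auto
      have "s = (\<Sum>n<M. f n)" unfolding f(3) using f(2) g(1) by (intro sum.mono_neutral_left) auto
      then have "s + t = (\<Sum>n<M. f n + g n)" by (simp add: g(3) sum.distrib)
      then show ?thesis using f(1) g(2) by (auto intro!: exI[of _ "\<lambda>n. f n + g n"] exI[of _ M] graded.add)
    qed
    show "emul (env_scalar c) s \<in> ?S" if s: "s \<in> ?S" for c s
    proof -
      obtain f N where f: "\<And>n. graded n (f n)" "s = (\<Sum>n<N. f n)" using s by auto
      have "emul (env_scalar c) (sum f A) = (\<Sum>n\<in>A. emul (env_scalar c) (f n))" for A
        by (induction A rule: infinite_finite_induct) (auto simp: emul_simps)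
      then show ?thesis using f by (auto intro!: exI[of _ "\<lambda>n. emul (env_scalar c) (f n)"] exI[of _ N] graded.scale)
    qed
    have single: "t \<in> ?S" if t: "zgraded z t" for t z
    proof -
      have g: "graded (nat z) t" using t graded_bal by (auto simp: zgraded_def split: if_splits)
      have "t = (\<Sum>n<Suc (nat z). if n = nat z then t else 0)" by simp
      then show ?thesis using g
        by (auto intro!: exI[of _ "\<lambda>n. if n = nat z then t else 0"] exI[of _ "Suc (nat z)"] graded.zero)
    qed
    show "amul i s \<in> ?S" if s: "s \<in> ?S" for i s
    proof -
      obtain f N where f: "\<And>n. graded n (f n)" "s = (\<Sum>n<N. f n)" using s by auto
      have "amul i (\<Sum>n<M. f n) \<in> ?S" for M
      proof (induction M)
        case 0
        show ?case using \<open>0 \<in> ?S\<close> by (simp add: emul_simps)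
      next
        case (Suc M)
        have "amul i (f M) \<in> ?S" by (rule single[OF zgraded_amul[OF f(1)]])
        from add[OF Suc this] show ?case by (simp add: emul_simps)
      qed
      then show ?thesis unfolding f(2) .
    qed
    show "top_vec (single k 1) \<in> ?S" for k
      by (rule single[OF zgraded_nat[OF graded.top]])
  qed
  then show ?thesis by blast
qed

text \<open>
  The grading is the eigenspace decomposition of the degree derivation modulo the relations.
\<close>

lemma graded_euler:
  "graded n s \<Longrightarrow> amul (Monom 0 0 Dir0) s - emul (env_scalar (topw - of_nat n)) s \<in> bal"
proof (induction rule: graded.induct)
  case (top t)
  let ?d = "Monom 0 0 Dir0"
  have "T_basis_act \<alpha> topw \<gamma> ?d = (\<lambda>k. scale_pm topw (single k 1))" by (rule ext) simp
  then have "lin_ext (T_basis_act \<alpha> topw \<gamma> ?d) t = scale_pm topw (lin_ext (\<lambda>k. single k 1) t)"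
    unfolding lin_ext_def by (simp only: scale_pm_sum) (simp add: mult.commute)
  also have "lin_ext (\<lambda>k. single k 1) t = t"
    unfolding lin_ext_def using pm_expand[of t] by simp
  finally have T: "T_act \<alpha> topw \<gamma> (single ?d 1) t = scale_pm topw t"
    by (simp only: T_act_single)
  show ?case using top_vec_act[OF single_nonneg, of ?d t] unfolding T pure_tensor_scale by simp
next
  case (zero n)
  then show ?case by (simp add: emul_simps balD)
next
  case (add n s t)
  then show ?case using balD(2)[OF add.IH] by (simp add: emul_simps algebra_simps)
next
  case (scale n s c)
  let ?D = "amul (Monom 0 0 Dir0)" and ?e = "emul (env_scalar (topw - of_nat n))"
  have "?D (emul (env_scalar c) s) - ?e (emul (env_scalar c) s) = emul (env_scalar c) (?D s - ?e s)"
    by (simp add: amul_scalar emul_simps(4)) (simp only: emul_simps(7) env_scalar_simps(4) mult.commute)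
  then show ?case using balD(5)[OF scale.IH, of c] by simp
next
  case (step y n s)
  let ?D = "amul (Monom 0 0 Dir0)" and ?e = "\<lambda>n. emul (env_scalar (topw - of_nat n))"
  let ?N = "n + nat (- t0_degree y)"
  have "bracket_basis (Monom 0 0 Dir0) y = single y (of_int (t0_degree y))"
    by (cases y; cases "case y of Monom _ _ b \<Rightarrow> b") auto
  then have b: "emul (env_of_vf (bracket_basis (Monom 0 0 Dir0) y)) s = emul (env_scalar (of_int (t0_degree y))) (amul y s)"
    using env_of_vf_single[of y "of_int (t0_degree y)"] by (simp add: emul_simps)
  have c: "topw - of_nat ?N = (topw - of_nat n) + of_int (t0_degree y)"
    using step.hyps(1) by simp
  have "?D (amul y s) - ?e ?N (amul y s) = amul y (?D s) + emul (env_scalar (of_int (t0_degree y))) (amul y s)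
     - (?e n (amul y s) + emul (env_scalar (of_int (t0_degree y))) (amul y s))"
    unfolding c env_scalar_simps(1) emul_simps(5) env_tensor_bracket[of "Monom 0 0 Dir0" y] b ..
  also have "\<dots> = amul y (?D s - ?e n s)"
    by (simp add: emul_simps(4) amul_scalar)
  finally show ?case using balD(6)[OF step.IH] by metis
next
  case (bal n s b)
  let ?D = "amul (Monom 0 0 Dir0)" and ?e = "emul (env_scalar (topw - of_nat n))"
  have "?D (s + b) - ?e (s + b) = (?D s - ?e s) + (?D b - ?e b)" by (simp add: emul_simps)
  moreover have "?D b - ?e b \<in> bal" using bal.hyps by (intro balD)
  ultimately show ?case using balD(2)[OF bal.IH] by metis
qed

lemma graded_0_top: "graded n s \<Longrightarrow> n = 0 \<Longrightarrow> \<exists>t. s - top_vec t \<in> bal"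
proof (induction rule: graded.induct)
  case (top t)
  show ?case by (intro exI[of _ t]) (simp add: balD)
next
  case (zero n)
  show ?case by (intro exI[of _ 0]) (simp add: pure_tensor_simps balD)
next
  case (add n s t)
  then obtain u v where uv: "s - top_vec u \<in> bal" "t - top_vec v \<in> bal" by auto
  have "top_vec (u + v) = top_vec u + top_vec v"
    by (rule poly_mapping_eqI) (simp add: lookup_pure_tensor lookup_add env_scalar_simps distrib_left)
  then have "s + t - top_vec (u + v) = (s - top_vec u) + (t - top_vec v)" by simp
  then show ?case using balD(2)[OF uv] by metis
next
  case (scale n s c)
  then obtain u where u: "s - top_vec u \<in> bal" by auto
  have "emul (env_scalar c) s - top_vec (scale_pm c u) = emul (env_scalar c) (s - top_vec u)"
    by (simp add: pure_tensor_scale emul_simps(4))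
  then show ?case using balD(5)[OF u, of c] by metis
next
  case (step y n s)
  then show ?case by simp
next
  case (bal n s b)
  then obtain u where "s - top_vec u \<in> bal" by auto
  from balD(2)[OF this bal.hyps(2)] have "s + b - top_vec u \<in> bal" by (simp add: algebra_simps)
  then show ?case by blast
qed


subsection \<open>The unique maximal submodule\<close>

abbreviation verma :: "(int \<Rightarrow>\<^sub>0 env_alg) set vf_module" where
  "verma \<equiv> M_D \<alpha> topw \<gamma>"

sublocale ET_bal: quotient_setup ET bal
  by unfold_locales (rule ET_module, rule balancing_submodule)

lemma verma_eq: "verma = quot_module ET bal"
  by (simp add: M_D_def)

text \<open>
  The kernel, as a set of cosets.
\<close>

definition radical :: "(int \<Rightarrow>\<^sub>0 env_alg) set set" where
  "radical = ET_bal.cls ` kernel"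

lemma realize_top: "realize (top_vec (single k 1)) = vac k"
  by (simp add: realize_pure embed_def)

lemma ket_nonzero: "ket b \<noteq> 0"
  by (metis lookup_single_eq lookup_zero zero_neq_one)

lemma submodule_image_cases:
  assumes irr: "\<alpha> \<notin> \<rat>" and K: "vf_submodule ET K"
  shows "K \<subseteq> kernel \<or> realize ` K = UNIV"
proof (cases "K \<subseteq> kernel")
  case False
  then obtain s where "s \<in> K" "realize s \<noteq> 0" unfolding kernel_def by blast
  then have "realize ` K = UNIV"
    by (intro fock_irreducible[OF irr image_rep_stable[OF K], of "realize s"]) auto
  then show ?thesis ..
qed simp

lemma realize_surj:
  assumes "\<alpha> \<notin> \<rat>" shows "\<exists>s. realize s = w"
proof -
  have "vf_submodule ET UNIV" by (simp add: ET_submodule_iff)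
  moreover have "\<not> UNIV \<subseteq> kernel"
  proof
    assume "UNIV \<subseteq> kernel"
    then have "realize (top_vec (single 0 1)) = 0" unfolding kernel_def by blast
    then have "ket (0, 0) = 0" by (simp only: realize_top)
    with ket_nonzero show False by blast
  qed
  ultimately have "range realize = UNIV" using submodule_image_cases[OF assms] by blast
  then show ?thesis by (metis rangeE UNIV_I)
qed

text \<open>
  One vector of the top generates the whole top since the derivations \<open>t\<^sub>1^m d\<^sub>0\<close> act on it as nonzero multiples
  \<open>\<beta>\<close> of shifts.
\<close>

lemma submodule_with_top:
  assumes irr: "\<alpha> \<notin> \<rat>" and K: "vf_submodule ET K" "bal \<subseteq> K"
    and top: "top_vec (single 0 1) \<in> K"
  shows "K = UNIV"
proof -
  note S = ET_submoduleD[OF K(1)]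
  have topk: "top_vec (single k 1) \<in> K" for k
  proof -
    let ?i = "Monom 0 k Dir0"
    have "T_act \<alpha> topw \<gamma> (single ?i 1) (single 0 1) = scale_pm topw (single k 1)"
      by (simp add: T_act_single del: single_one)
    then have d: "amul ?i (top_vec (single 0 1)) - emul (env_scalar topw) (top_vec (single k 1)) \<in> bal"
      using top_vec_act[OF single_nonneg, of ?i "single 0 1"] by (simp only: pure_tensor_scale) simp
    have "amul ?i (top_vec (single 0 1))
      - (amul ?i (top_vec (single 0 1)) - emul (env_scalar topw) (top_vec (single k 1))) \<in> K"
      by (rule S(4)[OF S(6)[OF top] subsetD[OF K(2) d]])
    then have "emul (env_scalar topw) (top_vec (single k 1)) \<in> K" by simp
    from S(5)[OF this, of "1 / topw"]
    have "emul (env_scalar (1 / topw) * env_scalar topw) (top_vec (single k 1)) \<in> K"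
      by (simp only: emul_simps(7))
    moreover have "env_scalar (1 / topw) * env_scalar topw = env_scalar 1"
      using weight_nonzero[OF irr] by (simp add: env_scalar_simps)
    moreover have "emul (env_scalar 1) s = s" for s
      by (rule poly_mapping_eqI) (simp add: env_scalar_1)
    ultimately show ?thesis by simp
  qed
  have "s \<in> K" for s
    by (rule ET_generated[of K]) (auto intro: S topk)
  then show ?thesis by blast
qed

lemma realize_graded_depth:
  assumes "graded n s" "p \<in> keys (realize s)"
  shows "depth p = int n"
proof -
  have "realize (amul (Monom 0 0 Dir0) s - emul (env_scalar (topw - of_nat n)) s) = 0"
    using graded_euler[OF assms(1)] bal_subset_kernel unfolding kernel_def by blast
  then have "app euler (realize s) = scale_pm (topw - of_nat n) (realize s)"
    by (simp add: realize_diff realize_scalar realize_act euler_def del: rep.simps)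
  moreover have "euler = diag_op (\<lambda>b. - (of_int (depth b) + \<alpha> * (\<alpha> + 1) / 2))"
    by (rule endo_eqI_basis) (simp add: euler_ket)
  ultimately have "lookup (app (diag_op (\<lambda>b. - (of_int (depth b) + \<alpha> * (\<alpha> + 1) / 2))) (realize s)) p
      = (topw - of_nat n) * lookup (realize s) p"
    by simp
  then have "- (of_int (depth p) + \<alpha> * (\<alpha> + 1) / 2) = topw - of_nat n"
    using assms(2) unfolding lookup_diag_op by (simp add: in_keys_iff)
  then have "of_int (depth p) = (of_int (int n) :: complex)" by simp
  then show ?thesis by (simp only: of_int_eq_iff)
qed

text \<open>
  If a proper submodule had elements outside the kernel, it would map onto the irreducible Fock space.
  An element over \<open>vac 0\<close> decomposes into components of fixed depth, which are eigenvectors of the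
  degree derivation modulo the relations and hence belong to the submodule. The component of depth
  zero still lies over \<open>vac 0\<close> and equals the top vector modulo the relations.
\<close>

lemma submodule_below_kernel:
  assumes irr: "\<alpha> \<notin> \<rat>" and K: "vf_submodule ET K" "bal \<subseteq> K" and proper: "K \<noteq> UNIV"
  shows "K \<subseteq> kernel"
proof (rule ccontr)
  assume "\<not> K \<subseteq> kernel"
  then have "realize ` K = UNIV" using submodule_image_cases[OF irr K(1)] by blast
  then obtain s where s: "s \<in> K" "realize s = vac 0" by (metis UNIV_I imageE)
  note S = ET_submoduleD[OF K(1)]
  obtain f N where f: "\<And>n. graded n (f n)" "s = (\<Sum>n<N. f n)" using graded_decomposition[of s] by blast
  define ev where "ev n = topw - of_nat n" for n :: nat
  have inj: "inj_on ev A" for A by (auto simp: inj_on_def ev_def)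
  define g where "g c = f (the_inv ev c)" for c
  have g: "g (ev n) = f n" for n by (simp add: g_def the_inv_f_f inj)
  have "\<forall>c\<in>ev ` {..<N}. g c \<in> K"
  proof (rule eigen_components[where sc = "\<lambda>c. emul (env_scalar c)" and D = "amul (Monom 0 0 Dir0)"])
    fix c assume "c \<in> ev ` {..<N}"
    then obtain n where c: "c = ev n" by blast
    show "amul (Monom 0 0 Dir0) (g c) - emul (env_scalar c) (g c) \<in> K"
      unfolding c g using graded_euler[OF f(1)[of n]] K(2) by (auto simp: ev_def)
  next
    have "(\<Sum>c\<in>ev ` {..<N}. g c) = s" unfolding sum.reindex[OF inj] f(2) by (simp add: g)
    then show "(\<Sum>c\<in>ev ` {..<N}. g c) \<in> K" using s(1) by simp
  next
    fix a b c :: complex and x y :: "int \<Rightarrow>\<^sub>0 env_alg"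
    show "emul (env_scalar 1) x = x" by (rule poly_mapping_eqI) (simp add: env_scalar_1)
    show "amul (Monom 0 0 Dir0) (emul (env_scalar c) x) = emul (env_scalar c) (amul (Monom 0 0 Dir0) x)"
      by (rule amul_scalar)
    show "emul (env_scalar a) (emul (env_scalar b) x) = emul (env_scalar (a * b)) x"
      by (simp only: emul_simps(7) env_scalar_simps(4))
    show "emul (env_scalar (a - b)) x = emul (env_scalar a) x - emul (env_scalar b) x"
      by (simp only: emul_simps(6) env_scalar_simps(3))
  qed (simp_all add: emul_simps(1) S)
  then have fK: "f n \<in> K" if "n < N" for n using that g[of n] by force
  have lk: "lookup (realize (f n)) p = 0" if "depth p \<noteq> int n" for n p
    using realize_graded_depth[OF f(1), of p n] that by (auto simp: in_keys_iff)
  have sum: "vac 0 = (\<Sum>n<N. realize (f n))" using s(2) f(2) by (simp add: realize_sum)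
  have "N \<noteq> 0"
  proof
    assume "N = 0"
    then have "vac 0 = 0" using sum by simp
    with ket_nonzero show False by blast
  qed
  have "realize (f 0) = vac 0"
  proof (rule poly_mapping_eqI)
    fix p
    show "lookup (realize (f 0)) p = lookup (vac 0) p"
    proof (cases "depth p = 0")
      case True
      have "lookup (vac 0) p = (\<Sum>n<N. lookup (realize (f n)) p)"
        unfolding sum lookup_sum ..
      also have "\<dots> = (\<Sum>n<N. if n = 0 then lookup (realize (f 0)) p else 0)"
        using True lk by (intro sum.cong) auto
      also have "\<dots> = lookup (realize (f 0)) p"
        using \<open>N \<noteq> 0\<close> by (subst sum.delta) auto
      finally show ?thesis by simp
    next
      case False
      then have "p \<noteq> (0, 0)" by auto
      then show ?thesis using lk[of p 0] False by (simp add: lookup_single when_def)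
    qed
  qed
  moreover obtain t where t: "f 0 - top_vec t \<in> bal" using graded_0_top[OF f(1)[of 0]] by blast
  then have "realize (f 0) = realize (top_vec t)"
    using bal_subset_kernel unfolding kernel_def by (auto simp: realize_diff)
  ultimately have "embed t = vac 0" by (simp add: realize_pure)
  then have "lookup t k = lookup (single 0 1) k" for k
    using lookup_embed[of t k] by (simp add: lookup_single when_def del: single_one)
  then have "t = single 0 1" by (rule poly_mapping_eqI)
  moreover have "top_vec t \<in> K"
    using S(4)[OF fK[of 0], of "f 0 - top_vec t"] t K(2) \<open>N \<noteq> 0\<close> by auto
  ultimately have "top_vec (single 0 1) \<in> K" by (simp only:)
  then have "K = UNIV" by (rule submodule_with_top[OF irr K])
  with proper show False by simp
qed

lemma radical_maximal:
  assumes irr: "\<alpha> \<notin> \<rat>"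
  shows "maximal_submodule verma radical"
    and "\<And>N. maximal_submodule verma N \<Longrightarrow> N = radical"
proof -
  let ?M = "quot_module ET bal"
  have rad: "vf_submodule ?M radical"
    unfolding radical_def by (rule ET_bal.image_submodule[OF kernel_submodule])
  have mem: "ET_bal.cls s \<in> radical \<longleftrightarrow> s \<in> kernel" for s
    unfolding radical_def using ET_bal.cls_mem_image[OF kernel_submodule bal_subset_kernel] by simp
  have carr: "carrier ?M = range ET_bal.cls" using ET_bal.Q_carrier by simp
  have "top_vec (single 0 1) \<notin> kernel"
    unfolding kernel_def mem_Collect_eq realize_top by (rule ket_nonzero)
  then have proper: "radical \<noteq> carrier ?M" unfolding carr using mem by blast
  have below: "N \<subseteq> radical" if N: "vf_submodule ?M N" "N \<noteq> carrier ?M" for N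
  proof -
    note P = ET_bal.preim_submodule[OF N(1)]
    have "ET_bal.preim N \<noteq> UNIV"
    proof
      assume "ET_bal.preim N = UNIV"
      then have "N = carrier ?M" using P(3) carr by metis
      with N(2) show False by simp
    qed
    from submodule_below_kernel[OF irr P(1,2) this] have "ET_bal.preim N \<subseteq> kernel" .
    then show ?thesis using P(3) unfolding radical_def by blast
  qed
  show "maximal_submodule verma radical"
    unfolding maximal_submodule_def verma_eq using rad proper below by blast
  show "N = radical" if "maximal_submodule verma N" for N
    using that rad proper below unfolding maximal_submodule_def verma_eq by blast
qed

lemma L_D_eq:
  assumes "\<alpha> \<notin> \<rat>"
  shows "L_D \<alpha> topw \<gamma> = quot_module verma radical"
proof -
  have "(THE N. maximal_submodule verma N) = radical"
    by (rule the_equality[where P = "maximal_submodule verma",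
        OF radical_maximal(1)[OF assms] radical_maximal(2)[OF assms]])
  then show ?thesis by (simp only: L_D_def)
qed

text \<open>
  The inverse of the isomorphism that \<open>realize\<close> induces: the class of any preimage.
\<close>

definition in_L :: "fock \<Rightarrow> (int \<Rightarrow>\<^sub>0 env_alg) set set" where
  "in_L w = radical +>\<^bsub>quot_module ET bal\<^esub> ET_bal.cls (SOME s. realize s = w)"

text \<open>
  Both \<open>L_D\<close> and the Fock space are the tensor product modulo the kernel of \<open>realize\<close>.
\<close>

lemma fock_iso:
  assumes irr: "\<alpha> \<notin> \<rat>"
  shows "operator_module (L_D \<alpha> topw \<gamma>)"
    "bij_betw in_L UNIV (carrier (L_D \<alpha> topw \<gamma>))"
    "in_L (v + w) = in_L v \<oplus>\<^bsub>L_D \<alpha> topw \<gamma>\<^esub> in_L w"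
    "in_L (scale_pm c v) = c \<odot>\<^bsub>L_D \<alpha> topw \<gamma>\<^esub> in_L v"
    "in_L (app (rho x) v) = act (L_D \<alpha> topw \<gamma>) x (in_L v)"
proof -
  let ?M = "quot_module ET bal"
  have rad: "vf_submodule ?M radical"
    unfolding radical_def by (rule ET_bal.image_submodule[OF kernel_submodule])
  interpret L: quotient_setup ?M radical
    by unfold_locales (rule ET_bal.Q_module, rule rad)
  have Leq: "L_D \<alpha> topw \<gamma> = quot_module ?M radical" using L_D_eq[OF irr] by (simp add: verma_eq)
  define c where "c s = radical +>\<^bsub>?M\<^esub> ET_bal.cls s" for s
  have carr: "ET_bal.cls s \<in> carrier ?M" for s using ET_bal.Q_carrier by simp
  have mem: "ET_bal.cls s \<in> radical \<longleftrightarrow> s \<in> kernel" for s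
    unfolding radical_def using ET_bal.cls_mem_image[OF kernel_submodule bal_subset_kernel] by simp
  have minus: "ET_bal.cls s \<ominus>\<^bsub>?M\<^esub> ET_bal.cls t = ET_bal.cls (s - t)" for s t
    unfolding a_minus_def by (simp add: ET_bal.Q_uminus ET_bal.Q_add)
  have ceq: "c s = c t \<longleftrightarrow> realize s = realize t" for s t
    unfolding c_def L.cls_eq_iff[OF carr carr] minus mem by (simp add: kernel_def realize_diff)
  have real: "realize (SOME s. realize s = w) = w" for w
    using realize_surj[OF irr, of w] by (rule someI_ex)
  have in_c: "in_L (realize s) = c s" for s
    using ceq[of "SOME t. realize t = realize s" s] real[of "realize s"] by (simp add: in_L_def c_def)
  have surj: "\<exists>s. v = realize s" for v using realize_surj[OF irr, of v] by metis
  show "operator_module (L_D \<alpha> topw \<gamma>)" unfolding Leq by (rule L.Q_module)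
  show "bij_betw in_L UNIV (carrier (L_D \<alpha> topw \<gamma>))"
  proof (rule bij_betwI')
    fix v w
    show "(in_L v = in_L w) = (v = w)" using surj[of v] surj[of w] by (auto simp: in_c ceq)
    show "in_L v \<in> carrier (L_D \<alpha> topw \<gamma>)"
      unfolding Leq L.Q_carrier in_L_def using carr by blast
  next
    fix X assume "X \<in> carrier (L_D \<alpha> topw \<gamma>)"
    then obtain s where "X = c s" unfolding Leq L.Q_carrier ET_bal.Q_carrier c_def by auto
    then have "X = in_L (realize s)" by (simp only: in_c)
    then show "\<exists>v\<in>UNIV. X = in_L v" by blast
  qed
  obtain s t where st: "v = realize s" "w = realize t" using surj by metis
  show "in_L (v + w) = in_L v \<oplus>\<^bsub>L_D \<alpha> topw \<gamma>\<^esub> in_L w"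
    unfolding st realize_add[symmetric] in_c unfolding c_def Leq
    by (simp add: L.Q_add[OF carr carr] ET_bal.Q_add)
  show "in_L (scale_pm a v) = a \<odot>\<^bsub>L_D \<alpha> topw \<gamma>\<^esub> in_L v" for a
    unfolding st realize_scalar[symmetric] in_c unfolding c_def Leq
    by (simp add: L.Q_smult[OF carr] ET_bal.Q_smult)
  show "in_L (app (rho x) v) = act (L_D \<alpha> topw \<gamma>) x (in_L v)"
    unfolding st realize_act[symmetric] in_c unfolding c_def Leq
    by (simp add: L.Q_act[OF carr] ET_bal.Q_act)
qed

end

section \<open>Characters of modules with a diagonal basis\<close>

lemma lookup_sum_single:
  "finite B \<Longrightarrow> lookup (\<Sum>b\<in>B. single b (c b)) p = (if p \<in> B then c p else 0)"
  by (simp add: lookup_sum lookup_single when_def)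

text \<open>
  A basis of joint eigenvectors of the two degree derivations, with finite joint multiplicities,
  computes the character. The module is presented through an additive bijection from finitely
  supported functions, so that coordinates decide all questions of existence and uniqueness.
\<close>

lemma has_character_diagonal:
  fixes V :: "'v vf_module" and h :: "('b \<Rightarrow>\<^sub>0 complex) \<Rightarrow> 'v" and wt :: "'b \<Rightarrow> complex \<times> complex"
  assumes V: "abelian_group V" and bij: "bij_betw h UNIV (carrier V)"
    and hadd: "\<And>v w. h (v + w) = h v \<oplus>\<^bsub>V\<^esub> h w" and scale: "\<And>c v. h (scale_pm c v) = c \<odot>\<^bsub>V\<^esub> h v"
    and act: "\<And>a v. act V (d_vf a) (h v) = h (D a v)"
    and D: "\<And>v p. lookup (D Dir0 v) p = fst (wt p) * lookup v p"
      "\<And>v p. lookup (D Dir1 v) p = snd (wt p) * lookup v p"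
    and fin: "\<And>s. finite {b. wt b = s}"
  shows "has_character V (\<lambda>s. of_nat (card {b. wt b = s}))"
proof -
  interpret abelian_group V by (rule V)
  have inj: "h v = h w \<longleftrightarrow> v = w" for v w using bij by (auto simp: bij_betw_def inj_on_def)
  have carr: "h v \<in> carrier V" for v using bij by (auto simp: bij_betw_def)
  have surj: "\<exists>v. x = h v" if "x \<in> carrier V" for x using bij that by (auto simp: bij_betw_def)
  have h0: "h 0 = \<zero>\<^bsub>V\<^esub>"
  proof -
    have "h 0 \<oplus>\<^bsub>V\<^esub> h 0 = h 0 \<oplus>\<^bsub>V\<^esub> \<zero>\<^bsub>V\<^esub>" using hadd[of 0 0] carr by simp
    then show ?thesis using carr by (metis add.l_cancel_one r_zero)
  qed
  have hz: "h v = \<zero>\<^bsub>V\<^esub> \<longleftrightarrow> v = 0" for v using inj[of v 0] h0 by simp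
  have hsum: "h (sum f A) = (\<Oplus>\<^bsub>V\<^esub>i\<in>A. h (f i))" if "finite A" for f and A :: "'i set"
    using that by (induction A rule: finite_induct) (auto simp: h0 hadd carr)
  have ws: "h v \<in> weight_space V s \<longleftrightarrow> (\<forall>p. wt p \<noteq> s \<longrightarrow> lookup v p = 0)" for v s
  proof -
    have "h v \<in> weight_space V s \<longleftrightarrow> D Dir0 v = scale_pm (fst s) v \<and> D Dir1 v = scale_pm (snd s) v"
      unfolding weight_space_def mem_Collect_eq act scale[symmetric] inj using carr by simp
    also have "\<dots> \<longleftrightarrow> (\<forall>p. wt p \<noteq> s \<longrightarrow> lookup v p = 0)"
      unfolding poly_mapping_eq_iff fun_eq_iff D lookup_scale_pm by (auto simp: prod_eq_iff)
    finally show ?thesis .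
  qed
  have "is_weight_module V"
    unfolding is_weight_module_def
  proof
    fix x assume "x \<in> carrier V"
    then obtain v where x: "x = h v" using surj by blast
    let ?c = "\<lambda>s. h (part (\<lambda>b. wt b = s) v)"
    have ne: "part (\<lambda>b. wt b = s) v \<noteq> 0 \<longleftrightarrow> s \<in> wt ` keys v" for s
      by (auto simp: poly_mapping_eq_iff fun_eq_iff lookup_part in_keys_iff)
    show "\<exists>!w. (\<forall>s. w s \<in> weight_space V s) \<and> finite {s. w s \<noteq> \<zero>\<^bsub>V\<^esub>}
      \<and> x = (\<Oplus>\<^bsub>V\<^esub>s\<in>{s. w s \<noteq> \<zero>\<^bsub>V\<^esub>}. w s)"
    proof (rule ex1I[of _ ?c], intro conjI allI)
      show "?c s \<in> weight_space V s" for s by (auto simp: ws lookup_part)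
      have S: "{s. ?c s \<noteq> \<zero>\<^bsub>V\<^esub>} = wt ` keys v" unfolding hz ne by simp
      show "finite {s. ?c s \<noteq> \<zero>\<^bsub>V\<^esub>}" unfolding S by simp
      have "v = (\<Sum>s\<in>wt ` keys v. part (\<lambda>b. wt b = s) v)"
      proof (rule poly_mapping_eqI)
        fix p
        have "(\<Sum>s\<in>wt ` keys v. lookup (part (\<lambda>b. wt b = s) v) p)
            = (if wt p \<in> wt ` keys v then lookup v p else 0)"
          unfolding lookup_part by (subst sum.delta') auto
        then show "lookup v p
            = lookup (\<Sum>s\<in>wt ` keys v. part (\<lambda>b. wt b = s) v) p"
          unfolding lookup_sum by (auto simp: in_keys_iff)
      qed
      then show "x = (\<Oplus>\<^bsub>V\<^esub>s\<in>{s. ?c s \<noteq> \<zero>\<^bsub>V\<^esub>}. ?c s)"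
        unfolding S x by (subst hsum[symmetric]) auto
    next
      fix w assume w: "(\<forall>s. w s \<in> weight_space V s) \<and> finite {s. w s \<noteq> \<zero>\<^bsub>V\<^esub>}
        \<and> x = (\<Oplus>\<^bsub>V\<^esub>s\<in>{s. w s \<noteq> \<zero>\<^bsub>V\<^esub>}. w s)"
      have "\<forall>s. \<exists>u. w s = h u" using w surj by (auto simp: weight_space_def)
      then obtain u where u: "\<And>s. w s = h (u s)" by metis
      let ?S = "{s. u s \<noteq> 0}"
      have Sw: "{s. w s \<noteq> \<zero>\<^bsub>V\<^esub>} = ?S" unfolding u hz ..
      have fS: "finite ?S" using w unfolding Sw by blast
      have "x = (\<Oplus>\<^bsub>V\<^esub>s\<in>?S. w s)" using w unfolding Sw by blast
      then have "h v = h (\<Sum>s\<in>?S. u s)" unfolding x u hsum[OF fS] .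
      then have vs: "v = (\<Sum>s\<in>?S. u s)" unfolding inj .
      have us: "lookup (u s) p = 0" if "wt p \<noteq> s" for s p
        using w that ws[of "u s" s] unfolding u by blast
      have "u s = part (\<lambda>b. wt b = s) v" for s
      proof (rule poly_mapping_eqI)
        fix p
        have "lookup v p = (\<Sum>s\<in>?S. if s = wt p then lookup (u (wt p)) p else 0)"
          unfolding vs lookup_sum by (rule sum.cong) (auto simp: us)
        also have "\<dots> = lookup (u (wt p)) p" using fS by (subst sum.delta) auto
        finally show "lookup (u s) p = lookup (part (\<lambda>b. wt b = s) v) p"
          using us[of p s] by (auto simp: lookup_part)
      qed
      then show "w = ?c" unfolding fun_eq_iff u by simp
    qed
  qed
  moreover have "\<exists>B. is_finite_basis V (weight_space V s) B \<and> real (card {b. wt b = s}) = of_nat (card B)" for s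
  proof (intro exI conjI)
    let ?I = "{b. wt b = s}"
    define e where "e b = h (single b 1)" for b :: 'b
    have inj_e: "inj_on e A" for A by (rule inj_onI) (metis e_def inj keys_single singleton_inject zero_neq_one)
    show "real (card ?I) = of_nat (card (e ` ?I))" by (simp add: card_image[OF inj_e])
    have comb: "(\<Oplus>\<^bsub>V\<^esub>b\<in>e ` ?I. c b \<odot>\<^bsub>V\<^esub> b) = h (\<Sum>b\<in>?I. single b (c (e b)))" for c
    proof -
      have "(\<Oplus>\<^bsub>V\<^esub>b\<in>e ` ?I. c b \<odot>\<^bsub>V\<^esub> b) = (\<Oplus>\<^bsub>V\<^esub>b\<in>?I. c (e b) \<odot>\<^bsub>V\<^esub> e b)"
        by (rule finsum_reindex) (auto simp: inj_e e_def scale[symmetric] carr)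
      also have "\<dots> = (\<Oplus>\<^bsub>V\<^esub>b\<in>?I. h (single b (c (e b))))"
        by (simp add: e_def scale[symmetric])
      finally show ?thesis by (simp add: hsum[OF fin])
    qed
    show "is_finite_basis V (weight_space V s) (e ` ?I)"
      unfolding is_finite_basis_def
    proof (intro conjI ballI)
      show "finite (e ` ?I)" using fin by simp
      show "e ` ?I \<subseteq> weight_space V s" by (auto simp: e_def ws lookup_single when_def)
      fix x assume x: "x \<in> weight_space V s"
      then obtain v where v: "x = h v" using surj by (auto simp: weight_space_def)
      have v0: "wt p \<noteq> s \<Longrightarrow> lookup v p = 0" for p using x ws[of v s] v by blast
      let ?c = "\<lambda>y\<in>e ` ?I. lookup v (the_inv_into ?I e y)"
      have coord: "x = (\<Oplus>\<^bsub>V\<^esub>b\<in>e ` ?I. c b \<odot>\<^bsub>V\<^esub> b) \<longleftrightarrow> (\<forall>b\<in>?I. c (e b) = lookup v b)" for c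
        unfolding comb v inj poly_mapping_eq_iff fun_eq_iff lookup_sum_single[OF fin] using v0 by auto
      show "\<exists>!c. c \<in> e ` ?I \<rightarrow>\<^sub>E (UNIV :: complex set) \<and> x = (\<Oplus>\<^bsub>V\<^esub>b\<in>e ` ?I. c b \<odot>\<^bsub>V\<^esub> b)"
      proof (rule ex1I[of _ ?c])
        show "?c \<in> e ` ?I \<rightarrow>\<^sub>E UNIV \<and> x = (\<Oplus>\<^bsub>V\<^esub>b\<in>e ` ?I. ?c b \<odot>\<^bsub>V\<^esub> b)"
          unfolding coord by (auto simp: the_inv_into_f_f[OF inj_e])
      next
        fix c assume c: "c \<in> e ` ?I \<rightarrow>\<^sub>E (UNIV :: complex set) \<and> x = (\<Oplus>\<^bsub>V\<^esub>b\<in>e ` ?I. c b \<odot>\<^bsub>V\<^esub> b)"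
        then have cb: "\<forall>b\<in>?I. c (e b) = lookup v b" unfolding coord by blast
        show "c = ?c"
          by (rule PiE_ext[of _ "e ` ?I" "\<lambda>_. UNIV"]) (use c cb in \<open>auto simp: the_inv_into_f_f[OF inj_e]\<close>)
      qed
    qed
  qed
  ultimately show ?thesis unfolding has_character_def by blast
qed

section \<open>Counting monomials of given depth\<close>

definition monomials_on :: "(color \<times> nat) set \<Rightarrow> nat \<Rightarrow> monomial set" where
  "monomials_on V n = {\<mu>. keys \<mu> \<subseteq> V \<and> weight_sum mode_size \<mu> = int n}"

abbreviation count_fps :: "(color \<times> nat) set \<Rightarrow> real fps" where
  "count_fps V \<equiv> Abs_fps (\<lambda>n. of_nat (card (monomials_on V n)))"

lemma monomials_on_empty: "monomials_on {} n = (if n = 0 then {0} else {})"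
  by (auto simp: monomials_on_def)

lemma monomials_on_0: "monomials_on V 0 = {0}"
proof -
  have "weight_sum mode_size \<mu> = 0 \<longleftrightarrow> \<mu> = 0" for \<mu>
    using depth_0_iff[of 0 \<mu>] by (simp only: depth_def snd_conv)
  note eq = this
  show ?thesis unfolding monomials_on_def of_nat_0 eq by auto
qed

text \<open>
  A monomial on an enlarged set of variables either avoids the new one or is divisible by it.
\<close>

lemma monomials_on_insert:
  assumes "v \<notin> V"
  shows "monomials_on (insert v V) n = monomials_on V n \<union>
    (if Suc (snd v) \<le> n then (\<lambda>\<mu>. \<mu> + single v 1) ` monomials_on (insert v V) (n - Suc (snd v)) else {})"
    (is "?L = ?A \<union> ?B")
proof (intro subset_antisym subsetI)
  fix \<mu> assume mu: "\<mu> \<in> ?L"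
  show "\<mu> \<in> ?A \<union> ?B"
  proof (cases "v \<in> keys \<mu>")
    case False
    with mu show ?thesis by (auto simp: monomials_on_def)
  next
    case True
    let ?\<nu> = "\<mu> - single v 1"
    have nz: "lookup \<mu> v \<noteq> 0" using True by (simp add: in_keys_iff)
    have ws: "weight_sum mode_size ?\<nu> = int n - int (Suc (snd v))"
      using weight_sum_remove[OF nz, of mode_size] mu by (simp add: monomials_on_def mode_size_def)
    have "0 \<le> weight_sum mode_size ?\<nu>" using depth_nonneg[of "(0, ?\<nu>)"] by (simp add: depth_def)
    then have le: "Suc (snd v) \<le> n" using ws by linarith
    have sub: "keys ?\<nu> \<subseteq> keys \<mu>" by (auto simp: in_keys_iff lookup_minus)
    have "?\<nu> \<in> monomials_on (insert v V) (n - Suc (snd v))"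
      using mu sub ws le by (auto simp: monomials_on_def of_nat_diff)
    then show ?thesis using monomial_remove[OF nz] le by (auto intro: image_eqI[of _ _ ?\<nu>])
  qed
next
  fix \<mu> assume "\<mu> \<in> ?A \<union> ?B"
  then show "\<mu> \<in> ?L"
    using keys_add by (fastforce simp: monomials_on_def weight_sum_add mode_size_def of_nat_diff split: if_splits)
qed

lemma finite_monomials_on: "finite V \<Longrightarrow> finite (monomials_on V n)"
proof (induction V arbitrary: n rule: finite_induct)
  case empty
  show ?case by (simp add: monomials_on_empty)
next
  case (insert v V)
  show ?case
  proof (induction n rule: less_induct)
    case (less n)
    show ?case
      by (subst monomials_on_insert[OF insert(2)]) (use insert(3) less[of "n - Suc (snd v)"] in auto)
  qed
qed

lemma card_monomials_on_insert:
  assumes "finite V" "v \<notin> V"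
  shows "card (monomials_on (insert v V) n) = card (monomials_on V n)
    + (if Suc (snd v) \<le> n then card (monomials_on (insert v V) (n - Suc (snd v))) else 0)"
proof (cases "Suc (snd v) \<le> n")
  case True
  let ?f = "\<lambda>\<mu> :: monomial. \<mu> + single v 1"
  let ?S = "monomials_on (insert v V) (n - Suc (snd v))"
  have "v \<in> keys (?f \<mu>)" for \<mu> by (simp add: in_keys_iff lookup_add)
  then have disj: "monomials_on V n \<inter> ?f ` ?S = {}" using assms(2) by (auto simp: monomials_on_def)
  have "card (monomials_on (insert v V) n) = card (monomials_on V n) + card (?f ` ?S)"
    by (subst monomials_on_insert[OF assms(2)])
      (use True assms(1) in \<open>simp add: card_Un_disjoint[OF _ _ disj] finite_monomials_on\<close>)
  also have "card (?f ` ?S) = card ?S" by (rule card_image) (simp add: inj_on_def)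
  finally show ?thesis using True by simp
next
  case False
  then show ?thesis by (subst monomials_on_insert[OF assms(2)]) simp
qed

text \<open>
  Adding one variable of size \<open>w\<close> multiplies the generating function by a geometric series in \<open>X^w\<close>.
\<close>

lemma count_fps_eq_prod:
  assumes "finite V"
  shows "count_fps V = (\<Prod>v\<in>V. inverse (1 - fps_X ^ Suc (snd v)))"
  using assms
proof (induction V rule: finite_induct)
  case empty
  show ?case by (simp add: fps_eq_iff monomials_on_empty)
next
  case (insert v V)
  let ?w = "Suc (snd v)"
  have nz: "fps_nth (1 - fps_X ^ ?w :: real fps) 0 \<noteq> 0" by simp
  have "count_fps (insert v V) * (1 - fps_X ^ ?w) = count_fps V"
  proof (rule fps_ext)
    fix n
    have "fps_nth (count_fps (insert v V) * (1 - fps_X ^ ?w)) n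
        = fps_nth (count_fps (insert v V)) n - fps_nth (count_fps (insert v V) * fps_X ^ ?w) n"
      by (simp only: right_diff_distrib mult_1_right fps_sub_nth)
    also have "\<dots> = fps_nth (count_fps V) n"
      unfolding fps_X_power_mult_right_nth using card_monomials_on_insert[OF insert(1,2), of n] by auto
    finally show "fps_nth (count_fps (insert v V) * (1 - fps_X ^ ?w)) n = fps_nth (count_fps V) n" .
  qed
  then have "count_fps (insert v V) * ((1 - fps_X ^ ?w) * inverse (1 - fps_X ^ ?w))
      = count_fps V * inverse (1 - fps_X ^ ?w)"
    by (simp only: mult.assoc[symmetric])
  then have "count_fps (insert v V) = count_fps V * inverse (1 - fps_X ^ ?w)"
    unfolding inverse_mult_eq_1'[OF nz] by simp
  then show ?case using insert by (simp add: mult.commute)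
qed

lemma mode_le_weight:
  assumes "v \<in> keys \<mu>"
  shows "mode_size v \<le> weight_sum mode_size \<mu>"
proof -
  have "mode_size v * 1 \<le> mode_size v * int (lookup \<mu> v)"
    using assms by (intro mult_left_mono) (auto simp: mode_size_def in_keys_iff)
  also have "\<dots> \<le> weight_sum mode_size \<mu>"
    unfolding weight_sum_def mult.commute[of "mode_size v"]
    by (rule member_le_sum[OF assms]) (auto simp: mode_size_def)
  finally show ?thesis by simp
qed

lemma monomials_on_stable:
  assumes "n \<le> N"
  shows "monomials_on (UNIV \<times> {..N}) n = monomials_on UNIV n"
proof -
  have "snd v \<le> N" if "v \<in> keys \<mu>" "weight_sum mode_size \<mu> = int n" for \<mu> v
    using mode_le_weight[OF that(1)] that(2) assms by (simp add: mode_size_def)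
  then show ?thesis by (auto simp: monomials_on_def)
qed

lemma UNIV_color: "(UNIV :: color set) = {ColX, ColY, ColS}"
  using color.exhaust by auto

lemma finite_monomials: "finite (monomials_on UNIV n)"
  using finite_monomials_on[of "UNIV \<times> {..n}" n] monomials_on_stable[of n n] by (simp add: UNIV_color)

text \<open>
  The \<open>N\<close>-th partial product counts the monomials in the variables of size at most \<open>N + 1\<close>. In each
  degree this count is eventually constant, which is convergence of formal power series; the cube
  stems from the three colors.
\<close>

lemma prodinf_eq_count:
  "prodinf (\<lambda>n. inverse ((1 - fps_X ^ Suc n) ^ 3)) = count_fps UNIV"
proof -
  let ?f = "\<lambda>n. inverse ((1 - fps_X ^ Suc n) ^ 3) :: real fps"
  have partial: "(\<Prod>n\<le>N. ?f n) = count_fps (UNIV \<times> {..N})" for N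
  proof -
    have "count_fps (UNIV \<times> {..N}) = (\<Prod>v\<in>(UNIV :: color set) \<times> {..N}. inverse (1 - fps_X ^ Suc (snd v)))"
      by (rule count_fps_eq_prod) (simp add: UNIV_color)
    also have "\<dots> = (\<Prod>c\<in>(UNIV :: color set). \<Prod>n\<le>N. inverse (1 - fps_X ^ Suc n))"
      unfolding prod.cartesian_product by (rule prod.cong) auto
    also have "\<dots> = (\<Prod>n\<le>N. inverse (1 - fps_X ^ Suc n)) ^ 3"
      by (simp add: UNIV_color power3_eq_cube mult.assoc)
    finally show ?thesis by (simp only: prod_power_distrib fps_inverse_power)
  qed
  have "(\<lambda>N. \<Prod>n\<le>N. ?f n) \<longlonglongrightarrow> count_fps UNIV"
  proof (rule tendsto_fpsI)
    fix n
    show "\<forall>\<^sub>F N in sequentially. fps_nth (\<Prod>n\<le>N. ?f n) n = fps_nth (count_fps UNIV) n"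
      using eventually_ge_at_top[of n] unfolding partial
      by eventually_elim (simp add: monomials_on_stable)
  qed
  moreover have "fps_nth (count_fps UNIV) 0 \<noteq> 0" by (simp add: monomials_on_0)
  then have "count_fps UNIV \<noteq> 0" by force
  ultimately have "?f has_prod count_fps UNIV"
    unfolding has_prod_def raw_has_prod_def by simp
  then show ?thesis by (rule has_prod_unique[symmetric])
qed

section \<open>The product of the three formal sums\<close>

lemma fs_times_q0_q1:
  "(q0_power b \<star> q1_power_sum J) s = (if fst s = b \<and> snd s \<in> J then 1 else 0)"
proof -
  have q0: "q0_power b r = (if r = (b, 0) then 1 else 0)" for r by (cases r) (simp add: q0_power_def)
  have q1: "q1_power_sum J (s - (b, 0)) = (if fst s = b \<and> snd s \<in> J then 1 else 0)"
    by (cases s) (simp add: q1_power_sum_def)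
  have "{r. q0_power b r \<noteq> 0 \<and> q1_power_sum J (s - r) \<noteq> 0} = (if fst s = b \<and> snd s \<in> J then {(b, 0)} else {})"
    using q1 by (auto simp: q0 split: if_splits)
  then show ?thesis by (simp add: fs_times_def q0 q1)
qed

lemma at_inverse_q0_nth: "at_inverse_q0 P (- of_nat k, 0) = fps_nth P k"
proof -
  have "{j. (- of_nat k :: complex) = - of_nat j \<and> (0 :: complex) = 0} = {k}" by auto
  then show ?thesis by (simp add: at_inverse_q0_def)
qed

lemma at_inverse_q0_eq_0: "(\<forall>k. fst s \<noteq> - of_nat k) \<or> snd s \<noteq> 0 \<Longrightarrow> at_inverse_q0 P s = 0"
  by (cases s) (auto simp: at_inverse_q0_def)

text \<open>
  For given \<open>s\<close> at most one pair of terms of the two formal sums contributes.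
\<close>

lemma character_product:
  "(q0_power b \<star> q1_power_sum J \<star> at_inverse_q0 P) s
    = (if \<exists>k. fst s = b - of_nat k \<and> snd s \<in> J then fps_nth P (THE k. fst s = b - of_nat k) else 0)"
proof -
  let ?g = "q0_power b \<star> q1_power_sum J"
  let ?R = "{r. ?g r \<noteq> 0 \<and> at_inverse_q0 P (s - r) \<noteq> 0}"
  have R: "r = (b, snd s) \<and> snd s \<in> J \<and> (\<exists>k. fst s = b - of_nat k)" if "r \<in> ?R" for r
  proof -
    have "fst r = b" "snd r \<in> J" using that by (auto simp: fs_times_q0_q1 split: if_splits)
    moreover have "snd (s - r) = 0" "\<exists>k. fst (s - r) = - of_nat k"
      using that at_inverse_q0_eq_0[of "s - r" P] by auto
    ultimately show ?thesis by (auto simp: prod_eq_iff algebra_simps)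
  qed
  show ?thesis
  proof (cases "\<exists>k. fst s = b - of_nat k \<and> snd s \<in> J")
    case True
    then obtain k where k: "fst s = b - of_nat k" "snd s \<in> J" by blast
    have the: "(THE k. fst s = b - of_nat k) = k" using k(1) by (intro the_equality) auto
    have s: "s - (b, snd s) = (- of_nat k, 0)" using k by (simp add: prod_eq_iff)
    have "(\<Sum>r\<in>?R. ?g r * at_inverse_q0 P (s - r)) = (\<Sum>r\<in>{(b, snd s)}. ?g r * at_inverse_q0 P (s - r))"
      by (rule sum.mono_neutral_left) (use R in auto)
    also have "\<dots> = fps_nth P k" using k by (simp add: s at_inverse_q0_nth fs_times_q0_q1)
    finally show ?thesis using True the by (simp add: fs_times_def[of ?g])
  next
    case False
    then have "?R = {}" using R by blast
    then have "(?g \<star> at_inverse_q0 P) s = 0" unfolding fs_times_def[of ?g] by (simp only: sum.empty)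
    with False show ?thesis by (simp only: if_False)
  qed
qed

section \<open>The character\<close>

lemma card_fock_weight:
  "finite {b :: fock_index. (w - of_int (depth b), \<gamma> + of_int (fst b)) = (s :: complex \<times> complex)}"
  "real (card {b :: fock_index. (w - of_int (depth b), \<gamma> + of_int (fst b)) = s})
    = (q0_power w \<star> q1_power_sum (range (\<lambda>k :: int. \<gamma> + of_int k)) \<star> at_inverse_q0 (count_fps UNIV)) s"
proof -
  let ?I = "{b :: fock_index. (w - of_int (depth b), \<gamma> + of_int (fst b)) = s}"
  have *: "finite ?I \<and> real (card ?I)
    = (q0_power w \<star> q1_power_sum (range (\<lambda>k :: int. \<gamma> + of_int k)) \<star> at_inverse_q0 (count_fps UNIV)) s"
  proof (cases "\<exists>n. fst s = w - of_nat n \<and> snd s \<in> range (\<lambda>k :: int. \<gamma> + of_int k)")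
    case True
    then obtain n k where nk: "fst s = w - of_nat n" "snd s = \<gamma> + of_int k" by blast
    have the: "(THE j. fst s = w - of_nat j) = n" using nk(1) by (intro the_equality) auto
    have "(of_int (depth b) :: complex) = of_nat n \<longleftrightarrow> depth b = int n" for b
      by (metis of_int_eq_iff of_int_of_nat_eq)
    then have "?I = Pair k ` monomials_on UNIV n"
      using nk by (force simp: prod_eq_iff monomials_on_def depth_def)
    moreover have "inj_on (Pair k) A" for A :: "monomial set" by (simp add: inj_on_def)
    ultimately show ?thesis
      unfolding character_product using True by (simp add: the finite_monomials card_image)
  next
    case False
    have "b \<notin> ?I" for b
    proof
      assume b: "b \<in> ?I"
      then have "fst s = w - of_nat (nat (depth b))" "snd s \<in> range (\<lambda>k :: int. \<gamma> + of_int k)"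
        using b depth_nonneg[of b] by force+
      with False show False by blast
    qed
    then have "?I = {}" by blast
    then show ?thesis
      unfolding character_product if_not_P[OF False] by (simp only: finite.emptyI card.empty of_nat_0)
  qed
  then show "finite ?I" and "real (card ?I)
    = (q0_power w \<star> q1_power_sum (range (\<lambda>k :: int. \<gamma> + of_int k)) \<star> at_inverse_q0 (count_fps UNIV)) s"
    by blast+
qed

context torus_fock
begin

lemma has_character_L_D:
  assumes "\<alpha> \<notin> \<rat>"
  shows "has_character (L_D \<alpha> topw \<gamma>)
    (q0_power topw \<star> q1_power_sum (range (\<lambda>k :: int. \<gamma> + of_int k)) \<star> at_inverse_q0 (count_fps UNIV))"
proof -
  note iso = fock_iso[OF assms]
  let ?wt = "\<lambda>b :: fock_index. (topw - of_int (depth b), \<gamma> + of_int (fst b))"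
  have d: "rho (d_vf a) = rep (Monom 0 0 a)" for a unfolding d_vf_def rho_single by simp
  have diag: "A = diag_op c" if "\<And>b. app A (ket b) = scale_pm (c b) (ket b)" for A c
    by (rule endo_eqI_basis) (simp add: that)
  have energy: "topw - of_int (depth b) = - (of_int (depth b) + \<alpha> * (\<alpha> + 1) / 2)" for b by simp
  have d0: "rho (d_vf Dir0) = diag_op (\<lambda>b. fst (?wt b))"
    unfolding d euler_def[symmetric] by (rule diag) (simp only: euler_ket fst_conv energy)
  have d1: "rho (d_vf Dir1) = diag_op (\<lambda>b. snd (?wt b))"
    unfolding d loop_0 by (rule diag) (simp only: dd_0_ket snd_conv)
  have "has_character (L_D \<alpha> topw \<gamma>) (\<lambda>s. of_nat (card {b. ?wt b = s}))"
    by (rule has_character_diagonal[where h = in_L and D = "\<lambda>a. app (rho (d_vf a))", OF operator_moduleD(1)[OF iso(1)] iso(2)])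
       (auto simp: iso(3,4,5) d0 d1 lookup_diag_op card_fock_weight(1) simp del: prod.inject)
  then show ?thesis unfolding card_fock_weight(2) .
qed

end

theorem corollary1p3:
  fixes \<alpha> \<beta> \<gamma> :: complex
  assumes "\<alpha> \<notin> \<rat>" and "\<beta> = - (1 / 2) * \<alpha> * (\<alpha> + 1)"
  shows "has_character (L_D \<alpha> \<beta> \<gamma>)
    (q0_power \<beta> \<star> q1_power_sum (range (\<lambda>k :: int. \<gamma> + of_int k))
      \<star> at_inverse_q0 (prodinf (\<lambda>n. inverse ((1 - fps_X ^ Suc n) ^ 3))))"
proof -
  have "\<beta> = - (\<alpha> * (\<alpha> + 1) / 2)" using assms(2) by simp
  then show ?thesis
    unfolding prodinf_eq_count using torus_fock.has_character_L_D[OF assms(1)] by simp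
qed

end
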